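(* Let $(M^3,g,f,\rho)$ be a static perfect fluid space with energy density $\mu$, with constant scalar curvature, harmonic curvature, and boundary $\partial M=f^{-1}(c)$, where $c$ is a regular value of $f$. There is no compact two-sided free boundary stable minimal surface $\Sigma^2\subset M^3$ with positive Gauss curvature such that $$\mu+\rho\le\frac{2\kappa^2}{c^2}\quad\text{on }\Sigma,$$ where $\kappa=|\nabla f|\big|_{\partial\Sigma}$ (a constant).
   Context: A three-dimensional static perfect fluid space $(M^3,g,f,\rho)$ is a Riemannian manifold $(M^3,g)$ with smooth functions $f>0$ and $\rho,\mu$ on $M$ satisfying $$f\,Ric=\nabla^2 f+\frac{\mu-\rho}{2}\,f\,g,\qquad \Delta f=\frac{\mu+3\rho}{2}\,f,\qquad \mu=\frac{R}{2},$$ where $Ric$, $\nabla^2$, $\Delta$, $R$ are the Ricci tensor, Hessian, Laplacian and scalar curvature of $g$. Harmonic curvature means the Riemann curvature tensor is divergence free (equivalently $Ric$ is a Codazzi tensor). The outward unit normal of $\partial M=f^{-1}(c)$ is $X=-\nabla f/|\nabla f|$. A surface $\Sigma$ immersed in $M$ with $\Sigma\cap\partial M=\partial\Sigma$ is free boundary if it meets $\partial M$ orthogonally, i.e. its outward conormal $\nu$ along $\partial\Sigma$ equals $X$; it is two-sided if it has a global unit normal field $N$. A free boundary minimal $\Sigma$ is stable if for all $\phi\in C^\infty(\Sigma)$ $$-\int_\Sigma\phi\{\Delta_\Sigma\phi+(Ric(N,N)+|A_\Sigma|^2)\phi\}\,d\sigma+\int_{\partial\Sigma}\phi\left\{\frac{\partial\phi}{\partial\nu}-II(N,N)\phi\right\}da\ge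 0,$$ where $A_\Sigma$ is the second fundamental form of $\Sigma$ and $II(W,W)=\langle\nabla_W X,W\rangle$ that of $\partial M$. *)

theory Defs
  imports "HOL-Analysis.Analysis"
begin

section \<open>Smooth maps on subsets of Euclidean space\<close>

text \<open>\<open>Ck_on k f U\<close> is the class \<open>C^k\<close>; it is only meant for open \<open>U\<close>.\<close>

primrec Ck_on :: "nat \<Rightarrow> ('a::euclidean_space \<Rightarrow> 'b::real_normed_vector) \<Rightarrow> 'a set \<Rightarrow> bool" where
  "Ck_on 0 f U \<longleftrightarrow> continuous_on U f"
| "Ck_on (Suc k) f U \<longleftrightarrow> f differentiable_on U \<and>
     (\<forall>b\<in>Basis. Ck_on k (\<lambda>x. frechet_derivative f (at x) b) U)"

text \<open>Smoothness on an arbitrary set (here: relatively open subsets of a half-space) means local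
  extendability to a smooth map on an open set.\<close>

definition smooth_on :: "'a::euclidean_space set \<Rightarrow> ('a \<Rightarrow> 'b::real_normed_vector) \<Rightarrow> bool" where
  "smooth_on D f \<longleftrightarrow>
     (\<forall>x\<in>D. \<exists>U h. open U \<and> x \<in> U \<and> (\<forall>k. Ck_on k h U) \<and> (\<forall>y\<in>U \<inter> D. h y = f y))"

text \<open>Partial derivatives are taken within \<open>D\<close>, so that they are one-sided on the boundary of the
  half-space. For \<open>D\<close> relatively open in the half-space the derivative within \<open>D\<close> is unique.\<close>

definition pd :: "(real^'n) set \<Rightarrow> 'n \<Rightarrow> (real^'n \<Rightarrow> real) \<Rightarrow> real^'n \<Rightarrow> real" where
  "pd D i u x = frechet_derivative u (at x within D) (axis i 1)"


section \<open>Riemannian geometry in a coordinate patch\<close>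

text \<open>Throughout, \<open>D\<close> is the coordinate patch and \<open>G x\<close> the matrix \<open>(g_ij(x))\<close>.\<close>

definition ip :: "real^'n^'n \<Rightarrow> real^'n \<Rightarrow> real^'n \<Rightarrow> real" where
  "ip A v w = v \<bullet> (A *v w)"

definition christoffel ::
  "(real^'n) set \<Rightarrow> (real^'n \<Rightarrow> real^'n^'n) \<Rightarrow> 'n \<Rightarrow> 'n \<Rightarrow> 'n \<Rightarrow> real^'n \<Rightarrow> real" where
  "christoffel D G k i j x = (1/2) * (\<Sum>l\<in>UNIV. matrix_inv (G x) $ k $ l *
      (pd D i (\<lambda>y. G y $ j $ l) x + pd D j (\<lambda>y. G y $ i $ l) x - pd D l (\<lambda>y. G y $ i $ j) x))"

text \<open>\<open>riem D G l k i j\<close> is the component \<open>R^l_{kij}\<close> with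
  \<open>R(\<partial>_i, \<partial>_j) \<partial>_k = \<Sum>_l R^l_{kij} \<partial>_l\<close>
  and \<open>R(X,Y)Z = \<nabla>_X \<nabla>_Y Z - \<nabla>_Y \<nabla>_X Z - \<nabla>_{[X,Y]} Z\<close>.\<close>

definition riem ::
  "(real^'n) set \<Rightarrow> (real^'n \<Rightarrow> real^'n^'n) \<Rightarrow> 'n \<Rightarrow> 'n \<Rightarrow> 'n \<Rightarrow> 'n \<Rightarrow> real^'n \<Rightarrow> real" where
  "riem D G l k i j x =
     pd D i (christoffel D G l j k) x - pd D j (christoffel D G l i k) x
     + (\<Sum>m\<in>UNIV. christoffel D G l i m x * christoffel D G m j k x
                - christoffel D G l j m x * christoffel D G m i k x)"

definition ricci :: "(real^'n) set \<Rightarrow> (real^'n \<Rightarrow> real^'n^'n) \<Rightarrow> real^'n \<Rightarrow> real^'n^'n" where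
  "ricci D G x = (\<chi> k j. \<Sum>i\<in>UNIV. riem D G i k i j x)"

definition scalar_curvature :: "(real^'n) set \<Rightarrow> (real^'n \<Rightarrow> real^'n^'n) \<Rightarrow> real^'n \<Rightarrow> real" where
  "scalar_curvature D G x =
     (\<Sum>i\<in>UNIV. \<Sum>j\<in>UNIV. matrix_inv (G x) $ i $ j * ricci D G x $ i $ j)"

text \<open>The component \<open>\<Sum>_l \<nabla>_l R^l_{kij}\<close> of the divergence of the curvature tensor.\<close>

definition div_riem ::
  "(real^'n) set \<Rightarrow> (real^'n \<Rightarrow> real^'n^'n) \<Rightarrow> 'n \<Rightarrow> 'n \<Rightarrow> 'n \<Rightarrow> real^'n \<Rightarrow> real" where
  "div_riem D G k i j x = (\<Sum>l\<in>UNIV. pd D l (riem D G l k i j) x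
     + (\<Sum>m\<in>UNIV. christoffel D G l l m x * riem D G m k i j x
                - christoffel D G m l k x * riem D G l m i j x
                - christoffel D G m l i x * riem D G l k m j x
                - christoffel D G m l j x * riem D G l k i m x))"

definition hessian ::
  "(real^'n) set \<Rightarrow> (real^'n \<Rightarrow> real^'n^'n) \<Rightarrow> (real^'n \<Rightarrow> real) \<Rightarrow> real^'n \<Rightarrow> real^'n^'n" where
  "hessian D G u x =
     (\<chi> i j. pd D i (pd D j u) x - (\<Sum>k\<in>UNIV. christoffel D G k i j x * pd D k u x))"

definition laplacian ::
  "(real^'n) set \<Rightarrow> (real^'n \<Rightarrow> real^'n^'n) \<Rightarrow> (real^'n \<Rightarrow> real) \<Rightarrow> real^'n \<Rightarrow> real" where
  "laplacian D G u x =
     (\<Sum>i\<in>UNIV. \<Sum>j\<in>UNIV. matrix_inv (G x) $ i $ j * hessian D G u x $ i $ j)"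

definition gradient ::
  "(real^'n) set \<Rightarrow> (real^'n \<Rightarrow> real^'n^'n) \<Rightarrow> (real^'n \<Rightarrow> real) \<Rightarrow> real^'n \<Rightarrow> real^'n" where
  "gradient D G u x = matrix_inv (G x) *v (\<chi> j. pd D j u x)"

definition gradient_norm ::
  "(real^'n) set \<Rightarrow> (real^'n \<Rightarrow> real^'n^'n) \<Rightarrow> (real^'n \<Rightarrow> real) \<Rightarrow> real^'n \<Rightarrow> real" where
  "gradient_norm D G u x = sqrt (ip (G x) (gradient D G u x) (gradient D G u x))"

text \<open>The vector field \<open>-\<nabla>u / |\<nabla>u|\<close>, for use where \<open>\<nabla>u\<close> does not vanish.\<close>

definition level_normal ::
  "(real^'n) set \<Rightarrow> (real^'n \<Rightarrow> real^'n^'n) \<Rightarrow> (real^'n \<Rightarrow> real) \<Rightarrow> real^'n \<Rightarrow> real^'n" where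
  "level_normal D G u x = - (gradient D G u x /\<^sub>R gradient_norm D G u x)"

text \<open>The covariant derivative \<open>\<nabla>_v X\<close> of a vector field \<open>X\<close> at \<open>x\<close>.\<close>

definition cov_deriv ::
  "(real^'n) set \<Rightarrow> (real^'n \<Rightarrow> real^'n^'n) \<Rightarrow> (real^'n \<Rightarrow> real^'n) \<Rightarrow> real^'n \<Rightarrow> real^'n \<Rightarrow> real^'n" where
  "cov_deriv D G X v x = (\<chi> k. \<Sum>j\<in>UNIV. v $ j *
      (pd D j (\<lambda>y. X y $ k) x + (\<Sum>l\<in>UNIV. christoffel D G k j l x * X x $ l)))"

text \<open>The boundary of the half-space is \<open>x_1 = 0\<close>; its outward unit normal is
  \<open>- \<nabla>x_1 / |\<nabla>x_1|\<close>.\<close>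

definition outward_unit_normal ::
  "(real^'n::{finite,one} \<Rightarrow> real^'n::{finite,one}^'n::{finite,one})
     \<Rightarrow> real^'n::{finite,one} \<Rightarrow> real^'n::{finite,one}" where
  "outward_unit_normal G x =
     (\<chi> i. - (matrix_inv (G x) $ i $ 1 / sqrt (matrix_inv (G x) $ 1 $ 1)))"

text \<open>\<open>K = <R(\<partial>_1,\<partial>_2)\<partial>_2, \<partial>_1> / det g\<close>.\<close>

definition gauss_curvature :: "(real^2) set \<Rightarrow> (real^2 \<Rightarrow> real^2^2) \<Rightarrow> real^2 \<Rightarrow> real" where
  "gauss_curvature D G x = (\<Sum>l\<in>UNIV. G x $ 1 $ l * riem D G l 2 1 2 x) / det (G x)"


section \<open>Riemannian manifolds with boundary\<close>

text \<open>A chart is a pair of its domain and the coordinate map into the half-space \<open>x_1 \<ge> 0\<close>;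
  interior charts are those whose image avoids \<open>x_1 = 0\<close>. Outside of its domain a coordinate map
  is irrelevant. A metric is given by its component matrices \<open>metric_in M c x\<close> in each chart \<open>c\<close>, as
  functions of the coordinates \<open>x\<close>.\<close>

type_synonym ('a, 'n) chart = "'a set \<times> ('a \<Rightarrow> real^'n)"

record ('a, 'n) riem_structure =
  mtop :: "'a topology"
  atlas :: "('a, 'n::finite) chart set"
  metric_in :: "('a, 'n) chart \<Rightarrow> real^'n \<Rightarrow> real^'n^'n"

definition half_space :: "(real^'n::{finite,one}) set" where
  "half_space = {x. 0 \<le> x $ 1}"

abbreviation patch :: "('a, 'n::finite) chart \<Rightarrow> (real^'n) set" where
  "patch c \<equiv> snd c ` fst c"

abbreviation chart_inv :: "('a, 'n::finite) chart \<Rightarrow> real^'n \<Rightarrow> 'a" where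
  "chart_inv c \<equiv> inv_into (fst c) (snd c)"

definition is_chart :: "'a topology \<Rightarrow> ('a, 'n::{finite,one}) chart \<Rightarrow> bool" where
  "is_chart T c \<longleftrightarrow> openin T (fst c) \<and> openin (top_of_set half_space) (patch c) \<and>
     homeomorphic_map (subtopology T (fst c)) (top_of_set (patch c)) (snd c)"

text \<open>Coordinate expression of a function, and of a map \<open>F\<close> together with its domain.\<close>

abbreviation in_chart :: "('a, 'n::finite) chart \<Rightarrow> ('a \<Rightarrow> 'b) \<Rightarrow> real^'n \<Rightarrow> 'b" where
  "in_chart c u \<equiv> (\<lambda>x. u (chart_inv c x))"

definition map_dom ::
  "('s, 'k::finite) chart \<Rightarrow> ('m, 'n::finite) chart \<Rightarrow> ('s \<Rightarrow> 'm) \<Rightarrow> (real^'k) set" where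
  "map_dom c d F = snd c ` {p \<in> fst c. F p \<in> fst d}"

definition map_rep ::
  "('s, 'k::finite) chart \<Rightarrow> ('m, 'n::finite) chart \<Rightarrow> ('s \<Rightarrow> 'm) \<Rightarrow> real^'k \<Rightarrow> real^'n" where
  "map_rep c d F x = snd d (F (chart_inv c x))"

definition map_jac ::
  "('s, 'k::finite) chart \<Rightarrow> ('m, 'n::finite) chart \<Rightarrow> ('s \<Rightarrow> 'm) \<Rightarrow> real^'k \<Rightarrow> real^'k^'n" where
  "map_jac c d F x = jacobian (map_rep c d F) (at x within map_dom c d F)"

definition riemannian_manifold :: "('a, 'n::{finite,one}) riem_structure \<Rightarrow> bool" where
  "riemannian_manifold M \<longleftrightarrow>
     Hausdorff_space (mtop M) \<and> second_countable (mtop M) \<and>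
     (\<forall>c\<in>atlas M. is_chart (mtop M) c) \<and>
     (\<Union>c\<in>atlas M. fst c) = topspace (mtop M) \<and>
     (\<forall>c\<in>atlas M. \<forall>d\<in>atlas M. smooth_on (map_dom c d id) (map_rep c d id)) \<and>
     (\<forall>c\<in>atlas M. smooth_on (patch c) (metric_in M c) \<and>
        (\<forall>x\<in>patch c. transpose (metric_in M c x) = metric_in M c x \<and>
           (\<forall>v. v \<noteq> 0 \<longrightarrow> ip (metric_in M c x) v v > 0))) \<and>
     (\<forall>c\<in>atlas M. \<forall>d\<in>atlas M. \<forall>x\<in>map_dom c d id.
        metric_in M c x =
          transpose (map_jac c d id x) ** metric_in M d (map_rep c d id x) ** map_jac c d id x)"

definition mboundary :: "('a, 'n::{finite,one}) riem_structure \<Rightarrow> 'a set" where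
  "mboundary M = {p. \<exists>c\<in>atlas M. p \<in> fst c \<and> snd c p $ 1 = 0}"

definition smooth_function :: "('a, 'n::finite) riem_structure \<Rightarrow> ('a \<Rightarrow> real) \<Rightarrow> bool" where
  "smooth_function M u \<longleftrightarrow> (\<forall>c\<in>atlas M. smooth_on (patch c) (in_chart c u))"

text \<open>Chart-independent scalars are evaluated at a point by means of an arbitrary chart there.\<close>

definition chart_at :: "('a, 'n::finite) riem_structure \<Rightarrow> 'a \<Rightarrow> ('a, 'n) chart" where
  "chart_at M p = (SOME c. c \<in> atlas M \<and> p \<in> fst c)"

definition grad_norm_at :: "('a, 'n::finite) riem_structure \<Rightarrow> ('a \<Rightarrow> real) \<Rightarrow> 'a \<Rightarrow> real" where
  "grad_norm_at M u p = (let c = chart_at M p in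
     gradient_norm (patch c) (metric_in M c) (in_chart c u) (snd c p))"

definition laplacian_at :: "('a, 'n::finite) riem_structure \<Rightarrow> ('a \<Rightarrow> real) \<Rightarrow> 'a \<Rightarrow> real" where
  "laplacian_at M u p = (let c = chart_at M p in
     laplacian (patch c) (metric_in M c) (in_chart c u) (snd c p))"

definition gauss_curvature_at :: "('s, 2) riem_structure \<Rightarrow> 's \<Rightarrow> real" where
  "gauss_curvature_at S p = (let c = chart_at S p in
     gauss_curvature (patch c) (metric_in S c) (snd c p))"

text \<open>The derivative \<open>\<partial>u/\<partial>\<nu>\<close> in the direction of the outward unit normal of the boundary.\<close>

definition outward_deriv_at ::
  "('a, 'n::{finite,one}) riem_structure \<Rightarrow> ('a \<Rightarrow> real) \<Rightarrow> 'a \<Rightarrow> real" where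
  "outward_deriv_at M u p = (let c = chart_at M p; x = snd c p in
     (\<Sum>i\<in>UNIV. outward_unit_normal (metric_in M c) x $ i * pd (patch c) i (in_chart c u) x))"

text \<open>The Riemannian volume measure is the unique Borel measure with density \<open>sqrt (det g)\<close> in every
  chart; likewise for the length measure of the boundary of a surface, which is parametrized by
  \<open>t \<mapsto> (0, t)\<close> in a chart.\<close>

definition volume_measure :: "('a, 'n::finite) riem_structure \<Rightarrow> 'a measure" where
  "volume_measure M = (THE m.
     space m = topspace (mtop M) \<and>
     sets m = sigma_sets (topspace (mtop M)) {U. openin (mtop M) U} \<and>
     (\<forall>c\<in>atlas M. \<forall>E\<in>sets m. E \<subseteq> fst c \<longrightarrow>
        emeasure m E = (\<integral>\<^sup>+x\<in>snd c ` E. ennreal (sqrt (det (metric_in M c x))) \<partial>lborel)))"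

definition boundary_length_measure :: "('s, 2) riem_structure \<Rightarrow> 's measure" where
  "boundary_length_measure S = (THE m.
     space m = mboundary S \<and>
     sets m = sigma_sets (mboundary S) {mboundary S \<inter> U | U. openin (mtop S) U} \<and>
     (\<forall>c\<in>atlas S. \<forall>E\<in>sets m. E \<subseteq> fst c \<longrightarrow>
        emeasure m E = (\<integral>\<^sup>+t\<in>{t. vector [0, t] \<in> snd c ` E}.
           ennreal (sqrt (metric_in S c (vector [0, t]) $ 2 $ 2)) \<partial>lborel)))"


section \<open>Static perfect fluid spaces\<close>

definition static_perfect_fluid ::
  "('m, 3) riem_structure \<Rightarrow> ('m \<Rightarrow> real) \<Rightarrow> ('m \<Rightarrow> real) \<Rightarrow> ('m \<Rightarrow> real) \<Rightarrow> bool" where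
  "static_perfect_fluid M f \<rho> \<mu> \<longleftrightarrow>
     riemannian_manifold M \<and>
     smooth_function M f \<and> smooth_function M \<rho> \<and> smooth_function M \<mu> \<and>
     (\<forall>p\<in>topspace (mtop M). f p > 0) \<and>
     (\<forall>c\<in>atlas M. \<forall>p\<in>fst c.
        let D = patch c; G = metric_in M c; u = in_chart c f; x = snd c p in
        f p *\<^sub>R ricci D G x = hessian D G u x + ((\<mu> p - \<rho> p) / 2 * f p) *\<^sub>R G x \<and>
        laplacian D G u x = (\<mu> p + 3 * \<rho> p) / 2 * f p \<and>
        \<mu> p = scalar_curvature D G x / 2)"

definition constant_scalar_curvature :: "('m, 'n::finite) riem_structure \<Rightarrow> bool" where
  "constant_scalar_curvature M \<longleftrightarrow>
     (\<exists>R0. \<forall>c\<in>atlas M. \<forall>x\<in>patch c. scalar_curvature (patch c) (metric_in M c) x = R0)"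

definition harmonic_curvature :: "('m, 'n::finite) riem_structure \<Rightarrow> bool" where
  "harmonic_curvature M \<longleftrightarrow>
     (\<forall>c\<in>atlas M. \<forall>x\<in>patch c. \<forall>k i j. div_riem (patch c) (metric_in M c) k i j x = 0)"

definition regular_value :: "('m, 'n::finite) riem_structure \<Rightarrow> ('m \<Rightarrow> real) \<Rightarrow> real \<Rightarrow> bool" where
  "regular_value M f a \<longleftrightarrow>
     (\<forall>c\<in>atlas M. \<forall>p\<in>fst c. f p = a \<longrightarrow> (\<exists>i. pd (patch c) i (in_chart c f) (snd c p) \<noteq> 0))"

text \<open>The outward unit normal of the boundary of \<open>M\<close> is \<open>X = - \<nabla>f / |\<nabla>f|\<close>.\<close>

definition outward_normal_is_level_normal ::
  "('m, 'n::{finite,one}) riem_structure \<Rightarrow> ('m \<Rightarrow> real) \<Rightarrow> bool" where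
  "outward_normal_is_level_normal M f \<longleftrightarrow>
     (\<forall>d\<in>atlas M. \<forall>q\<in>fst d. snd d q $ 1 = 0 \<longrightarrow>
        outward_unit_normal (metric_in M d) (snd d q)
          = level_normal (patch d) (metric_in M d) (in_chart d f) (snd d q))"

text \<open>\<open>II(W,W) = <\<nabla>_W X, W>\<close> at \<open>q\<close>, where \<open>w\<close> are the components of \<open>W\<close> in \<open>chart_at M q\<close>.\<close>

definition boundary_sff_at ::
  "('m, 'n::finite) riem_structure \<Rightarrow> ('m \<Rightarrow> real) \<Rightarrow> 'm \<Rightarrow> real^'n \<Rightarrow> real" where
  "boundary_sff_at M f q w = (let d = chart_at M q; D = patch d; G = metric_in M d; y = snd d q in
     ip (G y) (cov_deriv D G (level_normal D G (in_chart d f)) w y) w)"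


section \<open>Immersed surfaces\<close>

text \<open>A surface \<open>\<Sigma>\<close> immersed in \<open>M\<close> is an abstract surface \<open>S\<close> with an immersion \<open>F\<close>; its metric is
  the induced one. The last condition is \<open>\<Sigma> \<inter> \<partial>M = \<partial>\<Sigma>\<close>.\<close>

definition immersed_surface ::
  "('m, 3) riem_structure \<Rightarrow> ('s, 2) riem_structure \<Rightarrow> ('s \<Rightarrow> 'm) \<Rightarrow> bool" where
  "immersed_surface M S F \<longleftrightarrow>
     riemannian_manifold S \<and> continuous_map (mtop S) (mtop M) F \<and>
     (\<forall>c\<in>atlas S. \<forall>d\<in>atlas M.
        smooth_on (map_dom c d F) (map_rep c d F) \<and>
        (\<forall>x\<in>map_dom c d F. inj ((*v) (map_jac c d F x)) \<and>
           metric_in S c x =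
             transpose (map_jac c d F x) ** metric_in M d (map_rep c d F x) ** map_jac c d F x)) \<and>
     (\<forall>p\<in>topspace (mtop S). F p \<in> mboundary M \<longleftrightarrow> p \<in> mboundary S)"

text \<open>A vector field along \<open>F\<close> is given by its components \<open>N d p\<close> in each chart \<open>d\<close> of \<open>M\<close> around
  \<open>F p\<close>. The surface is two-sided iff a field \<open>N\<close> as follows exists.\<close>

definition unit_normal_field ::
  "('m, 3) riem_structure \<Rightarrow> ('s, 2) riem_structure \<Rightarrow> ('s \<Rightarrow> 'm)
     \<Rightarrow> (('m, 3) chart \<Rightarrow> 's \<Rightarrow> real^3) \<Rightarrow> bool" where
  "unit_normal_field M S F N \<longleftrightarrow>
     (\<forall>d\<in>atlas M. \<forall>d'\<in>atlas M. \<forall>p\<in>topspace (mtop S). F p \<in> fst d \<inter> fst d' \<longrightarrow>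
        N d' p = map_jac d d' id (snd d (F p)) *v N d p) \<and>
     (\<forall>c\<in>atlas S. \<forall>d\<in>atlas M.
        smooth_on (map_dom c d F) (in_chart c (N d)) \<and>
        (\<forall>x\<in>map_dom c d F.
           let G = metric_in M d (map_rep c d F x); n = in_chart c (N d) x in
           ip G n n = 1 \<and> (\<forall>v. ip G n (map_jac c d F x *v v) = 0)))"

text \<open>\<open>A_ab = <\<nabla>_{\<partial>_a} dF(\<partial>_b), N>\<close>, its trace, and \<open>|A|^2\<close>.\<close>

definition sff ::
  "('m, 3) riem_structure \<Rightarrow> ('s \<Rightarrow> 'm) \<Rightarrow> (('m, 3) chart \<Rightarrow> 's \<Rightarrow> real^3)
     \<Rightarrow> ('s, 2) chart \<Rightarrow> ('m, 3) chart \<Rightarrow> real^2 \<Rightarrow> real^2^2" where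
  "sff M F N c d x = (let W = map_dom c d F; \<Phi> = map_rep c d F; G = metric_in M d in
     (\<chi> a b. ip (G (\<Phi> x))
        (\<chi> k. pd W a (pd W b (\<lambda>y. \<Phi> y $ k)) x
            + (\<Sum>i\<in>UNIV. \<Sum>j\<in>UNIV. christoffel (patch d) G k i j (\<Phi> x)
                 * pd W a (\<lambda>y. \<Phi> y $ i) x * pd W b (\<lambda>y. \<Phi> y $ j) x))
        (in_chart c (N d) x)))"

definition minimal_surface ::
  "('m, 3) riem_structure \<Rightarrow> ('s, 2) riem_structure \<Rightarrow> ('s \<Rightarrow> 'm)
     \<Rightarrow> (('m, 3) chart \<Rightarrow> 's \<Rightarrow> real^3) \<Rightarrow> bool" where
  "minimal_surface M S F N \<longleftrightarrow>
     (\<forall>c\<in>atlas S. \<forall>d\<in>atlas M. \<forall>x\<in>map_dom c d F.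
        (\<Sum>a\<in>UNIV. \<Sum>b\<in>UNIV. matrix_inv (metric_in S c x) $ a $ b * sff M F N c d x $ a $ b) = 0)"

definition sff_norm_sq_at ::
  "('m, 3) riem_structure \<Rightarrow> ('s, 2) riem_structure \<Rightarrow> ('s \<Rightarrow> 'm)
     \<Rightarrow> (('m, 3) chart \<Rightarrow> 's \<Rightarrow> real^3) \<Rightarrow> 's \<Rightarrow> real" where
  "sff_norm_sq_at M S F N p =
     (let c = chart_at S p; x = snd c p; A = sff M F N c (chart_at M (F p)) x;
          H = matrix_inv (metric_in S c x) in
      \<Sum>a\<in>UNIV. \<Sum>b\<in>UNIV. \<Sum>a'\<in>UNIV. \<Sum>b'\<in>UNIV. H $ a $ a' * H $ b $ b' * A $ a $ b * A $ a' $ b')"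

definition ricci_normal_at ::
  "('m, 3) riem_structure \<Rightarrow> ('s \<Rightarrow> 'm) \<Rightarrow> (('m, 3) chart \<Rightarrow> 's \<Rightarrow> real^3) \<Rightarrow> 's \<Rightarrow> real" where
  "ricci_normal_at M F N p = (let d = chart_at M (F p) in
     ip (ricci (patch d) (metric_in M d) (snd d (F p))) (N d p) (N d p))"

text \<open>The outward conormal \<open>\<nu>\<close> of \<open>S\<close> is mapped to \<open>X = - \<nabla>f / |\<nabla>f|\<close> along the boundary.\<close>

definition free_boundary ::
  "('m, 3) riem_structure \<Rightarrow> ('m \<Rightarrow> real) \<Rightarrow> ('s, 2) riem_structure \<Rightarrow> ('s \<Rightarrow> 'm) \<Rightarrow> bool" where
  "free_boundary M f S F \<longleftrightarrow>
     (\<forall>c\<in>atlas S. \<forall>d\<in>atlas M. \<forall>x\<in>map_dom c d F. x $ 1 = 0 \<longrightarrow>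
        map_jac c d F x *v outward_unit_normal (metric_in S c) x
          = level_normal (patch d) (metric_in M d) (in_chart d f) (map_rep c d F x))"

definition stable_free_boundary ::
  "('m, 3) riem_structure \<Rightarrow> ('m \<Rightarrow> real) \<Rightarrow> ('s, 2) riem_structure \<Rightarrow> ('s \<Rightarrow> 'm)
     \<Rightarrow> (('m, 3) chart \<Rightarrow> 's \<Rightarrow> real^3) \<Rightarrow> bool" where
  "stable_free_boundary M f S F N \<longleftrightarrow>
     (\<forall>\<phi>. smooth_function S \<phi> \<longrightarrow>
        - (LINT p|volume_measure S. \<phi> p *
             (laplacian_at S \<phi> p + (ricci_normal_at M F N p + sff_norm_sq_at M S F N p) * \<phi> p))
        + (LINT p|boundary_length_measure S. \<phi> p *
             (outward_deriv_at S \<phi> p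
                - boundary_sff_at M f (F p) (N (chart_at M (F p)) p) * \<phi> p)) \<ge> 0)"

end

theory Submission imports Defs begin

text \<open>Write \<open>R = 6 r\<close>, \<open>a = (\<mu> + \<rho>) f\<close> and \<open>B = Ric - 2 r g\<close>. Since \<open>Ric\<close> is a Codazzi tensor, commuting derivatives in the
  field equation shows that \<open>a\<close> is locally constant, that \<open>Hess f = f B - (r f - a/2) g\<close>, and that
  \<open>B = (w/2) (g - 3 df df / \<bar>df\<bar>\<^sup>2)\<close> where \<open>df\<close> does not vanish. On a minimal surface the Jacobi operator
  \<open>L = \<Delta> + Ric(N,N) + \<bar>A\<bar>\<^sup>2\<close> satisfies \<open>L f = a + \<bar>A\<bar>\<^sup>2 f\<close>, and positive Gauss curvature means \<open>Ric(N,N) < 3 r - \<bar>A\<bar>\<^sup>2/2\<close>. Along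
  the free boundary \<open>\<partial>f/\<partial>\<nu> = -\<kappa>\<close> and \<open>II(N,N) = - Hess f(N,N) / \<kappa>\<close>.

  Let \<open>a\<^sub>0\<close> be the value of \<open>a\<close> at a boundary point. If \<open>a\<^sub>0 \<ge> 0\<close>, the function \<open>f\<close> destabilizes the surface: \<open>L f \<ge> 0\<close>, and the bound
  on \<open>\<mu> + \<rho>\<close> makes the boundary integrand negative. If \<open>a\<^sub>0 < 0\<close> and \<open>B = 0\<close> there, the constant \<open>1\<close> does. If \<open>a\<^sub>0 < 0\<close> and
  \<open>B \<noteq> 0\<close>, the metric is locally a warped product and carries a solution \<open>f\<^sub>0 > 0\<close> of \<open>Hess f\<^sub>0 = f\<^sub>0 (B - r g)\<close>, so that
  \<open>L f\<^sub>0 = \<bar>A\<bar>\<^sup>2 f\<^sub>0\<close>; a smooth cutoff of \<open>f\<^sub>0 - \<epsilon> f\<close> at \<open>0\<close> destabilizes, for small \<open>\<epsilon>\<close>. In each case the test function is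
  restricted to a clopen part of the surface on which the relevant local constants are fixed.\<close>

section \<open>Smooth functions on relatively open subsets of the half-space\<close>

text \<open>\<open>B\<close> has the eigenvector \<open>grad f\<close>, but that direction is
  undefined at critical points of \<open>f\<close>. Hence \<open>w\<close> and \<open>P\<close> are
  built from traces and gradients that stay smooth there, identities are cleared of denominators
  \<open>\<bar>df\<bar>\<^sup>2\<close>, and continuity extends them: where
  \<open>B \<noteq> 0\<close>, critical points have empty interior.

  For \<open>a < 0\<close> the sign of \<open>L f\<close> is lost. The function
  \<open>f\<^sub>0\<close> keeps it but contains a square root that is singular where
  \<open>P = 0\<close>. Subtracting \<open>\<epsilon> f\<close> helps twice: where
  \<open>f\<^sub>0 - \<epsilon> f \<ge> 0\<close> one has \<open>f\<^sub>0 > 0\<close>, hence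
  smoothness, and \<open>L\<close> gains the positive term \<open>-\<epsilon> a\<close>, which pays
  for the error of a convex cutoff.

  It remains to separate the zeros of \<open>B\<close> from the part of the surface on which
  \<open>f\<^sub>0\<close> is used. Where \<open>B \<noteq> 0\<close>, the function
  \<open>\<bar>w\<bar>^(-2/3) (P + r + w)\<close> is locally constant. Since
  \<open>P \<ge> 0\<close>, and since positive Gauss curvature forces \<open>r > 0\<close> at a zero
  of \<open>B\<close> on the surface, it would blow up at such a zero; so its level sets are clopen
  in the surface.\<close>

lemma Ck_on_mono: "Ck_on k f U \<Longrightarrow> V \<subseteq> U \<Longrightarrow> Ck_on k f V"
  by (induction k arbitrary: f) (auto intro: continuous_on_subset differentiable_on_subset)

lemma frechet_derivative_cong_open:
  assumes "open U" "x \<in> U" "\<And>y. y \<in> U \<Longrightarrow> f y = g y"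
  shows "frechet_derivative f (at x) = frechet_derivative g (at x)"
proof -
  have "(f has_derivative f') (at x) \<longleftrightarrow> (g has_derivative f') (at x)" for f'
    using has_derivative_transform_within_open[OF _ assms(1,2), of f f' UNIV g]
      has_derivative_transform_within_open[OF _ assms(1,2), of g f' UNIV f] assms(3) by auto
  then show ?thesis by (simp add: frechet_derivative_def)
qed

lemma Ck_on_cong:
  assumes "open U" "\<And>y. y \<in> U \<Longrightarrow> f y = g y"
  shows "Ck_on k f U \<longleftrightarrow> Ck_on k g U"
  using assms(2)
proof (induction k arbitrary: f g)
  case 0
  then show ?case by (simp cong: continuous_on_cong)
next
  case (Suc k)
  have "f differentiable_on U \<longleftrightarrow> g differentiable_on U"
    using Suc.prems differentiable_transform_within[of f _ U 1 g] differentiable_transform_within[of g _ U 1 f]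
    by (auto simp: differentiable_on_def)
  moreover have "frechet_derivative f (at x) b = frechet_derivative g (at x) b" if "x \<in> U" for x b
    using frechet_derivative_cong_open[OF \<open>open U\<close> that, of f g] Suc.prems by simp
  then have "Ck_on k (\<lambda>x. frechet_derivative f (at x) b) U \<longleftrightarrow> Ck_on k (\<lambda>x. frechet_derivative g (at x) b) U" for b
    by (rule Suc.IH)
  ultimately show ?case by simp
qed

lemma Ck_on_SucD: "Ck_on (Suc k) f U \<Longrightarrow> Ck_on k f U"
  by (induction k arbitrary: f) (auto simp: differentiable_imp_continuous_on)

lemma Ck_on_Suc_has_derivative:
  assumes "Ck_on (Suc k) f U" "open U" "x \<in> U"
  shows "(f has_derivative frechet_derivative f (at x)) (at x)"
  using assms by (auto simp: differentiable_on_eq_differentiable_at frechet_derivative_works)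

lemma Ck_on_SucI:
  assumes "open U" "\<And>x. x \<in> U \<Longrightarrow> (f has_derivative f' x) (at x)"
    and "\<And>b. b \<in> Basis \<Longrightarrow> Ck_on k (\<lambda>x. f' x b) U"
  shows "Ck_on (Suc k) f U"
proof -
  have "frechet_derivative f (at x) = f' x" if "x \<in> U" for x
    using frechet_derivative_at[OF assms(2)[OF that]] by simp
  then have "Ck_on k (\<lambda>x. frechet_derivative f (at x) b) U" if "b \<in> Basis" for b
    using Ck_on_cong[OF assms(1), of "\<lambda>x. frechet_derivative f (at x) b" "\<lambda>x. f' x b"] assms(3)[OF that] by simp
  then show ?thesis
    using assms(1,2) by (auto simp: differentiable_on_eq_differentiable_at differentiable_def)
qed

lemma Ck_on_const: "Ck_on k (\<lambda>x. c) U"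
  by (induction k arbitrary: c) auto

lemma Ck_on_linear:
  assumes "open U" "bounded_linear L"
  shows "Ck_on k L U"
proof (cases k)
  case 0
  then show ?thesis using assms by (simp add: linear_continuous_on)
next
  case (Suc m)
  show ?thesis unfolding Suc
    by (rule Ck_on_SucI[where f' = "\<lambda>x. L"])
      (use assms in \<open>auto simp: bounded_linear_imp_has_derivative Ck_on_const\<close>)
qed

lemma Ck_on_add:
  assumes "open U"
  shows "Ck_on k f U \<Longrightarrow> Ck_on k g U \<Longrightarrow> Ck_on k (\<lambda>x. f x + g x) U"
proof (induction k arbitrary: f g)
  case 0
  then show ?case by (auto intro: continuous_on_add)
next
  case (Suc k)
  show ?case
  proof (rule Ck_on_SucI[where f' = "\<lambda>x b. frechet_derivative f (at x) b + frechet_derivative g (at x) b"])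
    fix x assume x: "x \<in> U"
    show "((\<lambda>x. f x + g x) has_derivative
         (\<lambda>b. frechet_derivative f (at x) b + frechet_derivative g (at x) b)) (at x)"
      by (intro has_derivative_add Ck_on_Suc_has_derivative[OF Suc.prems(1) assms x] Ck_on_Suc_has_derivative[OF Suc.prems(2) assms x])
  next
    fix b :: 'a assume "b \<in> Basis"
    then show "Ck_on k (\<lambda>x. frechet_derivative f (at x) b + frechet_derivative g (at x) b) U"
      using Suc.prems by (intro Suc.IH) auto
  qed (rule assms)
qed

lemma Ck_on_bilinear:
  assumes "open U" "bounded_bilinear bop"
  shows "Ck_on k f U \<Longrightarrow> Ck_on k g U \<Longrightarrow> Ck_on k (\<lambda>x. bop (f x) (g x)) U"
proof (induction k arbitrary: f g)
  case 0
  then show ?case using assms by (auto intro: bounded_bilinear.continuous_on)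
next
  case (Suc k)
  show ?case
  proof (rule Ck_on_SucI[where f' = "\<lambda>x b. bop (f x) (frechet_derivative g (at x) b) + bop (frechet_derivative f (at x) b) (g x)"])
    fix x assume x: "x \<in> U"
    show "((\<lambda>x. bop (f x) (g x)) has_derivative
         (\<lambda>b. bop (f x) (frechet_derivative g (at x) b) + bop (frechet_derivative f (at x) b) (g x))) (at x)"
      by (intro bounded_bilinear.FDERIV[OF assms(2)] Ck_on_Suc_has_derivative[OF Suc.prems(1) assms(1) x] Ck_on_Suc_has_derivative[OF Suc.prems(2) assms(1) x])
  next
    fix b :: 'a assume "b \<in> Basis"
    then show "Ck_on k (\<lambda>x. bop (f x) (frechet_derivative g (at x) b) + bop (frechet_derivative f (at x) b) (g x)) U"
      using Suc.prems Ck_on_SucD[OF Suc.prems(1)] Ck_on_SucD[OF Suc.prems(2)]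
      by (intro Ck_on_add assms Suc.IH) auto
  qed (use assms in auto)
qed

lemmas Ck_on_mult = Ck_on_bilinear[OF _ bounded_bilinear_mult]
  and Ck_on_scaleR = Ck_on_bilinear[OF _ bounded_bilinear_scaleR]
  and Ck_on_inner = Ck_on_bilinear[OF _ bounded_bilinear_inner]

lemma Ck_on_sum:
  assumes "open U" "finite I" "\<And>i. i \<in> I \<Longrightarrow> Ck_on k (f i) U"
  shows "Ck_on k (\<lambda>x. \<Sum>i\<in>I. f i x) U"
  using assms(2,3) by (induction I rule: finite_induct) (auto simp: Ck_on_const intro: Ck_on_add assms(1))

lemma Ck_on_compose:
  fixes f :: "'a::euclidean_space \<Rightarrow> 'b::euclidean_space" and g :: "'b \<Rightarrow> 'c::real_normed_vector"
  assumes "open U" "open V" "f ` U \<subseteq> V"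
  shows "Ck_on k f U \<Longrightarrow> Ck_on k g V \<Longrightarrow> Ck_on k (\<lambda>x. g (f x)) U"
proof (induction k arbitrary: g)
  case 0
  then show ?case using assms by (auto intro: continuous_on_compose2)
next
  case (Suc k)
  have f: "(f has_derivative frechet_derivative f (at x)) (at x)" if "x \<in> U" for x
    using Ck_on_Suc_has_derivative[OF Suc.prems(1) assms(1) that] .
  have g: "(g has_derivative frechet_derivative g (at (f x))) (at (f x))" if "x \<in> U" for x
    using Ck_on_Suc_has_derivative[OF Suc.prems(2) assms(2)] assms(3) that by blast
  \<comment> \<open>The derivative of \<open>g\<close> is expanded over \<open>Basis\<close>,
    because the induction hypothesis only covers derivatives along basis vectors.\<close>
  show ?case
  proof (rule Ck_on_SucI[where f' = "\<lambda>x b. \<Sum>c\<in>Basis. (frechet_derivative f (at x) b \<bullet> c) *\<^sub>R frechet_derivative g (at (f x)) c"])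
    fix x assume x: "x \<in> U"
    have lin: "linear (frechet_derivative g (at (f x)))"
      using g[OF x] by (simp add: has_derivative_linear)
    have rep: "frechet_derivative g (at (f x)) v = (\<Sum>c\<in>Basis. (v \<bullet> c) *\<^sub>R frechet_derivative g (at (f x)) c)" for v
      using lin linear_sum[OF lin, of "\<lambda>c. (v \<bullet> c) *\<^sub>R c" Basis]
      by (simp add: euclidean_representation linear_cmul)
    have "(\<lambda>b. \<Sum>c\<in>Basis. (frechet_derivative f (at x) b \<bullet> c) *\<^sub>R frechet_derivative g (at (f x)) c)
        = (\<lambda>b. frechet_derivative g (at (f x)) (frechet_derivative f (at x) b))"
      by (rule ext) (rule rep[symmetric])
    then show "((\<lambda>x. g (f x)) has_derivative (\<lambda>b. \<Sum>c\<in>Basis. (frechet_derivative f (at x) b \<bullet> c) *\<^sub>R frechet_derivative g (at (f x)) c)) (at x)"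
      using has_derivative_compose[OF f[OF x] g[OF x]] by (simp only:)
  next
    fix b :: 'a assume b: "b \<in> Basis"
    have 1: "Ck_on k (\<lambda>x. frechet_derivative f (at x) b \<bullet> c) U" for c
      using Suc.prems(1) b by (intro Ck_on_inner Ck_on_const assms) auto
    have 2: "Ck_on k (\<lambda>x. frechet_derivative g (at (f x)) c) U" if "c \<in> Basis" for c
      using Suc.IH[OF Ck_on_SucD[OF Suc.prems(1)], of "\<lambda>y. frechet_derivative g (at y) c"] Suc.prems(2) that by auto
    show "Ck_on k (\<lambda>x. \<Sum>c\<in>Basis. (frechet_derivative f (at x) b \<bullet> c) *\<^sub>R frechet_derivative g (at (f x)) c) U"
      by (intro Ck_on_sum Ck_on_scaleR assms(1) 1 2) auto
  qed (rule assms)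
qed

lemma Ck_on_real_SucI:
  fixes f :: "real \<Rightarrow> real"
  assumes "open U" "\<And>x. x \<in> U \<Longrightarrow> (f has_real_derivative f' x) (at x)" "Ck_on k f' U"
  shows "Ck_on (Suc k) f U"
proof (rule Ck_on_SucI[where f' = "\<lambda>x b. f' x * b"])
  show "(f has_derivative (*) (f' x)) (at x)" if "x \<in> U" for x
    using assms(2)[OF that] by (simp add: has_field_derivative_def)
qed (use assms in auto)

lemma Ck_on_inverse: "Ck_on k (inverse :: real \<Rightarrow> real) (- {0})"
proof (induction k)
  case 0
  show ?case by (auto intro!: continuous_intros)
next
  case (Suc k)
  have "Ck_on k (\<lambda>x::real. -1 * (inverse x * inverse x)) (- {0})"
    by (intro Ck_on_mult Suc Ck_on_const) auto
  then show ?case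
    by (rule Ck_on_real_SucI[rotated 2]) (auto intro!: derivative_eq_intros simp: power2_eq_square)
qed

lemma Ck_on_exp: "Ck_on k (exp :: real \<Rightarrow> real) UNIV"
proof (induction k)
  case (Suc k)
  show ?case
    by (rule Ck_on_real_SucI[OF _ _ Suc]) (auto intro!: derivative_eq_intros)
qed (auto intro!: continuous_intros)

lemma Ck_on_ln: "Ck_on k (ln :: real \<Rightarrow> real) {0<..}"
proof (cases k)
  case 0
  then show ?thesis by (auto intro!: continuous_intros)
next
  case (Suc m)
  show ?thesis unfolding Suc
  proof (rule Ck_on_real_SucI)
    show "Ck_on m inverse {0::real<..}"
      by (rule Ck_on_mono[OF Ck_on_inverse]) auto
  qed (auto intro!: derivative_eq_intros simp: divide_inverse)
qed

text \<open>The flat function exp(-\<delta>/t), extended by 0. The powers of 1/t are included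
  because the family is then closed under differentiation, so that smoothness at 0 is a single
  induction.\<close>

definition flat :: "real \<Rightarrow> nat \<Rightarrow> real \<Rightarrow> real" where
  "flat \<delta> n t = (if t > 0 then inverse t ^ n * exp (- \<delta> / t) else 0)"

text \<open>The term of order \<open>n + 2\<close> of the exponential series bounds
  \<open>exp (\<delta> / t)\<close> from below. The two surplus orders leave the factor
  \<open>t\<^sup>2\<close>, which gives the derivative 0 at \<open>t = 0\<close>.\<close>

lemma flat_le:
  assumes "\<delta> > 0"
  shows "\<bar>flat \<delta> n t\<bar> \<le> fact (n + 2) / \<delta> ^ (n + 2) * t\<^sup>2"
proof (cases "t > 0")
  case True
  have "(\<Sum>k\<in>{n + 2}. (\<delta> / t) ^ k /\<^sub>R fact k) \<le> exp (\<delta> / t)"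
    unfolding exp_def using assms True by (intro sum_le_suminf summable_exp_generic) auto
  then have "(\<delta> / t) ^ (n + 2) / fact (n + 2) \<le> exp (\<delta> / t)"
    by (simp add: divide_inverse ac_simps del: fact_Suc power_Suc)
  moreover have "inverse E \<le> F / X" if "X / F \<le> E" "X > 0" "F > 0" "E > 0" for X F E :: real
    using that by (simp add: field_simps)
  ultimately have "exp (- (\<delta> / t)) \<le> fact (n + 2) / (\<delta> / t) ^ (n + 2)"
    using assms True unfolding exp_minus by (metis divide_pos_pos exp_gt_zero fact_gt_zero zero_less_power)
  then have "inverse t ^ n * exp (- \<delta> / t) \<le> inverse t ^ n * (fact (n + 2) / (\<delta> / t) ^ (n + 2))"
    using True by (intro mult_left_mono) auto
  also have "\<dots> = fact (n + 2) / \<delta> ^ (n + 2) * t\<^sup>2"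
    using True assms by (simp add: field_simps power_add power2_eq_square)
  finally show ?thesis using True by (simp add: flat_def)
next
  case False
  then show ?thesis using assms by (simp add: flat_def)
qed

lemma flat_has_derivative:
  assumes "\<delta> > 0"
  shows "(flat \<delta> n has_real_derivative (- real n * flat \<delta> (n + 1) t + \<delta> * flat \<delta> (n + 2) t)) (at t)"
proof -
  consider "t > 0" | "t < 0" | "t = 0" by linarith
  then show ?thesis
  proof cases
    case 1
    have "((\<lambda>t. inverse t ^ n) has_real_derivative real n * inverse t ^ (n - 1) * - (inverse t * inverse t)) (at t)"
      using 1 by (auto intro!: derivative_eq_intros simp: power2_eq_square)
    moreover have "real n * inverse t ^ (n - 1) * - (inverse t * inverse t) = - real n * inverse t ^ (n + 1)"
      by (cases n) (auto simp: algebra_simps)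
    ultimately have 2: "((\<lambda>t. inverse t ^ n) has_real_derivative - real n * inverse t ^ (n + 1)) (at t)"
      by (simp only:)
    have "((\<lambda>t. exp (- \<delta> / t)) has_real_derivative exp (- \<delta> / t) * (\<delta> * inverse t ^ 2)) (at t)"
      using 1 by (auto intro!: derivative_eq_intros simp: power2_eq_square divide_inverse)
    from DERIV_mult[OF 2 this]
    have "((\<lambda>t. inverse t ^ n * exp (- \<delta> / t)) has_real_derivative
        (- real n * flat \<delta> (n + 1) t + \<delta> * flat \<delta> (n + 2) t)) (at t)"
      using 1 by (simp add: flat_def algebra_simps power2_eq_square)
    then show ?thesis
      by (rule has_field_derivative_transform_within_open[of _ _ _ "{0<..}"]) (use 1 in \<open>auto simp: flat_def\<close>)
  next
    case 2
    have "((\<lambda>t. 0) has_real_derivative 0) (at t)" by simp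
    then have "(flat \<delta> n has_real_derivative 0) (at t)"
      by (rule has_field_derivative_transform_within_open[of _ _ _ "{..<0}"]) (use 2 in \<open>auto simp: flat_def\<close>)
    then show ?thesis using 2 by (simp add: flat_def)
  next
    case 3
    let ?C = "fact (n + 2) / \<delta> ^ (n + 2)"
    have "((\<lambda>h. flat \<delta> n h / h) \<longlongrightarrow> 0) (at 0)"
    proof (rule Lim_null_comparison[of _ "\<lambda>h. ?C * \<bar>h\<bar>"])
      show "\<forall>\<^sub>F h in at 0. norm (flat \<delta> n h / h) \<le> ?C * \<bar>h\<bar>"
      proof (rule eventuallyI)
        fix h :: real
        show "norm (flat \<delta> n h / h) \<le> ?C * \<bar>h\<bar>"
        proof (cases "h = 0")
          case False
          then show ?thesis using flat_le[OF assms, of n h]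
            by (simp add: divide_le_eq power2_eq_square mult.assoc del: fact_Suc power_Suc)
        qed auto
      qed
      show "((\<lambda>h. ?C * \<bar>h\<bar>) \<longlongrightarrow> 0) (at 0)"
        by (rule tendsto_eq_intros | simp)+
    qed
    then show ?thesis using 3 by (simp add: DERIV_def flat_def)
  qed
qed

lemma Ck_on_flat:
  assumes "\<delta> > 0"
  shows "Ck_on k (flat \<delta> n) UNIV"
proof (induction k arbitrary: n)
  case 0
  have "isCont (flat \<delta> n) t" for t
    using flat_has_derivative[OF assms] DERIV_isCont by blast
  then show ?case by (simp add: continuous_at_imp_continuous_on)
next
  case (Suc k)
  have "Ck_on k (\<lambda>t. - real n * flat \<delta> (n + 1) t + \<delta> * flat \<delta> (n + 2) t) UNIV"
    by (intro Ck_on_add Ck_on_mult Suc Ck_on_const) auto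
  then show ?case
    by (rule Ck_on_real_SucI[OF open_UNIV flat_has_derivative[OF assms]])
qed

lemma smooth_onI:
  assumes "\<And>x. x \<in> D \<Longrightarrow> \<exists>U h. open U \<and> x \<in> U \<and> (\<forall>k. Ck_on k h U) \<and> (\<forall>y\<in>U \<inter> D. h y = f y)"
  shows "smooth_on D f"
  using assms by (simp add: smooth_on_def)

lemma smooth_onE:
  assumes "smooth_on D f" "x \<in> D"
  obtains U h where "open U" "x \<in> U" "\<And>k. Ck_on k h U" "\<And>y. y \<in> U \<Longrightarrow> y \<in> D \<Longrightarrow> h y = f y"
proof -
  obtain U h where "open U \<and> x \<in> U \<and> (\<forall>k. Ck_on k h U) \<and> (\<forall>y\<in>U \<inter> D. h y = f y)"
    using assms unfolding smooth_on_def by meson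
  then show ?thesis
    by (intro that[of U h]) simp_all
qed

lemma smooth_on_subset:
  assumes "smooth_on D f" "E \<subseteq> D"
  shows "smooth_on E f"
proof (rule smooth_onI)
  fix x assume "x \<in> E"
  then obtain U h where "open U" "x \<in> U" "\<And>k. Ck_on k h U" "\<And>y. y \<in> U \<Longrightarrow> y \<in> D \<Longrightarrow> h y = f y"
    using smooth_onE[OF assms(1), of x] assms(2) by blast
  then show "\<exists>U h. open U \<and> x \<in> U \<and> (\<forall>k. Ck_on k h U) \<and> (\<forall>y\<in>U \<inter> E. h y = f y)"
    using assms(2) by (intro exI[of _ U] exI[of _ h]) (simp add: subset_iff)
qed

lemma smooth_on_cong:
  assumes "smooth_on D f" "\<And>x. x \<in> D \<Longrightarrow> f x = g x"
  shows "smooth_on D g"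
proof (rule smooth_onI)
  fix x assume "x \<in> D"
  then obtain U h where "open U" "x \<in> U" "\<And>k. Ck_on k h U" "\<And>y. y \<in> U \<Longrightarrow> y \<in> D \<Longrightarrow> h y = f y"
    using smooth_onE[OF assms(1), of x] by blast
  then show "\<exists>U h. open U \<and> x \<in> U \<and> (\<forall>k. Ck_on k h U) \<and> (\<forall>y\<in>U \<inter> D. h y = g y)"
    by (intro exI[of _ U] exI[of _ h]) (simp add: assms(2))
qed

lemma smooth_on_local:
  assumes "\<And>x. x \<in> D \<Longrightarrow> \<exists>W. x \<in> W \<and> openin (top_of_set D) W \<and> smooth_on W f"
  shows "smooth_on D f"
proof (rule smooth_onI)
  fix x assume "x \<in> D"
  then obtain O' where O: "x \<in> D \<inter> O'" "open O'" "smooth_on (D \<inter> O') f"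
    using assms unfolding openin_open by metis
  then obtain U h where "open U" "x \<in> U" "\<And>k. Ck_on k h U" "\<And>y. y \<in> U \<Longrightarrow> y \<in> D \<inter> O' \<Longrightarrow> h y = f y"
    using smooth_onE[OF O(3,1)] by blast
  with O show "\<exists>U h. open U \<and> x \<in> U \<and> (\<forall>k. Ck_on k h U) \<and> (\<forall>y\<in>U \<inter> D. h y = f y)"
    by (intro exI[of _ "U \<inter> O'"] exI[of _ h]) (simp add: open_Int Ck_on_mono[of _ h U])
qed

named_theorems smooth_intros

lemma smooth_on_const [smooth_intros]: "smooth_on D (\<lambda>x. c)"
  by (rule smooth_onI, rule exI[of _ UNIV], rule exI[of _ "\<lambda>x. c"]) (simp add: Ck_on_const)

lemma smooth_on_bilinear:
  assumes "bounded_bilinear bop" "smooth_on D f" "smooth_on D g"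
  shows "smooth_on D (\<lambda>x. bop (f x) (g x))"
proof (rule smooth_onI)
  fix x assume x: "x \<in> D"
  obtain U h where U: "open U" "x \<in> U" "\<And>k. Ck_on k h U" "\<And>y. y \<in> U \<Longrightarrow> y \<in> D \<Longrightarrow> h y = f y"
    using smooth_onE[OF assms(2) x] by metis
  obtain V l where V: "open V" "x \<in> V" "\<And>k. Ck_on k l V" "\<And>y. y \<in> V \<Longrightarrow> y \<in> D \<Longrightarrow> l y = g y"
    using smooth_onE[OF assms(3) x] by metis
  have "Ck_on k (\<lambda>x. bop (h x) (l x)) (U \<inter> V)" for k
    by (rule Ck_on_bilinear[OF open_Int[OF U(1) V(1)] assms(1) Ck_on_mono[OF U(3)] Ck_on_mono[OF V(3)]]) auto
  then show "\<exists>U h. open U \<and> x \<in> U \<and> (\<forall>k. Ck_on k h U) \<and> (\<forall>y\<in>U \<inter> D. h y = bop (f y) (g y))"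
    by (intro exI[of _ "U \<inter> V"] exI[of _ "\<lambda>x. bop (h x) (l x)"]) (simp add: U V open_Int)
qed

lemma smooth_on_add [smooth_intros]:
  assumes "smooth_on D f" "smooth_on D g"
  shows "smooth_on D (\<lambda>x. f x + g x)"
proof (rule smooth_onI)
  fix x assume x: "x \<in> D"
  obtain U h where U: "open U" "x \<in> U" "\<And>k. Ck_on k h U" "\<And>y. y \<in> U \<Longrightarrow> y \<in> D \<Longrightarrow> h y = f y"
    using smooth_onE[OF assms(1) x] by metis
  obtain V l where V: "open V" "x \<in> V" "\<And>k. Ck_on k l V" "\<And>y. y \<in> V \<Longrightarrow> y \<in> D \<Longrightarrow> l y = g y"
    using smooth_onE[OF assms(2) x] by metis
  have "Ck_on k (\<lambda>x. h x + l x) (U \<inter> V)" for k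
    by (rule Ck_on_add[OF open_Int[OF U(1) V(1)] Ck_on_mono[OF U(3)] Ck_on_mono[OF V(3)]]) auto
  then show "\<exists>U h. open U \<and> x \<in> U \<and> (\<forall>k. Ck_on k h U) \<and> (\<forall>y\<in>U \<inter> D. h y = f y + g y)"
    by (intro exI[of _ "U \<inter> V"] exI[of _ "\<lambda>x. h x + l x"]) (simp add: U V open_Int)
qed

lemma smooth_on_compose:
  fixes f :: "'a::euclidean_space \<Rightarrow> 'b::euclidean_space" and g :: "'b \<Rightarrow> 'c::real_normed_vector"
  assumes "smooth_on D f" "smooth_on E g" "f ` D \<subseteq> E"
  shows "smooth_on D (\<lambda>x. g (f x))"
proof (rule smooth_onI)
  fix x assume x: "x \<in> D"
  obtain U h where U: "open U" "x \<in> U" "\<And>k. Ck_on k h U" "\<And>y. y \<in> U \<Longrightarrow> y \<in> D \<Longrightarrow> h y = f y"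
    using smooth_onE[OF assms(1) x] by metis
  obtain V l where V: "open V" "f x \<in> V" "\<And>k. Ck_on k l V" "\<And>y. y \<in> V \<Longrightarrow> y \<in> E \<Longrightarrow> l y = g y"
    using smooth_onE[OF assms(2)] x assms(3) by (metis image_subset_iff)
  have "continuous_on U h" using U(3)[of 0] by simp
  then have "open (U \<inter> h -` V)" using U(1) V(1) by (metis Int_commute continuous_on_open_vimage)
  moreover have eq: "l (h y) = g (f y)" if "y \<in> U" "h y \<in> V" "y \<in> D" for y
    using U(4)[of y] V(4)[of "f y"] that assms(3) by auto
  moreover from calculation(1) have "Ck_on k (\<lambda>x. l (h x)) (U \<inter> h -` V)" for k
    by (rule Ck_on_compose[OF _ V(1) _ Ck_on_mono[OF U(3)] V(3)]) auto
  ultimately show "\<exists>U h. open U \<and> x \<in> U \<and> (\<forall>k. Ck_on k h U) \<and> (\<forall>y\<in>U \<inter> D. h y = g (f y))"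
    using U(2) V(2) U(4)[OF U(2) x] eq
    by (intro exI[of _ "U \<inter> h -` V"] exI[of _ "\<lambda>x. l (h x)"]) simp
qed


lemma smooth_on_linear:
  assumes "bounded_linear L" shows "smooth_on D L"
  by (rule smooth_onI, rule exI[of _ UNIV], rule exI[of _ L]) (simp add: Ck_on_linear assms)

lemma smooth_on_linear_compose:
  fixes f :: "'a::euclidean_space \<Rightarrow> 'b::euclidean_space"
  assumes "bounded_linear L" "smooth_on D f"
  shows "smooth_on D (\<lambda>x. L (f x))"
  using smooth_on_compose[OF assms(2) smooth_on_linear[OF assms(1)], of UNIV] by simp

lemma smooth_on_mult [smooth_intros]:
  "smooth_on D f \<Longrightarrow> smooth_on D g \<Longrightarrow> smooth_on D (\<lambda>x. f x * g x :: real)"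
  using smooth_on_bilinear[OF bounded_bilinear_mult] .

lemma smooth_on_minus [smooth_intros]:
  "smooth_on D f \<Longrightarrow> smooth_on D (\<lambda>x. - f x :: real)"
  using smooth_on_mult[OF smooth_on_const[of D "-1"]] by simp

lemma smooth_on_diff [smooth_intros]:
  "smooth_on D f \<Longrightarrow> smooth_on D g \<Longrightarrow> smooth_on D (\<lambda>x. f x - g x :: real)"
  using smooth_on_add[OF _ smooth_on_minus] by fastforce

lemma smooth_on_sum [smooth_intros]:
  "(\<And>i. i \<in> I \<Longrightarrow> smooth_on D (f i)) \<Longrightarrow> smooth_on D (\<lambda>x. \<Sum>i\<in>I. f i x :: real)"
  by (induction I rule: infinite_finite_induct) (auto intro: smooth_intros)

lemma smooth_on_prod [smooth_intros]:
  "(\<And>i. i \<in> I \<Longrightarrow> smooth_on D (f i)) \<Longrightarrow> smooth_on D (\<lambda>x. \<Prod>i\<in>I. f i x :: real)"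
  by (induction I rule: infinite_finite_induct) (auto intro: smooth_intros)

lemma smooth_on_power [smooth_intros]:
  "smooth_on D f \<Longrightarrow> smooth_on D (\<lambda>x. f x ^ n :: real)"
  by (induction n) (auto intro: smooth_intros)

lemma smooth_on_inverse [smooth_intros]:
  assumes "smooth_on D f" "\<And>x. x \<in> D \<Longrightarrow> f x \<noteq> 0"
  shows "smooth_on D (\<lambda>x. inverse (f x) :: real)"
proof (rule smooth_on_compose[OF assms(1), of "- {0}"])
  show "smooth_on (- {0}) (inverse :: real \<Rightarrow> real)"
    by (rule smooth_onI, rule exI[of _ "- {0}"], rule exI[of _ inverse]) (simp add: Ck_on_inverse open_Compl)
qed (use assms(2) in auto)

lemma smooth_on_divide [smooth_intros]:
  assumes "smooth_on D f" "smooth_on D g" "\<And>x. x \<in> D \<Longrightarrow> g x \<noteq> 0"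
  shows "smooth_on D (\<lambda>x. f x / g x :: real)"
  using assms by (auto simp: divide_inverse intro!: smooth_intros)

lemma smooth_on_exp [smooth_intros]:
  assumes "smooth_on D f"
  shows "smooth_on D (\<lambda>x. exp (f x) :: real)"
proof (rule smooth_on_compose[OF assms, of UNIV])
  show "smooth_on UNIV (exp :: real \<Rightarrow> real)"
    by (rule smooth_onI, rule exI[of _ UNIV], rule exI[of _ exp]) (simp add: Ck_on_exp)
qed auto

lemma smooth_on_ln [smooth_intros]:
  assumes "smooth_on D f" "\<And>x. x \<in> D \<Longrightarrow> f x > 0"
  shows "smooth_on D (\<lambda>x. ln (f x) :: real)"
proof (rule smooth_on_compose[OF assms(1), of "{0<..}"])
  show "smooth_on {0<..} (ln :: real \<Rightarrow> real)"
    by (rule smooth_onI, rule exI[of _ "{0<..}"], rule exI[of _ ln]) (simp add: Ck_on_ln)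
qed (use assms(2) in auto)

lemma smooth_on_flat [smooth_intros]:
  assumes "smooth_on D f" "\<delta> > 0"
  shows "smooth_on D (\<lambda>x. flat \<delta> n (f x))"
proof (rule smooth_on_compose[OF assms(1), of UNIV])
  show "smooth_on UNIV (flat \<delta> n)"
    by (rule smooth_onI, rule exI[of _ UNIV], rule exI[of _ "flat \<delta> n"]) (simp add: Ck_on_flat assms(2))
qed auto

lemma smooth_on_nth:
  fixes f :: "'a::euclidean_space \<Rightarrow> ('b::euclidean_space)^'n"
  assumes "smooth_on D f"
  shows "smooth_on D (\<lambda>x. f x $ i)"
  using smooth_on_linear_compose[OF bounded_linear_vec_nth assms] .

lemma smooth_on_det [smooth_intros]:
  fixes A :: "'a::euclidean_space \<Rightarrow> real^'n^'n"
  assumes "\<And>i j. smooth_on D (\<lambda>x. A x $ i $ j)"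
  shows "smooth_on D (\<lambda>x. det (A x))"
  unfolding det_def by (intro smooth_intros assms)

lemma smooth_on_imp_continuous_on:
  assumes "smooth_on D f" shows "continuous_on D f"
  unfolding continuous_on_eq_continuous_within
proof
  fix x assume x: "x \<in> D"
  obtain U h where U: "open U" "x \<in> U" "\<And>k. Ck_on k h U" "\<And>y. y \<in> U \<Longrightarrow> y \<in> D \<Longrightarrow> h y = f y"
    using smooth_onE[OF assms x] by metis
  have "isCont h x" using U(3)[of 0] U(1,2) by (simp add: continuous_on_eq_continuous_at)
  then have "(h \<longlongrightarrow> h x) (at x within D)"
    by (auto simp: isCont_def intro: tendsto_within_subset)
  moreover have "\<forall>\<^sub>F y in at x within D. h y = f y"
    using U by (auto simp: eventually_at_topological)
  ultimately show "continuous (at x within D) f"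
    using U(4)[OF U(2) x] by (auto simp: continuous_within intro: Lim_transform_eventually)
qed

lemma smooth_on_differentiable:
  assumes "smooth_on D f" "x \<in> D"
  shows "f differentiable (at x within D)"
proof -
  obtain U h where U: "open U" "x \<in> U" "\<And>k. Ck_on k h U" "\<And>y. y \<in> U \<Longrightarrow> y \<in> D \<Longrightarrow> h y = f y"
    using smooth_onE[OF assms] by metis
  have "(h has_derivative frechet_derivative h (at x)) (at x within D)"
    using Ck_on_Suc_has_derivative[OF U(3) U(1,2)] has_derivative_at_withinI by blast
  moreover obtain e where "e > 0" "ball x e \<subseteq> U" using U(1,2) openE by blast
  ultimately have "(f has_derivative frechet_derivative h (at x)) (at x within D)"
    by (intro has_derivative_transform_within[of h _ x D e f] assms(2))
      (use U(4) in \<open>auto simp: dist_commute subset_iff\<close>)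
  then show ?thesis by (auto simp: differentiable_def)
qed

section \<open>Partial derivatives on coordinate patches\<close>

definition hs_open :: "(real^'n::{finite,one}) set \<Rightarrow> bool" where
  "hs_open D \<longleftrightarrow> openin (top_of_set half_space) D"

lemma hs_open_iff: "hs_open D \<longleftrightarrow> (\<exists>U. open U \<and> D = half_space \<inter> U)"
  by (simp add: hs_open_def openin_open)

lemma hs_open_Int: "hs_open D \<Longrightarrow> hs_open E \<Longrightarrow> hs_open (D \<inter> E)"
  by (simp add: hs_open_def openin_Int)

lemma hs_open_openin: "hs_open D \<Longrightarrow> openin (top_of_set D) W \<Longrightarrow> hs_open W"
  unfolding hs_open_def using openin_trans by blast

text \<open>The increment is positive because at a point with first coordinate 0 only the inward
  direction stays in the half-space. Positive increments along the axes suffice for the uniqueness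
  of derivatives within the set.\<close>

lemma hs_open_direction:
  fixes D :: "(real^'n::{finite,one}) set"
  assumes "hs_open D" "x \<in> D" "e > 0"
  shows "\<exists>d. 0 < d \<and> d < e \<and> x + d *\<^sub>R axis i 1 \<in> D"
proof -
  obtain U where U: "open U" "D = half_space \<inter> U" using assms(1) hs_open_iff by blast
  then obtain r where r: "r > 0" "ball x r \<subseteq> U" using assms(2) openE by blast
  define d where "d = min r e / 2"
  have d: "0 < d" "d < e" "d < r" using r assms(3) by (auto simp: d_def)
  have "x + d *\<^sub>R axis i 1 \<in> ball x r"
    using d by (simp add: dist_norm)
  moreover have "x + d *\<^sub>R axis i 1 \<in> half_space"
    using assms(2) U(2) d by (auto simp: half_space_def axis_def)
  ultimately show ?thesis using U r d by blast
qed

lemma has_derivative_unique_hs: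
  fixes f :: "real^'n::{finite,one} \<Rightarrow> 'b::real_normed_vector"
  assumes "hs_open D" "x \<in> D"
    and "(f has_derivative f') (at x within D)" "(f has_derivative f'') (at x within D)"
  shows "f' = f''"
proof (rule frechet_derivative_unique_within[OF assms(3,4)])
  fix b :: "real^'n::{finite,one}" and e :: real assume "b \<in> Basis" "e > 0"
  moreover from this obtain i where "b = axis i 1" by (auto simp: Basis_vec_def)
  ultimately show "\<exists>d. 0 < \<bar>d\<bar> \<and> \<bar>d\<bar> < e \<and> x + d *\<^sub>R b \<in> D"
    using hs_open_direction[OF assms(1,2), of e i] by (metis abs_of_pos)
qed

lemma frechet_derivative_hs:
  fixes f :: "real^'n::{finite,one} \<Rightarrow> 'b::real_normed_vector"
  assumes "hs_open D" "x \<in> D" "(f has_derivative f') (at x within D)"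
  shows "frechet_derivative f (at x within D) = f'"
  using has_derivative_unique_hs[OF assms(1,2) _ assms(3)] assms(3) frechet_derivative_works
  by (metis differentiableI)

lemma pd_eqI:
  assumes "(u has_derivative u') (at x within D)" "hs_open D" "x \<in> D"
  shows "pd D i u x = u' (axis i 1)"
  unfolding pd_def using frechet_derivative_hs[OF assms(2,3,1)] by simp

lemma linear_axis_sum:
  fixes L :: "real^'n \<Rightarrow> 'b::real_vector"
  assumes "linear L"
  shows "L v = (\<Sum>i\<in>UNIV. (v $ i) *\<^sub>R L (axis i 1))"
proof -
  have "L v = L (\<Sum>i\<in>UNIV. (v $ i) *\<^sub>R axis i 1)"
    using basis_expansion[of v] by (simp add: scalar_mult_eq_scaleR)
  then show ?thesis by (simp add: linear_sum[OF assms] linear_cmul[OF assms])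
qed

lemma has_derivative_pd:
  fixes u :: "real^'n \<Rightarrow> real"
  assumes "u differentiable (at x within D)"
  shows "(u has_derivative (\<lambda>v. \<Sum>i\<in>UNIV. v $ i * pd D i u x)) (at x within D)"
proof -
  have d: "(u has_derivative frechet_derivative u (at x within D)) (at x within D)"
    using assms frechet_derivative_works by blast
  have "frechet_derivative u (at x within D) = (\<lambda>v. \<Sum>i\<in>UNIV. v $ i * pd D i u x)"
    unfolding pd_def real_scaleR_def[symmetric] by (rule ext) (rule linear_axis_sum[OF has_derivative_linear[OF d]])
  from d[unfolded this] show ?thesis .
qed

lemma pd_subset:
  assumes "hs_open D" "hs_open W" "W \<subseteq> D" "x \<in> W" "u differentiable (at x within D)"
  shows "pd W i u x = pd D i u x"
proof -
  have "(u has_derivative frechet_derivative u (at x within D)) (at x within W)"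
    using assms(5,3) frechet_derivative_works has_derivative_subset by blast
  from pd_eqI[OF this assms(2,4)] show ?thesis by (simp add: pd_def)
qed

lemma pd_cong:
  assumes "\<And>y. y \<in> D \<Longrightarrow> u y = v y" "x \<in> D"
  shows "pd D i u x = pd D i v x"
proof -
  have "(u has_derivative f') (at x within D) \<longleftrightarrow> (v has_derivative f') (at x within D)" for f'
    using has_derivative_transform[OF assms(2), of u v f'] has_derivative_transform[OF assms(2), of v u f'] assms(1)
    by auto
  then show ?thesis by (simp add: pd_def frechet_derivative_def)
qed

text \<open>One-sided partial derivatives are those of any smooth local extension, so facts about
  open sets transfer to points of the boundary.\<close>

lemma pd_extension:
  assumes "hs_open D" "x \<in> D" "open U" "x \<in> U" "(h has_derivative h') (at x)"
    and "\<And>y. y \<in> U \<Longrightarrow> y \<in> D \<Longrightarrow> h y = u y"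
  shows "pd D i u x = h' (axis i 1)"
proof -
  obtain e where e: "e > 0" "ball x e \<subseteq> U" using assms(3,4) openE by blast
  have "(h has_derivative h') (at x within D)" using assms(5) has_derivative_at_withinI by blast
  then have "(u has_derivative h') (at x within D)"
    by (rule has_derivative_transform_within[OF _ e(1) assms(2)])
      (use assms(6) e(2) in \<open>auto simp: dist_commute subset_iff\<close>)
  from pd_eqI[OF this assms(1,2)] show ?thesis .
qed

lemma smooth_on_pd [smooth_intros]:
  assumes "smooth_on D u" "hs_open D"
  shows "smooth_on D (pd D i u)"
proof (rule smooth_onI)
  fix x assume "x \<in> D"
  then obtain U h where U: "open U" "x \<in> U" "\<And>k. Ck_on k h U" "\<And>y. y \<in> U \<Longrightarrow> y \<in> D \<Longrightarrow> h y = u y"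
    using smooth_onE[OF assms(1), of x] by blast
  have "(axis i 1 :: real^_) \<in> Basis" by (simp add: axis_in_Basis_iff)
  then have "Ck_on k (\<lambda>y. frechet_derivative h (at y) (axis i 1)) U" for k
    using U(3)[of "Suc k"] by simp
  moreover have "frechet_derivative h (at y) (axis i 1) = pd D i u y" if "y \<in> U" "y \<in> D" for y
    using pd_extension[OF assms(2) that(2) U(1) that(1) Ck_on_Suc_has_derivative[OF U(3) U(1) that(1)] U(4)] by simp
  ultimately show "\<exists>U h. open U \<and> x \<in> U \<and> (\<forall>k. Ck_on k h U) \<and> (\<forall>y\<in>U \<inter> D. h y = pd D i u y)"
    by (intro exI[of _ U] exI[of _ "\<lambda>y. frechet_derivative h (at y) (axis i 1)"]) (simp add: U(1,2))
qed

text \<open>The mean value theorem is used twice: in the direction \<open>b\<close> for the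
  difference of \<open>h\<close> along \<open>c\<close>, then in the direction \<open>c\<close> for
  the derivative of \<open>h\<close> along \<open>b\<close>. The bound \<open>2 * s < e\<close>
  keeps the whole parallelogram in the ball.\<close>

lemma second_difference:
  fixes h :: "'a::euclidean_space \<Rightarrow> real"
  assumes C: "Ck_on (Suc (Suc 0)) h U" and U: "open U" and bc: "b \<in> Basis" "c \<in> Basis"
    and s: "0 < s" "2 * s < e" "ball x e \<subseteq> U"
  shows "\<exists>p\<in>ball x e. h (x + s *\<^sub>R b + s *\<^sub>R c) - h (x + s *\<^sub>R b) - h (x + s *\<^sub>R c) + h x
     = s * s * frechet_derivative (\<lambda>y. frechet_derivative h (at y) b) (at p) c"
proof -
  have inU: "x + \<sigma> *\<^sub>R b + \<tau> *\<^sub>R c \<in> ball x e" if "0 \<le> \<sigma>" "\<sigma> \<le> s" "0 \<le> \<tau>" "\<tau> \<le> s" for \<sigma> \<tau>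
  proof -
    have "norm (\<sigma> *\<^sub>R b + \<tau> *\<^sub>R c) \<le> \<sigma> + \<tau>"
      using norm_triangle_ineq[of "\<sigma> *\<^sub>R b" "\<tau> *\<^sub>R c"] that bc by simp
    moreover have "dist x (x + \<sigma> *\<^sub>R b + \<tau> *\<^sub>R c) = norm (\<sigma> *\<^sub>R b + \<tau> *\<^sub>R c)"
      by (metis add.assoc add_diff_cancel_left' dist_commute dist_norm)
    ultimately show ?thesis using that s by simp
  qed
  have dh: "((\<lambda>\<sigma>. h (v + \<sigma> *\<^sub>R b)) has_real_derivative frechet_derivative h (at (v + \<sigma> *\<^sub>R b)) b) (at \<sigma>)"
    if "v + \<sigma> *\<^sub>R b \<in> U" for v \<sigma>
  proof -
    have d: "(h has_derivative frechet_derivative h (at (v + \<sigma> *\<^sub>R b))) (at (v + \<sigma> *\<^sub>R b))"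
      using Ck_on_Suc_has_derivative[OF C U that] .
    have "((\<lambda>\<sigma>. v + \<sigma> *\<^sub>R b) has_derivative (\<lambda>t. t *\<^sub>R b)) (at \<sigma>)"
      by (auto intro!: derivative_eq_intros)
    from has_derivative_compose[OF this d] show ?thesis
      by (simp add: has_field_derivative_def linear_cmul[OF has_derivative_linear[OF d]] mult.commute[of _ "frechet_derivative h _ b"])
  qed
  have dh2: "((\<lambda>\<tau>. frechet_derivative h (at (v + \<tau> *\<^sub>R c)) b) has_real_derivative
      frechet_derivative (\<lambda>y. frechet_derivative h (at y) b) (at (v + \<tau> *\<^sub>R c)) c) (at \<tau>)"
    if "v + \<tau> *\<^sub>R c \<in> U" for v \<tau>
  proof -
    let ?g = "\<lambda>y. frechet_derivative h (at y) b"
    have "Ck_on (Suc 0) ?g U" using C bc by simp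
    then have d: "(?g has_derivative frechet_derivative ?g (at (v + \<tau> *\<^sub>R c))) (at (v + \<tau> *\<^sub>R c))"
      using Ck_on_Suc_has_derivative[OF _ U that] by blast
    have "((\<lambda>\<sigma>. v + \<sigma> *\<^sub>R c) has_derivative (\<lambda>t. t *\<^sub>R c)) (at \<tau>)"
      by (auto intro!: derivative_eq_intros)
    from has_derivative_compose[OF this d] show ?thesis
      by (simp add: has_field_derivative_def linear_cmul[OF has_derivative_linear[OF d]] mult.commute[of _ "frechet_derivative ?g _ c"])
  qed
  have "\<exists>\<sigma>. 0 < \<sigma> \<and> \<sigma> < s \<and>
      (\<lambda>\<sigma>. h (x + s *\<^sub>R c + \<sigma> *\<^sub>R b) - h (x + \<sigma> *\<^sub>R b)) s - (\<lambda>\<sigma>. h (x + s *\<^sub>R c + \<sigma> *\<^sub>R b) - h (x + \<sigma> *\<^sub>R b)) 0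
      = (s - 0) * (frechet_derivative h (at (x + s *\<^sub>R c + \<sigma> *\<^sub>R b)) b - frechet_derivative h (at (x + \<sigma> *\<^sub>R b)) b)"
  proof (rule MVT2)
    fix \<sigma> assume "0 \<le> \<sigma>" "\<sigma> \<le> s"
    then have "x + s *\<^sub>R c + \<sigma> *\<^sub>R b \<in> U" "x + \<sigma> *\<^sub>R b \<in> U"
      using inU[of \<sigma> s] inU[of \<sigma> 0] s by (auto simp: ac_simps)
    then show "((\<lambda>\<sigma>. h (x + s *\<^sub>R c + \<sigma> *\<^sub>R b) - h (x + \<sigma> *\<^sub>R b)) has_real_derivative
        (frechet_derivative h (at (x + s *\<^sub>R c + \<sigma> *\<^sub>R b)) b - frechet_derivative h (at (x + \<sigma> *\<^sub>R b)) b)) (at \<sigma>)"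
      by (intro DERIV_diff dh)
  qed (rule s)
  then obtain \<sigma> where \<sigma>: "0 < \<sigma>" "\<sigma> < s"
    "h (x + s *\<^sub>R b + s *\<^sub>R c) - h (x + s *\<^sub>R b) - h (x + s *\<^sub>R c) + h x
      = s * (frechet_derivative h (at (x + \<sigma> *\<^sub>R b + s *\<^sub>R c)) b - frechet_derivative h (at (x + \<sigma> *\<^sub>R b)) b)"
    by (auto simp: algebra_simps)
  have "\<exists>\<tau>. 0 < \<tau> \<and> \<tau> < s \<and>
      (\<lambda>\<tau>. frechet_derivative h (at (x + \<sigma> *\<^sub>R b + \<tau> *\<^sub>R c)) b) s - (\<lambda>\<tau>. frechet_derivative h (at (x + \<sigma> *\<^sub>R b + \<tau> *\<^sub>R c)) b) 0
      = (s - 0) * frechet_derivative (\<lambda>y. frechet_derivative h (at y) b) (at (x + \<sigma> *\<^sub>R b + \<tau> *\<^sub>R c)) c"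
    using inU \<sigma>(1,2) s by (intro MVT2 dh2) auto
  then obtain \<tau> where \<tau>: "0 < \<tau>" "\<tau> < s"
    "frechet_derivative h (at (x + \<sigma> *\<^sub>R b + s *\<^sub>R c)) b - frechet_derivative h (at (x + \<sigma> *\<^sub>R b)) b
      = s * frechet_derivative (\<lambda>y. frechet_derivative h (at y) b) (at (x + \<sigma> *\<^sub>R b + \<tau> *\<^sub>R c)) c"
    by auto
  show ?thesis
    by (rule bexI[of _ "x + \<sigma> *\<^sub>R b + \<tau> *\<^sub>R c"])
      (use \<sigma> \<tau> inU[of \<sigma> \<tau>] in \<open>auto simp: mult.assoc\<close>)
qed

text \<open>The second difference is symmetric in \<open>b\<close> and \<open>c\<close>, so the two
  mixed derivatives take a common value at two points near \<open>x\<close>. A gap between them at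
  \<open>x\<close> would contradict their continuity.\<close>

lemma frechet_derivative_swap:
  fixes h :: "'a::euclidean_space \<Rightarrow> real"
  assumes C: "Ck_on (Suc (Suc 0)) h U" and U: "open U" "x \<in> U" and bc: "b \<in> Basis" "c \<in> Basis"
  shows "frechet_derivative (\<lambda>y. frechet_derivative h (at y) b) (at x) c
       = frechet_derivative (\<lambda>y. frechet_derivative h (at y) c) (at x) b" (is "?A x = ?B x")
proof (rule ccontr)
  assume ne: "?A x \<noteq> ?B x"
  have "continuous_on U ?A" "continuous_on U ?B"
    using C bc by (auto dest!: bspec[of Basis])
  then have "isCont ?A x" "isCont ?B x"
    using U by (auto simp: continuous_on_eq_continuous_at)
  moreover have "\<bar>?A x - ?B x\<bar> / 2 > 0" using ne by simp
  ultimately obtain d1 d2 where d: "d1 > 0" "\<And>y. dist y x < d1 \<Longrightarrow> dist (?A y) (?A x) < \<bar>?A x - ?B x\<bar> / 2"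
    "d2 > 0" "\<And>y. dist y x < d2 \<Longrightarrow> dist (?B y) (?B x) < \<bar>?A x - ?B x\<bar> / 2"
    unfolding continuous_at_eps_delta by metis
  obtain r where r: "r > 0" "ball x r \<subseteq> U" using U openE by blast
  define e where "e = min r (min d1 d2)"
  have e: "e > 0" "ball x e \<subseteq> U" "e \<le> d1" "e \<le> d2" using r d by (auto simp: e_def)
  obtain p where p: "p \<in> ball x e" "h (x + (e/4) *\<^sub>R b + (e/4) *\<^sub>R c) - h (x + (e/4) *\<^sub>R b) - h (x + (e/4) *\<^sub>R c) + h x = e/4 * (e/4) * ?A p"
    using second_difference[OF C U(1) bc, of "e/4" e x] e by auto
  obtain q where q: "q \<in> ball x e" "h (x + (e/4) *\<^sub>R c + (e/4) *\<^sub>R b) - h (x + (e/4) *\<^sub>R c) - h (x + (e/4) *\<^sub>R b) + h x = e/4 * (e/4) * ?B q"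
    using second_difference[OF C U(1) bc(2,1), of "e/4" e x] e by auto
  have "e/4 * (e/4) * ?A p = e/4 * (e/4) * ?B q"
    using p(2) q(2) unfolding add.assoc add.commute[of "(e/4) *\<^sub>R c"] by linarith
  then have "?A p = ?B q" using e by simp
  moreover have "dist (?A p) (?A x) < \<bar>?A x - ?B x\<bar> / 2" "dist (?B q) (?B x) < \<bar>?A x - ?B x\<bar> / 2"
    using p(1) q(1) d e by (auto simp: dist_commute)
  ultimately show False by (simp add: dist_real_def abs_if split: if_splits)
qed

lemma pd_swap:
  assumes "smooth_on D u" "hs_open D" "x \<in> D"
  shows "pd D i (pd D j u) x = pd D j (pd D i u) x"
proof -
  obtain U h where U: "open U" "x \<in> U" "\<And>k. Ck_on k h U" "\<And>y. y \<in> U \<Longrightarrow> y \<in> D \<Longrightarrow> h y = u y"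
    using smooth_onE[OF assms(1,3)] by blast
  have B: "(axis i 1 :: real^_) \<in> Basis" for i by (simp add: axis_in_Basis_iff)
  have 1: "frechet_derivative h (at y) (axis i 1) = pd D i u y" if "y \<in> U" "y \<in> D" for y i
    using pd_extension[OF assms(2) that(2) U(1) that(1) Ck_on_Suc_has_derivative[OF U(3) U(1) that(1)] U(4)] by simp
  have 2: "pd D i (pd D j u) x = frechet_derivative (\<lambda>y. frechet_derivative h (at y) (axis j 1)) (at x) (axis i 1)" for i j
  proof (rule pd_extension[OF assms(2,3) U(1,2) Ck_on_Suc_has_derivative[OF _ U(1,2)] 1])
    show "Ck_on (Suc 0) (\<lambda>y. frechet_derivative h (at y) (axis j 1)) U"
      using U(3)[of "Suc (Suc 0)"] B[of j] by simp
  qed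
  show ?thesis unfolding 2
    by (rule frechet_derivative_swap[OF U(3) U(1,2) B B])
qed

lemma pd_const [simp]: "hs_open D \<Longrightarrow> x \<in> D \<Longrightarrow> pd D i (\<lambda>y. a) x = 0"
  by (subst pd_eqI[where u' = "\<lambda>v. 0"]) auto

lemma pd_add:
  assumes "smooth_on D u" "smooth_on D v" "hs_open D" "x \<in> D"
  shows "pd D i (\<lambda>y. u y + v y) x = pd D i u x + pd D i v x"
  using pd_eqI[OF has_derivative_add[OF has_derivative_pd[OF smooth_on_differentiable[OF assms(1,4)]]
        has_derivative_pd[OF smooth_on_differentiable[OF assms(2,4)]]] assms(3,4), of i]
  by (simp add: axis_def if_distrib if_distribR cong: if_cong)

lemma pd_mult:
  assumes "smooth_on D u" "smooth_on D v" "hs_open D" "x \<in> D"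
  shows "pd D i (\<lambda>y. u y * v y) x = u x * pd D i v x + pd D i u x * v x"
  using pd_eqI[OF has_derivative_mult[OF has_derivative_pd[OF smooth_on_differentiable[OF assms(1,4)]]
        has_derivative_pd[OF smooth_on_differentiable[OF assms(2,4)]]] assms(3,4), of i]
  by (simp add: axis_def if_distrib if_distribR cong: if_cong)

lemma pd_real_compose:
  assumes "smooth_on D u" "(\<psi> has_real_derivative r) (at (u x))" "hs_open D" "x \<in> D"
  shows "pd D i (\<lambda>y. \<psi> (u y)) x = r * pd D i u x"
  using pd_eqI[OF has_derivative_compose[OF has_derivative_pd[OF smooth_on_differentiable[OF assms(1,4)]]
        assms(2)[unfolded has_field_derivative_def]] assms(3,4), of i]
  by (simp add: axis_def if_distrib if_distribR cong: if_cong)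

lemma pd_cmult:
  assumes "smooth_on D u" "hs_open D" "x \<in> D"
  shows "pd D i (\<lambda>y. a * u y) x = a * pd D i u x"
  using pd_mult[OF smooth_on_const assms(1,2,3)] assms by simp

lemma pd_minus:
  assumes "smooth_on D u" "hs_open D" "x \<in> D"
  shows "pd D i (\<lambda>y. - u y) x = - pd D i u x"
  using pd_cmult[OF assms, of i "-1"] by simp

lemma pd_diff:
  assumes "smooth_on D u" "smooth_on D v" "hs_open D" "x \<in> D"
  shows "pd D i (\<lambda>y. u y - v y) x = pd D i u x - pd D i v x"
  using pd_add[OF assms(1) smooth_on_minus[OF assms(2)] assms(3,4)] pd_minus[OF assms(2-4)] by simp

lemma pd_sum:
  assumes "\<And>k. k \<in> I \<Longrightarrow> smooth_on D (u k)" "hs_open D" "x \<in> D"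
  shows "pd D i (\<lambda>y. \<Sum>k\<in>I. u k y) x = (\<Sum>k\<in>I. pd D i (u k) x)"
  using assms(1)
  by (induction I rule: infinite_finite_induct)
    (simp_all add: assms(2,3) pd_add smooth_on_sum)

lemma pd_chain:
  fixes \<Phi> :: "real^'k::{finite,one} \<Rightarrow> real^'n::{finite,one}"
  assumes "smooth_on W \<Phi>" "smooth_on D u" "\<Phi> ` W \<subseteq> D" "hs_open W" "x \<in> W"
  shows "pd W a (\<lambda>y. u (\<Phi> y)) x = (\<Sum>k\<in>UNIV. pd D k u (\<Phi> x) * pd W a (\<lambda>y. \<Phi> y $ k) x)"
proof -
  have d: "(\<Phi> has_derivative frechet_derivative \<Phi> (at x within W)) (at x within W)"
    using smooth_on_differentiable[OF assms(1,5)] frechet_derivative_works by blast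
  have "(u has_derivative (\<lambda>v. \<Sum>k\<in>UNIV. v $ k * pd D k u (\<Phi> x))) (at (\<Phi> x) within \<Phi> ` W)"
    by (rule has_derivative_subset[OF has_derivative_pd[OF smooth_on_differentiable[OF assms(2)]] assms(3)])
      (use assms(3,5) in auto)
  from has_derivative_in_compose[OF d this]
  have "pd W a (\<lambda>y. u (\<Phi> y)) x = (\<Sum>k\<in>UNIV. frechet_derivative \<Phi> (at x within W) (axis a 1) $ k * pd D k u (\<Phi> x))"
    by (rule pd_eqI) (use assms in auto)
  moreover have "pd W a (\<lambda>y. \<Phi> y $ k) x = frechet_derivative \<Phi> (at x within W) (axis a 1) $ k" for k
    by (rule pd_eqI[OF bounded_linear.has_derivative[OF bounded_linear_vec_nth d] assms(4,5)])
  ultimately show ?thesis by (simp add: mult.commute)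
qed

lemma jacobian_nth_pd:
  fixes \<Phi> :: "real^'k::{finite,one} \<Rightarrow> real^'n"
  assumes "smooth_on W \<Phi>" "hs_open W" "x \<in> W"
  shows "jacobian \<Phi> (at x within W) $ k $ a = pd W a (\<lambda>y. \<Phi> y $ k) x"
proof -
  have d: "(\<Phi> has_derivative frechet_derivative \<Phi> (at x within W)) (at x within W)"
    using smooth_on_differentiable[OF assms(1,3)] frechet_derivative_works by blast
  have "pd W a (\<lambda>y. \<Phi> y $ k) x = frechet_derivative \<Phi> (at x within W) (axis a 1) $ k"
    by (rule pd_eqI[OF bounded_linear.has_derivative[OF bounded_linear_vec_nth d] assms(2,3)])
  then show ?thesis by (simp add: jacobian_def matrix_def)
qed

section \<open>Inverse matrices\<close>

lemma matrix_inv: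
  fixes A :: "real^'n^'n"
  assumes "det A \<noteq> 0"
  shows matrix_inv_right: "A ** matrix_inv A = mat 1" and matrix_inv_left: "matrix_inv A ** A = mat 1"
proof -
  have "\<exists>A'. A ** A' = mat 1 \<and> A' ** A = mat 1"
    using assms invertible_det_nz[of A] by (simp add: invertible_def)
  then have "A ** matrix_inv A = mat 1 \<and> matrix_inv A ** A = mat 1"
    unfolding matrix_inv_def by (rule someI_ex)
  then show "A ** matrix_inv A = mat 1" "matrix_inv A ** A = mat 1" by auto
qed

lemma matrix_inv_unique:
  fixes A B :: "real^'n^'n"
  assumes "A ** B = mat 1"
  shows "matrix_inv A = B"
proof -
  have "det A * det B = 1" using arg_cong[OF assms, of det] by (simp add: det_mul)
  then have "det A \<noteq> 0" by auto
  then have "matrix_inv A ** (A ** B) = B" by (simp add: matrix_mul_assoc matrix_inv_left)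
  then show ?thesis using assms by simp
qed

lemma matrix_inv_nth:
  fixes A :: "real^'n^'n"
  assumes "det A \<noteq> 0"
  shows "matrix_inv A $ i $ j = det (\<chi> k l. if l = i then axis j 1 $ k else A $ k $ l) / det A"
proof -
  have "A *v (matrix_inv A *v axis j 1) = axis j 1"
    using matrix_inv_right[OF assms] by (simp add: matrix_vector_mul_assoc)
  then have "matrix_inv A *v axis j 1 = (\<chi> i. det (\<chi> k l. if l = i then axis j 1 $ k else A $ k $ l) / det A)"
    using cramer[OF assms] by blast
  then have "(matrix_inv A *v axis j 1) $ i = det (\<chi> k l. if l = i then axis j 1 $ k else A $ k $ l) / det A"
    by simp
  then show ?thesis by (simp add: matrix_vector_mult_basis column_def)
qed

text \<open>Cramer's rule writes each entry as a quotient of determinants, which are polynomials in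
  the entries of the matrix.\<close>

lemma smooth_on_matrix_inv [smooth_intros]:
  fixes A :: "'a::euclidean_space \<Rightarrow> real^'n^'n"
  assumes "\<And>i j. smooth_on D (\<lambda>x. A x $ i $ j)" "\<And>x. x \<in> D \<Longrightarrow> det (A x) \<noteq> 0"
  shows "smooth_on D (\<lambda>x. matrix_inv (A x) $ i $ j)"
proof (rule smooth_on_cong)
  show "smooth_on D (\<lambda>x. det (\<chi> k l. if l = i then axis j 1 $ k else A x $ k $ l) / det (A x))"
  proof (intro smooth_on_divide smooth_on_det assms)
    show "smooth_on D (\<lambda>x. (\<chi> k l. if l = i then axis j 1 $ k else A x $ k $ l) $ k $ l)" for k l
      by (cases "l = i") (simp_all add: assms smooth_on_const)
  qed
qed (simp add: matrix_inv_nth assms(2))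

section \<open>Derivatives of vector and matrix fields\<close>

definition pdv :: "(real^'k::{finite,one}) set \<Rightarrow> 'k \<Rightarrow> (real^'k::{finite,one} \<Rightarrow> real^'n) \<Rightarrow> real^'k::{finite,one} \<Rightarrow> real^'n" where
  "pdv W a V x = (\<chi> k. pd W a (\<lambda>z. V z $ k) x)"

definition pdm :: "(real^'k::{finite,one}) set \<Rightarrow> 'k \<Rightarrow> (real^'k::{finite,one} \<Rightarrow> real^'n^'m) \<Rightarrow> real^'k::{finite,one} \<Rightarrow> real^'n^'m" where
  "pdm W a M x = (\<chi> k l. pd W a (\<lambda>z. M z $ k $ l) x)"

text \<open>Smoothness is required componentwise, since \<open>pd\<close> differentiates real
  functions only.\<close>

definition smv :: "(real^'k::{finite,one}) set \<Rightarrow> (real^'k::{finite,one} \<Rightarrow> real^'n) \<Rightarrow> bool" where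
  "smv W V \<longleftrightarrow> (\<forall>k. smooth_on W (\<lambda>z. V z $ k))"

definition smm :: "(real^'k::{finite,one}) set \<Rightarrow> (real^'k::{finite,one} \<Rightarrow> real^'n^'m) \<Rightarrow> bool" where
  "smm W M \<longleftrightarrow> (\<forall>k l. smooth_on W (\<lambda>z. M z $ k $ l))"

lemma smvD: "smv W V \<Longrightarrow> smooth_on W (\<lambda>z. V z $ k)"
  by (simp add: smv_def)

lemma smmD: "smm W M \<Longrightarrow> smooth_on W (\<lambda>z. M z $ k $ l)"
  by (simp add: smm_def)

lemma smv_add: "smv W V \<Longrightarrow> smv W U \<Longrightarrow> smv W (\<lambda>z. V z + U z)"
  by (auto simp: smv_def intro: smooth_intros)

lemma smv_matvec: "smm W M \<Longrightarrow> smv W V \<Longrightarrow> smv W (\<lambda>z. M z *v V z)"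
  by (auto simp: smv_def smm_def matrix_vector_mult_def intro!: smooth_intros)

lemma smm_matmul: "smm W M \<Longrightarrow> smm W N \<Longrightarrow> smm W (\<lambda>z. M z ** N z)"
  by (auto simp: smm_def matrix_matrix_mult_def intro!: smooth_intros)

lemma smv_pdv: "smv W V \<Longrightarrow> hs_open W \<Longrightarrow> smv W (pdv W a V)"
  by (auto simp: smv_def pdv_def intro!: smooth_intros)

lemma smooth_on_inner: "smv W V \<Longrightarrow> smv W U \<Longrightarrow> smooth_on W (\<lambda>z. V z \<bullet> U z)"
  by (auto simp: smv_def inner_vec_def intro!: smooth_intros)

lemma smooth_on_ip: "smm W M \<Longrightarrow> smv W V \<Longrightarrow> smv W U \<Longrightarrow> smooth_on W (\<lambda>z. ip (M z) (V z) (U z))"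
  unfolding ip_def by (intro smooth_on_inner smv_matvec)

lemma pdv_add:
  assumes "smv W V" "smv W U" "hs_open W" "x \<in> W"
  shows "pdv W a (\<lambda>z. V z + U z) x = pdv W a V x + pdv W a U x"
  by (simp add: pdv_def vec_eq_iff pd_add smvD[OF assms(1)] smvD[OF assms(2)] assms)

lemma pdv_matvec:
  assumes "smm W M" "smv W V" "hs_open W" "x \<in> W"
  shows "pdv W a (\<lambda>z. M z *v V z) x = pdm W a M x *v V x + M x *v pdv W a V x"
  using smmD[OF assms(1)] smvD[OF assms(2)] assms(3,4)
  by (simp add: pdv_def pdm_def vec_eq_iff matrix_vector_mult_def pd_sum pd_mult smooth_on_mult
      sum.distrib[symmetric] add.commute)

lemma pdm_matmul:
  assumes "smm W M" "smm W N" "hs_open W" "x \<in> W"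
  shows "pdm W a (\<lambda>z. M z ** N z) x = pdm W a M x ** N x + M x ** pdm W a N x"
  using smmD[OF assms(1)] smmD[OF assms(2)] assms(3,4)
  by (simp add: pdm_def vec_eq_iff matrix_matrix_mult_def pd_sum pd_mult smooth_on_mult
      sum.distrib[symmetric] add.commute)

lemma pd_inner:
  assumes "smv W V" "smv W U" "hs_open W" "x \<in> W"
  shows "pd W a (\<lambda>z. V z \<bullet> U z) x = pdv W a V x \<bullet> U x + V x \<bullet> pdv W a U x"
  using smvD[OF assms(1)] smvD[OF assms(2)] assms(3,4)
  by (simp add: pdv_def inner_vec_def pd_sum pd_mult smooth_on_mult sum.distrib[symmetric] add.commute)

lemma pd_ip:
  assumes "smm W M" "smv W V" "smv W U" "hs_open W" "x \<in> W"
  shows "pd W a (\<lambda>z. ip (M z) (V z) (U z)) x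
    = ip (pdm W a M x) (V x) (U x) + ip (M x) (pdv W a V x) (U x) + ip (M x) (V x) (pdv W a U x)"
  unfolding ip_def
  by (simp add: pd_inner[OF assms(2) smv_matvec[OF assms(1,3)] assms(4,5)] pdv_matvec[OF assms(1,3-5)] inner_add_right)

lemma pdv_swap:
  assumes "smv W V" "hs_open W" "x \<in> W"
  shows "pdv W a (pdv W b V) x = pdv W b (pdv W a V) x"
  using pd_swap[OF smvD[OF assms(1)] assms(2,3)] by (simp add: pdv_def)

lemma ip_add_left: "ip A (v + w) u = ip A v u + ip A w u"
  and ip_add_right: "ip A u (v + w) = ip A u v + ip A u w"
  and ip_diff_left: "ip A (v - w) u = ip A v u - ip A w u"
  and ip_diff_right: "ip A u (v - w) = ip A u v - ip A u w"
  and ip_scaleR_left: "ip A (c *\<^sub>R v) u = c * ip A v u"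
  and ip_scaleR_right: "ip A u (c *\<^sub>R v) = c * ip A u v"
  and ip_zero_left: "ip A 0 u = 0" and ip_zero_right: "ip A u 0 = 0"
  by (simp_all add: ip_def inner_add_left inner_add_right inner_diff_left inner_diff_right
      matrix_vector_right_distrib matrix_vector_mult_diff_distrib matrix_vector_mult_scaleR)

lemma ip_minus_left: "ip A (- v) u = - ip A v u"
  and ip_minus_right: "ip A u (- v) = - ip A u v"
  using ip_scaleR_left[of A "-1" v u] ip_scaleR_right[of A u "-1" v] by simp_all

lemmas ip_simps = ip_add_left ip_add_right ip_diff_left ip_diff_right ip_scaleR_left ip_scaleR_right
  ip_zero_left ip_zero_right ip_minus_left ip_minus_right

lemma ip_sum_left: "ip A (\<Sum>i\<in>I. v i) u = (\<Sum>i\<in>I. ip A (v i) u)"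
  by (induction I rule: infinite_finite_induct) (auto simp: ip_simps)

lemma ip_sum_right: "ip A u (\<Sum>i\<in>I. v i) = (\<Sum>i\<in>I. ip A u (v i))"
  by (induction I rule: infinite_finite_induct) (auto simp: ip_simps)

lemma ip_sum_matrix: "ip (\<Sum>i\<in>I. c i *\<^sub>R A i) v w = (\<Sum>i\<in>I. c i * ip (A i) v w)"
  by (induction I rule: infinite_finite_induct)
    (auto simp: ip_def matrix_vector_mult_add_rdistrib inner_add_right scaleR_matrix_vector_assoc[symmetric])

lemma inner_transpose: "(transpose A *v v) \<bullet> w = v \<bullet> (A *v w)" for A :: "real^'n^'m"
  by (simp add: transpose_matrix_vector dot_lmul_matrix)

lemma ip_commute:
  assumes "transpose A = A" shows "ip A v w = ip A w v"
  using inner_transpose[of A v w] assms by (simp add: ip_def inner_commute)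

lemma ip_axis: "ip A (axis i 1) (axis j 1) = A $ i $ j"
  by (simp add: ip_def matrix_vector_mult_basis column_def inner_axis')

lemma ip_expand: "ip A v w = (\<Sum>i\<in>UNIV. \<Sum>j\<in>UNIV. v $ i * A $ i $ j * w $ j)"
  by (simp add: ip_def inner_vec_def matrix_vector_mult_def sum_distrib_left mult.assoc)

section \<open>Levi-Civita connection in a coordinate patch\<close>

locale riem_patch =
  fixes D :: "(real^'n::{finite,one}) set" and G :: "real^'n::{finite,one} \<Rightarrow> real^'n::{finite,one}^'n::{finite,one}"
  assumes hs_open: "hs_open D"
    and smooth_G: "smooth_on D G"
    and transpose_G: "\<And>x. x \<in> D \<Longrightarrow> transpose (G x) = G x"
    and pos_G: "\<And>x v. x \<in> D \<Longrightarrow> v \<noteq> 0 \<Longrightarrow> ip (G x) v v > 0"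
begin

lemma G_sym: "x \<in> D \<Longrightarrow> G x $ i $ j = G x $ j $ i"
  using arg_cong[OF transpose_G, of x "\<lambda>A. A $ j $ i"] by (simp add: transpose_def)

lemma det_G: assumes "x \<in> D" shows "det (G x) \<noteq> 0"
proof
  assume "det (G x) = 0"
  then have "\<not> invertible (G x)" using invertible_det_nz by blast
  then obtain v where "G x *v v = 0" "v \<noteq> 0"
    unfolding invertible_left_inverse matrix_left_invertible_ker by blast
  then show False using pos_G[OF assms, of v] by (simp add: ip_def)
qed

lemma G_inv: "x \<in> D \<Longrightarrow> G x ** matrix_inv (G x) = mat 1" "x \<in> D \<Longrightarrow> matrix_inv (G x) ** G x = mat 1"
  using matrix_inv_right matrix_inv_left det_G by blast+

lemma smooth_g [smooth_intros]: "smooth_on D (\<lambda>x. G x $ i $ j)"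
  by (intro smooth_on_nth smooth_G)

lemma smooth_ginv [smooth_intros]: "smooth_on D (\<lambda>x. matrix_inv (G x) $ i $ j)"
  by (intro smooth_on_matrix_inv smooth_g det_G)

lemma smm_G: "smm D G"
  by (simp add: smm_def smooth_g)

lemma smooth_christoffel [smooth_intros]: "smooth_on D (christoffel D G k i j)"
  unfolding christoffel_def[abs_def] by (intro smooth_intros hs_open)

lemma smooth_riem [smooth_intros]: "smooth_on D (riem D G l k i j)"
  unfolding riem_def[abs_def] by (intro smooth_intros hs_open)

lemma pd_g_sym: "x \<in> D \<Longrightarrow> pd D k (\<lambda>y. G y $ i $ j) x = pd D k (\<lambda>y. G y $ j $ i) x"
  by (rule pd_cong[OF G_sym])

lemma christoffel_sym: "x \<in> D \<Longrightarrow> christoffel D G k i j x = christoffel D G k j i x"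
  unfolding christoffel_def using pd_g_sym[of x _ i j] by (simp add: add.commute)

lemma christoffel_lower:
  assumes x: "x \<in> D"
  shows "(\<Sum>k\<in>UNIV. G x $ m $ k * christoffel D G k i j x)
    = (pd D i (\<lambda>y. G y $ j $ m) x + pd D j (\<lambda>y. G y $ i $ m) x - pd D m (\<lambda>y. G y $ i $ j) x) / 2"
proof -
  define w where "w = (\<chi> l. (pd D i (\<lambda>y. G y $ j $ l) x + pd D j (\<lambda>y. G y $ i $ l) x - pd D l (\<lambda>y. G y $ i $ j) x) / 2)"
  have "christoffel D G k i j x = (matrix_inv (G x) *v w) $ k" for k
    by (simp add: christoffel_def w_def matrix_vector_mult_def sum_divide_distrib)
  then have "(\<Sum>k\<in>UNIV. G x $ m $ k * christoffel D G k i j x) = (G x *v (matrix_inv (G x) *v w)) $ m"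
    by (simp add: matrix_vector_mult_def)
  also have "\<dots> = w $ m"
    using G_inv(1)[OF x] by (simp add: matrix_vector_mul_assoc)
  finally show ?thesis by (simp add: w_def)
qed

lemma metric_compat:
  assumes x: "x \<in> D"
  shows "pd D i (\<lambda>y. G y $ j $ k) x
    = (\<Sum>l\<in>UNIV. G x $ k $ l * christoffel D G l i j x) + (\<Sum>l\<in>UNIV. G x $ j $ l * christoffel D G l i k x)"
  unfolding christoffel_lower[OF x]
  using pd_g_sym[OF x, of i j k] pd_g_sym[OF x, of j i k] pd_g_sym[OF x, of k i j] by (simp add: field_simps)

text \<open>The connection form evaluated at \<open>v\<close>: an endomorphism, the zeroth-order
  part of the covariant derivative in the direction \<open>v\<close>.\<close>

definition Gam :: "real^'n::{finite,one} \<Rightarrow> real^'n::{finite,one} \<Rightarrow> real^'n::{finite,one}^'n::{finite,one}" where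
  "Gam x v = (\<chi> k j. \<Sum>i\<in>UNIV. v $ i * christoffel D G k i j x)"

text \<open>The curvature endomorphism R(X, Y), ready to act on vectors as a matrix.\<close>

definition Rop :: "real^'n::{finite,one} \<Rightarrow> real^'n::{finite,one} \<Rightarrow> real^'n::{finite,one} \<Rightarrow> real^'n::{finite,one}^'n::{finite,one}" where
  "Rop x X Y = (\<chi> l k. \<Sum>i\<in>UNIV. \<Sum>j\<in>UNIV. X $ i * Y $ j * riem D G l k i j x)"

lemma Gam_sym:
  assumes "x \<in> D" shows "Gam x v *v w = Gam x w *v v"
proof -
  have "(\<Sum>j\<in>UNIV. (\<Sum>i\<in>UNIV. v $ i * christoffel D G k i j x) * w $ j)
    = (\<Sum>j\<in>UNIV. (\<Sum>i\<in>UNIV. w $ i * christoffel D G k i j x) * v $ j)" for k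
    unfolding sum_distrib_right
    by (subst sum.swap) (simp add: christoffel_sym[OF assms, of k] mult_ac)
  then show ?thesis by (simp add: Gam_def matrix_vector_mult_def vec_eq_iff)
qed

lemma metric_compat_ip:
  assumes x: "x \<in> D"
  shows "(\<Sum>m\<in>UNIV. z $ m * ip (pdm D m G x) v w) = ip (G x) (Gam x z *v v) w + ip (G x) v (Gam x z *v w)"
proof -
  let ?A = "\<lambda>m. \<chi> k j. christoffel D G k m j x"
  have Gam: "Gam x z *v v = (\<Sum>m\<in>UNIV. z $ m *\<^sub>R (?A m *v v))" for v
    by (simp add: Gam_def matrix_vector_mult_def vec_eq_iff sum_distrib_left sum_distrib_right mult.assoc)
      (subst sum.swap, simp)
  have 1: "pdm D m G x = transpose (?A m) ** G x + G x ** ?A m" for m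
    using metric_compat[OF x, of m] G_sym[OF x]
    by (simp add: pdm_def vec_eq_iff matrix_matrix_mult_def transpose_def mult.commute)
  have "ip (pdm D m G x) v w = ip (G x) (?A m *v v) w + ip (G x) v (?A m *v w)" for m
  proof -
    have "v \<bullet> (transpose (?A m) *v (G x *v w)) = (?A m *v v) \<bullet> (G x *v w)"
      using inner_transpose[of "?A m" "G x *v w" v] by (simp add: inner_commute)
    then show ?thesis
      unfolding 1 ip_def by (simp add: matrix_vector_mult_add_rdistrib inner_add_right matrix_vector_mul_assoc[symmetric] del: transpose_matrix_vector)
  qed
  then show ?thesis
    unfolding Gam ip_sum_left ip_sum_right ip_scaleR_left ip_scaleR_right
    by (simp only: distrib_left sum.distrib)
qed

end

section \<open>Vector fields along a map\<close>

text \<open>Two kinds of maps are meant: the identity of a patch, for which fields along the map are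
  ordinary vector fields, and an immersion, for which they are ambient fields along the surface. One
  set of formulas serves both.\<close>

locale map_patch = riem_patch D G
  for D :: "(real^'n::{finite,one}) set" and G +
  fixes W :: "(real^'k::{finite,one}) set" and \<Phi> :: "real^'k::{finite,one} \<Rightarrow> real^'n::{finite,one}"
  assumes hs_open_W: "hs_open W" and smooth_map: "smooth_on W \<Phi>" and map_in: "\<And>x. x \<in> W \<Longrightarrow> \<Phi> x \<in> D"
begin

definition tang :: "'k \<Rightarrow> real^'k::{finite,one} \<Rightarrow> real^'n::{finite,one}" where
  "tang a = pdv W a \<Phi>"

text \<open>The pullback of the Levi-Civita connection along the map.\<close>

definition cd :: "'k \<Rightarrow> (real^'k::{finite,one} \<Rightarrow> real^'n::{finite,one}) \<Rightarrow> real^'k::{finite,one} \<Rightarrow> real^'n::{finite,one}" where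
  "cd a V x = pdv W a V x + Gam (\<Phi> x) (tang a x) *v V x"

lemma smv_map: "smv W \<Phi>"
  by (simp add: smv_def smooth_on_nth smooth_map)

lemma smv_tang: "smv W (tang a)"
  unfolding tang_def by (intro smv_pdv smv_map hs_open_W)

lemma smooth_comp [smooth_intros]: "smooth_on D u \<Longrightarrow> smooth_on W (\<lambda>x. u (\<Phi> x))"
  using map_in by (intro smooth_on_compose[OF smooth_map]) auto

lemma pd_comp:
  "smooth_on D u \<Longrightarrow> x \<in> W \<Longrightarrow> pd W a (\<lambda>y. u (\<Phi> y)) x = (\<Sum>k\<in>UNIV. tang a x $ k * pd D k u (\<Phi> x))"
  using pd_chain[OF smooth_map, of D u x a] map_in hs_open_W
  by (auto simp: tang_def pdv_def mult.commute)

lemma smm_Gam: "smm W (\<lambda>x. Gam (\<Phi> x) (tang a x))"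
  unfolding smm_def Gam_def using smvD[OF smv_tang]
  by (auto intro!: smooth_on_sum smooth_on_mult smooth_comp smooth_christoffel)

lemma smv_cd: "smv W V \<Longrightarrow> smv W (cd a V)"
  unfolding cd_def[abs_def] by (intro smv_add smv_pdv smv_matvec smm_Gam hs_open_W)

lemma smm_metric: "smm W (\<lambda>x. G (\<Phi> x))"
  by (auto simp: smm_def intro: smooth_comp smooth_g)

text \<open>Torsion-freeness of the pullback connection: second derivatives of the map commute and
  the Christoffel symbols are symmetric.\<close>

lemma cd_tang_sym:
  assumes "x \<in> W" shows "cd a (tang b) x = cd b (tang a) x"
  using pdv_swap[OF smv_map hs_open_W assms, of a b] Gam_sym[OF map_in[OF assms], of "tang a x" "tang b x"]
  by (simp add: cd_def tang_def)

lemma pd_ip_metric: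
  assumes "smv W V" "smv W U" "x \<in> W"
  shows "pd W a (\<lambda>y. ip (G (\<Phi> y)) (V y) (U y)) x = ip (G (\<Phi> x)) (cd a V x) (U x) + ip (G (\<Phi> x)) (V x) (cd a U x)"
proof -
  have e: "pdm W a (\<lambda>y. G (\<Phi> y)) x = (\<Sum>m\<in>UNIV. tang a x $ m *\<^sub>R pdm D m G (\<Phi> x))"
    using pd_comp[OF smooth_g assms(3), of a] by (simp add: pdm_def vec_eq_iff)
  show ?thesis
    unfolding pd_ip[OF smm_metric assms(1,2) hs_open_W assms(3)] e ip_sum_matrix
      metric_compat_ip[OF map_in[OF assms(3)]] cd_def ip_add_left ip_add_right by simp
qed

text \<open>The structure equation for the pulled-back connection form. The terms with second
  derivatives of the map cancel by symmetry, and what remains is the coordinate formula for the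
  curvature, contracted with the two tangent vectors.\<close>

lemma curvature_Gam:
  assumes x: "x \<in> W"
  shows "pdm W a (\<lambda>y. Gam (\<Phi> y) (tang b y)) x - pdm W b (\<lambda>y. Gam (\<Phi> y) (tang a y)) x
     + Gam (\<Phi> x) (tang a x) ** Gam (\<Phi> x) (tang b x) - Gam (\<Phi> x) (tang b x) ** Gam (\<Phi> x) (tang a x)
     = Rop (\<Phi> x) (tang a x) (tang b x)"
proof -
  let ?\<Gamma> = "\<lambda>k i j. christoffel D G k i j"
  let ?X = "tang a x" and ?Y = "tang b x" and ?p = "\<Phi> x"
  have 1: "pd W a (\<lambda>y. \<Sum>i\<in>UNIV. tang b y $ i * ?\<Gamma> l i k (\<Phi> y)) x
    = (\<Sum>i\<in>UNIV. \<Sum>m\<in>UNIV. tang a x $ m * tang b x $ i * pd D m (?\<Gamma> l i k) ?p)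
      + (\<Sum>i\<in>UNIV. pdv W a (tang b) x $ i * ?\<Gamma> l i k ?p)" for a b l k
    using smvD[OF smv_tang] x hs_open_W
    by (simp add: pd_sum pd_mult smooth_on_mult smooth_comp smooth_christoffel pd_comp pdv_def
        sum.distrib sum_distrib_left mult_ac)
  have 2: "pdv W a (tang b) x = pdv W b (tang a) x"
    unfolding tang_def by (rule pdv_swap[OF smv_map hs_open_W x])
  have 3: "(Gam ?p X ** Gam ?p Y) $ l $ k = (\<Sum>i\<in>UNIV. \<Sum>j\<in>UNIV. X $ i * Y $ j * (\<Sum>m\<in>UNIV. ?\<Gamma> l i m ?p * ?\<Gamma> m j k ?p))" for X Y l k
  proof -
    have "(Gam ?p X ** Gam ?p Y) $ l $ k = (\<Sum>m\<in>UNIV. \<Sum>i\<in>UNIV. \<Sum>j\<in>UNIV. X $ i * Y $ j * (?\<Gamma> l i m ?p * ?\<Gamma> m j k ?p))"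
      by (simp add: Gam_def matrix_matrix_mult_def sum_product mult_ac)
    also have "\<dots> = (\<Sum>i\<in>UNIV. \<Sum>m\<in>UNIV. \<Sum>j\<in>UNIV. X $ i * Y $ j * (?\<Gamma> l i m ?p * ?\<Gamma> m j k ?p))"
      by (rule sum.swap)
    also have "\<dots> = (\<Sum>i\<in>UNIV. \<Sum>j\<in>UNIV. \<Sum>m\<in>UNIV. X $ i * Y $ j * (?\<Gamma> l i m ?p * ?\<Gamma> m j k ?p))"
      by (intro sum.cong refl sum.swap)
    finally show ?thesis by (simp add: sum_distrib_left)
  qed
  have 4: "(\<Sum>i\<in>UNIV. \<Sum>j\<in>UNIV. ?Y $ i * ?X $ j * c i j) = (\<Sum>i\<in>UNIV. \<Sum>j\<in>UNIV. ?X $ i * ?Y $ j * c j i)" for c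
    by (subst sum.swap) (simp add: mult_ac)
  have 5: "(\<Sum>i\<in>UNIV. \<Sum>m\<in>UNIV. ?X $ m * ?Y $ i * c m i) = (\<Sum>i\<in>UNIV. \<Sum>j\<in>UNIV. ?X $ i * ?Y $ j * c i j)" for c
    by (rule sum.swap)
  have "(pdm W a (\<lambda>y. Gam (\<Phi> y) (tang b y)) x - pdm W b (\<lambda>y. Gam (\<Phi> y) (tang a y)) x
     + Gam ?p ?X ** Gam ?p ?Y - Gam ?p ?Y ** Gam ?p ?X) $ l $ k = Rop ?p ?X ?Y $ l $ k" for l k
  proof -
    have e0: "(pdm W a (\<lambda>y. Gam (\<Phi> y) (tang b y)) x - pdm W b (\<lambda>y. Gam (\<Phi> y) (tang a y)) x
       + Gam ?p ?X ** Gam ?p ?Y - Gam ?p ?Y ** Gam ?p ?X) $ l $ k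
      = (\<Sum>i\<in>UNIV. \<Sum>m\<in>UNIV. ?X $ m * ?Y $ i * pd D m (?\<Gamma> l i k) ?p)
        - (\<Sum>i\<in>UNIV. \<Sum>m\<in>UNIV. ?Y $ m * ?X $ i * pd D m (?\<Gamma> l i k) ?p)
        + (\<Sum>i\<in>UNIV. \<Sum>j\<in>UNIV. ?X $ i * ?Y $ j * (\<Sum>m\<in>UNIV. ?\<Gamma> l i m ?p * ?\<Gamma> m j k ?p))
        - (\<Sum>i\<in>UNIV. \<Sum>j\<in>UNIV. ?Y $ i * ?X $ j * (\<Sum>m\<in>UNIV. ?\<Gamma> l i m ?p * ?\<Gamma> m j k ?p))"
      unfolding 3[symmetric] by (simp add: pdm_def Gam_def 1 2[symmetric])
    have e1: "(\<Sum>i\<in>UNIV. \<Sum>m\<in>UNIV. ?Y $ m * ?X $ i * pd D m (?\<Gamma> l i k) ?p)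
        = (\<Sum>i\<in>UNIV. \<Sum>j\<in>UNIV. ?X $ i * ?Y $ j * pd D j (?\<Gamma> l i k) ?p)"
      by (simp add: mult_ac)
    show ?thesis
      unfolding e0 e1 4 5
      by (simp add: Rop_def riem_def sum_subtractf sum.distrib algebra_simps)
  qed
  then show ?thesis by (simp add: vec_eq_iff)
qed

lemma cd_commute:
  assumes V: "smv W V" and x: "x \<in> W"
  shows "cd a (cd b V) x - cd b (cd a V) x = Rop (\<Phi> x) (tang a x) (tang b x) *v V x"
proof -
  have "cd a (cd b V) x = pdv W a (pdv W b V) x + (pdm W a (\<lambda>y. Gam (\<Phi> y) (tang b y)) x *v V x
      + Gam (\<Phi> x) (tang b x) *v pdv W a V x)
      + Gam (\<Phi> x) (tang a x) *v (pdv W b V x + Gam (\<Phi> x) (tang b x) *v V x)" for a b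
    unfolding cd_def[abs_def]
    by (simp add: pdv_add[OF smv_pdv[OF V hs_open_W] smv_matvec[OF smm_Gam V] hs_open_W x]
        pdv_matvec[OF smm_Gam V hs_open_W x])
  then show ?thesis
    unfolding curvature_Gam[OF x, symmetric] using pdv_swap[OF V hs_open_W x, of a b]
    by (simp add: matrix_vector_right_distrib matrix_vector_mult_diff_rdistrib matrix_vector_mult_add_rdistrib
        matrix_vector_mul_assoc)
qed

text \<open>Metric compatibility trades the outer covariant derivatives for derivatives of scalar
  products. Both the skew symmetry of the curvature and the Gauss equation are read off from this
  form.\<close>

lemma ip_curvature:
  assumes V: "smv W V" and U: "smv W U" and x: "x \<in> W"
  shows "ip (G (\<Phi> x)) (Rop (\<Phi> x) (tang a x) (tang b x) *v V x) (U x)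
    = pd W a (\<lambda>y. ip (G (\<Phi> y)) (cd b V y) (U y)) x - ip (G (\<Phi> x)) (cd b V x) (cd a U x)
    - pd W b (\<lambda>y. ip (G (\<Phi> y)) (cd a V y) (U y)) x + ip (G (\<Phi> x)) (cd a V x) (cd b U x)"
  unfolding cd_commute[OF V x, symmetric] ip_simps
    pd_ip_metric[OF smv_cd[OF V] U x] by simp

end

lemma matrix_diff_distrib:
  fixes A B C :: "real^'n^'n"
  shows "A ** (B - C) = A ** B - A ** C" "(A - B) ** C = A ** C - B ** C" "(A + B) ** C = A ** C + B ** C"
  by (simp_all add: matrix_matrix_mult_def vec_eq_iff sum_subtractf sum.distrib algebra_simps)

lemma matrix_vector_sum_left: "(\<Sum>i\<in>I. A i) *v v = (\<Sum>i\<in>I. A i *v v)" for A :: "_ \<Rightarrow> real^'n^'m"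
  by (induction I rule: infinite_finite_induct) (simp_all add: matrix_vector_mult_add_rdistrib)

lemma sum_axis: "(\<Sum>a\<in>UNIV. axis i 1 $ a * c a) = (c i :: real)"
  by (simp add: axis_def mult_delta_left)

section \<open>Bianchi and Ricci identities\<close>

context riem_patch begin

text \<open>Components of the covariant derivative of a tensor with two lower indices; the first
  index is the direction of differentiation.\<close>

definition nab :: "'n \<Rightarrow> (real^'n::{finite,one} \<Rightarrow> real^'n::{finite,one}^'n::{finite,one}) \<Rightarrow> 'n \<Rightarrow> 'n \<Rightarrow> real^'n::{finite,one} \<Rightarrow> real" where
  "nab i T j k x = pd D i (\<lambda>y. T y $ j $ k) x
     - (\<Sum>m\<in>UNIV. christoffel D G m i j x * T x $ m $ k) - (\<Sum>m\<in>UNIV. christoffel D G m i k x * T x $ j $ m)"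

lemma smooth_hessian: "smooth_on D u \<Longrightarrow> smooth_on D (\<lambda>y. hessian D G u y $ i $ j)"
  by (auto simp: hessian_def intro!: smooth_intros hs_open)

lemma smooth_ricci: "smooth_on D (\<lambda>y. ricci D G y $ i $ j)"
  by (auto simp: ricci_def intro!: smooth_intros)

lemma hessian_sym:
  assumes "smooth_on D u" "x \<in> D" shows "hessian D G u x $ i $ j = hessian D G u x $ j $ i"
  unfolding hessian_def using pd_swap[OF assms(1) hs_open assms(2)] christoffel_sym[OF assms(2)] by simp

text \<open>The third partial derivatives of \<open>u\<close> cancel and the Christoffel terms
  assemble to the curvature. Combined with the Codazzi property of \<open>Ric\<close>, this turns
  the derivative of the field equation into an identity of first order in \<open>f\<close>.\<close>

lemma ricci_identity:
  assumes u: "smooth_on D u" and x: "x \<in> D"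
  shows "nab i (hessian D G u) j k x - nab j (hessian D G u) i k x = - (\<Sum>l\<in>UNIV. riem D G l k i j x * pd D l u x)"
proof -
  let ?\<Gamma> = "\<lambda>k i j. christoffel D G k i j x"
  let ?u = "\<lambda>i. pd D i u" and ?H = "\<lambda>i j. pd D i (pd D j u) x"
  have 1: "pd D i (\<lambda>y. hessian D G u y $ j $ k) x = pd D i (pd D j (?u k)) x
      - (\<Sum>l\<in>UNIV. ?\<Gamma> l j k * ?H i l) - (\<Sum>l\<in>UNIV. pd D i (christoffel D G l j k) x * ?u l x)" for i j
    using u hs_open x
    by (simp add: hessian_def pd_diff pd_sum pd_mult smooth_intros sum.distrib)
  have 2: "(\<Sum>m\<in>UNIV. ?\<Gamma> m i k * hessian D G u x $ j $ m) = (\<Sum>m\<in>UNIV. ?\<Gamma> m i k * ?H j m)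
      - (\<Sum>l\<in>UNIV. (\<Sum>m\<in>UNIV. ?\<Gamma> l j m * ?\<Gamma> m i k) * ?u l x)" for i j
  proof -
    have "(\<Sum>m\<in>UNIV. ?\<Gamma> m i k * (\<Sum>l\<in>UNIV. ?\<Gamma> l j m * ?u l x)) = (\<Sum>l\<in>UNIV. (\<Sum>m\<in>UNIV. ?\<Gamma> l j m * ?\<Gamma> m i k) * ?u l x)"
      unfolding sum_distrib_left sum_distrib_right by (subst sum.swap) (simp add: mult_ac)
    then show ?thesis by (simp add: hessian_def right_diff_distrib sum_subtractf)
  qed
  have 3: "(\<Sum>m\<in>UNIV. ?\<Gamma> m i j * hessian D G u x $ m $ k) = (\<Sum>m\<in>UNIV. ?\<Gamma> m j i * hessian D G u x $ m $ k)"
    using christoffel_sym[OF x, of _ i j] by simp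
  have 4: "pd D i (pd D j (?u k)) x = pd D j (pd D i (?u k)) x"
    by (intro pd_swap smooth_intros u hs_open x)
  show ?thesis
    unfolding nab_def 1 2 3 4
    by (simp add: riem_def sum_subtractf sum.distrib algebra_simps sum_distrib_left sum_distrib_right)
qed

lemma riem_antisym: "riem D G l k i j x = - riem D G l k j i x"
  by (simp add: riem_def sum_subtractf)

text \<open>With the curvature written as dA plus a commutator of connection matrices, second
  derivatives cancel in pairs and the cubic terms cancel as well. \<open>DR\<close> corrects only
  for the endomorphism indices; the Christoffel terms of the indices \<open>p, i, j\<close> would
  cancel in the cyclic sum by symmetry.\<close>

lemma second_bianchi:
  assumes x: "x \<in> D"
  defines "R \<equiv> \<lambda>i j y. (\<chi> l k. riem D G l k i j y)"
    and "A \<equiv> \<lambda>i y. (\<chi> l k. christoffel D G l i k y)"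
  defines "DR \<equiv> \<lambda>p i j. pdm D p (R i j) x + A p x ** R i j x - R i j x ** A p x"
  shows "DR p i j + DR i j p + DR j p i = 0"
proof -
  have smA: "smm D (A i)" for i by (simp add: A_def smm_def smooth_christoffel)
  have sw: "pdm D p (pdm D i (A j)) x = pdm D i (pdm D p (A j)) x" for p i j
    using pd_swap[OF smooth_christoffel hs_open x] by (simp add: pdm_def A_def vec_eq_iff)
  have smpA: "smm D (pdm D i (A j))" for i j
    by (auto simp: smm_def pdm_def A_def intro!: smooth_intros hs_open)
  have pdm_add: "pdm D p (\<lambda>y. M y + N y) x = pdm D p M x + pdm D p N x"
    and pdm_diff: "pdm D p (\<lambda>y. M y - N y) x = pdm D p M x - pdm D p N x"
    and sm_add: "smm D (\<lambda>y. M y + N y)" and sm_diff: "smm D (\<lambda>y. M y - N y)" if "smm D M" "smm D N" for p M N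
    using smmD[OF that(1)] smmD[OF that(2)] hs_open x
    by (auto simp: pdm_def vec_eq_iff pd_add pd_diff smm_def intro: smooth_intros)
  have "R i j = (\<lambda>y. pdm D i (A j) y - pdm D j (A i) y + (A i y ** A j y - A j y ** A i y))" for i j
    by (simp add: R_def A_def riem_def fun_eq_iff vec_eq_iff pdm_def matrix_matrix_mult_def sum_subtractf)
  note R = this
  have 1: "pdm D p (R i j) x = pdm D p (pdm D i (A j)) x - pdm D p (pdm D j (A i)) x
      + (pdm D p (A i) x ** A j x + A i x ** pdm D p (A j) x - (pdm D p (A j) x ** A i x + A j x ** pdm D p (A i) x))" for p i j
    unfolding R
    by (simp add: pdm_add pdm_diff sm_add sm_diff smpA smA smm_matmul pdm_matmul hs_open x)
  show ?thesis
    unfolding DR_def 1 unfolding R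
    by (simp add: sw[of i p j] sw[of j p i] sw[of j i p] matrix_add_ldistrib matrix_diff_distrib matrix_mul_assoc)
qed

text \<open>The contracted second Bianchi identity. It makes harmonic curvature equivalent to the
  Codazzi equation for \<open>Ric\<close>.\<close>

lemma div_riem_eq:
  assumes x: "x \<in> D"
  shows "div_riem D G k i j x = nab i (ricci D G) k j x - nab j (ricci D G) k i x"
proof -
  let ?\<Gamma> = "\<lambda>k i j. christoffel D G k i j x" and ?R = "\<lambda>l k i j. riem D G l k i j x"
  let ?D = "\<lambda>p i j l. pd D p (riem D G l k i j) x + (\<Sum>m\<in>UNIV. ?\<Gamma> l p m * ?R m k i j) - (\<Sum>m\<in>UNIV. ?R l m i j * ?\<Gamma> m p k)"
  have "?D l i j l + ?D i j l l + ?D j l i l = 0" for l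
    using arg_cong[OF second_bianchi[OF x, of l i j], of "\<lambda>M. M $ l $ k"]
    by (simp add: pdm_def matrix_matrix_mult_def)
  then have 0: "(\<Sum>l\<in>UNIV. ?D l i j l) + (\<Sum>l\<in>UNIV. ?D i j l l) + (\<Sum>l\<in>UNIV. ?D j l i l) = 0"
    by (simp add: sum.distrib[symmetric])
  have pdR: "pd D i (\<lambda>y. ricci D G y $ k $ j) x = (\<Sum>l\<in>UNIV. pd D i (riem D G l k l j) x)" for i j
    using hs_open x by (simp add: ricci_def pd_sum smooth_riem)
  have sw: "(\<Sum>l\<in>UNIV. \<Sum>m\<in>UNIV. ?\<Gamma> l i m * ?R m k l j) = (\<Sum>l\<in>UNIV. \<Sum>m\<in>UNIV. ?\<Gamma> m l i * ?R l k m j)" for i j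
    by (subst sum.swap) (simp add: christoffel_sym[OF x, of _ i])
  have t: "(\<Sum>l\<in>UNIV. \<Sum>m\<in>UNIV. ?R l m l j * ?\<Gamma> m i k) = (\<Sum>m\<in>UNIV. ?\<Gamma> m i k * ricci D G x $ m $ j)" for i j
    by (subst sum.swap) (simp add: ricci_def sum_distrib_left mult.commute)
  have 2: "(\<Sum>l\<in>UNIV. ?D j l i l) = nab j (ricci D G) k i x + (\<Sum>m\<in>UNIV. ?\<Gamma> m j i * ricci D G x $ k $ m)
      + (\<Sum>l\<in>UNIV. \<Sum>m\<in>UNIV. ?\<Gamma> m l j * ?R l k m i)" for i j
    by (simp add: nab_def pdR sum.distrib sum_subtractf sw t)
  have "pd D i (riem D G l k j l) x = - pd D i (riem D G l k l j) x" for l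
  proof -
    have "riem D G l k j l = (\<lambda>y. - riem D G l k l j y)" by (rule ext) (rule riem_antisym)
    then show ?thesis using pd_minus[OF smooth_riem hs_open x, of i l k l j] by simp
  qed
  then have f: "?D i j l l = - ?D i l j l" for l
    using riem_antisym[of _ _ j l x] by (simp add: sum_negf)
  have 1: "(\<Sum>l\<in>UNIV. ?D i j l l) = - (\<Sum>l\<in>UNIV. ?D i l j l)"
    by (subst sum_negf[symmetric], rule sum.cong[OF refl], rule f)
  have 3: "div_riem D G k i j x = (\<Sum>l\<in>UNIV. ?D l i j l)
      - (\<Sum>l\<in>UNIV. \<Sum>m\<in>UNIV. ?\<Gamma> m l i * ?R l k m j) + (\<Sum>l\<in>UNIV. \<Sum>m\<in>UNIV. ?\<Gamma> m l j * ?R l k m i)"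
    using riem_antisym[of _ k i _ x]
    by (simp add: div_riem_def sum.distrib sum_subtractf sum_negf mult.commute)
  show ?thesis
    using 0 christoffel_sym[OF x, of _ i j] unfolding 1 2 3 by simp
qed

lemma map_patch_id: "map_patch D G D (\<lambda>x. x)"
  by unfold_locales (auto simp: hs_open intro: smooth_on_linear[OF bounded_linear_ident])

lemma tang_id:
  assumes "x \<in> D" shows "map_patch.tang D (\<lambda>x. x) a x = axis a 1"
proof -
  have "pd D a (\<lambda>z. z $ k) x = (axis a 1 :: real^'n::{finite,one}) $ k" for k
    by (rule pd_eqI[OF bounded_linear.has_derivative[OF bounded_linear_vec_nth has_derivative_ident] hs_open assms])
  then show ?thesis
    by (simp add: map_patch.tang_def[OF map_patch_id] pdv_def vec_eq_iff)
qed

lemma Rop_axis: "Rop x (axis i 1) (axis j 1) $ l $ k = riem D G l k i j x"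
  by (simp add: Rop_def mult.assoc sum_distrib_left[symmetric] sum_axis)

lemma Rop_expand: "Rop x X Y = (\<Sum>i\<in>UNIV. \<Sum>j\<in>UNIV. (X $ i * Y $ j) *\<^sub>R Rop x (axis i 1) (axis j 1))"
  by (simp add: vec_eq_iff Rop_axis) (simp add: Rop_def)

lemma Rop_flip: "Rop x Y X = - Rop x X Y"
proof -
  have "(\<Sum>i\<in>UNIV. \<Sum>j\<in>UNIV. Y $ i * X $ j * riem D G l k i j x)
      = (\<Sum>i\<in>UNIV. \<Sum>j\<in>UNIV. - (X $ i * Y $ j * riem D G l k i j x))" for l k
    by (subst sum.swap) (intro sum.cong refl, subst riem_antisym, simp)
  then show ?thesis by (simp add: Rop_def vec_eq_iff sum_negf)
qed

text \<open>For constant component vectors \<open>V\<close> and \<open>U\<close>, the sum of the two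
  sides is the commutator of two coordinate derivatives applied to the function
  \<open>ip (G y) V U\<close>, which is 0.\<close>

lemma Rop_skew:
  assumes x: "x \<in> D"
  shows "ip (G x) (Rop x X Y *v V) U = - ip (G x) (Rop x X Y *v U) V"
proof -
  interpret I: map_patch D G D "\<lambda>x. x" by (rule map_patch_id)
  have 1: "ip (G x) (Rop x (axis i 1) (axis j 1) *v V) U = - ip (G x) (Rop x (axis i 1) (axis j 1) *v U) V" for i j
  proof -
    have c: "smv D (\<lambda>y. V)" for V :: "real^'n::{finite,one}" by (simp add: smv_def smooth_on_const)
    have "ip (G x) (Rop x (axis i 1) (axis j 1) *v V) U + ip (G x) (Rop x (axis i 1) (axis j 1) *v U) V
      = (pd D i (\<lambda>y. ip (G y) (I.cd j (\<lambda>y. V) y) U) x + pd D i (\<lambda>y. ip (G y) (I.cd j (\<lambda>y. U) y) V) x)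
       - (pd D j (\<lambda>y. ip (G y) (I.cd i (\<lambda>y. V) y) U) x + pd D j (\<lambda>y. ip (G y) (I.cd i (\<lambda>y. U) y) V) x)"
      using I.ip_curvature[OF c c x, of i j V U] I.ip_curvature[OF c c x, of i j U V]
        ip_commute[OF transpose_G[OF x]] by (simp add: tang_id x)
    also have "\<dots> = pd D i (pd D j (\<lambda>y. ip (G y) V U)) x - pd D j (pd D i (\<lambda>y. ip (G y) V U)) x"
    proof -
      have "pd D i (\<lambda>y. ip (G y) (I.cd j (\<lambda>y. V) y) U) x + pd D i (\<lambda>y. ip (G y) (I.cd j (\<lambda>y. U) y) V) x
        = pd D i (pd D j (\<lambda>y. ip (G y) V U)) x" for i j
        using pd_cong[of D "pd D j (\<lambda>y. ip (G y) V U)" "\<lambda>y. ip (G y) (I.cd j (\<lambda>y. V) y) U + ip (G y) (I.cd j (\<lambda>y. U) y) V" x i]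
          I.pd_ip_metric[OF c c, of _ j V U] ip_commute[OF transpose_G] x
          pd_add[OF smooth_on_ip[OF smm_G I.smv_cd[OF c] c] smooth_on_ip[OF smm_G I.smv_cd[OF c] c] hs_open x, of i j V U j U V]
        by simp
      then show ?thesis by simp
    qed
    also have "\<dots> = 0"
      using pd_swap[OF smooth_on_ip[OF smm_G c c] hs_open x] by simp
    finally show ?thesis by simp
  qed
  show ?thesis
    unfolding Rop_expand[of x X Y]
    by (simp add: matrix_vector_sum_left ip_sum_left scaleR_matrix_vector_assoc[symmetric] ip_scaleR_left 1 sum_negf)
qed

end

section \<open>Isometric maps\<close>

locale iso_map = map_patch D G W \<Phi> + Wp: riem_patch W GW
  for D :: "(real^'n::{finite,one}) set" and G and W :: "(real^'k::{finite,one}) set" and \<Phi> and GW +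
  assumes iso: "\<And>x a b. x \<in> W \<Longrightarrow> GW x $ a $ b = ip (G (\<Phi> x)) (tang a x) (tang b x)"
begin

abbreviation chr :: "'k \<Rightarrow> 'k \<Rightarrow> 'k \<Rightarrow> real^'k::{finite,one} \<Rightarrow> real" where
  "chr \<equiv> christoffel W GW"

text \<open>The vector-valued second fundamental form: the Christoffel symbols of the induced metric
  subtract exactly the tangential part, as \<open>Pi_orth\<close> confirms.\<close>

definition Pi :: "'k \<Rightarrow> 'k \<Rightarrow> real^'k::{finite,one} \<Rightarrow> real^'n::{finite,one}" where
  "Pi a b x = cd a (tang b) x - (\<Sum>d\<in>UNIV. chr d a b x *\<^sub>R tang d x)"

lemma ipG_commute: "x \<in> W \<Longrightarrow> ip (G (\<Phi> x)) v w = ip (G (\<Phi> x)) w v"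
  by (rule ip_commute[OF transpose_G[OF map_in]])

lemma pd_GW:
  assumes x: "x \<in> W"
  shows "pd W a (\<lambda>y. GW y $ b $ c) x = ip (G (\<Phi> x)) (cd a (tang b) x) (tang c x) + ip (G (\<Phi> x)) (tang b x) (cd a (tang c) x)"
  using pd_cong[of W "\<lambda>y. GW y $ b $ c" "\<lambda>y. ip (G (\<Phi> y)) (tang b y) (tang c y)" x a] iso x
    pd_ip_metric[OF smv_tang smv_tang x] by simp

text \<open>Koszul's formula. The Christoffel symbols of the induced metric are combinations of
  derivatives of scalar products of tangent vectors, and metric compatibility with torsion-freeness
  reduces the combination to one term.\<close>

lemma cd_tang_lower:
  assumes x: "x \<in> W"
  shows "ip (G (\<Phi> x)) (cd a (tang b) x) (tang c x) = (\<Sum>d\<in>UNIV. GW x $ c $ d * chr d a b x)"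
  unfolding Wp.christoffel_lower[OF x] pd_GW[OF x]
  using cd_tang_sym[OF x, of a b] cd_tang_sym[OF x, of a c] cd_tang_sym[OF x, of b c]
    ipG_commute[OF x, of "tang a x"] ipG_commute[OF x, of "tang b x"] by simp

lemma Pi_orth:
  assumes x: "x \<in> W" shows "ip (G (\<Phi> x)) (Pi a b x) (tang c x) = 0"
  unfolding Pi_def ip_simps ip_sum_left cd_tang_lower[OF x] iso[OF x, symmetric]
  by (simp add: Wp.G_sym[OF x, of c] mult.commute)

lemma cd_tang: "cd a (tang b) x = (\<Sum>d\<in>UNIV. chr d a b x *\<^sub>R tang d x) + Pi a b x"
  by (simp add: Pi_def)

text \<open>The ambient Christoffel symbols complete the second derivatives of the map to
  \<open>cd\<close>; after subtraction of the Christoffel symbols of \<open>GW\<close>, only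
  \<open>Pi\<close> is left of them.\<close>

lemma hessian_comp:
  assumes u: "smooth_on D u" and x: "x \<in> W"
  shows "hessian W GW (\<lambda>y. u (\<Phi> y)) x $ a $ b
     = ip (hessian D G u (\<Phi> x)) (tang a x) (tang b x) + (\<Sum>k\<in>UNIV. pd D k u (\<Phi> x) * Pi a b x $ k)"
proof -
  let ?p = "\<Phi> x" and ?H = "\<lambda>i j. pd D i (pd D j u) (\<Phi> x)"
  have "pd W a (pd W b (\<lambda>y. u (\<Phi> y))) x = pd W a (\<lambda>y. \<Sum>k\<in>UNIV. tang b y $ k * pd D k u (\<Phi> y)) x"
    using x by (intro pd_cong pd_comp u) auto
  also have "\<dots> = (\<Sum>k\<in>UNIV. tang b x $ k * (\<Sum>i\<in>UNIV. tang a x $ i * ?H i k)) + (\<Sum>k\<in>UNIV. pdv W a (tang b) x $ k * pd D k u ?p)"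
    using smvD[OF smv_tang] hs_open_W x u hs_open
    by (simp add: pd_sum pd_mult smooth_on_mult smooth_comp smooth_on_pd pd_comp pdv_def sum.distrib)
  also have "(\<Sum>k\<in>UNIV. tang b x $ k * (\<Sum>i\<in>UNIV. tang a x $ i * ?H i k)) = (\<Sum>i\<in>UNIV. \<Sum>j\<in>UNIV. tang a x $ i * ?H i j * tang b x $ j)"
    unfolding sum_distrib_left by (subst sum.swap) (simp add: mult_ac)
  finally have 1: "pd W a (pd W b (\<lambda>y. u (\<Phi> y))) x = (\<Sum>i\<in>UNIV. \<Sum>j\<in>UNIV. tang a x $ i * ?H i j * tang b x $ j)
     + (\<Sum>k\<in>UNIV. pdv W a (tang b) x $ k * pd D k u ?p)" .
  have 2: "(\<Sum>k\<in>UNIV. pd D k u ?p * (Gam ?p (tang a x) *v tang b x) $ k)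
     = (\<Sum>i\<in>UNIV. \<Sum>j\<in>UNIV. tang a x $ i * (\<Sum>k\<in>UNIV. christoffel D G k i j ?p * pd D k u ?p) * tang b x $ j)"
  proof -
    have "(\<Sum>k\<in>UNIV. pd D k u ?p * (Gam ?p (tang a x) *v tang b x) $ k)
      = (\<Sum>k\<in>UNIV. \<Sum>j\<in>UNIV. \<Sum>i\<in>UNIV. tang a x $ i * (christoffel D G k i j ?p * pd D k u ?p) * tang b x $ j)"
      by (simp add: Gam_def matrix_vector_mult_def sum_distrib_left sum_distrib_right mult_ac)
    also have "\<dots> = (\<Sum>j\<in>UNIV. \<Sum>k\<in>UNIV. \<Sum>i\<in>UNIV. tang a x $ i * (christoffel D G k i j ?p * pd D k u ?p) * tang b x $ j)"
      by (rule sum.swap)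
    also have "\<dots> = (\<Sum>j\<in>UNIV. \<Sum>i\<in>UNIV. \<Sum>k\<in>UNIV. tang a x $ i * (christoffel D G k i j ?p * pd D k u ?p) * tang b x $ j)"
      by (intro sum.cong refl sum.swap)
    also have "\<dots> = (\<Sum>i\<in>UNIV. \<Sum>j\<in>UNIV. \<Sum>k\<in>UNIV. tang a x $ i * (christoffel D G k i j ?p * pd D k u ?p) * tang b x $ j)"
      by (rule sum.swap)
    finally show ?thesis by (simp add: sum_distrib_left sum_distrib_right)
  qed
  have 3: "(\<Sum>k\<in>UNIV. chr k a b x * pd W k (\<lambda>y. u (\<Phi> y)) x)
     = (\<Sum>k\<in>UNIV. pd D k u ?p * (\<Sum>d\<in>UNIV. chr d a b x *\<^sub>R tang d x) $ k)"
    unfolding pd_comp[OF u x] sum_distrib_left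
    by (subst sum.swap) (simp add: sum_distrib_left mult_ac)
  have 4: "(\<Sum>k\<in>UNIV. pd D k u ?p * Pi a b x $ k) = (\<Sum>k\<in>UNIV. pdv W a (tang b) x $ k * pd D k u ?p)
     + (\<Sum>k\<in>UNIV. pd D k u ?p * (Gam ?p (tang a x) *v tang b x) $ k)
     - (\<Sum>k\<in>UNIV. pd D k u ?p * (\<Sum>d\<in>UNIV. chr d a b x *\<^sub>R tang d x) $ k)"
    by (simp add: Pi_def cd_def sum.distrib sum_subtractf algebra_simps del: sum_component)
  have 5: "ip (hessian D G u ?p) (tang a x) (tang b x) = (\<Sum>i\<in>UNIV. \<Sum>j\<in>UNIV. tang a x $ i * ?H i j * tang b x $ j)
     - (\<Sum>i\<in>UNIV. \<Sum>j\<in>UNIV. tang a x $ i * (\<Sum>k\<in>UNIV. christoffel D G k i j ?p * pd D k u ?p) * tang b x $ j)"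
    by (simp add: ip_expand hessian_def right_diff_distrib left_diff_distrib sum_subtractf)
  show ?thesis
    unfolding 4 5 2 using 1 3 by (simp add: hessian_def)
qed

text \<open>All terms except those with \<open>Pi\<close> depend on \<open>GW\<close> alone. The
  same identity for the identity map of \<open>W\<close>, where \<open>Pi\<close> vanishes,
  therefore identifies them with the intrinsic curvature, and no curvature has to be expanded in
  coordinates.\<close>

lemma gauss_aux:
  assumes x: "x \<in> W"
  defines "L \<equiv> \<lambda>a b c y. \<Sum>e\<in>UNIV. GW y $ c $ e * chr e a b y"
    and "Q \<equiv> \<lambda>a b c d. \<Sum>e\<in>UNIV. \<Sum>f\<in>UNIV. chr e a b x * chr f c d x * GW x $ e $ f"
  shows "ip (G (\<Phi> x)) (Rop (\<Phi> x) (tang a x) (tang b x) *v tang c x) (tang d x)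
     = pd W a (L b c d) x - Q b c a d - pd W b (L a c d) x + Q a c b d
       - ip (G (\<Phi> x)) (Pi b c x) (Pi a d x) + ip (G (\<Phi> x)) (Pi a c x) (Pi b d x)"
proof -
  have 1: "pd W a (\<lambda>y. ip (G (\<Phi> y)) (cd b (tang c) y) (tang d y)) x = pd W a (L b c d) x" for a b c d
    using x by (intro pd_cong) (auto simp: L_def cd_tang_lower)
  have 2: "ip (G (\<Phi> x)) (cd a (tang b) x) (cd c (tang d) x) = Q a b c d + ip (G (\<Phi> x)) (Pi a b x) (Pi c d x)" for a b c d
    unfolding cd_tang ip_simps ip_sum_left ip_sum_right
    using Pi_orth[OF x] ipG_commute[OF x, of "tang _ x" "Pi _ _ x"]
    by (simp add: iso[OF x] Q_def mult.assoc) (subst sum.swap, simp add: sum_distrib_left mult_ac)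
  show ?thesis
    unfolding ip_curvature[OF smv_tang smv_tang x] 1 2 by simp
qed

end

lemma (in riem_patch) iso_map_id: "iso_map D G D (\<lambda>x. x) G"
proof -
  interpret map_patch D G D "\<lambda>x. x" by (rule map_patch_id)
  show ?thesis by unfold_locales (simp add: tang_id ip_axis)
qed

lemma (in riem_patch) Pi_id:
  assumes x: "x \<in> D" shows "iso_map.Pi D G D (\<lambda>x. x) G a b x = 0"
proof -
  interpret iso_map D G D "\<lambda>x. x" G by (rule iso_map_id)
  have "pdv D a (tang b) x = 0"
    using pd_cong[of D "\<lambda>y. tang b y $ k" "\<lambda>y. axis b 1 $ k" x a for k] x hs_open
    by (simp add: pdv_def vec_eq_iff tang_id)
  moreover have "Gam x (axis a 1) *v axis b 1 = (\<Sum>d\<in>UNIV. chr d a b x *\<^sub>R axis d 1)"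
    by (simp add: vec_eq_iff Gam_def matrix_vector_mult_basis column_def sum_axis) (simp add: axis_def mult_delta_right)
  ultimately show ?thesis
    by (simp add: Pi_def cd_def tang_id x)
qed

context iso_map begin

lemma gauss_equation:
  assumes x: "x \<in> W"
  shows "ip (G (\<Phi> x)) (Rop (\<Phi> x) (tang a x) (tang b x) *v tang c x) (tang d x)
     = ip (GW x) (Wp.Rop x (axis a 1) (axis b 1) *v axis c 1) (axis d 1)
       - ip (G (\<Phi> x)) (Pi b c x) (Pi a d x) + ip (G (\<Phi> x)) (Pi a c x) (Pi b d x)"
proof -
  interpret I: iso_map W GW W "\<lambda>x. x" GW by (rule Wp.iso_map_id)
  show ?thesis
    using gauss_aux[OF x, of a b c d] I.gauss_aux[OF x, of a b c d]
    by (simp add: Wp.Pi_id[OF x] Wp.tang_id[OF x] ip_simps)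
qed

end

section \<open>Orthonormal frames\<close>

definition frame :: "real^'n^'n \<Rightarrow> ('n \<Rightarrow> real^'n) \<Rightarrow> bool" where
  "frame A e \<longleftrightarrow> (\<forall>a b. ip A (e a) (e b) = (if a = b then 1 else 0))"

lemma frameD: "frame A e \<Longrightarrow> ip A (e a) (e b) = (if a = b then 1 else 0)"
  by (simp add: frame_def)

definition frame_matrix :: "('n \<Rightarrow> real^'n) \<Rightarrow> real^'n^'n" where
  "frame_matrix e = (\<chi> i a. e a $ i)"

lemma frame_matrix_ip: "(transpose (frame_matrix e) ** M ** frame_matrix e) $ a $ b = ip M (e a) (e b)"
  by (simp add: frame_matrix_def matrix_matrix_mult_def transpose_def ip_expand sum_distrib_right)
    (rule sum.swap)

lemma frame_matrix_inverse:
  assumes "frame A e"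
  shows "transpose (frame_matrix e) ** A ** frame_matrix e = mat 1"
    and "frame_matrix e ** (transpose (frame_matrix e) ** A) = mat 1"
proof -
  show 1: "transpose (frame_matrix e) ** A ** frame_matrix e = mat 1"
    using assms by (simp add: vec_eq_iff frame_matrix_ip frame_def mat_def)
  then show "frame_matrix e ** (transpose (frame_matrix e) ** A) = mat 1"
    using matrix_left_right_inverse by blast
qed

lemma frame_expand:
  assumes "frame A e" "transpose A = A"
  shows "v = (\<Sum>a\<in>UNIV. ip A v (e a) *\<^sub>R e a)"
proof -
  have "v = frame_matrix e *v (transpose (frame_matrix e) *v (A *v v))"
    using frame_matrix_inverse(2)[OF assms(1)] by (simp add: matrix_vector_mul_assoc)
  moreover have "(transpose (frame_matrix e) *v (A *v v)) $ a = ip A v (e a)" for a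
    using ip_commute[OF assms(2), of v "e a"]
    by (simp add: ip_def frame_matrix_def matrix_vector_mult_def transpose_def inner_vec_def)
  ultimately show ?thesis
    by (simp add: vec_eq_iff matrix_vector_mult_def[of "frame_matrix e"]) (simp add: frame_matrix_def mult.commute)
qed

lemma frame_inv:
  assumes "frame A e" "transpose A = A"
  shows "matrix_inv A = frame_matrix e ** transpose (frame_matrix e)"
proof (rule matrix_inv_unique)
  have "transpose (frame_matrix e ** (transpose (frame_matrix e) ** A)) = mat 1"
    using frame_matrix_inverse(2)[OF assms(1)] by simp
  then show "A ** (frame_matrix e ** transpose (frame_matrix e)) = mat 1"
    using assms(2) by (simp add: matrix_transpose_mul matrix_mul_assoc)
qed

lemma frame_contraction:
  assumes "frame A e" "transpose A = A"
  shows "(\<Sum>i\<in>UNIV. \<Sum>j\<in>UNIV. matrix_inv A $ i $ j * M $ i $ j) = (\<Sum>a\<in>UNIV. ip M (e a) (e a))"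
proof -
  have "(\<Sum>i\<in>UNIV. \<Sum>j\<in>UNIV. matrix_inv A $ i $ j * M $ i $ j)
    = (\<Sum>i\<in>UNIV. \<Sum>j\<in>UNIV. \<Sum>a\<in>UNIV. e a $ i * M $ i $ j * e a $ j)"
    by (simp add: frame_inv[OF assms] frame_matrix_def matrix_matrix_mult_def transpose_def sum_distrib_right sum_distrib_left mult_ac)
  also have "\<dots> = (\<Sum>i\<in>UNIV. \<Sum>a\<in>UNIV. \<Sum>j\<in>UNIV. e a $ i * M $ i $ j * e a $ j)"
    by (intro sum.cong refl sum.swap)
  also have "\<dots> = (\<Sum>a\<in>UNIV. \<Sum>i\<in>UNIV. \<Sum>j\<in>UNIV. e a $ i * M $ i $ j * e a $ j)"
    by (rule sum.swap)
  finally show ?thesis by (simp add: ip_expand)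
qed

lemma frame_eqI:
  assumes "frame A e" "\<And>a b. ip M (e a) (e b) = ip N (e a) (e b)"
  shows "M = N"
proof -
  let ?E = "frame_matrix e"
  have inv: "?E ** (transpose ?E ** A) = mat 1" by (rule frame_matrix_inverse(2)[OF assms(1)])
  then have inv': "transpose (transpose ?E ** A) ** transpose ?E = mat 1"
    by (metis matrix_transpose_mul transpose_mat)
  have "transpose ?E ** M ** ?E = transpose ?E ** N ** ?E"
    by (simp add: vec_eq_iff frame_matrix_ip assms(2))
  then have "transpose ?E ** M ** (?E ** (transpose ?E ** A)) = transpose ?E ** N ** (?E ** (transpose ?E ** A))"
    by (metis matrix_mul_assoc)
  then have "transpose (transpose ?E ** A) ** (transpose ?E ** M) = transpose (transpose ?E ** A) ** (transpose ?E ** N)"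
    by (simp add: inv)
  then show ?thesis by (simp add: matrix_mul_assoc inv')
qed

lemma frame_trace:
  assumes "frame A e" "transpose A = A"
  shows "(\<Sum>a\<in>UNIV. ip A (L *v e a) (e a)) = (\<Sum>i\<in>UNIV. L $ i $ i)"
proof -
  let ?E = "frame_matrix e"
  have "ip A (L *v e a) (e a) = (transpose ?E ** (A ** L) ** ?E) $ a $ a" for a
    unfolding frame_matrix_ip ip_commute[OF assms(2), of "L *v e a"]
    by (simp add: ip_def matrix_vector_mul_assoc)
  then have "(\<Sum>a\<in>UNIV. ip A (L *v e a) (e a)) = trace ((transpose ?E ** A) ** L ** ?E)"
    by (simp add: trace_def matrix_mul_assoc)
  also have "\<dots> = trace ((?E ** (transpose ?E ** A)) ** L)"
    by (metis matrix_mul_assoc trace_mul_sym)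
  finally show ?thesis by (simp add: frame_matrix_inverse(2)[OF assms(1)] trace_def)
qed

text \<open>Gram-Schmidt, with \<open>A\<close>-orthogonality to \<open>n\<close> expressed as
  Euclidean orthogonality to \<open>A *v n\<close>, so that a dimension count supplies each further
  vector.\<close>

lemma frame_exists:
  fixes A :: "real^3^3"
  assumes pos: "\<And>v. v \<noteq> 0 \<Longrightarrow> ip A v v > 0" and sym: "transpose A = A" and n: "ip A n n = 1"
  shows "\<exists>e. frame A e \<and> e 1 = n"
proof -
  have nrm: "\<exists>c. ip A (c *\<^sub>R v) (c *\<^sub>R v) = 1" if "v \<noteq> 0" for v
    using pos[OF that] by (intro exI[of _ "1 / sqrt (ip A v v)"]) (simp add: ip_simps power2_eq_square[symmetric] divide_simps)
  have "dim {A *v n} \<le> card {A *v n}" by (rule dim_le_card') simp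
  then have "dim {A *v n} < DIM(real^3)" by simp
  then obtain v where "v \<noteq> 0" "\<And>y. y \<in> span {A *v n} \<Longrightarrow> orthogonal v y"
    by (rule orthogonal_to_subspace_exists) blast
  then have v: "v \<noteq> 0" "v \<bullet> (A *v n) = 0"
    by (simp_all add: orthogonal_def span_base)
  obtain c where c: "ip A (c *\<^sub>R v) (c *\<^sub>R v) = 1" using nrm[OF v(1)] by blast
  define e2 where "e2 = c *\<^sub>R v"
  have "dim {A *v n, A *v e2} \<le> card {A *v n, A *v e2}" by (rule dim_le_card') simp
  also have "\<dots> \<le> 2" by (simp add: card_insert_if)
  finally have "dim {A *v n, A *v e2} < DIM(real^3)" by simp
  then obtain z where "z \<noteq> 0" "\<And>y. y \<in> span {A *v n, A *v e2} \<Longrightarrow> orthogonal z y"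
    by (rule orthogonal_to_subspace_exists) blast
  then have z: "z \<noteq> 0" "z \<bullet> (A *v n) = 0" "z \<bullet> (A *v e2) = 0"
    by (simp_all add: orthogonal_def span_base)
  obtain d where d: "ip A (d *\<^sub>R z) (d *\<^sub>R z) = 1" using nrm[OF z(1)] by blast
  define e3 where "e3 = d *\<^sub>R z"
  have o: "ip A e2 n = 0" "ip A e3 n = 0" "ip A e3 e2 = 0"
    using v(2) z(2,3) by (auto simp: e2_def e3_def ip_def)
  then have o': "ip A n e2 = 0" "ip A n e3 = 0" "ip A e2 e3 = 0"
    using ip_commute[OF sym] by auto
  define e :: "3 \<Rightarrow> real^3" where "e a = (if a = 1 then n else if a = 2 then e2 else e3)" for a
  have "frame A e"
    unfolding frame_def forall_3 using o o' c d n by (simp add: e_def e2_def[symmetric] e3_def[symmetric])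
  then show ?thesis by (intro exI[of _ e]) (simp add: e_def)
qed

text \<open>It carries identities between coordinate components to arbitrary vectors, in particular
  to orthonormal frames.\<close>

lemma trilinear_zero:
  fixes T :: "real^'n \<Rightarrow> real^'n \<Rightarrow> real^'n \<Rightarrow> real"
  assumes "\<And>Y Z. linear (\<lambda>X. T X Y Z)" "\<And>X Z. linear (\<lambda>Y. T X Y Z)" "\<And>X Y. linear (\<lambda>Z. T X Y Z)"
    and "\<And>i j k. T (axis i 1) (axis j 1) (axis k 1) = 0"
  shows "T X Y Z = 0"
proof -
  have "T (axis i 1) (axis j 1) Z = 0" for i j Z
    using linear_axis_sum[OF assms(3), of "axis i 1" "axis j 1" Z] assms(4) by simp
  then have "T (axis i 1) Y Z = 0" for i Y Z
    using linear_axis_sum[OF assms(2), of "axis i 1" Y Z] by simp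
  then show ?thesis
    using linear_axis_sum[OF assms(1), of X Y Z] by simp
qed

context riem_patch begin

lemma Rop_linear: "Rop x (X + X') Y = Rop x X Y + Rop x X' Y" "Rop x X (Y + Y') = Rop x X Y + Rop x X Y'"
  "Rop x (c *\<^sub>R X) Y = c *\<^sub>R Rop x X Y" "Rop x X (c *\<^sub>R Y) = c *\<^sub>R Rop x X Y"
  by (simp_all add: Rop_def vec_eq_iff sum.distrib sum_distrib_left algebra_simps)

lemma Rop_refl: "Rop x X X = 0"
proof -
  have "Rop x X X $ l $ k = - Rop x X X $ l $ k" for l k
    by (subst Rop_flip) simp
  then show ?thesis by (simp add: vec_eq_iff)
qed

lemma Rop_skew_zero: "x \<in> D \<Longrightarrow> ip (G x) (Rop x X Y *v V) V = 0"
  using Rop_skew[of x X Y V V] by simp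

text \<open>Both sides are the trace of the endomorphism that sends X to R(X, Y) Z, once in
  coordinates and once in the frame.\<close>

lemma ricci_trace:
  assumes x: "x \<in> D" and e: "frame (G x) e"
  shows "ip (ricci D G x) Z Y = (\<Sum>a\<in>UNIV. ip (G x) (Rop x (e a) Y *v Z) (e a))"
proof -
  define L where "L = (\<chi> l i. (Rop x (axis i 1) Y *v Z) $ l)"
  have "L *v X = Rop x X Y *v Z" for X
  proof -
    have "linear (\<lambda>X. Rop x X Y *v Z)"
      by (rule linearI) (simp_all add: Rop_linear matrix_vector_mult_add_rdistrib scaleR_matrix_vector_assoc[symmetric])
    from linear_axis_sum[OF this, of X] show ?thesis
      by (simp add: L_def vec_eq_iff matrix_vector_mult_def[of "vec_lambda _"] mult.commute)
  qed
  then have "(\<Sum>a\<in>UNIV. ip (G x) (Rop x (e a) Y *v Z) (e a)) = (\<Sum>i\<in>UNIV. L $ i $ i)"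
    using frame_trace[OF e transpose_G[OF x], of L] by simp
  also have "\<dots> = (\<Sum>i\<in>UNIV. \<Sum>k\<in>UNIV. \<Sum>j\<in>UNIV. Y $ j * riem D G i k i j x * Z $ k)"
    by (simp add: L_def matrix_vector_mult_def Rop_def mult.assoc sum_distrib_left[symmetric] sum_axis)
      (simp add: sum_distrib_left sum_distrib_right mult_ac)
  also have "\<dots> = (\<Sum>k\<in>UNIV. \<Sum>i\<in>UNIV. \<Sum>j\<in>UNIV. Y $ j * riem D G i k i j x * Z $ k)"
    by (rule sum.swap)
  also have "\<dots> = (\<Sum>k\<in>UNIV. \<Sum>j\<in>UNIV. \<Sum>i\<in>UNIV. Y $ j * riem D G i k i j x * Z $ k)"
    by (intro sum.cong refl sum.swap)
  finally show ?thesis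
    by (simp add: ip_expand ricci_def sum_distrib_left sum_distrib_right mult_ac)
qed

lemma scalar_frame:
  assumes "x \<in> D" "frame (G x) e"
  shows "scalar_curvature D G x = (\<Sum>a\<in>UNIV. ip (ricci D G x) (e a) (e a))"
  unfolding scalar_curvature_def by (rule frame_contraction[OF assms(2) transpose_G[OF assms(1)]])

lemma nab_G:
  assumes "x \<in> D" shows "nab i G j k x = 0"
  unfolding nab_def metric_compat[OF assms] using G_sym[OF assms] by (simp add: mult.commute)

definition dif :: "(real^'n::{finite,one} \<Rightarrow> real) \<Rightarrow> real^'n::{finite,one} \<Rightarrow> real^'n::{finite,one}" where
  "dif u x = (\<chi> k. pd D k u x)"

lemma ip_gradient: 
  assumes "x \<in> D" shows "ip (G x) (gradient D G u x) v = dif u x \<bullet> v"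
proof -
  have "ip (G x) (gradient D G u x) v = ip (G x) v (gradient D G u x)"
    by (rule ip_commute[OF transpose_G[OF assms]])
  also have "\<dots> = v \<bullet> dif u x"
    using G_inv(1)[OF assms] by (simp add: ip_def gradient_def matrix_vector_mul_assoc dif_def)
  finally show ?thesis by (simp add: inner_commute)
qed

lemma smv_dif: "smooth_on D u \<Longrightarrow> smv D (dif u)"
  by (simp add: smv_def dif_def smooth_on_pd hs_open)

lemma smv_gradient: "smooth_on D u \<Longrightarrow> smv D (gradient D G u)"
  unfolding gradient_def[abs_def] dif_def[symmetric]
  by (intro smv_matvec smv_dif) (simp add: smm_def smooth_ginv)

lemma hessian_cd:
  assumes u: "smooth_on D u" and x: "x \<in> D"
  shows "ip (G x) (map_patch.cd D G D (\<lambda>x. x) i (gradient D G u) x) (axis j 1) = hessian D G u x $ i $ j"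
proof -
  interpret I: map_patch D G D "\<lambda>x. x" by (rule map_patch_id)
  have c: "smv D (\<lambda>y. axis j 1)" by (simp add: smv_def smooth_on_const)
  have "pd D i (pd D j u) x = pd D i (\<lambda>y. ip (G y) (gradient D G u y) (axis j 1)) x"
    using x by (intro pd_cong) (simp_all add: ip_gradient dif_def inner_axis)
  also have "\<dots> = ip (G x) (I.cd i (gradient D G u) x) (axis j 1) + ip (G x) (gradient D G u x) (I.cd i (\<lambda>y. axis j 1) x)"
    by (rule I.pd_ip_metric[OF smv_gradient[OF u] c x])
  also have "ip (G x) (gradient D G u x) (I.cd i (\<lambda>y. axis j 1) x) = (\<Sum>k\<in>UNIV. christoffel D G k i j x * pd D k u x)"
  proof -
    have "I.cd i (\<lambda>y. axis j 1) x = (\<chi> k. christoffel D G k i j x)"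
      using hs_open x by (simp add: I.cd_def tang_id Gam_def matrix_vector_mult_basis column_def sum_axis pdv_def vec_eq_iff)
    then show ?thesis by (simp add: ip_gradient x dif_def inner_vec_def mult.commute)
  qed
  finally show ?thesis by (simp add: hessian_def)
qed

end

lemma matrix_vector_mult_minus_left: "(- A) *v v = - (A *v v)" for A :: "real^'n^'m"
  by (simp add: matrix_vector_mult_def vec_eq_iff sum_negf)

section \<open>Static perfect fluids with harmonic curvature in a coordinate patch\<close>

text \<open>The scalar curvature is normalized to \<open>6 * r\<close>, so that \<open>r\<close> is
  the sectional curvature in the case of constant curvature. Then \<open>\<mu>\<close> is the
  constant \<open>3 * r\<close> and has been substituted in the field equations.\<close>

locale fluid_patch = riem_patch D G for D :: "(real^3) set" and G +
  fixes f \<rho> :: "real^3 \<Rightarrow> real" and r :: real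
  assumes smooth_f: "smooth_on D f" and smooth_rho: "smooth_on D \<rho>"
    and f_pos: "\<And>x. x \<in> D \<Longrightarrow> f x > 0"
    and field_eq: "\<And>x. x \<in> D \<Longrightarrow> f x *\<^sub>R ricci D G x = hessian D G f x + ((3 * r - \<rho> x) / 2 * f x) *\<^sub>R G x"
    and lap_eq: "\<And>x. x \<in> D \<Longrightarrow> laplacian D G f x = (3 * r + 3 * \<rho> x) / 2 * f x"
    and scal_eq: "\<And>x. x \<in> D \<Longrightarrow> scalar_curvature D G x = 6 * r"
    and harmonic: "\<And>x k i j. x \<in> D \<Longrightarrow> div_riem D G k i j x = 0"
begin

definition al :: "real^3 \<Rightarrow> real" where "al x = (3 * r + \<rho> x) * f x"
definition psi :: "real^3 \<Rightarrow> real" where "psi x = (3 * r - \<rho> x) / 2 * f x"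
definition BB :: "real^3 \<Rightarrow> real^3^3" where "BB x = ricci D G x - (2 * r) *\<^sub>R G x"

abbreviation gr :: "real^3 \<Rightarrow> real^3" where "gr \<equiv> gradient D G f"

text \<open>The squared length of \<open>grad f\<close>. It is the denominator that later identities
  are cleared of in order to make sense at critical points.\<close>

definition uu :: "real^3 \<Rightarrow> real" where "uu x = dif f x \<bullet> gr x"

lemma smooth_al: "smooth_on D al" and smooth_psi: "smooth_on D psi"
  unfolding al_def[abs_def] psi_def[abs_def] by (intro smooth_intros smooth_f smooth_rho; simp)+

lemma psi_al: "psi x = 3 * r * f x - al x / 2"
  by (simp add: psi_def al_def field_simps)

lemma pd_psi:
  assumes x: "x \<in> D" shows "pd D i psi x = 3 * r * pd D i f x - pd D i al x / 2"
proof -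
  have "psi = (\<lambda>x. 3 * r * f x - al x / 2)" by (simp add: psi_al fun_eq_iff)
  moreover have "pd D i (\<lambda>y. al y / 2) x = pd D i al x / 2"
    using pd_cmult[OF smooth_al hs_open x, of i "1 / 2"] by simp
  moreover have "smooth_on D (\<lambda>y. al y / 2)" "smooth_on D (\<lambda>y. 3 * r * f y)"
    by (intro smooth_intros smooth_al smooth_f; simp)+
  ultimately show ?thesis
    using smooth_f hs_open x by (simp add: pd_diff pd_cmult)
qed

lemma ricci_eq:
  assumes "x \<in> D"
  shows "ricci D G x $ i $ j = (hessian D G f x $ i $ j + psi x * G x $ i $ j) / f x"
  using arg_cong[OF field_eq[OF assms], of "\<lambda>M. M $ i $ j"] f_pos[OF assms]
  by (simp add: psi_def field_simps)

lemma ricci_sym: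
  assumes "x \<in> D" shows "ricci D G x $ i $ j = ricci D G x $ j $ i"
  by (simp add: ricci_eq assms hessian_sym[OF smooth_f assms, of i j] G_sym[OF assms, of i j])

lemma transpose_ricci: "x \<in> D \<Longrightarrow> transpose (ricci D G x) = ricci D G x"
  using ricci_sym by (simp add: transpose_def vec_eq_iff)

lemma nab_cong:
  assumes "\<And>y. y \<in> D \<Longrightarrow> S y = T y" "x \<in> D" shows "nab i S j k x = nab i T j k x"
  using assms pd_cong[of D "\<lambda>y. S y $ j $ k" "\<lambda>y. T y $ j $ k" x i] by (simp add: nab_def)

lemma nab_scaleR:
  assumes "smooth_on D u" "smm D T" "x \<in> D"
  shows "nab i (\<lambda>y. u y *\<^sub>R T y) j k x = pd D i u x * T x $ j $ k + u x * nab i T j k x"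
  using smmD[OF assms(2)] assms(1,3) hs_open
  by (simp add: nab_def pd_mult sum_distrib_left algebra_simps)

lemma nab_add:
  assumes "smm D S" "smm D T" "x \<in> D"
  shows "nab i (\<lambda>y. S y + T y) j k x = nab i S j k x + nab i T j k x"
  using smmD[OF assms(1)] smmD[OF assms(2)] assms(3) hs_open
  by (simp add: nab_def pd_add sum.distrib algebra_simps)

lemma codazzi:
  assumes "x \<in> D" shows "nab i (ricci D G) j k x = nab j (ricci D G) i k x"
proof -
  have "nab i (ricci D G) j k x = nab i (ricci D G) k j x" for i j k
    using pd_cong[of D "\<lambda>y. ricci D G y $ j $ k" "\<lambda>y. ricci D G y $ k $ j" x i] ricci_sym assms
    by (simp add: nab_def)
  then show ?thesis using div_riem_eq[OF assms, of k i j] harmonic[OF assms] by simp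
qed

lemma smm_ricci: "smm D (ricci D G)" and smm_hessian: "smm D (hessian D G f)"
  by (simp_all add: smm_def smooth_ricci smooth_hessian smooth_f)

text \<open>The covariant derivative of the field equation, antisymmetrized in \<open>i\<close> and
  \<open>j\<close>: the Codazzi equation removes the derivative of \<open>Ric\<close>, and the Ricci
  identity turns the derivative of the Hessian into curvature.\<close>

lemma star:
  assumes x: "x \<in> D"
  shows "pd D i f x * ricci D G x $ j $ k - pd D j f x * ricci D G x $ i $ k
    = - (\<Sum>l\<in>UNIV. riem D G l k i j x * pd D l f x) + pd D i psi x * G x $ j $ k - pd D j psi x * G x $ i $ k"
proof -
  have "pd D i f x * ricci D G x $ j $ k + f x * nab i (ricci D G) j k x
      = nab i (hessian D G f) j k x + pd D i psi x * G x $ j $ k" for i j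
  proof -
    have "nab i (\<lambda>y. f y *\<^sub>R ricci D G y) j k x = nab i (\<lambda>y. hessian D G f y + psi y *\<^sub>R G y) j k x"
      using field_eq by (intro nab_cong x) (simp add: psi_def)
    moreover have "smm D (\<lambda>y. psi y *\<^sub>R G y)"
      using smooth_psi smooth_g by (auto simp: smm_def intro: smooth_on_mult)
    ultimately show ?thesis
      by (simp add: nab_scaleR nab_add smooth_f smooth_psi smm_ricci smm_hessian smm_G x nab_G)
  qed
  from this[of i j] this[of j i] show ?thesis
    using codazzi[OF x, of i j k] ricci_identity[OF smooth_f x, of i j k] by simp
qed

lemma starv:
  assumes x: "x \<in> D"
  shows "(dif f x \<bullet> X) * ip (ricci D G x) Y Z - (dif f x \<bullet> Y) * ip (ricci D G x) X Z
    = - (dif f x \<bullet> (Rop x X Y *v Z)) + (dif psi x \<bullet> X) * ip (G x) Y Z - (dif psi x \<bullet> Y) * ip (G x) X Z"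
proof -
  let ?T = "\<lambda>X Y Z. (dif f x \<bullet> X) * ip (ricci D G x) Y Z - (dif f x \<bullet> Y) * ip (ricci D G x) X Z
    + (dif f x \<bullet> (Rop x X Y *v Z)) - (dif psi x \<bullet> X) * ip (G x) Y Z + (dif psi x \<bullet> Y) * ip (G x) X Z"
  have "?T X Y Z = 0"
  proof (rule trilinear_zero[where T = ?T])
    note lin = ip_simps Rop_linear matrix_vector_mult_add_rdistrib matrix_vector_right_distrib
        matrix_vector_mult_scaleR scaleR_matrix_vector_assoc[symmetric] inner_add_right
    show "linear (\<lambda>X. ?T X Y Z)" for Y Z by (rule linearI; simp add: lin algebra_simps)
    show "linear (\<lambda>Y. ?T X Y Z)" for X Z by (rule linearI; simp add: lin algebra_simps)
    show "linear (\<lambda>Z. ?T X Y Z)" for X Y by (rule linearI; simp add: lin algebra_simps)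
    show "?T (axis i 1) (axis j 1) (axis k 1) = 0" for i j k
      using star[OF x, of i j k]
      by (simp add: ip_axis inner_axis dif_def matrix_vector_mult_basis column_def)
        (simp add: inner_vec_def Rop_axis mult.commute)
  qed
  then show ?thesis by simp
qed

lemma frame_at:
  assumes x: "x \<in> D" shows "\<exists>e. frame (G x) e"
proof -
  have "ip (G x) (axis 1 1) (axis 1 1) > 0" by (rule pos_G[OF x]) (simp add: axis_eq_0_iff)
  then have "ip (G x) ((1 / sqrt (ip (G x) (axis 1 1) (axis 1 1))) *\<^sub>R axis 1 1) ((1 / sqrt (ip (G x) (axis 1 1) (axis 1 1))) *\<^sub>R axis 1 1) = 1"
    by (simp add: ip_simps divide_simps)
  from frame_exists[OF pos_G[OF x] transpose_G[OF x] this] show ?thesis by blast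
qed

text \<open>Tracing \<open>starv\<close> over its last two arguments produces
  \<open>Ric(grad f, X)\<close> with the same sign on both sides. What is left is
  \<open>6 r df = 2 d psi\<close>, and \<open>psi = 3 r f - a / 2\<close> turns this into
  \<open>da = 0\<close>.\<close>

lemma pd_al:
  assumes x: "x \<in> D" shows "pd D i al x = 0"
proof -
  obtain e where e: "frame (G x) e" using frame_at[OF x] by blast
  note tr = transpose_G[OF x]
  have dv: "dif f x \<bullet> v = ip (G x) (gr x) v" for v by (simp add: ip_gradient x)
  let ?X = "axis i 1 :: real^3"
  have ex: "(\<Sum>a\<in>UNIV. (v \<bullet> e a) * ip M ?X (e a)) = ip M ?X (matrix_inv (G x) *v v)" for v M
  proof -
    have "ip (G x) (matrix_inv (G x) *v v) w = v \<bullet> w" for w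
      using G_inv(1)[OF x] by (simp add: ip_commute[OF tr, of _ w] ip_def[of _ w] matrix_vector_mul_assoc inner_commute)
    then have "matrix_inv (G x) *v v = (\<Sum>a\<in>UNIV. (v \<bullet> e a) *\<^sub>R e a)"
      using frame_expand[OF e tr, of "matrix_inv (G x) *v v"] by simp
    then show ?thesis by (simp add: ip_sum_right ip_simps)
  qed
  have "(\<Sum>a\<in>UNIV. (dif f x \<bullet> ?X) * ip (ricci D G x) (e a) (e a) - (dif f x \<bullet> e a) * ip (ricci D G x) ?X (e a))
    = (\<Sum>a\<in>UNIV. - (dif f x \<bullet> (Rop x ?X (e a) *v e a)) + (dif psi x \<bullet> ?X) * ip (G x) (e a) (e a)
        - (dif psi x \<bullet> e a) * ip (G x) ?X (e a))"
    by (intro sum.cong refl starv[OF x])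
  moreover have "(\<Sum>a\<in>UNIV. ip (ricci D G x) (e a) (e a)) = 6 * r"
    using scalar_frame[OF x e] scal_eq[OF x] by simp
  moreover have "(\<Sum>a\<in>UNIV. dif f x \<bullet> (Rop x ?X (e a) *v e a)) = ip (ricci D G x) (gr x) ?X"
  proof -
    have "dif f x \<bullet> (Rop x ?X (e a) *v e a) = ip (G x) (Rop x (e a) ?X *v gr x) (e a)" for a
      unfolding dv ip_commute[OF tr, of "gr x"] Rop_flip[of x "e a" ?X]
      using Rop_skew[OF x, of ?X "e a" "e a" "gr x"] by (simp add: ip_minus_left matrix_vector_mult_minus_left)
    then show ?thesis by (simp add: ricci_trace[OF x e])
  qed
  moreover have "(\<Sum>a\<in>UNIV. (dif f x \<bullet> e a) * ip (ricci D G x) ?X (e a)) = ip (ricci D G x) (gr x) ?X"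
    unfolding ex using ip_commute[OF transpose_ricci[OF x]] by (simp add: gradient_def dif_def)
  moreover have "(\<Sum>a\<in>UNIV. (dif psi x \<bullet> e a) * ip (G x) ?X (e a)) = dif psi x \<bullet> ?X"
    unfolding ex using G_inv(1)[OF x] by (simp add: ip_def matrix_vector_mul_assoc inner_commute)
  ultimately have "6 * r * (dif f x \<bullet> ?X) = 2 * (dif psi x \<bullet> ?X)"
    using frameD[OF e] by (simp add: sum_subtractf sum.distrib sum_distrib_left[symmetric] sum_negf)
  then have "6 * r * pd D i f x = 2 * pd D i psi x" by (simp add: dif_def inner_axis)
  with pd_psi[OF x, of i] show ?thesis by simp
qed

lemma dif_psi: "x \<in> D \<Longrightarrow> dif psi x = (3 * r) *\<^sub>R dif f x"
  by (simp add: dif_def vec_eq_iff pd_psi pd_al)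

lemma hessian_BB:
  assumes "x \<in> D"
  shows "hessian D G f x = f x *\<^sub>R BB x - (r * f x - al x / 2) *\<^sub>R G x"
proof -
  have "hessian D G f x = f x *\<^sub>R ricci D G x - psi x *\<^sub>R G x"
    using field_eq[OF assms] by (simp add: psi_def)
  then show ?thesis by (simp add: BB_def psi_al vec_eq_iff algebra_simps)
qed

lemma uu_gr: "x \<in> D \<Longrightarrow> uu x = ip (G x) (gr x) (gr x)"
  by (simp add: uu_def ip_gradient)

lemma uu_nonneg: "x \<in> D \<Longrightarrow> uu x \<ge> 0"
  using pos_G[of x "gr x"] by (cases "gr x = 0") (auto simp: uu_gr ip_simps)

lemma uu_eq_0: "x \<in> D \<Longrightarrow> uu x = 0 \<longleftrightarrow> dif f x = 0"
proof
  assume x: "x \<in> D" and "uu x = 0"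
  then have "gr x = 0" using pos_G[OF x, of "gr x"] by (auto simp: uu_gr)
  then have "dif f x \<bullet> v = 0" for v using ip_gradient[OF x, of f v] by (simp add: ip_simps)
  then show "dif f x = 0" by (metis inner_eq_zero_iff)
qed (simp add: uu_def)

lemma ip_BB: "ip (BB x) Y Z = ip (ricci D G x) Y Z - 2 * r * ip (G x) Y Z"
  by (simp add: BB_def ip_def matrix_vector_mult_diff_rdistrib scaleR_matrix_vector_assoc[symmetric] inner_diff_right)

text \<open>In dimension three \<open>Ric\<close> determines the curvature: the sectional curvature
  of a plane is half the scalar curvature, here \<open>3 * r\<close>, minus the Ricci curvature of
  its normal. The remaining components are those with \<open>e 1\<close> in the first and last slot,
  as needed when \<open>e 1\<close> points along \<open>grad f\<close>.\<close>

lemma ricci_flip_frame: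
  assumes x: "x \<in> D" and e: "frame (G x) e"
  shows "ip (G x) (Rop x (e 2) (e 3) *v e 3) (e 2) = 3 * r - ip (ricci D G x) (e 1) (e 1)"
    and "ip (G x) (Rop x (e 1) (e 2) *v e 2) (e 1) = ip (ricci D G x) (e 2) (e 2) - (3 * r - ip (ricci D G x) (e 1) (e 1))"
    and "ip (G x) (Rop x (e 1) (e 3) *v e 3) (e 1) = ip (ricci D G x) (e 3) (e 3) - (3 * r - ip (ricci D G x) (e 1) (e 1))"
    and "ip (G x) (Rop x (e 1) (e 2) *v e 3) (e 1) = ip (ricci D G x) (e 3) (e 2)"
proof -
  define K where "K a b c d = ip (G x) (Rop x (e a) (e b) *v e c) (e d)" for a b c d
  have K1: "K a b c d = - K b a c d" for a b c d
    unfolding K_def by (subst Rop_flip) (simp add: ip_minus_left matrix_vector_mult_minus_left)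
  have K2: "K a b c d = - K a b d c" for a b c d
    unfolding K_def by (rule Rop_skew[OF x])
  have K0: "K a a c d = 0" "K a b c c = 0" for a b c d
    using K1[of a a] K2[of a b c c] by auto
  have R: "ip (ricci D G x) (e c) (e b) = K 1 b c 1 + K 2 b c 2 + K 3 b c 3" for b c
    using ricci_trace[OF x e, of "e c" "e b"] by (simp add: K_def sum_3)
  have s: "ip (ricci D G x) (e 1) (e 1) + ip (ricci D G x) (e 2) (e 2) + ip (ricci D G x) (e 3) (e 3) = 6 * r"
    using scalar_frame[OF x e] scal_eq[OF x] by (simp add: sum_3)
  have p: "K b a a b = K a b b a" for a b
    using K1[of b a a b] K2[of a b a b] by simp
  show "ip (G x) (Rop x (e 2) (e 3) *v e 3) (e 2) = 3 * r - ip (ricci D G x) (e 1) (e 1)"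
    "ip (G x) (Rop x (e 1) (e 2) *v e 2) (e 1) = ip (ricci D G x) (e 2) (e 2) - (3 * r - ip (ricci D G x) (e 1) (e 1))"
    "ip (G x) (Rop x (e 1) (e 3) *v e 3) (e 1) = ip (ricci D G x) (e 3) (e 3) - (3 * r - ip (ricci D G x) (e 1) (e 1))"
    "ip (G x) (Rop x (e 1) (e 2) *v e 3) (e 1) = ip (ricci D G x) (e 3) (e 2)"
    using s p[of 2 1] p[of 3 1] p[of 3 2] K0 unfolding R K_def[symmetric] by simp_all
qed

lemma frame_gr:
  assumes x: "x \<in> D" and u: "uu x \<noteq> 0"
  obtains e where "frame (G x) e" "gr x = sqrt (uu x) *\<^sub>R e 1"
    "dif f x \<bullet> e 1 = sqrt (uu x)" "dif f x \<bullet> e 2 = 0" "dif f x \<bullet> e 3 = 0"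
proof -
  have u0: "uu x > 0" using u uu_nonneg[OF x] by simp
  have "ip (G x) ((1 / sqrt (uu x)) *\<^sub>R gr x) ((1 / sqrt (uu x)) *\<^sub>R gr x) = 1"
    using u0 by (simp add: ip_simps uu_gr[OF x, symmetric])
  from frame_exists[OF pos_G[OF x] transpose_G[OF x] this]
  obtain e where e: "frame (G x) e" "e 1 = (1 / sqrt (uu x)) *\<^sub>R gr x" by auto
  then have g: "gr x = sqrt (uu x) *\<^sub>R e 1" using u0 by simp
  have "dif f x \<bullet> e a = sqrt (uu x) * ip (G x) (e 1) (e a)" for a
    using ip_gradient[OF x, of f "e a"] g by (simp add: ip_simps)
  then show ?thesis using that[OF e(1) g] frameD[OF e(1)] by simp
qed

text \<open>In a frame with \<open>e 1\<close> along \<open>grad f\<close>, \<open>starv\<close>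
  with \<open>e 1\<close> as first argument is an equation between Ricci components only, because
  the curvature is determined by \<open>Ric\<close>. It kills the off-diagonal components and gives
  equal eigenvalues on the complement of \<open>grad f\<close>; the trace fixes the last
  one.\<close>

lemma BB_form:
  assumes x: "x \<in> D" and u: "uu x \<noteq> 0"
  shows "\<exists>w. \<forall>Y Z. ip (BB x) Y Z = w / 2 * ip (G x) Y Z - 3 * w / (2 * uu x) * (dif f x \<bullet> Y) * (dif f x \<bullet> Z)"
proof -
  have u0: "uu x > 0" using u uu_nonneg[OF x] by simp
  obtain e where e: "frame (G x) e" and g: "gr x = sqrt (uu x) *\<^sub>R e 1"
    and d: "dif f x \<bullet> e 1 = sqrt (uu x)" "dif f x \<bullet> e 2 = 0" "dif f x \<bullet> e 3 = 0"
    using frame_gr[OF x u] by blast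
  define \<eta> where "\<eta> a b = ip (ricci D G x) (e a) (e b)" for a b
  have sym: "\<eta> a b = \<eta> b a" for a b unfolding \<eta>_def by (rule ip_commute[OF transpose_ricci[OF x]])
  have dR: "dif f x \<bullet> v = sqrt (uu x) * ip (G x) v (e 1)" for v
    using ip_gradient[OF x, of f v] g ip_commute[OF transpose_G[OF x]] by (simp add: ip_simps)
  have S: "(dif f x \<bullet> e a) * \<eta> b c - (dif f x \<bullet> e b) * \<eta> a c = - sqrt (uu x) * ip (G x) (Rop x (e a) (e b) *v e c) (e 1)
    + 3 * r * (dif f x \<bullet> e a) * ip (G x) (e b) (e c) - 3 * r * (dif f x \<bullet> e b) * ip (G x) (e a) (e c)" for a b c
    using starv[OF x, of "e a" "e b" "e c"] by (simp add: \<eta>_def dif_psi[OF x] dR)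
  have su: "sqrt (uu x) \<noteq> 0" using u0 by simp
  have "sqrt (uu x) * \<eta> 2 1 = 0"
    using S[of 1 2 1] by (simp add: d Rop_skew_zero[OF x] frameD[OF e])
  moreover have "sqrt (uu x) * \<eta> 3 1 = 0"
    using S[of 1 3 1] by (simp add: d Rop_skew_zero[OF x] frameD[OF e])
  moreover have "sqrt (uu x) * \<eta> 2 2 = sqrt (uu x) * (- (\<eta> 2 2 - (3 * r - \<eta> 1 1)) + 3 * r)"
    using S[of 1 2 2] by (simp add: d frameD[OF e] ricci_flip_frame[OF x e] \<eta>_def[symmetric] algebra_simps)
  moreover have "sqrt (uu x) * \<eta> 3 3 = sqrt (uu x) * (- (\<eta> 3 3 - (3 * r - \<eta> 1 1)) + 3 * r)"
    using S[of 1 3 3] by (simp add: d frameD[OF e] ricci_flip_frame[OF x e] \<eta>_def[symmetric] algebra_simps)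
  moreover have "sqrt (uu x) * \<eta> 2 3 = sqrt (uu x) * (- \<eta> 3 2)"
    using S[of 1 2 3] by (simp add: d frameD[OF e] ricci_flip_frame[OF x e] \<eta>_def[symmetric] algebra_simps)
  moreover have "\<eta> 1 1 + \<eta> 2 2 + \<eta> 3 3 = 6 * r"
    using scalar_frame[OF x e] scal_eq[OF x] by (simp add: sum_3 \<eta>_def)
  ultimately have h: "\<eta> 2 1 = 0" "\<eta> 3 1 = 0" "\<eta> 3 3 = \<eta> 2 2" "\<eta> 3 2 = 0" "\<eta> 1 1 = 6 * r - 2 * \<eta> 2 2"
    using su sym[of 2 3] by (simp_all only: mult_cancel_left mult_eq_0_iff) auto
  \<comment> \<open>Half of \<open>w\<close> is the double eigenvalue of \<open>B\<close> on the
    complement of \<open>grad f\<close>; vanishing trace makes \<open>-w\<close> the eigenvalue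
    along \<open>grad f\<close>.\<close>
  define w where "w = 2 * (\<eta> 2 2 - 2 * r)"
  let ?M = "(w / 2) *\<^sub>R G x - (3 * w / (2 * uu x)) *\<^sub>R (\<chi> i j. dif f x $ i * dif f x $ j)"
  have M: "ip ?M Y Z = w / 2 * ip (G x) Y Z - 3 * w / (2 * uu x) * (dif f x \<bullet> Y) * (dif f x \<bullet> Z)" for Y Z
  proof -
    have "ip (\<chi> i j. dif f x $ i * dif f x $ j) Y Z = (dif f x \<bullet> Y) * (dif f x \<bullet> Z)"
      by (simp add: ip_expand inner_vec_def sum_product mult_ac)
    then show ?thesis
      by (simp add: ip_def matrix_vector_mult_diff_rdistrib scaleR_matrix_vector_assoc[symmetric] inner_diff_right)
  qed
  have "BB x = ?M"
  proof (rule frame_eqI[OF e])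
    have c: "3 * w * sqrt (uu x) * sqrt (uu x) / (2 * uu x) = 3 * w / 2"
      using u0 by (simp add: mult.assoc)
    have w: "\<eta> 2 2 = w / 2 + 2 * r" "\<eta> 3 3 = w / 2 + 2 * r" "\<eta> 1 1 = 2 * r - w"
      using h by (simp_all add: w_def field_simps)
    have "\<forall>a b. ip (BB x) (e a) (e b) = ip ?M (e a) (e b)"
      unfolding forall_3 M ip_BB \<eta>_def[symmetric]
      using h(1,2,4) sym[of 1 2] sym[of 1 3] sym[of 2 3] by (simp add: d frameD[OF e] w c)
    then show "ip (BB x) (e a) (e b) = ip ?M (e a) (e b)" for a b by blast
  qed
  then show ?thesis using M by (intro exI[of _ w]) simp
qed

end

lemma ip_axis_left: "ip M (axis i 1) v = (\<Sum>j\<in>UNIV. M $ i $ j * v $ j)"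
  by (simp add: ip_expand mult.assoc sum_distrib_left[symmetric] sum_axis)

lemma matrix_mult_nth: "(A ** B) $ i $ j = (\<Sum>k\<in>UNIV. A $ i $ k * B $ k $ j)"
  by (simp add: matrix_matrix_mult_def)

section \<open>Smooth invariants of the tracefree Ricci tensor\<close>

context fluid_patch begin

text \<open>Raising an index gives an endomorphism, which a change of chart conjugates; traces of
  its powers are therefore scalars on the manifold.\<close>

definition Bh :: "real^3 \<Rightarrow> real^3^3" where "Bh x = matrix_inv (G x) ** BB x"
definition bt :: "real^3 \<Rightarrow> real" where "bt x = trace (Bh x ** Bh x)"
definition zz :: "real^3 \<Rightarrow> real" where "zz x = trace (Bh x ** Bh x ** Bh x)"
text \<open>\<open>B\<close> will have the eigenvalues \<open>-w, w/2, w/2\<close>, so that \<open>tr B\<^sup>2 = 3 w\<^sup>2 / 2\<close> and \<open>tr B\<^sup>3 = - 3 w\<^sup>3 / 4\<close>. Unlike the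
  eigenvectors, this expression for \<open>w\<close> is smooth at the critical points of \<open>f\<close>.\<close>

definition ww :: "real^3 \<Rightarrow> real" where "ww x = - 2 * zz x / bt x"

lemma smm_BB: "smm D BB"
  using smmD[OF smm_ricci] smooth_g by (auto simp: smm_def BB_def intro!: smooth_intros)

lemma smm_Bh: "smm D Bh"
  unfolding Bh_def[abs_def] using smooth_ginv by (intro smm_matmul smm_BB) (simp add: smm_def)

lemma smooth_trace: "smm D M \<Longrightarrow> smooth_on D (\<lambda>x. trace (M x))"
  unfolding trace_def by (intro smooth_on_sum smmD)

lemma smooth_bt: "smooth_on D bt" and smooth_zz: "smooth_on D zz"
  unfolding bt_def[abs_def] zz_def[abs_def] by (intro smooth_trace smm_matmul smm_Bh)+

lemma BB_sym: "x \<in> D \<Longrightarrow> transpose (BB x) = BB x"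
  using ricci_sym G_sym by (simp add: BB_def transpose_def vec_eq_iff)

lemma bt_frame:
  assumes x: "x \<in> D" and e: "frame (G x) e"
  shows "bt x = (\<Sum>a\<in>UNIV. \<Sum>b\<in>UNIV. ip (BB x) (e a) (e b) * ip (BB x) (e b) (e a))"
    and "zz x = (\<Sum>a\<in>UNIV. \<Sum>b\<in>UNIV. (\<Sum>c\<in>UNIV. ip (BB x) (e a) (e c) * ip (BB x) (e c) (e b)) * ip (BB x) (e b) (e a))"
proof -
  let ?E = "frame_matrix e"
  let ?Q = "transpose ?E ** BB x ** ?E"
  have Bh: "Bh x = ?E ** (transpose ?E ** BB x)"
    by (simp add: Bh_def frame_inv[OF e transpose_G[OF x]] matrix_mul_assoc)
  have "bt x = trace (?E ** (transpose ?E ** BB x ** ?E ** (transpose ?E ** BB x)))"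
    by (simp add: bt_def Bh matrix_mul_assoc)
  also have "\<dots> = trace ((transpose ?E ** BB x ** ?E ** (transpose ?E ** BB x)) ** ?E)"
    by (rule trace_mul_sym)
  finally have "bt x = trace ((transpose ?E ** BB x ** ?E ** (transpose ?E ** BB x)) ** ?E)" .
  then have "bt x = trace (?Q ** ?Q)" by (simp add: matrix_mul_assoc)
  then show "bt x = (\<Sum>a\<in>UNIV. \<Sum>b\<in>UNIV. ip (BB x) (e a) (e b) * ip (BB x) (e b) (e a))"
    by (simp add: trace_def matrix_matrix_mult_def[of ?Q ?Q] frame_matrix_ip)
  have "zz x = trace (?E ** (transpose ?E ** BB x ** ?E ** (transpose ?E ** BB x) ** ?E ** (transpose ?E ** BB x)))"
    by (simp add: zz_def Bh matrix_mul_assoc)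
  also have "\<dots> = trace ((transpose ?E ** BB x ** ?E ** (transpose ?E ** BB x) ** ?E ** (transpose ?E ** BB x)) ** ?E)"
    by (rule trace_mul_sym)
  finally have "zz x = trace ((transpose ?E ** BB x ** ?E ** (transpose ?E ** BB x) ** ?E ** (transpose ?E ** BB x)) ** ?E)" .
  then have "zz x = trace (?Q ** ?Q ** ?Q)" by (simp add: matrix_mul_assoc)
  then show "zz x = (\<Sum>a\<in>UNIV. \<Sum>b\<in>UNIV. (\<Sum>c\<in>UNIV. ip (BB x) (e a) (e c) * ip (BB x) (e c) (e b)) * ip (BB x) (e b) (e a))"
    by (simp add: trace_def matrix_mult_nth[of "?Q ** ?Q" ?Q] matrix_mult_nth[of ?Q ?Q] frame_matrix_ip)
qed

lemma BB_trace:
  assumes "x \<in> D" "frame (G x) e" shows "(\<Sum>a\<in>UNIV. ip (BB x) (e a) (e a)) = 0"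
  using scalar_frame[OF assms] scal_eq[OF assms(1)] frameD[OF assms(2)]
  by (simp add: ip_BB sum_subtractf sum_distrib_left[symmetric])

lemma bt_zero:
  assumes x: "x \<in> D" and b: "bt x = 0" shows "BB x = 0"
proof -
  obtain e where e: "frame (G x) e" using frame_at[OF x] by blast
  have "(\<Sum>a\<in>UNIV. \<Sum>b\<in>UNIV. (ip (BB x) (e a) (e b))\<^sup>2) = 0"
    using b ip_commute[OF BB_sym[OF x]] unfolding bt_frame[OF x e] by (simp add: power2_eq_square)
  then have "\<forall>a. (\<Sum>b\<in>UNIV. (ip (BB x) (e a) (e b))\<^sup>2) = 0"
    by (subst (asm) sum_nonneg_eq_0_iff) (auto intro: sum_nonneg)
  then have "(ip (BB x) (e a) (e b))\<^sup>2 = 0" for a b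
    by (subst (asm) sum_nonneg_eq_0_iff) auto
  then show ?thesis by (intro frame_eqI[OF e]) (simp add: ip_def)
qed

lemma ww_form:
  assumes x: "x \<in> D" and u: "uu x \<noteq> 0"
  shows "ip (BB x) Y Z = ww x / 2 * ip (G x) Y Z - 3 * ww x / (2 * uu x) * (dif f x \<bullet> Y) * (dif f x \<bullet> Z)"
    and "bt x = 3 / 2 * (ww x)\<^sup>2"
proof -
  obtain w where w: "\<And>Y Z. ip (BB x) Y Z = w / 2 * ip (G x) Y Z - 3 * w / (2 * uu x) * (dif f x \<bullet> Y) * (dif f x \<bullet> Z)"
    using BB_form[OF x u] by blast
  obtain e where e: "frame (G x) e" and g: "gr x = sqrt (uu x) *\<^sub>R e 1"
    and d: "dif f x \<bullet> e 1 = sqrt (uu x)" "dif f x \<bullet> e 2 = 0" "dif f x \<bullet> e 3 = 0"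
    using frame_gr[OF x u] by blast
  have u0: "uu x > 0" using u uu_nonneg[OF x] by simp
  have c: "3 * w * sqrt (uu x) * sqrt (uu x) / (2 * uu x) = 3 * w / 2"
    using u0 by (simp add: mult.assoc)
  have "\<forall>a b. ip (BB x) (e a) (e b) = (if a = b then if a = 1 then - w else w / 2 else 0)"
    unfolding forall_3 w by (simp add: d frameD[OF e] c)
  then have b: "bt x = 3 / 2 * w\<^sup>2" and z: "zz x = - 3 / 4 * w ^ 3"
    by (simp_all add: bt_frame[OF x e] sum_3 field_simps power2_eq_square power3_eq_cube)
  \<comment> \<open>For \<open>w = 0\<close> the defining quotient of \<open>ww\<close> is 0 divided
    by 0, whose value 0 is the right one.\<close>
  have "ww x = w"
    by (cases "w = 0") (simp_all add: ww_def b z power2_eq_square power3_eq_cube field_simps)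
  with w b show "ip (BB x) Y Z = ww x / 2 * ip (G x) Y Z - 3 * ww x / (2 * uu x) * (dif f x \<bullet> Y) * (dif f x \<bullet> Z)"
    "bt x = 3 / 2 * (ww x)\<^sup>2" by simp_all
qed

lemma hs_open_smooth_preimage:
  assumes "smooth_on D \<phi>" "open (S :: real set)" shows "hs_open {x \<in> D. \<phi> x \<in> S}"
proof -
  have "openin (top_of_set D) (D \<inter> \<phi> -` S)"
    using continuous_openin_preimage_gen[OF smooth_on_imp_continuous_on[OF assms(1)] assms(2)] .
  moreover have "{x \<in> D. \<phi> x \<in> S} = D \<inter> \<phi> -` S" by auto
  ultimately show ?thesis using hs_open_openin[OF hs_open] by simp
qed

text \<open>If \<open>df\<close> vanished on a relatively open set, so would the Hessian, and
  \<open>hessian_BB\<close> would make \<open>f B\<close> a multiple of the metric. Since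
  \<open>B\<close> is tracefree, the factor would be 0 and \<open>B\<close> would vanish, against
  \<open>bt x \<noteq> 0\<close>.\<close>

lemma dense_uu:
  assumes x: "x \<in> N" and N: "hs_open N" "N \<subseteq> D" and b: "bt x \<noteq> 0"
  shows "\<exists>y\<in>N. uu y \<noteq> 0"
proof (rule ccontr)
  assume "\<not> ?thesis"
  then have "dif f y = 0" if "y \<in> N" for y using uu_eq_0 that N by blast
  then have z: "pd D k f y = 0" if "y \<in> N" for y k
    using that by (simp add: dif_def vec_eq_iff)
  have xD: "x \<in> D" using x N by blast
  have "pd D i (pd D k f) x = pd N i (pd D k f) x" for i k
    using pd_subset[OF hs_open N x, of "pd D k f" i] smooth_on_differentiable[OF smooth_on_pd[OF smooth_f hs_open] xD]
    by simp
  also have "pd N i (pd D k f) x = 0" for i k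
    using pd_cong[of N "pd D k f" "\<lambda>y. 0" x i] z x N(1) by simp
  finally have "hessian D G f x = 0"
    using z[OF x] by (simp add: hessian_def vec_eq_iff)
  then have B: "f x *\<^sub>R BB x = (r * f x - al x / 2) *\<^sub>R G x" (is "_ = ?c *\<^sub>R _")
    using hessian_BB[OF xD] by simp
  obtain e where e: "frame (G x) e" using frame_at[OF xD] by blast
  have ips: "ip (c *\<^sub>R M) v w = c * ip M v w" for c and M :: "real^3^3" and v w
    by (simp add: ip_def scaleR_matrix_vector_assoc[symmetric])
  have fB: "f x * ip (BB x) v w = ?c * ip (G x) v w" for v w
    using arg_cong[OF B, of "\<lambda>M. ip M v w"] by (simp only: ips)
  then have "(\<Sum>a\<in>UNIV. ?c * ip (G x) (e a) (e a)) = f x * (\<Sum>a\<in>UNIV. ip (BB x) (e a) (e a))"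
    by (simp add: sum_distrib_left)
  then have "?c = 0"
    using BB_trace[OF xD e] by (simp add: frameD[OF e])
  then have "f x *\<^sub>R BB x = 0" using B by (simp only: scaleR_zero_left)
  then have "BB x = 0" using f_pos[OF xD] by simp
  then show False using b by (simp add: bt_def Bh_def matrix_matrix_mult_def trace_def)
qed

lemma uu_deriv:
  assumes x: "x \<in> D" shows "pd D i uu x = 2 * ip (hessian D G f x) (axis i 1) (gr x)"
proof -
  interpret I: map_patch D G D "\<lambda>x. x" by (rule map_patch_id)
  have "pd D i uu x = pd D i (\<lambda>y. ip (G y) (gr y) (gr y)) x"
    using x by (intro pd_cong) (simp_all add: uu_gr)
  also have "\<dots> = 2 * ip (G x) (I.cd i gr x) (gr x)"
    using I.pd_ip_metric[OF smv_gradient[OF smooth_f] smv_gradient[OF smooth_f] x, of i]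
      ip_commute[OF transpose_G[OF x], of "gr x"] by simp
  also have "ip (G x) (I.cd i gr x) (gr x) = ip (hessian D G f x) (axis i 1) (gr x)"
  proof -
    have "linear (\<lambda>v. ip (G x) (I.cd i gr x) v)" by (rule linearI) (simp_all add: ip_simps)
    from linear_axis_sum[OF this, of "gr x"] show ?thesis
      by (simp add: hessian_cd[OF smooth_f x] ip_axis_left mult.commute)
  qed
  finally show ?thesis by simp
qed

lemma smooth_uu: "smooth_on D uu"
  unfolding uu_def[abs_def] by (intro smooth_on_inner smv_dif smv_gradient smooth_f)

end

section \<open>Identities in the region where the tracefree Ricci tensor does not vanish\<close>

locale curved_patch = fluid_patch +
  assumes bt_nz: "\<And>x. x \<in> D \<Longrightarrow> bt x \<noteq> 0"
begin

text \<open>The device that carries identities from noncritical points of \<open>f\<close> to all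
  points: a nonzero value of a smooth function persists on a relatively open set, and by
  \<open>dense_uu\<close> such a set contains a noncritical point.\<close>

lemma dense_eq:
  assumes "smooth_on D \<phi>" "\<And>y. y \<in> D \<Longrightarrow> uu y \<noteq> 0 \<Longrightarrow> \<phi> y = (0 :: real)" "x \<in> D"
  shows "\<phi> x = 0"
proof (rule ccontr)
  assume "\<phi> x \<noteq> 0"
  then obtain y where "y \<in> {x \<in> D. \<phi> x \<in> - {0}}" "uu y \<noteq> 0"
    using dense_uu[OF _ hs_open_smooth_preimage[OF assms(1), of "- {0}"], of x] assms(3) bt_nz by auto
  then show False using assms(2) by auto
qed

lemma smooth_ww: "smooth_on D ww"
  unfolding ww_def[abs_def] by (intro smooth_intros smooth_bt smooth_zz bt_nz)

lemma ww_sq: "x \<in> D \<Longrightarrow> bt x = 3 / 2 * (ww x)\<^sup>2"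
  using dense_eq[of "\<lambda>x. bt x - 3 / 2 * (ww x)\<^sup>2" x] ww_form(2)
  by (simp add: smooth_intros smooth_bt smooth_ww)

lemma ww_nz: "x \<in> D \<Longrightarrow> ww x \<noteq> 0"
  using ww_sq bt_nz by fastforce

text \<open>The eigenvalue of Hess f on the complement of \<open>grad f\<close>, where
  \<open>B\<close> acts as \<open>w / 2\<close>. In a warped product ds^2 + h^2 g_N with f depending
  on s, it is f' h'/h.\<close>

definition yy :: "real^3 \<Rightarrow> real" where "yy x = al x / 2 - f x * (r - ww x / 2)"

lemma smooth_yy: "smooth_on D yy"
  unfolding yy_def[abs_def] by (intro smooth_intros smooth_al smooth_f smooth_ww; simp)

lemma BB_uu:
  assumes x: "x \<in> D"
  shows "uu x * BB x $ j $ k = ww x / 2 * (uu x * G x $ j $ k - 3 * (pd D j f x * pd D k f x))"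
proof (cases "uu x = 0")
  case True
  then have "pd D j f x = 0" using uu_eq_0[OF x] by (simp add: dif_def vec_eq_iff)
  with True show ?thesis by simp
next
  case False
  then show ?thesis
    using ww_form(1)[OF x False, of "axis j 1" "axis k 1"]
    by (simp add: ip_axis dif_def inner_axis field_simps)
qed

lemma hessian_uu:
  assumes x: "x \<in> D"
  shows "uu x * hessian D G f x $ j $ k = yy x * uu x * G x $ j $ k - 3 / 2 * f x * ww x * (pd D j f x * pd D k f x)"
proof -
  have "uu x * hessian D G f x $ j $ k = f x * (uu x * BB x $ j $ k) - (r * f x - al x / 2) * (uu x * G x $ j $ k)"
    by (simp add: hessian_BB[OF x] algebra_simps)
  then show ?thesis unfolding BB_uu[OF x] by (simp add: yy_def algebra_simps)
qed

text \<open>The derivative of \<open>uu\<close> is twice Hess f applied to \<open>grad f\<close>,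
  and \<open>grad f\<close> is an eigenvector of Hess f with eigenvalue
  \<open>yy - 3/2 f w\<close>.\<close>

lemma pd_uu:
  assumes x: "x \<in> D" shows "pd D i uu x = 2 * (yy x - 3 / 2 * f x * ww x) * pd D i f x"
proof (cases "uu x = 0")
  case True
  then have d0: "dif f x = 0" using uu_eq_0[OF x] by simp
  then have "gr x = 0" by (simp add: gradient_def dif_def[symmetric])
  moreover have "pd D i f x = 0" using arg_cong[OF d0, of "\<lambda>v. v $ i"] by (simp add: dif_def)
  ultimately show ?thesis by (simp add: uu_deriv[OF x] ip_simps)
next
  case False
  have "uu x * ip (hessian D G f x) (axis i 1) (gr x)
     = (\<Sum>k\<in>UNIV. (uu x * hessian D G f x $ i $ k) * gr x $ k)"
    by (simp add: ip_expand mult.assoc sum_distrib_left[symmetric] sum_axis)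
  also have "\<dots> = yy x * uu x * (G x *v gr x) $ i - 3 / 2 * f x * ww x * pd D i f x * uu x"
  proof -
    have gen: "(\<Sum>k\<in>UNIV. (c * g k - d * (a * h k)) * v k) = c * (\<Sum>k\<in>UNIV. g k * v k) - d * a * (\<Sum>k\<in>UNIV. h k * v k)"
      for c d a :: real and g h v :: "3 \<Rightarrow> real"
      by (simp add: left_diff_distrib right_diff_distrib sum_subtractf sum_distrib_left mult_ac)
    show ?thesis
      unfolding hessian_uu[OF x] gen
      by (simp add: uu_def[of x] inner_vec_def dif_def matrix_vector_mult_def)
  qed
  also have "(G x *v gr x) $ i = pd D i f x"
    using G_inv(1)[OF x] by (simp add: gradient_def matrix_vector_mul_assoc)
  finally have "uu x * ip (hessian D G f x) (axis i 1) (gr x) = uu x * ((yy x - 3 / 2 * f x * ww x) * pd D i f x)"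
    by (simp add: algebra_simps)
  then have "ip (hessian D G f x) (axis i 1) (gr x) = (yy x - 3 / 2 * f x * ww x) * pd D i f x"
    using False by simp
  then show ?thesis by (simp add: uu_deriv[OF x])
qed

text \<open>The Codazzi equation holds for \<open>B\<close> as well, since \<open>B\<close> differs
  from \<open>Ric\<close> by a constant multiple of the metric. Applied to the product form
  \<open>BB_uu\<close> it leaves a first-order equation for \<open>w\<close>; in warped product
  terms w' = -3 w h'/h, so that w h^3 is constant.\<close>

lemma pd_ww:
  assumes x: "x \<in> D" shows "uu x * pd D i ww x = - 3 * ww x * yy x * pd D i f x"
proof (cases "uu x = 0")
  case True
  then have "pd D i f x = 0" using uu_eq_0[OF x] by (simp add: dif_def vec_eq_iff)
  with True show ?thesis by simp
next
  case False
  let ?F = "\<lambda>i. pd D i f x" and ?W = "\<lambda>i. pd D i ww x" and ?H = "\<lambda>j k. hessian D G f x $ j $ k"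
  define FF where "FF y = (\<chi> j k. pd D j f y * pd D k f y)" for y :: "real^3"
  have smFF: "smm D FF"
    by (auto simp: smm_def FF_def intro!: smooth_intros smooth_f hs_open)
  have nabFF: "nab i FF j k x = ?H i j * ?F k + ?F j * ?H i k" for i j k
    using smooth_f hs_open x
    by (simp add: nab_def FF_def pd_mult smooth_on_pd hessian_def left_diff_distrib right_diff_distrib
        sum_distrib_left sum_distrib_right mult_ac)
  have nabB: "nab i BB j k x = nab j BB i k x" for i j k
  proof -
    have "nab i (ricci D G) j k x = nab i (\<lambda>y. BB y + (\<lambda>y. 2 * r) y *\<^sub>R G y) j k x" for i j k
      by (rule nab_cong[OF _ x]) (simp add: BB_def)
    also have "\<dots> i j k = nab i BB j k x" for i j k
      using smooth_g x hs_open
      by (subst nab_add[OF smm_BB _ x]) (auto simp: smm_def smooth_on_mult smooth_on_const nab_scaleR[OF smooth_on_const smm_G x] nab_G)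
    finally show ?thesis using codazzi[OF x] by metis
  qed
  have main: "pd D i uu x * BB x $ j $ k + uu x * nab i BB j k x
     = ?W i / 2 * (uu x * G x $ j $ k - 3 * (?F j * ?F k))
       + ww x / 2 * (pd D i uu x * G x $ j $ k - 3 * (?H i j * ?F k + ?F j * ?H i k))" for i j k
  proof -
    let ?K = "\<lambda>y. uu y *\<^sub>R G y + (-3) *\<^sub>R FF y"
    have s1: "smm D (\<lambda>y. uu y *\<^sub>R G y)" and s2: "smm D (\<lambda>y. (-3) *\<^sub>R FF y)" and s3: "smm D ?K"
      using smooth_g smooth_uu smmD[OF smFF] by (auto simp: smm_def intro!: smooth_intros)
    have "nab i (\<lambda>y. uu y *\<^sub>R BB y) j k x = nab i (\<lambda>y. (ww y / 2) *\<^sub>R ?K y) j k x"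
      using BB_uu by (intro nab_cong x) (simp add: vec_eq_iff FF_def)
    moreover have "nab i ?K j k x = pd D i uu x * G x $ j $ k - 3 * (?H i j * ?F k + ?F j * ?H i k)"
      unfolding nab_add[OF s1 s2 x] nab_scaleR[OF smooth_uu smm_G x] nab_scaleR[OF smooth_on_const smFF x]
      by (simp add: nab_G x nabFF hs_open)
    moreover have "smooth_on D (\<lambda>y. ww y / 2)"
      by (intro smooth_intros smooth_ww) simp
    note nab_scaleR[OF this s3 x, of i j k]
    moreover have "?K x $ j $ k = uu x * G x $ j $ k - 3 * (?F j * ?F k)"
      by (simp add: FF_def)
    moreover have "pd D i (\<lambda>y. ww y / 2) x = ?W i / 2"
      using pd_cmult[OF smooth_ww hs_open x, of i "1/2"] by simp
    ultimately show ?thesis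
      using nab_scaleR[OF smooth_uu smm_BB x, of i j k] by (simp only:)
  qed
  let ?Z = "\<lambda>i. uu x * ?W i + 3 * ww x * yy x * ?F i"
  \<comment> \<open>The antisymmetrized equation is multiplied by \<open>uu\<close> so that
    \<open>B\<close> and the Hessian can be replaced through \<open>BB_uu\<close> and
    \<open>hessian_uu\<close>; the factor is cancelled at the end, \<open>uu\<close> being nonzero
    in this case.\<close>
  have idx: "?Z i * G x $ j $ k - ?Z j * G x $ i $ k - 3 * (?W i * ?F j - ?W j * ?F i) * ?F k = 0" for i j k
  proof -
    let ?\<upsilon> = "yy x - 3 / 2 * f x * ww x" and ?w = "ww x"
    have Hs: "?H i j = ?H j i" by (rule hessian_sym[OF smooth_f x])
    have "pd D i uu x * BB x $ j $ k - pd D j uu x * BB x $ i $ k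
      = ?W i / 2 * (uu x * G x $ j $ k - 3 * (?F j * ?F k)) - ?W j / 2 * (uu x * G x $ i $ k - 3 * (?F i * ?F k))
        + ww x / 2 * (pd D i uu x * G x $ j $ k - pd D j uu x * G x $ i $ k - 3 * (?F j * ?H i k - ?F i * ?H j k))"
      using main[of i j k] main[of j i k] nabB[of i j k] Hs by (simp add: algebra_simps)
    then have e: "uu x * (pd D i uu x * BB x $ j $ k - pd D j uu x * BB x $ i $ k)
      = uu x * (?W i / 2 * (uu x * G x $ j $ k - 3 * (?F j * ?F k)) - ?W j / 2 * (uu x * G x $ i $ k - 3 * (?F i * ?F k))
        + ww x / 2 * (pd D i uu x * G x $ j $ k - pd D j uu x * G x $ i $ k - 3 * (?F j * ?H i k - ?F i * ?H j k)))"
      by (simp only:)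
    have "uu x * (pd D i uu x * BB x $ j $ k - pd D j uu x * BB x $ i $ k)
      = 2 * ?\<upsilon> * (?F i * (uu x * BB x $ j $ k) - ?F j * (uu x * BB x $ i $ k))"
      by (simp add: pd_uu[OF x] algebra_simps)
    also have "\<dots> = ?\<upsilon> * ?w * uu x * (?F i * G x $ j $ k - ?F j * G x $ i $ k)"
      unfolding BB_uu[OF x] by (simp add: field_simps)
    finally have l: "uu x * (pd D i uu x * BB x $ j $ k - pd D j uu x * BB x $ i $ k)
      = ?\<upsilon> * ?w * uu x * (?F i * G x $ j $ k - ?F j * G x $ i $ k)" .
    have h: "uu x * (?F j * ?H i k - ?F i * ?H j k) = yy x * uu x * (?F j * G x $ i $ k - ?F i * G x $ j $ k)"
    proof -
      have "uu x * (?F j * ?H i k - ?F i * ?H j k) = ?F j * (uu x * ?H i k) - ?F i * (uu x * ?H j k)"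
        by (simp add: algebra_simps)
      then show ?thesis unfolding hessian_uu[OF x] by (simp add: algebra_simps)
    qed
    have rr: "uu x * (?W i / 2 * (uu x * G x $ j $ k - 3 * (?F j * ?F k)) - ?W j / 2 * (uu x * G x $ i $ k - 3 * (?F i * ?F k))
        + ww x / 2 * (pd D i uu x * G x $ j $ k - pd D j uu x * G x $ i $ k - 3 * (?F j * ?H i k - ?F i * ?H j k)))
      = uu x * (?W i / 2 * (uu x * G x $ j $ k - 3 * (?F j * ?F k)) - ?W j / 2 * (uu x * G x $ i $ k - 3 * (?F i * ?F k)))
        + uu x * (?w * ?\<upsilon> * (?F i * G x $ j $ k - ?F j * G x $ i $ k))
        - 3 / 2 * ?w * (uu x * (?F j * ?H i k - ?F i * ?H j k))"
      by (simp add: pd_uu[OF x] algebra_simps)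
    have "uu x * (?Z i * G x $ j $ k - ?Z j * G x $ i $ k - 3 * (?W i * ?F j - ?W j * ?F i) * ?F k) = 0"
      using e unfolding l rr h by (simp add: field_simps)
    then show ?thesis using False by simp
  qed
  define Z where "Z = (\<chi> i. ?Z i)"
  have vec: "(Z \<bullet> X) * ip (G x) Y V - (Z \<bullet> Y) * ip (G x) X V
      - 3 * ((dif ww x \<bullet> X) * (dif f x \<bullet> Y) - (dif ww x \<bullet> Y) * (dif f x \<bullet> X)) * (dif f x \<bullet> V) = 0" (is "?T X Y V = 0") for X Y V
  proof (rule trilinear_zero[where T = ?T])
    show "linear (\<lambda>X. ?T X Y V)" for Y V by (rule linearI; simp add: ip_simps inner_add_right algebra_simps)
    show "linear (\<lambda>Y. ?T X Y V)" for X V by (rule linearI; simp add: ip_simps inner_add_right algebra_simps)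
    show "linear (\<lambda>V. ?T X Y V)" for X Y by (rule linearI; simp add: ip_simps inner_add_right algebra_simps)
    show "?T (axis i 1) (axis j 1) (axis k 1) = 0" for i j k
      using idx[of i j k] by (simp add: ip_axis inner_axis dif_def Z_def)
  qed
  obtain e where e: "frame (G x) e" and d: "dif f x \<bullet> e 2 = 0" "dif f x \<bullet> e 3 = 0"
    using frame_gr[OF x False] by blast
  \<comment> \<open>In each instance the last vector is orthogonal to \<open>grad f\<close>, which
    removes the bracket with \<open>df\<close> and \<open>dw\<close>, and equals the second vector,
    which isolates \<open>Z\<close> on the first.\<close>
  have "Z \<bullet> e 1 = 0" "Z \<bullet> e 2 = 0" "Z \<bullet> e 3 = 0"
    using vec[of "e 1" "e 2" "e 2"] vec[of "e 2" "e 3" "e 3"] vec[of "e 3" "e 2" "e 2"] by (simp_all add: d frameD[OF e])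
  then have "\<forall>a. Z \<bullet> e a = 0" unfolding forall_3 by simp
  then have "Z \<bullet> v = 0" for v
    by (subst frame_expand[OF e transpose_G[OF x], of v]) (simp add: inner_sum_right)
  then have "Z = 0" by (metis inner_eq_zero_iff)
  then have "?Z i = 0" by (simp add: Z_def vec_eq_iff)
  then show ?thesis by simp
qed

text \<open>From w' = -3 w h'/h this is (h'/h)^2. Writing it with \<open>dw\<close> instead of
  \<open>yy\<^sup>2 / uu\<close> defines it at critical points of \<open>f\<close> too.\<close>

definition PP :: "real^3 \<Rightarrow> real" where
  "PP x = (dif ww x \<bullet> gradient D G ww x) / (9 * (ww x)\<^sup>2)"

lemma smooth_PP: "smooth_on D PP"
  unfolding PP_def[abs_def]
  by (intro smooth_on_divide smooth_on_inner smv_dif smv_gradient smooth_intros smooth_ww) (simp add: ww_nz)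

lemma uu_PP:
  assumes x: "x \<in> D" shows "uu x * PP x = (yy x)\<^sup>2"
proof -
  have "uu x * PP x - (yy x)\<^sup>2 = 0"
  proof (rule dense_eq[OF _ _ x])
    show "smooth_on D (\<lambda>x. uu x * PP x - (yy x)\<^sup>2)"
      by (intro smooth_intros smooth_uu smooth_PP smooth_yy)
    fix y assume y: "y \<in> D" and u: "uu y \<noteq> 0"
    define s where "s = - 3 * ww y * yy y / uu y"
    have "dif ww y = s *\<^sub>R dif f y"
      using pd_ww[OF y] u by (simp add: dif_def vec_eq_iff s_def field_simps)
    moreover from this have "gradient D G ww y = s *\<^sub>R gr y"
      by (simp add: gradient_def dif_def[symmetric] matrix_vector_mult_scaleR)
    ultimately have "PP y = s * s * uu y / (9 * (ww y)\<^sup>2)"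
      by (simp add: PP_def uu_def)
    then show "uu y * PP y - (yy y)\<^sup>2 = 0"
      using u ww_nz[OF y] by (simp add: s_def field_simps power2_eq_square)
  qed
  then show ?thesis by simp
qed

lemma PP_nonneg: "x \<in> D \<Longrightarrow> PP x \<ge> 0"
proof -
  assume x: "x \<in> D"
  have "dif ww x \<bullet> gradient D G ww x = ip (G x) (gradient D G ww x) (gradient D G ww x)"
    by (simp add: ip_gradient[OF x])
  then have "dif ww x \<bullet> gradient D G ww x \<ge> 0"
    using pos_G[OF x, of "gradient D G ww x"] by (cases "gradient D G ww x = 0") (auto simp: ip_simps)
  then show ?thesis by (simp add: PP_def)
qed

lemma pd_yy:
  assumes x: "x \<in> D" shows "pd D i yy x = - (r - ww x / 2) * pd D i f x + f x * pd D i ww x / 2"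
proof -
  have h: "pd D i (\<lambda>y. u y / 2) x = pd D i u x / 2" "smooth_on D (\<lambda>y. u y / 2)" if "smooth_on D u" for u
    using pd_cmult[OF that hs_open x, of i "1/2"] that by (auto intro!: smooth_intros)
  have s: "smooth_on D (\<lambda>y. r - ww y / 2)" by (intro smooth_intros smooth_ww) simp
  have "pd D i yy x = pd D i (\<lambda>x. al x / 2 - f x * (r - ww x / 2)) x"
    by (rule pd_cong[OF yy_def x])
  also have "\<dots> = - (f x * pd D i (\<lambda>x. r - ww x / 2) x + pd D i f x * (r - ww x / 2))"
    using pd_diff[OF h(2)[OF smooth_al] smooth_on_mult[OF smooth_f s] hs_open x, of i]
    by (simp add: h(1)[OF smooth_al] pd_al[OF x] pd_mult[OF smooth_f s hs_open x])
  also have "pd D i (\<lambda>x. r - ww x / 2) x = - pd D i ww x / 2"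
    using pd_diff[OF smooth_on_const h(2)[OF smooth_ww] hs_open x, of i r] h(1)[OF smooth_ww] hs_open x by simp
  finally show ?thesis by (simp add: algebra_simps)
qed

text \<open>The product rule for \<open>uu * PP = yy\<^sup>2\<close> involves only first derivatives
  that are already known. The equation is multiplied by \<open>uu\<close> once more, so that
  \<open>pd_ww\<close> and \<open>uu_PP\<close> can be inserted without division.\<close>

lemma pd_PP:
  assumes x: "x \<in> D" shows "3 * ww x * pd D i PP x = 2 * (PP x + r - ww x / 2) * pd D i ww x"
proof -
  have "3 * ww x * pd D i PP x - 2 * (PP x + r - ww x / 2) * pd D i ww x = 0"
  proof (rule dense_eq[OF _ _ x])
    show "smooth_on D (\<lambda>x. 3 * ww x * pd D i PP x - 2 * (PP x + r - ww x / 2) * pd D i ww x)"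
      by (intro smooth_intros smooth_PP smooth_ww hs_open) simp
    fix y assume y: "y \<in> D" and u: "uu y \<noteq> 0"
    let ?F = "pd D i f y" and ?W = "pd D i ww y" and ?P = "pd D i PP y"
    have "pd D i (\<lambda>x. uu x * PP x) y = pd D i (\<lambda>x. yy x * yy x) y"
      using uu_PP y by (intro pd_cong) (simp_all add: power2_eq_square)
    then have 1: "uu y * ?P + pd D i uu y * PP y = 2 * yy y * pd D i yy y"
      by (simp add: pd_mult smooth_uu smooth_PP smooth_yy hs_open y)
    have w: "uu y * ?W = - 3 * ww y * yy y * ?F" by (rule pd_ww[OF y])
    have p: "uu y * PP y = yy y * yy y" using uu_PP[OF y] by (simp add: power2_eq_square)
    have "uu y * pd D i yy y = - (r - ww y / 2) * uu y * ?F - 3 / 2 * f y * ww y * yy y * ?F"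
      using w by (simp add: pd_yy[OF y] algebra_simps)
    have "uu y * uu y * ?P = 2 * yy y * (uu y * pd D i yy y) - pd D i uu y * (uu y * PP y)"
      using arg_cong[OF 1, of "\<lambda>t. uu y * t"] by (simp add: algebra_simps)
    also have "\<dots> = - 2 * yy y * ?F * (yy y * yy y + uu y * (r - ww y / 2))"
      unfolding p \<open>uu y * pd D i yy y = _\<close> pd_uu[OF y] by (simp add: algebra_simps)
    finally have q: "uu y * uu y * ?P = - 2 * yy y * ?F * (uu y * PP y + uu y * (r - ww y / 2))"
      unfolding p .
    have "uu y * uu y * (3 * ww y * ?P - 2 * (PP y + r - ww y / 2) * ?W)
      = 3 * ww y * (uu y * uu y * ?P) - 2 * (uu y * PP y + uu y * (r - ww y / 2)) * (uu y * ?W)"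
      by (simp add: algebra_simps)
    also have "\<dots> = 0" unfolding q w by (simp add: algebra_simps)
    finally show "3 * ww y * ?P - 2 * (PP y + r - ww y / 2) * ?W = 0" using u by simp
  qed
  then show ?thesis by simp
qed

text \<open>In the warped product form \<open>ds\<^sup>2 + h\<^sup>2 g_N\<close> of the metric one has \<open>w = m / h\<^sup>3\<close> and \<open>P = (h'/h)\<^sup>2\<close>;
  then \<open>EE\<close> is a multiple of the curvature of \<open>g_N\<close>.\<close>

definition EE :: "real^3 \<Rightarrow> real" where
  "EE x = exp (- (1 / 3) * ln ((ww x)\<^sup>2)) * (PP x + r + ww x)"

lemma smooth_ln_ww: "smooth_on D (\<lambda>x. ln ((ww x)\<^sup>2))"
  by (intro smooth_intros smooth_ww) (simp add: ww_nz)

lemma pd_ln_ww: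
  assumes x: "x \<in> D" shows "pd D i (\<lambda>x. ln ((ww x)\<^sup>2)) x = 2 * pd D i ww x / ww x"
proof -
  have "((\<lambda>t. ln (t\<^sup>2)) has_real_derivative 2 / ww x) (at (ww x))"
    using ww_nz[OF x] zero_less_power2[of "ww x"] by (auto intro!: derivative_eq_intros simp: power2_eq_square)
  from pd_real_compose[OF smooth_ww this hs_open x] show ?thesis by simp
qed

lemma smooth_EE: "smooth_on D EE"
  unfolding EE_def[abs_def] by (intro smooth_intros smooth_ln_ww smooth_PP smooth_ww)

text \<open>\<open>pd_PP\<close> is a linear equation for \<open>P\<close> as a function of
  \<open>w\<close>: the derivative of \<open>P + r + w\<close> with respect to \<open>w\<close> is
  \<open>2 (P + r + w) / (3 w)\<close>. Hence \<open>P + r + w\<close> is a constant multiple of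
  \<open>\<bar>w\<bar>^(2/3)\<close>; the logarithm of \<open>w\<^sup>2\<close> produces this power
  for either sign of \<open>w\<close>.\<close>

lemma pd_EE:
  assumes x: "x \<in> D" shows "pd D i EE x = 0"
proof -
  let ?l = "\<lambda>x. - (1 / 3) * ln ((ww x)\<^sup>2)"
  have sl: "smooth_on D ?l" by (intro smooth_intros smooth_ln_ww)
  have se: "smooth_on D (\<lambda>x. exp (?l x))" by (intro smooth_intros sl)
  have sp: "smooth_on D (\<lambda>x. PP x + r + ww x)" by (intro smooth_intros smooth_PP smooth_ww)
  have l: "pd D i ?l x = - (1 / 3) * (2 * pd D i ww x / ww x)"
    using pd_cmult[OF smooth_ln_ww hs_open x, of i "- (1 / 3)"] pd_ln_ww[OF x] by simp
  have e: "pd D i (\<lambda>x. exp (?l x)) x = exp (?l x) * (- (1 / 3) * (2 * pd D i ww x / ww x))"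
    using pd_real_compose[OF sl DERIV_exp hs_open x, of i] unfolding l .
  have p: "pd D i (\<lambda>x. PP x + r + ww x) x = pd D i PP x + pd D i ww x"
    using hs_open x by (simp add: pd_add smooth_intros smooth_PP smooth_ww)
  have "pd D i EE x = pd D i (\<lambda>x. exp (?l x) * (PP x + r + ww x)) x"
    by (rule pd_cong[OF EE_def x])
  also have "\<dots> = exp (?l x) * (pd D i PP x + pd D i ww x - (2 / 3) * (pd D i ww x / ww x) * (PP x + r + ww x))"
    unfolding pd_mult[OF se sp hs_open x] e p by (simp add: algebra_simps)
  also have "pd D i PP x + pd D i ww x - (2 / 3) * (pd D i ww x / ww x) * (PP x + r + ww x) = 0"
    using pd_PP[OF x, of i] ww_nz[OF x] by (simp add: field_simps)
  finally show ?thesis by simp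
qed

end

text \<open>\<open>f0\<close> is \<open>\<bar>h'\<bar>\<close> in the warped product form; it solves the static vacuum equation.\<close>

locale static_vacuum_patch = curved_patch +
  assumes PP_pos: "\<And>x. x \<in> D \<Longrightarrow> PP x > 0"
begin

definition f0 :: "real^3 \<Rightarrow> real" where
  "f0 x = exp (- (1 / 6) * ln ((ww x)\<^sup>2) + (1 / 2) * ln (PP x))"

lemma smooth_f0: "smooth_on D f0"
  unfolding f0_def[abs_def] by (intro smooth_intros smooth_ln_ww smooth_PP PP_pos)

text \<open>The logarithmic derivative of \<open>f0\<close> combines those of \<open>w\<close> and
  \<open>P\<close>, which \<open>pd_PP\<close> and \<open>pd_ww\<close> express by
  \<open>df\<close>. Since \<open>uu * PP = yy\<^sup>2\<close> with \<open>PP > 0\<close>, the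
  factor \<open>yy\<close> vanishes exactly at the critical points of \<open>f\<close>; keeping it
  on the left covers them.\<close>

lemma pd_f0:
  assumes x: "x \<in> D" shows "yy x * pd D i f0 x = - f0 x * (r - ww x / 2) * pd D i f x"
proof -
  have "yy x * pd D i f0 x + f0 x * (r - ww x / 2) * pd D i f x = 0"
  proof (rule dense_eq[OF _ _ x])
    show "smooth_on D (\<lambda>x. yy x * pd D i f0 x + f0 x * (r - ww x / 2) * pd D i f x)"
      by (intro smooth_intros smooth_yy smooth_f0 smooth_ww smooth_f hs_open) simp
    fix y assume y: "y \<in> D" and u: "uu y \<noteq> 0"
    let ?l = "\<lambda>x. - (1 / 6) * ln ((ww x)\<^sup>2) + (1 / 2) * ln (PP x)"
    let ?F = "pd D i f y" and ?W = "pd D i ww y"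
    have s1: "smooth_on D (\<lambda>x. - (1 / 6) * ln ((ww x)\<^sup>2))" and s0: "smooth_on D (\<lambda>x. ln (PP x))"
      and s2: "smooth_on D (\<lambda>x. (1 / 2) * ln (PP x))"
      by (intro smooth_intros smooth_ln_ww smooth_PP PP_pos; simp)+
    have lp: "pd D i (\<lambda>x. ln (PP x)) y = pd D i PP y / PP y"
      using pd_real_compose[OF smooth_PP DERIV_ln[OF PP_pos[OF y]] hs_open y] by (simp add: divide_inverse)
    have l: "pd D i ?l y = - (1 / 6) * (2 * ?W / ww y) + (1 / 2) * (pd D i PP y / PP y)"
      unfolding pd_add[OF s1 s2 hs_open y] pd_cmult[OF smooth_ln_ww hs_open y] pd_cmult[OF s0 hs_open y]
        lp pd_ln_ww[OF y] ..
    have "pd D i f0 y = pd D i (\<lambda>x. exp (?l x)) y" by (rule pd_cong[OF f0_def y])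
    also have "\<dots> = f0 y * pd D i ?l y"
      using pd_real_compose[OF smooth_on_add[OF s1 s2] DERIV_exp hs_open y, of i] by (simp add: f0_def)
    finally have 1: "pd D i f0 y = f0 y * pd D i ?l y" .
    have w: "ww y \<noteq> 0" and p: "PP y > 0" using ww_nz PP_pos y by auto
    have P: "pd D i PP y = 2 * (PP y + r - ww y / 2) * ?W / (3 * ww y)"
      using pd_PP[OF y, of i] w by (simp add: field_simps)
    have "pd D i ?l y = (r - ww y / 2) * ?W / (3 * ww y * PP y)"
      unfolding l P using w p by (simp add: field_simps)
    moreover have W: "?W = - 3 * ww y * yy y * ?F / uu y"
      using pd_ww[OF y, of i] u by (simp add: field_simps)
    moreover have y2: "yy y * yy y = uu y * PP y" using uu_PP[OF y] by (simp add: power2_eq_square)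
    moreover have "yy y * ((r - ww y / 2) * (- 3 * ww y * yy y * ?F / uu y) / (3 * ww y * PP y))
        = - (r - ww y / 2) * ?F * (yy y * yy y) / (uu y * PP y)"
      using w u p by (simp add: field_simps)
    ultimately have m: "yy y * pd D i ?l y = - (r - ww y / 2) * ?F"
      using u p by simp
    then show "yy y * pd D i f0 y + f0 y * (r - ww y / 2) * pd D i f y = 0"
      unfolding 1 mult.left_commute[of "yy y"] m by (simp add: algebra_simps)
  qed
  then show ?thesis by simp
qed

text \<open>At noncritical points \<open>pd_f0\<close> is differentiated again and multiplied by
  \<open>yy\<close> and \<open>uu\<close> until Hess f, \<open>dw\<close> and \<open>B\<close> occur
  only in the product forms that are known. \<open>dense_eq\<close> then reaches the critical
  points.\<close>

lemma hessian_f0: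
  assumes x: "x \<in> D" shows "hessian D G f0 x = f0 x *\<^sub>R (BB x - r *\<^sub>R G x)"
proof -
  have "hessian D G f0 x $ j $ i - f0 x * (BB x $ j $ i - r * G x $ j $ i) = 0" for i j
  proof (rule dense_eq[OF _ _ x])
    show "smooth_on D (\<lambda>x. hessian D G f0 x $ j $ i - f0 x * (BB x $ j $ i - r * G x $ j $ i))"
      by (intro smooth_intros smooth_hessian smooth_f0 smmD[OF smm_BB])
    fix y assume y: "y \<in> D" and u: "uu y \<noteq> 0"
    let ?F = "\<lambda>i. pd D i f y" and ?W = "\<lambda>i. pd D i ww y" and ?q = "r - ww y / 2"
    have y2: "yy y * yy y = uu y * PP y" using uu_PP[OF y] by (simp add: power2_eq_square)
    then have yn: "yy y \<noteq> 0" using u PP_pos[OF y] by auto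
    have s: "smooth_on D (\<lambda>x. r - ww x / 2)" by (intro smooth_intros smooth_ww) simp
    have s': "smooth_on D (\<lambda>x. - f0 x * (r - ww x / 2))" by (intro smooth_intros smooth_f0 s)
    have q: "pd D j (\<lambda>x. r - ww x / 2) y = - ?W j / 2"
    proof -
      have h: "pd D j (\<lambda>x. ww x / 2) y = ?W j / 2" "smooth_on D (\<lambda>x. ww x / 2)"
        using pd_cmult[OF smooth_ww hs_open y, of j "1/2"] smooth_ww by (auto intro!: smooth_intros)
      show ?thesis using pd_diff[OF smooth_on_const h(2) hs_open y, of j r] h(1) hs_open y by simp
    qed
    have "pd D j (\<lambda>x. yy x * pd D i f0 x) y = pd D j (\<lambda>x. - f0 x * (r - ww x / 2) * pd D i f x) y"
      by (rule pd_cong[OF pd_f0 y])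
    then have d: "yy y * pd D j (pd D i f0) y + pd D j yy y * pd D i f0 y
      = - f0 y * ?q * pd D j (pd D i f) y + (- f0 y * (- ?W j / 2) - pd D j f0 y * ?q) * ?F i"
      using pd_mult[OF smooth_yy smooth_on_pd[OF smooth_f0 hs_open] hs_open y, of j i]
        pd_mult[OF s' smooth_on_pd[OF smooth_f hs_open] hs_open y, of j i]
        pd_mult[OF smooth_on_minus[OF smooth_f0] s hs_open y, of j] pd_minus[OF smooth_f0 hs_open y, of j] q
      by simp
    have c: "yy y * (\<Sum>k\<in>UNIV. christoffel D G k j i y * pd D k f0 y) = - f0 y * ?q * (\<Sum>k\<in>UNIV. christoffel D G k j i y * ?F k)"
    proof -
      have "yy y * (christoffel D G k j i y * pd D k f0 y) = - f0 y * ?q * (christoffel D G k j i y * ?F k)" for k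
        using pd_f0[OF y, of k] by (simp add: mult.left_commute[of "yy y"] mult_ac)
      then show ?thesis by (simp only: sum_distrib_left)
    qed
    have h: "yy y * hessian D G f0 y $ j $ i
      = - f0 y * ?q * hessian D G f y $ j $ i + f0 y * ?W j / 2 * ?F i - pd D j f0 y * ?q * ?F i - pd D j yy y * pd D i f0 y"
      using c d by (simp add: hessian_def algebra_simps)
    have "yy y * yy y * hessian D G f0 y $ j $ i
      = - yy y * f0 y * ?q * hessian D G f y $ j $ i + yy y * f0 y * ?W j / 2 * ?F i
        - (yy y * pd D j f0 y) * ?q * ?F i - pd D j yy y * (yy y * pd D i f0 y)"
      using arg_cong[OF h, of "\<lambda>t. yy y * t"] by (simp add: algebra_simps)
    also have "\<dots> = - yy y * f0 y * ?q * hessian D G f y $ j $ i + f0 y / 2 * (f y * ?q + yy y) * ?W j * ?F i"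
      unfolding pd_f0[OF y] pd_yy[OF y] by (simp add: field_simps)
    finally have h2: "yy y * yy y * hessian D G f0 y $ j $ i
      = - yy y * f0 y * ?q * hessian D G f y $ j $ i + f0 y / 2 * (f y * ?q + yy y) * ?W j * ?F i" .
    have "uu y * (yy y * yy y * hessian D G f0 y $ j $ i)
      = - yy y * f0 y * ?q * (uu y * hessian D G f y $ j $ i) + f0 y / 2 * (f y * ?q + yy y) * (uu y * ?W j) * ?F i"
      unfolding h2 by (simp add: algebra_simps)
    also have "\<dots> = yy y * yy y * (f0 y * (uu y * BB y $ j $ i - uu y * (r * G y $ j $ i)))"
      unfolding hessian_uu[OF y] pd_ww[OF y] BB_uu[OF y] by (simp add: algebra_simps)
    finally have "(yy y * yy y * uu y) * (hessian D G f0 y $ j $ i - f0 y * (BB y $ j $ i - r * G y $ j $ i)) = 0"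
      by (simp add: algebra_simps)
    then show "hessian D G f0 y $ j $ i - f0 y * (BB y $ j $ i - r * G y $ j $ i) = 0"
      using yn u by simp
  qed
  then show ?thesis by (simp add: vec_eq_iff)
qed

end

section \<open>Restriction to smaller patches\<close>

text \<open>Both sets are relatively open in the half-space, so the two filters at \<open>x\<close>
  coincide; hence the equation holds for arbitrary \<open>u\<close>.\<close>

lemma pd_restrict:
  assumes "hs_open D" "hs_open W" "W \<subseteq> D" "x \<in> W"
  shows "pd W i u x = pd D i u x"
proof -
  obtain U where U: "open U" "W = half_space \<inter> U" using assms(2) hs_open_iff by blast
  have "D \<subseteq> half_space" using assms(1) by (auto simp: hs_open_iff)
  then have "at x within W = at x within D"
    using U assms(3,4) by (intro at_within_nhd[of x U]) auto
  then show ?thesis by (simp add: pd_def)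
qed

context riem_patch begin

context
  fixes W
  assumes W: "hs_open W" "W \<subseteq> D"
begin

lemma pd_W: "x \<in> W \<Longrightarrow> pd W i u x = pd D i u x"
  by (rule pd_restrict[OF hs_open W])

lemma christoffel_W: "x \<in> W \<Longrightarrow> christoffel W G k i j x = christoffel D G k i j x"
  by (simp add: christoffel_def pd_W)

lemma riem_W: "x \<in> W \<Longrightarrow> riem W G l k i j x = riem D G l k i j x"
proof -
  assume x: "x \<in> W"
  have "pd W i (christoffel W G l j k) x = pd D i (christoffel D G l j k) x" for i j k
    using pd_cong[of W "christoffel W G l j k" "christoffel D G l j k" x i] christoffel_W x pd_W by simp
  then show ?thesis by (simp add: riem_def christoffel_W x)
qed

lemma ricci_W: "x \<in> W \<Longrightarrow> ricci W G x = ricci D G x"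
  by (simp add: ricci_def riem_W)

lemma scalar_curvature_W: "x \<in> W \<Longrightarrow> scalar_curvature W G x = scalar_curvature D G x"
  by (simp add: scalar_curvature_def ricci_W)

lemma hessian_W: "x \<in> W \<Longrightarrow> hessian W G u x = hessian D G u x"
proof -
  assume x: "x \<in> W"
  have "pd W i (pd W j u) x = pd D i (pd D j u) x" for i j
    using pd_cong[of W "pd W j u" "pd D j u" x i] x pd_W by simp
  then show ?thesis by (simp add: hessian_def christoffel_W x pd_W)
qed

lemma laplacian_W: "x \<in> W \<Longrightarrow> laplacian W G u x = laplacian D G u x"
  by (simp add: laplacian_def hessian_W)

lemma div_riem_W: "x \<in> W \<Longrightarrow> div_riem W G k i j x = div_riem D G k i j x"
proof -
  assume x: "x \<in> W"
  have "pd W l (riem W G l k i j) x = pd D l (riem D G l k i j) x" for l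
    using pd_cong[of W "riem W G l k i j" "riem D G l k i j" x l] riem_W x pd_W by simp
  then show ?thesis by (simp add: div_riem_def christoffel_W riem_W x)
qed

lemma riem_patch_W: "riem_patch W G"
  by unfold_locales (use W smooth_on_subset[OF smooth_G] transpose_G pos_G in auto)

end

end

lemma (in fluid_patch) fluid_patch_W:
  assumes "hs_open W" "W \<subseteq> D" shows "fluid_patch W G f \<rho> r"
proof -
  interpret W: riem_patch W G by (rule riem_patch_W[OF assms])
  show ?thesis
    by unfold_locales
      (use assms smooth_on_subset[OF smooth_f] smooth_on_subset[OF smooth_rho] f_pos field_eq lap_eq scal_eq harmonic in
        \<open>auto simp: ricci_W[OF assms] hessian_W[OF assms] laplacian_W[OF assms] scalar_curvature_W[OF assms] div_riem_W[OF assms]\<close>)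
qed

section \<open>Surfaces\<close>

lemma frame2_exists:
  fixes A :: "real^2^2"
  assumes pos: "\<And>v. v \<noteq> 0 \<Longrightarrow> ip A v v > 0" and sym: "transpose A = A"
  shows "\<exists>e. frame A e"
proof -
  have nrm: "\<exists>c. ip A (c *\<^sub>R v) (c *\<^sub>R v) = 1" if "v \<noteq> 0" for v
    using pos[OF that] by (intro exI[of _ "1 / sqrt (ip A v v)"]) (simp add: ip_simps power2_eq_square[symmetric] divide_simps)
  have "axis 1 1 \<noteq> (0 :: real^2)" by (simp add: axis_eq_0_iff)
  then obtain b where b: "ip A (b *\<^sub>R axis 1 1) (b *\<^sub>R axis 1 1) = 1" using nrm by blast
  define n where "n = b *\<^sub>R (axis 1 1 :: real^2)"
  have "dim {A *v n} \<le> card {A *v n}" by (rule dim_le_card') simp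
  then have "dim {A *v n} < DIM(real^2)" by simp
  then obtain v where "v \<noteq> 0" "\<And>y. y \<in> span {A *v n} \<Longrightarrow> orthogonal v y"
    by (rule orthogonal_to_subspace_exists) blast
  then have v: "v \<noteq> 0" "v \<bullet> (A *v n) = 0"
    by (simp_all add: orthogonal_def span_base)
  obtain c where c: "ip A (c *\<^sub>R v) (c *\<^sub>R v) = 1" using nrm[OF v(1)] by blast
  define e2 where "e2 = c *\<^sub>R v"
  have o: "ip A e2 n = 0" using v(2) by (auto simp: e2_def ip_def)
  then have o': "ip A n e2 = 0" using ip_commute[OF sym] by auto
  have "frame A (\<lambda>a. if a = 1 then n else e2)"
    unfolding frame_def forall_2 using o o' b c by (simp add: n_def[symmetric] e2_def[symmetric])
  then show ?thesis by blast
qed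

locale surface_patch = iso_map D G W \<Phi> GW
  for D :: "(real^3) set" and G and W :: "(real^2) set" and \<Phi> and GW
begin

definition push :: "real^2 \<Rightarrow> real^2 \<Rightarrow> real^3" where
  "push x v = (\<Sum>i\<in>UNIV. v $ i *\<^sub>R tang i x)"

text \<open>The scalar second fundamental form in the direction \<open>n\<close>. Using
  \<open>cd\<close> in place of \<open>Pi\<close> makes no difference for normal \<open>n\<close>,
  because the two differ by a tangential vector.\<close>

definition Aff :: "real^2 \<Rightarrow> real^3 \<Rightarrow> real^2^2" where
  "Aff x n = (\<chi> a b. ip (G (\<Phi> x)) (cd a (tang b) x) n)"

lemma ip_push: "ip M (push x v) (push x w) = ip (\<chi> a b. ip M (tang a x) (tang b x)) v w"
  unfolding push_def ip_sum_left ip_sum_right ip_scaleR_left ip_scaleR_right ip_expand[of "vec_lambda _"] sum_distrib_left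
  by (subst sum.swap) (simp add: mult_ac)

lemma Aff_sym: "x \<in> W \<Longrightarrow> Aff x n $ a $ b = Aff x n $ b $ a"
  by (simp add: Aff_def cd_tang_sym[of x a b])

lemma push_frame:
  assumes x: "x \<in> W" and n: "ip (G (\<Phi> x)) n n = 1" "\<And>a. ip (G (\<Phi> x)) n (tang a x) = 0"
    and e: "frame (GW x) e"
  shows "frame (G (\<Phi> x)) (\<lambda>a. if a = 1 then n else if a = 2 then push x (e 1) else push x (e 2))"
proof -
  have "GW x = (\<chi> a b. ip (G (\<Phi> x)) (tang a x) (tang b x))"
    by (simp add: vec_eq_iff iso[OF x])
  then have p: "ip (G (\<Phi> x)) (push x v) (push x w) = ip (GW x) v w" for v w
    by (simp add: ip_push)
  have q: "ip (G (\<Phi> x)) n (push x v) = 0" "ip (G (\<Phi> x)) (push x v) n = 0" for v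
    using n(2) ipG_commute[OF x, of n] by (simp_all add: push_def ip_sum_right ip_sum_left ip_simps)
  show ?thesis
    unfolding frame_def forall_3 by (simp add: p q n frameD[OF e])
qed

lemma Pi_normal:
  assumes x: "x \<in> W" and n: "ip (G (\<Phi> x)) n n = 1" "\<And>a. ip (G (\<Phi> x)) n (tang a x) = 0"
  shows "Pi a b x = Aff x n $ a $ b *\<^sub>R n"
proof -
  obtain e where e: "frame (GW x) e" using frame2_exists[OF Wp.pos_G[OF x] Wp.transpose_G[OF x]] by blast
  let ?e = "\<lambda>a :: 3. if a = 1 then n else if a = 2 then push x (e 1) else push x (e 2)"
  have z: "ip (G (\<Phi> x)) (Pi a b x) (push x v) = 0" for v
    by (simp add: push_def ip_sum_right ip_simps Pi_orth[OF x])
  have "Pi a b x = (\<Sum>c\<in>UNIV. ip (G (\<Phi> x)) (Pi a b x) (?e c) *\<^sub>R ?e c)"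
    by (rule frame_expand[OF push_frame[OF x n e] transpose_G[OF map_in[OF x]]])
  also have "\<dots> = ip (G (\<Phi> x)) (Pi a b x) n *\<^sub>R n"
    by (simp add: sum_3 z)
  also have "ip (G (\<Phi> x)) (Pi a b x) n = Aff x n $ a $ b"
    using n(2) ipG_commute[OF x, of n]
    by (simp add: Pi_def Aff_def ip_simps ip_sum_left)
  finally show ?thesis .
qed

lemma trace_surface:
  assumes x: "x \<in> W" and n: "ip (G (\<Phi> x)) n n = 1" "\<And>a. ip (G (\<Phi> x)) n (tang a x) = 0"
  shows "(\<Sum>a\<in>UNIV. \<Sum>b\<in>UNIV. matrix_inv (GW x) $ a $ b * ip M (tang a x) (tang b x))
    = (\<Sum>i\<in>UNIV. \<Sum>j\<in>UNIV. matrix_inv (G (\<Phi> x)) $ i $ j * M $ i $ j) - ip M n n"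
proof -
  obtain e where e: "frame (GW x) e" using frame2_exists[OF Wp.pos_G[OF x] Wp.transpose_G[OF x]] by blast
  have "(\<Sum>i\<in>UNIV. \<Sum>j\<in>UNIV. matrix_inv (G (\<Phi> x)) $ i $ j * M $ i $ j)
    = ip M n n + ip M (push x (e 1)) (push x (e 1)) + ip M (push x (e 2)) (push x (e 2))"
    unfolding frame_contraction[OF push_frame[OF x n e] transpose_G[OF map_in[OF x]]] by (simp add: sum_3)
  moreover have "(\<Sum>a\<in>UNIV. \<Sum>b\<in>UNIV. matrix_inv (GW x) $ a $ b * (\<chi> a b. ip M (tang a x) (tang b x)) $ a $ b)
    = ip M (push x (e 1)) (push x (e 1)) + ip M (push x (e 2)) (push x (e 2))"
    unfolding frame_contraction[OF e Wp.transpose_G[OF x]] by (simp add: sum_2 ip_push)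
  ultimately show ?thesis by simp
qed

text \<open>The intrinsic Hessian of the restriction differs from the ambient one by
  \<open>du\<close> applied to the second fundamental form, whose trace vanishes by minimality. What
  remains is the ambient trace without its normal part.\<close>

lemma laplacian_surface:
  assumes x: "x \<in> W" and n: "ip (G (\<Phi> x)) n n = 1" "\<And>a. ip (G (\<Phi> x)) n (tang a x) = 0"
    and minimal: "(\<Sum>a\<in>UNIV. \<Sum>b\<in>UNIV. matrix_inv (GW x) $ a $ b * Aff x n $ a $ b) = 0"
    and u: "smooth_on D u"
  shows "laplacian W GW (\<lambda>y. u (\<Phi> y)) x = laplacian D G u (\<Phi> x) - ip (hessian D G u (\<Phi> x)) n n"
proof -
  have "(\<Sum>k\<in>UNIV. pd D k u (\<Phi> x) * Pi a b x $ k) = (dif u (\<Phi> x) \<bullet> n) * Aff x n $ a $ b" for a b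
    by (simp add: Pi_normal[OF x n] dif_def inner_vec_def sum_distrib_right sum_distrib_left mult_ac)
  then have "laplacian W GW (\<lambda>y. u (\<Phi> y)) x
    = (\<Sum>a\<in>UNIV. \<Sum>b\<in>UNIV. matrix_inv (GW x) $ a $ b * ip (hessian D G u (\<Phi> x)) (tang a x) (tang b x))
      + (dif u (\<Phi> x) \<bullet> n) * (\<Sum>a\<in>UNIV. \<Sum>b\<in>UNIV. matrix_inv (GW x) $ a $ b * Aff x n $ a $ b)"
    by (simp add: laplacian_def[of W] hessian_comp[OF u x] distrib_left sum.distrib sum_distrib_left mult_ac)
  then show ?thesis
    using trace_surface[OF x n] minimal by (simp add: laplacian_def)
qed

end

text \<open>By the Gauss equation the curvature is the ambient sectional curvature of the tangent
  plane plus the determinant of the second fundamental form. The former is \<open>3 * r\<close>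
  minus the normal Ricci curvature in dimension three; for a tracefree form the latter is
  \<open>- N2 / 2\<close>.\<close>

lemma (in fluid_patch) gauss_surface:
  assumes "surface_patch D G W \<Phi> GW" and x: "x \<in> W"
    and n: "ip (G (\<Phi> x)) n n = 1" "\<And>a. ip (G (\<Phi> x)) n (map_patch.tang W \<Phi> a x) = 0"
  defines "A \<equiv> surface_patch.Aff D G W \<Phi> x n" and "H \<equiv> matrix_inv (GW x)"
  defines "N2 \<equiv> (\<Sum>a\<in>UNIV. \<Sum>b\<in>UNIV. \<Sum>a'\<in>UNIV. \<Sum>b'\<in>UNIV. H $ a $ a' * H $ b $ b' * A $ a $ b * A $ a' $ b')"
  assumes minimal: "(\<Sum>a\<in>UNIV. \<Sum>b\<in>UNIV. H $ a $ b * A $ a $ b) = 0"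
  shows "gauss_curvature W GW x = 3 * r - ip (ricci D G (\<Phi> x)) n n - N2 / 2" and "N2 \<ge> 0"
proof -
  interpret surface_patch D G W \<Phi> GW by fact
  let ?p = "\<Phi> x"
  have p: "?p \<in> D" by (rule map_in[OF x])
  obtain e where e: "frame (GW x) e" using frame2_exists[OF Wp.pos_G[OF x] Wp.transpose_G[OF x]] by blast
  let ?E = "\<lambda>a :: 3. if a = 1 then n else if a = 2 then push x (e 1) else push x (e 2)"
  have E: "frame (G ?p) ?E" by (rule push_frame[OF x n e])
  define a b c where "a = ip A (e 1) (e 1)" and "b = ip A (e 1) (e 2)" and "c = ip A (e 2) (e 2)"
  have As: "transpose A = A" using Aff_sym[OF x] by (simp add: A_def transpose_def vec_eq_iff)
  have b': "ip A (e 2) (e 1) = b" unfolding b_def by (rule ip_commute[OF As])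
  have H: "H $ i $ j = e 1 $ i * e 1 $ j + e 2 $ i * e 2 $ j" for i j
    by (simp add: H_def frame_inv[OF e Wp.transpose_G[OF x]] matrix_mult_nth frame_matrix_def transpose_def sum_2)
  have "N2 = a\<^sup>2 + b\<^sup>2 + (ip A (e 2) (e 1))\<^sup>2 + c\<^sup>2"
    unfolding N2_def H a_def b_def c_def ip_expand sum_2 by (simp add: power2_eq_square algebra_simps)
  then have N2: "N2 = a\<^sup>2 + 2 * b\<^sup>2 + c\<^sup>2" by (simp add: b')
  then show "N2 \<ge> 0" by simp
  have "a + c = (\<Sum>i\<in>UNIV. \<Sum>j\<in>UNIV. H $ i $ j * A $ i $ j)"
    unfolding H_def frame_contraction[OF e Wp.transpose_G[OF x]] by (simp add: sum_2 a_def c_def)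
  then have c: "c = - a" using minimal by simp
  define q where "q i j = ip (GW x) (axis i 1) (e j)" for i j
  have ax: "axis i 1 = q i 1 *\<^sub>R e 1 + q i 2 *\<^sub>R e 2" for i
    using frame_expand[OF e Wp.transpose_G[OF x], of "axis i 1"] by (simp add: sum_2 q_def)
  have psh: "push x (axis i 1) = tang i x" for i
    by (simp add: push_def vec_eq_iff sum_axis)
  have pl: "push x (s *\<^sub>R v + t *\<^sub>R w) = s *\<^sub>R push x v + t *\<^sub>R push x w" for s t v w
    by (simp add: push_def scaleR_add_left sum.distrib scaleR_sum_right)
  have tg: "tang i x = q i 1 *\<^sub>R push x (e 1) + q i 2 *\<^sub>R push x (e 2)" for i
    unfolding psh[symmetric, of i] by (subst ax[of i]) (rule pl)
  \<comment> \<open>The determinant of the change from coordinate vectors to the orthonormal frame.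
    Numerator and denominator of the Gauss curvature both carry the factor
    \<open>\<delta>\<^sup>2\<close>.\<close>
  define \<delta> where "\<delta> = q 1 1 * q 2 2 - q 1 2 * q 2 1"
  have "GW x $ i $ j = q i 1 * q j 1 + q i 2 * q j 2" for i j
    unfolding ip_axis[symmetric, of "GW x"]
    by (subst ax[of i], subst ax[of j]) (simp add: ip_simps frameD[OF e])
  then have detG: "det (GW x) = \<delta>\<^sup>2"
    by (simp add: det_2 \<delta>_def power2_eq_square algebra_simps)
  have "A $ i $ j = q i 1 * q j 1 * a + (q i 1 * q j 2 + q i 2 * q j 1) * b + q i 2 * q j 2 * c" for i j
    unfolding ip_axis[symmetric, of A]
    by (subst ax[of i], subst ax[of j]) (simp add: ip_simps a_def b_def[symmetric] c_def b' algebra_simps)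
  then have detA: "A $ 1 $ 1 * A $ 2 $ 2 - A $ 1 $ 2 * A $ 2 $ 1 = \<delta>\<^sup>2 * (a * c - b\<^sup>2)"
    by (simp add: \<delta>_def power2_eq_square algebra_simps)
  let ?K = "ip (G ?p) (Rop ?p (push x (e 1)) (push x (e 2)) *v push x (e 2)) (push x (e 1))"
  have K: "?K = 3 * r - ip (ricci D G ?p) n n"
    using ricci_flip_frame(1)[OF p E] by simp
  have "Rop ?p (tang 1 x) (tang 2 x) = \<delta> *\<^sub>R Rop ?p (push x (e 1)) (push x (e 2))"
    unfolding tg by (simp add: Rop_linear Rop_refl Rop_flip[of _ "push x (e 1)" "push x (e 2)"] \<delta>_def
        scaleR_diff_left scaleR_add_right mult_ac)
  then have "ip (G ?p) (Rop ?p (tang 1 x) (tang 2 x) *v tang 2 x) (tang 1 x)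
     = \<delta> * ip (G ?p) (Rop ?p (push x (e 1)) (push x (e 2)) *v tang 2 x) (tang 1 x)"
    by (simp add: scaleR_matrix_vector_assoc[symmetric] ip_simps)
  also have "\<dots> = \<delta>\<^sup>2 * ?K"
    using Rop_skew[OF p, of "push x (e 1)" "push x (e 2)" "push x (e 1)" "push x (e 2)"]
    unfolding tg by (simp add: matrix_vector_right_distrib matrix_vector_mult_scaleR ip_simps Rop_skew_zero[OF p]
        \<delta>_def power2_eq_square algebra_simps)
  finally have 1: "ip (G ?p) (Rop ?p (tang 1 x) (tang 2 x) *v tang 2 x) (tang 1 x) = \<delta>\<^sup>2 * ?K" .
  have 2: "ip (GW x) (Wp.Rop x (axis 1 1) (axis 2 1) *v axis 2 1) (axis 1 1) = (\<Sum>l\<in>UNIV. GW x $ 1 $ l * riem W GW l 2 1 2 x)"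
    by (subst ip_commute[OF Wp.transpose_G[OF x]])
      (simp add: ip_axis_left matrix_vector_mult_basis column_def Wp.Rop_axis)
  have "\<delta>\<^sup>2 * ?K = (\<Sum>l\<in>UNIV. GW x $ 1 $ l * riem W GW l 2 1 2 x)
      - (A $ 1 $ 1 * A $ 2 $ 2 - A $ 1 $ 2 * A $ 2 $ 1)"
    using gauss_equation[OF x, of 1 2 2 1] n(1)
    unfolding 1 2 Pi_normal[OF x n] by (simp add: ip_simps A_def)
  then have "(\<Sum>l\<in>UNIV. GW x $ 1 $ l * riem W GW l 2 1 2 x) = \<delta>\<^sup>2 * (?K + (a * c - b\<^sup>2))"
    unfolding detA by (simp add: algebra_simps)
  moreover have "\<delta>\<^sup>2 \<noteq> 0" using Wp.det_G[OF x] detG by simp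
  ultimately have "gauss_curvature W GW x = ?K + (a * c - b\<^sup>2)"
    by (simp add: gauss_curvature_def detG)
  then show "gauss_curvature W GW x = 3 * r - ip (ricci D G ?p) n n - N2 / 2"
    unfolding K N2 c by (simp add: power2_eq_square field_simps)
qed

section \<open>The second fundamental form of a level set\<close>

lemma exp_half_ln: assumes "t > 0" shows "exp ((1 / 2) * ln t) = sqrt t"
proof -
  have "(1 / 2) * ln t = ln (sqrt t)" using ln_sqrt[OF less_imp_le[OF assms]] by simp
  then show ?thesis using assms by simp
qed

text \<open>Differentiating the normalizing factor of the level normal only contributes a multiple
  of \<open>grad f\<close>, which is orthogonal to \<open>n\<close>. The remaining term is Hess f,
  divided by the gradient norm with the sign of the outward normal.\<close>

lemma (in riem_patch) level_sff:
  assumes f: "smooth_on D f" and x: "x \<in> D" and n: "dif f x \<bullet> n = 0" and u: "ip (G x) (gradient D G f x) (gradient D G f x) \<noteq> 0"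
  shows "ip (G x) (cov_deriv D G (level_normal D G f) n x) n = - ip (hessian D G f x) n n / gradient_norm D G f x"
proof -
  let ?g = "gradient D G f" and ?uu = "\<lambda>y. ip (G y) (gradient D G f y) (gradient D G f y)"
  have su: "smooth_on D ?uu" by (intro smooth_on_ip smm_G smv_gradient f)
  define W where "W = {y \<in> D. ?uu y \<in> {0<..}}"
  have pos: "?uu y \<ge> 0" if "y \<in> D" for y
    using pos_G[OF that, of "?g y"] by (cases "?g y = 0") (auto simp: ip_simps)
  have xW: "x \<in> W" using x u pos[OF x] by (simp add: W_def)
  have W: "hs_open W" "W \<subseteq> D"
  proof -
    have "openin (top_of_set D) (D \<inter> ?uu -` {0<..})"
      using continuous_openin_preimage_gen[OF smooth_on_imp_continuous_on[OF su]] by simp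
    moreover have "W = D \<inter> ?uu -` {0<..}" by (auto simp: W_def)
    ultimately show "hs_open W" using hs_open_openin[OF hs_open] by simp
    show "W \<subseteq> D" by (auto simp: W_def)
  qed
  \<comment> \<open>Minus the inverse gradient norm, written as an exponential so that
    \<open>smooth_on_exp\<close> and \<open>smooth_on_ln\<close> give its smoothness where the
    gradient is nonzero.\<close>
  define \<psi> where "\<psi> y = - exp (- ((1 / 2) * ln (?uu y)))" for y
  have s\<psi>: "smooth_on W \<psi>"
    unfolding \<psi>_def by (intro smooth_intros smooth_on_subset[OF su W(2)]) (simp add: W_def)
  have \<psi>: "\<psi> y = - 1 / gradient_norm D G f y" if "y \<in> W" for y
  proof -
    have "?uu y > 0" using that unfolding W_def by blast
    from exp_half_ln[OF this] have e: "exp ((1 / 2) * ln (?uu y)) = gradient_norm D G f y"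
      unfolding gradient_norm_def .
    show ?thesis unfolding \<psi>_def exp_minus e by (simp add: divide_inverse)
  qed
  interpret I: map_patch D G D "\<lambda>x. x" by (rule map_patch_id)
  have pdX: "pd D j (\<lambda>y. level_normal D G f y $ k) x = \<psi> x * pd D j (\<lambda>y. ?g y $ k) x + pd W j \<psi> x * ?g x $ k" for j k
  proof -
    have sg: "smooth_on W (\<lambda>y. ?g y $ k)"
      by (rule smooth_on_subset[OF smvD[OF smv_gradient[OF f]] W(2)])
    have "pd D j (\<lambda>y. level_normal D G f y $ k) x = pd W j (\<lambda>y. level_normal D G f y $ k) x"
      by (rule pd_restrict[OF hs_open W xW, symmetric])
    also have "\<dots> = pd W j (\<lambda>y. \<psi> y * ?g y $ k) x"
      by (rule pd_cong[OF _ xW]) (simp add: level_normal_def \<psi> divide_inverse)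
    also have "\<dots> = \<psi> x * pd W j (\<lambda>y. ?g y $ k) x + pd W j \<psi> x * ?g x $ k"
      by (rule pd_mult[OF s\<psi> sg W(1) xW])
    finally show ?thesis by (simp add: pd_restrict[OF hs_open W xW])
  qed
  have lnx: "level_normal D G f x = \<psi> x *\<^sub>R ?g x"
    by (simp add: level_normal_def \<psi>[OF xW] divide_inverse)
  have "cov_deriv D G (level_normal D G f) n x
    = (\<Sum>j\<in>UNIV. n $ j *\<^sub>R (\<psi> x *\<^sub>R I.cd j ?g x + pd W j \<psi> x *\<^sub>R ?g x))"
    by (simp add: vec_eq_iff cov_deriv_def pdX lnx I.cd_def tang_id x Gam_def matrix_vector_mult_def pdv_def sum_axis
        sum_distrib_left algebra_simps)
  then have 1: "ip (G x) (cov_deriv D G (level_normal D G f) n x) n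
    = (\<Sum>j\<in>UNIV. n $ j * (\<psi> x * ip (G x) (I.cd j ?g x) n))"
    by (simp add: ip_sum_left ip_simps ip_gradient[OF x] n)
  have 2: "ip (G x) (I.cd j ?g x) n = (\<Sum>k\<in>UNIV. hessian D G f x $ j $ k * n $ k)" for j
  proof -
    have "linear (\<lambda>v. ip (G x) (I.cd j ?g x) v)" by (rule linearI) (simp_all add: ip_simps)
    from linear_axis_sum[OF this, of n] show ?thesis
      by (simp add: hessian_cd[OF f x] mult.commute)
  qed
  have "(\<Sum>j\<in>UNIV. n $ j * (\<psi> x * (\<Sum>k\<in>UNIV. hessian D G f x $ j $ k * n $ k))) = \<psi> x * ip (hessian D G f x) n n"
    by (simp add: ip_expand sum_distrib_left mult_ac)
  then show ?thesis unfolding 1 2 by (simp add: \<psi>[OF xW])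
qed

section \<open>Charts\<close>

lemma hs_open_patch: "is_chart T c \<Longrightarrow> hs_open (patch c)"
  by (simp add: is_chart_def hs_open_def)

context
  fixes T and c :: "('a, 'n::{finite,one}) chart"
  assumes c: "is_chart T c"
begin

lemma chart_subset: "fst c \<subseteq> topspace T"
  using c by (simp add: is_chart_def openin_subset)

lemma chart_inj: "inj_on (snd c) (fst c)"
proof -
  have "topspace (subtopology T (fst c)) = fst c" using chart_subset by auto
  then show ?thesis
    using c homeomorphic_imp_injective_map[of "subtopology T (fst c)" "top_of_set (patch c)" "snd c"]
    by (simp add: is_chart_def)
qed

lemma chart_inv_eq: "p \<in> fst c \<Longrightarrow> chart_inv c (snd c p) = p"
  by (rule inv_into_f_f[OF chart_inj])

lemma chart_inv_mem: "x \<in> patch c \<Longrightarrow> chart_inv c x \<in> fst c" "x \<in> patch c \<Longrightarrow> snd c (chart_inv c x) = x"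
  by (auto intro: inv_into_into f_inv_into_f)

lemma continuous_map_chart: "continuous_map (subtopology T (fst c)) (top_of_set (patch c)) (snd c)"
  using c by (simp add: is_chart_def homeomorphic_imp_continuous_map)

lemma chart_image_open:
  assumes "openin T U" shows "hs_open (snd c ` (fst c \<inter> U))"
proof -
  have "openin (subtopology T (fst c)) (fst c \<inter> U)"
    using assms by (metis inf_commute openin_subtopology_Int)
  then have "openin (top_of_set (patch c)) (snd c ` (fst c \<inter> U))"
    using c unfolding is_chart_def by (metis homeomorphic_map_openness openin_subset)
  then show ?thesis using hs_open_openin hs_open_patch[OF c] by blast
qed

lemma chart_preimage_open:
  assumes "openin (top_of_set (patch c)) V" shows "openin T {p \<in> fst c. snd c p \<in> V}"
proof -
  have "openin (subtopology T (fst c)) {p \<in> topspace (subtopology T (fst c)). snd c p \<in> V}"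
    using openin_continuous_map_preimage[OF continuous_map_chart assms] .
  moreover have e: "topspace (subtopology T (fst c)) = fst c" using chart_subset by auto
  moreover have "openin T (fst c)" using c by (simp add: is_chart_def)
  ultimately show ?thesis using openin_open_subtopology unfolding e by blast
qed

lemma continuous_map_chart_inv: "continuous_map (top_of_set (patch c)) T (chart_inv c)"
  unfolding continuous_map_def
proof (intro conjI allI impI)
  show "chart_inv c \<in> topspace (top_of_set (patch c)) \<rightarrow> topspace T"
    using chart_inv_mem chart_subset by auto
  fix U assume U: "openin T U"
  have "openin (subtopology T (fst c)) (fst c \<inter> U)"
    using U by (metis inf_commute openin_subtopology_Int)
  then have "openin (top_of_set (patch c)) (snd c ` (fst c \<inter> U))"
    using c unfolding is_chart_def by (metis homeomorphic_map_openness openin_subset)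
  moreover have "snd c ` (fst c \<inter> U) = {x \<in> topspace (top_of_set (patch c)). chart_inv c x \<in> U}"
    using chart_inv_eq chart_inv_mem by force
  ultimately show "openin (top_of_set (patch c)) {x \<in> topspace (top_of_set (patch c)). chart_inv c x \<in> U}"
    by simp
qed

end

lemma continuous_map_locally:
  assumes "\<And>p. p \<in> topspace X \<Longrightarrow> \<exists>U. openin X U \<and> p \<in> U \<and> continuous_map (subtopology X U) Y g"
  shows "continuous_map X Y g"
  unfolding continuous_map_def
proof (intro conjI allI impI)
  show "g \<in> topspace X \<rightarrow> topspace Y"
  proof
    fix p assume p: "p \<in> topspace X"
    then obtain U where U: "openin X U" "p \<in> U" "continuous_map (subtopology X U) Y g" using assms by blast
    then have "g \<in> topspace (subtopology X U) \<rightarrow> topspace Y" by (simp add: continuous_map_def)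
    then show "g p \<in> topspace Y" using U p by auto
  qed
  fix V assume V: "openin Y V"
  show "openin X {x \<in> topspace X. g x \<in> V}"
  proof (subst openin_subopen, intro ballI)
    fix p assume p: "p \<in> {x \<in> topspace X. g x \<in> V}"
    then obtain U where U: "openin X U" "p \<in> U" "continuous_map (subtopology X U) Y g" using assms by blast
    let ?O = "{q \<in> topspace (subtopology X U). g q \<in> V}"
    have "openin (subtopology X U) ?O" using openin_continuous_map_preimage[OF U(3) V] .
    then have "openin X ?O" using U(1) openin_open_subtopology by blast
    moreover have "p \<in> ?O" "?O \<subseteq> {x \<in> topspace X. g x \<in> V}" using U(2) p by auto
    ultimately show "\<exists>O'. openin X O' \<and> p \<in> O' \<and> O' \<subseteq> {x \<in> topspace X. g x \<in> V}" by blast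
  qed
qed

section \<open>Riemannian manifolds\<close>

locale riem_manifold =
  fixes M :: "('a, 'n::{finite,one}) riem_structure"
  assumes riem: "riemannian_manifold M"
begin

lemma chart: "c \<in> atlas M \<Longrightarrow> is_chart (mtop M) c"
  and charts_cover: "(\<Union>c\<in>atlas M. fst c) = topspace (mtop M)"
  and smooth_transition: "c \<in> atlas M \<Longrightarrow> d \<in> atlas M \<Longrightarrow> smooth_on (map_dom c d id) (map_rep c d id)"
  and metric_transition: "c \<in> atlas M \<Longrightarrow> d \<in> atlas M \<Longrightarrow> x \<in> map_dom c d id \<Longrightarrow>
    metric_in M c x = transpose (map_jac c d id x) ** metric_in M d (map_rep c d id x) ** map_jac c d id x"
  using riem unfolding riemannian_manifold_def by blast+

lemma chart_ex: "p \<in> topspace (mtop M) \<Longrightarrow> \<exists>c\<in>atlas M. p \<in> fst c"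
  using charts_cover by blast

lemma chart_at: "p \<in> topspace (mtop M) \<Longrightarrow> chart_at M p \<in> atlas M \<and> p \<in> fst (chart_at M p)"
  unfolding chart_at_def using chart_ex[of p] by (metis (mono_tags, lifting) someI_ex)

lemma riem_patch: "c \<in> atlas M \<Longrightarrow> riem_patch (patch c) (metric_in M c)"
  using riem hs_open_patch[OF chart] unfolding riemannian_manifold_def by unfold_locales auto

lemma continuous_map_in_chart:
  assumes "\<And>c. c \<in> atlas M \<Longrightarrow> continuous_on (patch c) (in_chart c g)"
  shows "continuous_map (mtop M) euclidean g"
proof (rule continuous_map_locally)
  fix p assume "p \<in> topspace (mtop M)"
  then obtain c where c: "c \<in> atlas M" "p \<in> fst c" using chart_ex by blast
  note ch = chart[OF c(1)]
  have "continuous_map (subtopology (mtop M) (fst c)) euclidean (in_chart c g \<circ> snd c)"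
    using continuous_map_compose[OF continuous_map_chart[OF ch], of euclidean "in_chart c g"] assms[OF c(1)] by simp
  then have "continuous_map (subtopology (mtop M) (fst c)) euclidean g"
    by (rule continuous_map_eq) (use chart_inv_eq[OF ch] in auto)
  then show "\<exists>U. openin (mtop M) U \<and> p \<in> U \<and> continuous_map (subtopology (mtop M) U) euclidean g"
    using ch c(2) by (auto simp: is_chart_def)
qed

end

lemma map_dom_iff:
  assumes "is_chart T c"
  shows "x \<in> map_dom c d F \<longleftrightarrow> x \<in> patch c \<and> F (chart_inv c x) \<in> fst d"
  using chart_inv_eq[OF assms] chart_inv_mem[OF assms] by (fastforce simp: map_dom_def)

lemma hs_open_map_dom:
  assumes "is_chart T c" "is_chart T' d" "continuous_map T T' F"
  shows "hs_open (map_dom c d F)"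
proof -
  have "openin T {p \<in> topspace T. F p \<in> fst d}"
    using assms(2,3) openin_continuous_map_preimage unfolding is_chart_def by fastforce
  note op = chart_image_open[OF assms(1) this]
  have "fst c \<inter> {p \<in> topspace T. F p \<in> fst d} = {p \<in> fst c. F p \<in> fst d}"
    using chart_subset[OF assms(1)] by blast
  from op[unfolded this] show ?thesis by (simp add: map_dom_def)
qed

lemma map_rep_mem:
  assumes "is_chart T c" "x \<in> map_dom c d F" shows "map_rep c d F x \<in> patch d"
  using assms by (simp add: map_dom_iff map_rep_def)

context riem_manifold begin

lemma hs_open_transition: "c \<in> atlas M \<Longrightarrow> d \<in> atlas M \<Longrightarrow> hs_open (map_dom c d id)"
  using hs_open_map_dom[OF chart chart continuous_map_id] by simp

text \<open>Coordinate changes become instances of the locale that also describes immersions, so the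
  formulas for derivatives and Hessians of compositions apply to them.\<close>

lemma iso_map_transition:
  assumes c: "c \<in> atlas M" and d: "d \<in> atlas M"
  shows "iso_map (patch d) (metric_in M d) (map_dom c d id) (map_rep c d id) (metric_in M c)"
proof -
  let ?W = "map_dom c d id" and ?\<Phi> = "map_rep c d id"
  interpret C: riem_patch "patch c" "metric_in M c" by (rule riem_patch[OF c])
  interpret D: riem_patch "patch d" "metric_in M d" by (rule riem_patch[OF d])
  have W: "hs_open ?W" "?W \<subseteq> patch c"
    using hs_open_transition[OF c d] by (simp_all add: map_dom_iff[OF chart[OF c]] subset_iff del: id_apply)
  interpret W: riem_patch ?W "metric_in M c" by (rule C.riem_patch_W[OF W])
  interpret P: map_patch "patch d" "metric_in M d" ?W ?\<Phi>
    by unfold_locales (use W smooth_transition[OF c d] map_rep_mem[OF chart[OF c], of _ d id] in auto)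
  show ?thesis
  proof unfold_locales
    fix x a b assume x: "x \<in> ?W"
    have J: "map_jac c d id x $ k $ a = P.tang a x $ k" for k a
      using jacobian_nth_pd[OF P.smooth_map W(1) x] by (simp add: map_jac_def P.tang_def pdv_def)
    show "metric_in M c x $ a $ b = ip (metric_in M d (?\<Phi> x)) (P.tang a x) (P.tang b x)"
      unfolding metric_transition[OF c d x]
      by (simp add: matrix_mult_nth transpose_def J ip_expand sum_distrib_right) (rule sum.swap)
  qed
qed

text \<open>At an interior coordinate point mapped into the boundary, the first component of the transition map
  would be minimal, so that its Jacobian would be singular.\<close>

lemma boundary_chart_independent:
  assumes c: "c \<in> atlas M" and d: "d \<in> atlas M" and p: "p \<in> fst c" "p \<in> fst d" and b: "snd d p $ 1 = 0"
  shows "snd c p $ 1 = 0"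
proof (rule ccontr)
  assume n: "snd c p $ 1 \<noteq> 0"
  let ?W = "map_dom c d id" and ?\<Phi> = "map_rep c d id"
  interpret I: iso_map "patch d" "metric_in M d" ?W ?\<Phi> "metric_in M c" by (rule iso_map_transition[OF c d])
  define x where "x = snd c p"
  have x: "x \<in> ?W" using p by (auto simp: x_def map_dom_def)
  obtain U where U: "open U" "?W = half_space \<inter> U" using I.hs_open_W hs_open_iff by blast
  have "x $ 1 > 0" using n x U(2) by (auto simp: x_def half_space_def)
  then have xi: "x \<in> U \<inter> {y. 0 < y $ 1}" using x U(2) by auto
  have op: "open (U \<inter> {y. 0 < y $ 1})"
    by (intro open_Int U(1) open_Collect_less continuous_intros)
  have "U \<inter> {y. 0 < y $ 1} \<subseteq> half_space \<inter> U" unfolding half_space_def by (blast intro: less_imp_le)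
  then have sub: "U \<inter> {y. 0 < y $ 1} \<subseteq> ?W" by (simp only: U(2))
  have at: "at x within ?W = at x"
    by (rule at_within_interior[OF subsetD[OF interior_maximal[OF sub op] xi]])
  have \<Phi>x: "?\<Phi> x $ 1 = 0" using b p chart_inv_eq[OF chart[OF c] p(1)] by (simp add: x_def map_rep_def)
  have pos: "?\<Phi> y $ 1 \<ge> 0" if "y \<in> ?W" for y
    using I.map_in[OF that] I.hs_open by (auto simp: hs_open_iff half_space_def)
  have "pd ?W i (\<lambda>y. ?\<Phi> y $ 1) x = 0" for i
  proof -
    have A: "((\<lambda>y. ?\<Phi> y $ 1) has_derivative (\<lambda>v. \<Sum>j\<in>UNIV. v $ j * pd ?W j (\<lambda>y. ?\<Phi> y $ 1) x)) (at (x + 0 *\<^sub>R axis i 1))"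
      unfolding scaleR_zero_left add_0_right by (rule has_derivative_pd[OF smooth_on_differentiable[OF smooth_on_nth[OF I.smooth_map] x], unfolded at])
    have B: "((\<lambda>t. x + t *\<^sub>R axis i 1) has_derivative (\<lambda>t. t *\<^sub>R axis i 1)) (at 0)"
      by (auto intro!: derivative_eq_intros)
    have "((\<lambda>t. ?\<Phi> (x + t *\<^sub>R axis i 1) $ 1) has_derivative
        (\<lambda>t. \<Sum>j\<in>UNIV. (t *\<^sub>R axis i 1) $ j * pd ?W j (\<lambda>y. ?\<Phi> y $ 1) x)) (at 0)"
      by (rule has_derivative_compose[OF B A])
    then have D: "((\<lambda>t. ?\<Phi> (x + t *\<^sub>R axis i 1) $ 1) has_real_derivative pd ?W i (\<lambda>y. ?\<Phi> y $ 1) x) (at 0)"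
      by (simp add: has_field_derivative_def mult.assoc sum_distrib_left[symmetric] sum_axis mult.commute[of _ "pd ?W i _ x"])
    obtain e where e: "e > 0" "ball x e \<subseteq> U \<inter> {y. 0 < y $ 1}" by (rule openE[OF op xi])
    show ?thesis
    proof (rule DERIV_local_min[OF D e(1)], intro allI impI)
      fix t :: real assume "\<bar>0 - t\<bar> < e"
      then have "x + t *\<^sub>R axis i 1 \<in> ball x e" by (simp add: dist_norm)
      then have "x + t *\<^sub>R axis i 1 \<in> ?W" using e(2) sub by blast
      then show "?\<Phi> (x + 0 *\<^sub>R axis i 1) $ 1 \<le> ?\<Phi> (x + t *\<^sub>R axis i 1) $ 1" using pos \<Phi>x by simp
    qed
  qed
  then have "I.tang i x $ 1 = 0" for i by (simp add: I.tang_def pdv_def)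
  moreover have "det (map_jac c d id x) \<noteq> 0"
    using I.Wp.det_G[OF x] metric_transition[OF c d x] by (auto simp: det_mul)
  moreover have "map_jac c d id x $ 1 $ i = I.tang i x $ 1" for i
    using jacobian_nth_pd[OF I.smooth_map I.hs_open_W x] by (simp add: map_jac_def I.tang_def pdv_def)
  ultimately have "row 1 (map_jac c d id x) = 0" "det (map_jac c d id x) \<noteq> 0"
    by (simp_all add: row_def vec_eq_iff)
  then show False using det_zero_row(1) by blast
qed

lemma mboundary_iff:
  assumes "c \<in> atlas M" "p \<in> fst c" shows "p \<in> mboundary M \<longleftrightarrow> snd c p $ 1 = 0"
  using assms boundary_chart_independent unfolding mboundary_def by blast

lemma mboundary_subset: "mboundary M \<subseteq> topspace (mtop M)"
  using chart_subset[OF chart] unfolding mboundary_def by blast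

lemma closedin_mboundary: "closedin (mtop M) (mboundary M)"
proof -
  have "openin (mtop M) (topspace (mtop M) - mboundary M)"
  proof (subst openin_subopen, intro ballI)
    fix p assume p: "p \<in> topspace (mtop M) - mboundary M"
    then obtain c where c: "c \<in> atlas M" "p \<in> fst c" using chart_ex by blast
    have "open {x :: real^'n::{finite,one}. x $ 1 \<noteq> 0}" by (intro open_Collect_neq continuous_intros)
    then have "openin (top_of_set (patch c)) (patch c \<inter> {x. x $ 1 \<noteq> 0})" by (rule openin_open_Int)
    note op = chart_preimage_open[OF chart[OF c(1)] this]
    let ?O = "{p \<in> fst c. snd c p \<in> patch c \<inter> {x. x $ 1 \<noteq> 0}}"
    have "p \<in> ?O" using p c mboundary_iff[OF c] by simp
    moreover have "?O \<subseteq> topspace (mtop M) - mboundary M"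
      using mboundary_iff[OF c(1)] chart_subset[OF chart[OF c(1)]] by fastforce
    ultimately show "\<exists>U. openin (mtop M) U \<and> p \<in> U \<and> U \<subseteq> topspace (mtop M) - mboundary M"
      using op by blast
  qed
  then show ?thesis using mboundary_subset by (simp add: closedin_def)
qed

end

section \<open>The boundary length measure\<close>

text \<open>Change of variables for nonnegative functions; the library version is for absolutely integrable functions,
  so the domain is exhausted by sets on which the integrand is.\<close>

lemma nn_integral_change_of_variables:
  fixes h k \<tau> :: "real \<Rightarrow> real"
  assumes T: "T \<in> sets borel" and S: "\<tau> ` T \<in> sets borel"
    and der: "\<And>t. t \<in> T \<Longrightarrow> (\<tau> has_field_derivative \<tau>' t) (at t within T)"
    and inj: "inj_on \<tau> T"
    and h: "h \<in> borel_measurable borel" "\<And>s. 0 \<le> h s"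
    and k: "k \<in> borel_measurable borel" "\<And>t. t \<in> T \<Longrightarrow> k t = \<bar>\<tau>' t\<bar> * h (\<tau> t)"
  shows "(\<integral>\<^sup>+s\<in>\<tau> ` T. ennreal (h s) \<partial>lborel) = (\<integral>\<^sup>+t\<in>T. ennreal (k t) \<partial>lborel)"
proof -
  have cont: "continuous_on T \<tau>"
    unfolding continuous_on_eq_continuous_within using der DERIV_continuous by blast
  have bounded_case: "(\<integral>\<^sup>+s\<in>\<tau> ` A. ennreal (h s) \<partial>lborel) = (\<integral>\<^sup>+t\<in>A. ennreal (k t) \<partial>lborel)"
    if A: "A \<subseteq> T" "A \<in> sets borel" "\<tau> ` A \<in> sets borel" and B: "\<And>s. s \<in> \<tau> ` A \<Longrightarrow> \<bar>s\<bar> \<le> n \<and> h s \<le> n" for A and n :: real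
  proof -
    have "integrable lborel (\<lambda>s. indicator (\<tau> ` A) s *\<^sub>R h s)"
    proof (rule integrableI_bounded_set[of "\<tau> ` A \<inter> {-n..n}" _ _ n])
      have "emeasure lborel (\<tau> ` A \<inter> {-n..n}) \<le> emeasure lborel {-n..n}" by (intro emeasure_mono) auto
      then show "emeasure lborel (\<tau> ` A \<inter> {-n..n}) < \<infinity>" by (auto simp: emeasure_lborel_Icc_eq intro: le_less_trans)
      show "AE s in lborel. s \<in> \<tau> ` A \<inter> {-n..n} \<longrightarrow> norm (indicator (\<tau> ` A) s *\<^sub>R h s) \<le> n"
        using B h(2) by (intro AE_I2) (auto simp: indicator_def)
      show "AE s in lborel. s \<notin> \<tau> ` A \<inter> {-n..n} \<longrightarrow> indicator (\<tau> ` A) s *\<^sub>R h s = 0"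
        using B by (intro AE_I2) (fastforce simp: indicator_def abs_le_iff)
    qed (use A h in \<open>auto intro!: borel_measurable_scaleR\<close>)
    then have "h absolutely_integrable_on \<tau> ` A"
      unfolding set_integrable_def using A h by (subst integrable_completion) (auto intro!: borel_measurable_scaleR)
    moreover have "A \<in> sets lebesgue" using A(2) by auto
    moreover have "(\<tau> has_field_derivative \<tau>' t) (at t within A)" if "t \<in> A" for t
      using der that A(1) DERIV_subset by blast
    moreover have "inj_on \<tau> A" using inj A(1) inj_on_subset by blast
    ultimately have i: "(\<lambda>t. \<bar>\<tau>' t\<bar> * h (\<tau> t)) absolutely_integrable_on A"
      "integral A (\<lambda>t. \<bar>\<tau>' t\<bar> * h (\<tau> t)) = integral (\<tau> ` A) h" "h absolutely_integrable_on \<tau> ` A"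
      using has_absolute_integral_change_of_variables_1'[of A \<tau> \<tau>' h "integral (\<tau> ` A) h"] by auto
    have "(h has_integral integral (\<tau> ` A) h) (\<tau> ` A)"
      using i(3) set_lebesgue_integral_eq_integral(1) integrable_integral by blast
    from nn_integral_has_integral_lebesgue'[OF h(2) this]
    have 1: "(\<integral>\<^sup>+s\<in>\<tau> ` A. ennreal (h s) \<partial>lborel) = ennreal (integral (\<tau> ` A) h)" .
    have "(k has_integral integral (\<tau> ` A) h) A"
    proof (rule has_integral_eq)
      show "((\<lambda>t. \<bar>\<tau>' t\<bar> * h (\<tau> t)) has_integral integral (\<tau> ` A) h) A"
        using i(1,2) set_lebesgue_integral_eq_integral(1) integrable_integral by metis
    qed (use k(2) A(1) in auto)
    moreover have "0 \<le> k t" if "t \<in> A" for t using k(2)[of t] A(1) that h(2) by auto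
    ultimately have "(\<integral>\<^sup>+t\<in>A. ennreal (k t) \<partial>lborel) = ennreal (integral (\<tau> ` A) h)"
      by (intro nn_integral_has_integral_lebesgue')
    with 1 show ?thesis by simp
  qed
  define S' where "S' n = {s \<in> \<tau> ` T. \<bar>s\<bar> \<le> real n \<and> h s \<le> real n}" for n
  define T' where "T' n = {t \<in> T. \<tau> t \<in> S' n}" for n
  have S'm: "S' n \<in> sets borel" for n
  proof -
    have 1: "h -` {..real n} \<in> sets borel" using measurable_sets[OF h(1), of "{..real n}"] by simp
    have 2: "{-real n..real n} \<in> sets borel" by (rule borel_closed[OF closed_atLeastAtMost])
    have "S' n = \<tau> ` T \<inter> {-real n..real n} \<inter> h -` {..real n}" by (auto simp: S'_def)
    then show ?thesis using sets.Int[OF sets.Int[OF S 2] 1] by (rule ssubst)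
  qed
  have T'm: "T' n \<in> sets borel" for n
  proof -
    have "\<tau> \<in> borel_measurable (restrict_space borel T)" by (rule borel_measurable_continuous_on_restrict[OF cont])
    from measurable_sets[OF this S'm[of n]] have "\<tau> -` S' n \<inter> T \<in> sets (restrict_space borel T)"
      by (simp add: space_restrict_space)
    then have "\<tau> -` S' n \<inter> T \<in> sets borel" using T by (auto simp: sets_restrict_space)
    moreover have "T' n = \<tau> -` S' n \<inter> T" by (auto simp: T'_def)
    ultimately show ?thesis by simp
  qed
  have im: "\<tau> ` T' n = S' n" for n by (auto simp: T'_def S'_def)
  have eq: "(\<integral>\<^sup>+s\<in>S' n. ennreal (h s) \<partial>lborel) = (\<integral>\<^sup>+t\<in>T' n. ennreal (k t) \<partial>lborel)" for n
  proof -
    have "T' n \<subseteq> T" by (auto simp: T'_def)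
    moreover have "\<tau> ` T' n \<in> sets borel" unfolding im by (rule S'm)
    moreover have "\<bar>s\<bar> \<le> real n \<and> h s \<le> real n" if "s \<in> \<tau> ` T' n" for s using that unfolding im by (simp add: S'_def)
    ultimately show ?thesis using bounded_case[OF _ T'm] unfolding im by blast
  qed
  have US: "(\<Union>n. S' n) = \<tau> ` T"
  proof -
    have "\<exists>n. \<bar>s\<bar> \<le> real n \<and> h s \<le> real n" for s
      using real_arch_simple[of "max \<bar>s\<bar> (h s)"] by auto
    then show ?thesis by (auto simp: S'_def)
  qed
  then have UT: "(\<Union>n. T' n) = T" by (auto simp: T'_def)
  have inc: "incseq S'" "incseq T'"
    by (auto simp: incseq_def S'_def T'_def)
  have mh: "(\<lambda>s. ennreal (h s)) \<in> borel_measurable lborel" and mk: "(\<lambda>t. ennreal (k t)) \<in> borel_measurable lborel"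
    using h(1) k(1) by auto
  have "(\<integral>\<^sup>+s\<in>\<tau> ` T. ennreal (h s) \<partial>lborel) = emeasure (density lborel (\<lambda>s. ennreal (h s))) (\<Union>n. S' n)"
    using emeasure_density[OF mh, of "\<tau> ` T"] S US by simp
  also have "\<dots> = (SUP n. emeasure (density lborel (\<lambda>s. ennreal (h s))) (S' n))"
    using S'm by (intro SUP_emeasure_incseq[symmetric] inc) auto
  also have "\<dots> = (SUP n. emeasure (density lborel (\<lambda>t. ennreal (k t))) (T' n))"
    using emeasure_density[OF mh] emeasure_density[OF mk] S'm T'm eq by simp
  also have "\<dots> = emeasure (density lborel (\<lambda>t. ennreal (k t))) (\<Union>n. T' n)"
    using T'm by (intro SUP_emeasure_incseq inc) auto
  also have "\<dots> = (\<integral>\<^sup>+t\<in>T. ennreal (k t) \<partial>lborel)"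
    using emeasure_density[OF mk, of T] T UT by simp
  finally show ?thesis .
qed

section \<open>The length measure on the boundary of a compact surface\<close>

locale compact_surface = riem_manifold S for S :: "('s, 2) riem_structure" +
  assumes compact: "compact_space (mtop S)"
begin

abbreviation e2 :: "real \<Rightarrow> real^2" where "e2 t \<equiv> vector [0, t]"

definition bdom :: "('s, 2) chart \<Rightarrow> real set" where "bdom c = {t. e2 t \<in> patch c}"
definition gam :: "('s, 2) chart \<Rightarrow> real \<Rightarrow> 's" where "gam c t = chart_inv c (e2 t)"
definition dens :: "('s, 2) chart \<Rightarrow> real \<Rightarrow> real" where "dens c t = sqrt (metric_in S c (e2 t) $ 2 $ 2)"
text \<open>Extension by 0 makes the density a Borel function on the whole line, so that each chart
  yields a measure on the line.\<close>

definition bdens :: "('s, 2) chart \<Rightarrow> real \<Rightarrow> real" where "bdens c t = indicator (bdom c) t *\<^sub>R dens c t"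
definition bpre :: "('s, 2) chart \<Rightarrow> 's set \<Rightarrow> real set" where "bpre c E = {t. e2 t \<in> snd c ` E}"
definition bsets :: "'s set set" where "bsets = sigma_sets (mboundary S) {mboundary S \<inter> U | U. openin (mtop S) U}"

lemma bsets_subset: "E \<in> bsets \<Longrightarrow> E \<subseteq> mboundary S"
  unfolding bsets_def by (rule sigma_sets_into_sp[rotated]) auto

lemma e2_eq: "e2 t = t *\<^sub>R axis 2 1"
  by (simp add: vec_eq_iff forall_2 axis_def)

lemma continuous_e2: "continuous_on A e2"
  unfolding e2_eq by (intro continuous_intros)

lemma e2_nth [simp]: "e2 t $ 1 = 0" "e2 t $ 2 = t"
  by auto

lemma boundary_e2: "c \<in> atlas S \<Longrightarrow> p \<in> fst c \<Longrightarrow> p \<in> mboundary S \<Longrightarrow> snd c p = e2 (snd c p $ 2)"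
  using mboundary_iff[of c p] by (simp add: vec_eq_iff forall_2)

lemma gam_mem:
  assumes "c \<in> atlas S" "t \<in> bdom c"
  shows "gam c t \<in> fst c" "snd c (gam c t) = e2 t" "gam c t \<in> mboundary S"
proof -
  show 1: "gam c t \<in> fst c" "snd c (gam c t) = e2 t"
    using chart_inv_mem[OF chart[OF assms(1)]] assms(2) by (simp_all add: gam_def bdom_def)
  show "gam c t \<in> mboundary S" using mboundary_iff[OF assms(1) 1(1)] 1(2) by simp
qed

lemma bdom_snd:
  assumes "c \<in> atlas S" "p \<in> fst c" "p \<in> mboundary S"
  shows "snd c p $ 2 \<in> bdom c" "gam c (snd c p $ 2) = p"
  using boundary_e2[OF assms] assms(2) chart_inv_eq[OF chart[OF assms(1)] assms(2)]
  by (auto simp: bdom_def gam_def)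

lemma bpre_eq:
  assumes "c \<in> atlas S" "E \<subseteq> fst c"
  shows "bpre c E = {t \<in> bdom c. gam c t \<in> E}"
proof
  show "bpre c E \<subseteq> {t \<in> bdom c. gam c t \<in> E}"
    using assms chart_inv_eq[OF chart[OF assms(1)]] by (fastforce simp: bpre_def bdom_def gam_def)
  show "{t \<in> bdom c. gam c t \<in> E} \<subseteq> bpre c E"
    using gam_mem[OF assms(1)] by (force simp: bpre_def)
qed

lemma open_bdom: assumes "c \<in> atlas S" shows "open (bdom c)"
proof -
  obtain U where U: "open U" "patch c = half_space \<inter> U"
    using hs_open_patch[OF chart[OF assms]] hs_open_iff by blast
  have "bdom c = e2 -` U" unfolding bdom_def U(2) by (auto simp: half_space_def)
  then show ?thesis using open_vimage[OF U(1)] continuous_e2[of UNIV] by simp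
qed

lemma open_gam_preimage:
  assumes c: "c \<in> atlas S" and U: "openin (mtop S) U"
  shows "open {t \<in> bdom c. gam c t \<in> U}"
proof -
  have "hs_open (snd c ` (fst c \<inter> U))" by (rule chart_image_open[OF chart[OF c] U])
  then obtain V where V: "open V" "snd c ` (fst c \<inter> U) = half_space \<inter> V" using hs_open_iff by blast
  have "{t \<in> bdom c. gam c t \<in> U} = bpre c (fst c \<inter> U)"
    using bpre_eq[OF c, of "fst c \<inter> U"] gam_mem(1)[OF c] by auto
  also have "\<dots> = e2 -` V" unfolding bpre_def V(2) by (auto simp: half_space_def)
  finally show ?thesis using open_vimage[OF V(1)] continuous_e2[of UNIV] by simp
qed

lemma gam_preimage_borel:
  assumes c: "c \<in> atlas S" and E: "E \<in> bsets"
  shows "{t \<in> bdom c. gam c t \<in> E} \<in> sets borel"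
  using E unfolding bsets_def
proof (induction rule: sigma_sets.induct)
  case (Basic a)
  then obtain U where U: "a = mboundary S \<inter> U" "openin (mtop S) U" by blast
  have "{t \<in> bdom c. gam c t \<in> a} = {t \<in> bdom c. gam c t \<in> U}" using gam_mem(3)[OF c] U by auto
  then show ?case using open_gam_preimage[OF c U(2)] by simp
next
  case (Compl a)
  have "{t \<in> bdom c. gam c t \<in> mboundary S - a} = bdom c - {t \<in> bdom c. gam c t \<in> a}" using gam_mem(3)[OF c] by auto
  then show ?case using Compl open_bdom[OF c] by auto
next
  case (Union a)
  have "{t \<in> bdom c. gam c t \<in> \<Union> (range a)} = (\<Union>i. {t \<in> bdom c. gam c t \<in> a i})" by auto
  then show ?case using Union by auto
qed simp

lemma bpre_borel:
  assumes "c \<in> atlas S" "E \<in> bsets" "E \<subseteq> fst c" shows "bpre c E \<in> sets borel"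
  using gam_preimage_borel[OF assms(1,2)] bpre_eq[OF assms(1,3)] by simp

lemma continuous_dens: assumes c: "c \<in> atlas S" shows "continuous_on (bdom c) (dens c)"
proof -
  interpret C: riem_patch "patch c" "metric_in S c" by (rule riem_patch[OF c])
  have "continuous_on (bdom c) (\<lambda>t. metric_in S c (e2 t) $ 2 $ 2)"
    by (rule continuous_on_compose2[OF smooth_on_imp_continuous_on[OF C.smooth_g] continuous_e2]) (auto simp: bdom_def)
  then show ?thesis unfolding dens_def by (rule continuous_on_real_sqrt)
qed

lemma dens_pos: assumes c: "c \<in> atlas S" "t \<in> bdom c" shows "dens c t > 0"
proof -
  interpret C: riem_patch "patch c" "metric_in S c" by (rule riem_patch[OF c(1)])
  have "metric_in S c (e2 t) $ 2 $ 2 > 0"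
    using C.pos_G[of "e2 t" "axis 2 1"] c(2) by (simp add: bdom_def ip_axis axis_eq_0_iff)
  then show ?thesis by (simp add: dens_def)
qed

lemma bdens_borel: "c \<in> atlas S \<Longrightarrow> bdens c \<in> borel_measurable borel"
  unfolding bdens_def[abs_def]
  by (intro borel_measurable_continuous_on_indicator continuous_dens) (use open_bdom in auto)

lemma bdens_nonneg: "c \<in> atlas S \<Longrightarrow> bdens c t \<ge> 0"
  using dens_pos[of c t] by (auto simp: bdens_def indicator_def)

definition blen :: "('s, 2) chart \<Rightarrow> real measure" where "blen c = density lborel (\<lambda>t. ennreal (bdens c t))"

lemma emeasure_blen:
  assumes c: "c \<in> atlas S" and T: "T \<in> sets borel" "T \<subseteq> bdom c"
  shows "emeasure (blen c) T = (\<integral>\<^sup>+t\<in>T. ennreal (dens c t) \<partial>lborel)"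
proof -
  have "emeasure (blen c) T = (\<integral>\<^sup>+t. ennreal (bdens c t) * indicator T t \<partial>lborel)"
    unfolding blen_def using bdens_borel[OF c] T(1) by (intro emeasure_density) auto
  also have "\<dots> = (\<integral>\<^sup>+t\<in>T. ennreal (dens c t) \<partial>lborel)"
    using T(2) by (intro nn_integral_cong) (auto simp: bdens_def indicator_def)
  finally show ?thesis .
qed

text \<open>A coordinate change maps boundary points to boundary points, hence restricts there to a
  one-dimensional reparametrization \<open>\<tau>\<close>. The isometry property says that the two
  length densities differ by the factor \<open>\<bar>\<tau>' t\<bar>\<close>, as the change of
  variables requires.\<close>

lemma bpre_transition:
  assumes c: "c \<in> atlas S" and d: "d \<in> atlas S" and E: "E \<in> bsets" "E \<subseteq> fst c" "E \<subseteq> fst d"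
  shows "emeasure (blen d) (bpre d E) = emeasure (blen c) (bpre c E)"
proof -
  let ?W = "map_dom c d id" and ?\<Phi> = "map_rep c d id"
  interpret I: iso_map "patch d" "metric_in S d" ?W ?\<Phi> "metric_in S c" by (rule iso_map_transition[OF c d])
  have EB: "E \<subseteq> mboundary S" by (rule bsets_subset[OF E(1)])
  define \<tau> where "\<tau> t = snd d (gam c t) $ 2" for t
  define \<tau>' where "\<tau>' t = I.tang 2 (e2 t) $ 2" for t
  have W: "e2 t \<in> ?W" if "t \<in> bpre c E" for t
    using that E by (auto simp: bpre_def map_dom_def)
  have rep: "?\<Phi> (e2 t) = snd d (gam c t)" for t by (simp add: map_rep_def gam_def)
  have g: "gam c t \<in> E" "t \<in> bdom c" if "t \<in> bpre c E" for t
    using that bpre_eq[OF c E(2)] by auto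
  have \<tau>e: "e2 (\<tau> t) = snd d (gam c t)" if "t \<in> bpre c E" for t
  proof -
    have "gam c t \<in> fst d" "gam c t \<in> mboundary S" using g[OF that] E EB by blast+
    from boundary_e2[OF d this] show ?thesis unfolding \<tau>_def by (rule sym)
  qed
  have im: "\<tau> ` bpre c E = bpre d E"
  proof
    show "\<tau> ` bpre c E \<subseteq> bpre d E" using \<tau>e g by (auto simp: bpre_def)
    show "bpre d E \<subseteq> \<tau> ` bpre c E"
    proof
      fix s assume "s \<in> bpre d E"
      then obtain p where p: "p \<in> E" "snd d p = e2 s" by (auto simp: bpre_def)
      have pc: "p \<in> fst c" "p \<in> mboundary S" using p(1) E(2) EB by blast+
      have "snd c p $ 2 \<in> bpre c E"
        unfolding bpre_eq[OF c E(2)] mem_Collect_eq bdom_snd(2)[OF c pc]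
        by (intro conjI bdom_snd(1)[OF c pc] p(1))
      moreover have "\<tau> (snd c p $ 2) = s" unfolding \<tau>_def bdom_snd(2)[OF c pc] p(2) by (rule e2_nth(2))
      ultimately show "s \<in> \<tau> ` bpre c E" by blast
    qed
  qed
  have inj: "inj_on \<tau> (bpre c E)"
  proof
    fix s t assume st: "s \<in> bpre c E" "t \<in> bpre c E" "\<tau> s = \<tau> t"
    then have "snd d (gam c s) = snd d (gam c t)" using \<tau>e by metis
    then have "gam c s = gam c t"
      using chart_inj[OF chart[OF d]] g st E(3) by (meson inj_onD subsetD)
    then have "e2 s = e2 t" using gam_mem(2)[OF c] g st by metis
    then show "s = t" using e2_nth(2) by metis
  qed
  have der: "((\<lambda>t. ?\<Phi> (e2 t) $ k) has_field_derivative I.tang 2 (e2 t) $ k) (at t within A)" if t: "e2 t \<in> ?W" and A: "e2 ` A \<subseteq> ?W" for t k A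
  proof -
    have "((\<lambda>y. ?\<Phi> y $ k) has_derivative (\<lambda>v. \<Sum>j\<in>UNIV. v $ j * pd ?W j (\<lambda>y. ?\<Phi> y $ k) (e2 t))) (at (e2 t) within ?W)"
      by (rule has_derivative_pd[OF smooth_on_differentiable[OF smooth_on_nth[OF I.smooth_map] t]])
    then have 1: "((\<lambda>y. ?\<Phi> y $ k) has_derivative (\<lambda>v. \<Sum>j\<in>UNIV. v $ j * pd ?W j (\<lambda>y. ?\<Phi> y $ k) (e2 t))) (at (e2 t) within e2 ` A)"
      using A by (rule has_derivative_subset)
    have 2: "(e2 has_derivative (\<lambda>s. s *\<^sub>R axis 2 1)) (at t within A)"
      unfolding e2_eq by (auto intro!: derivative_eq_intros)
    have "(\<lambda>s. \<Sum>j\<in>UNIV. (s *\<^sub>R axis 2 1) $ j * pd ?W j (\<lambda>y. ?\<Phi> y $ k) (e2 t)) = (*) (I.tang 2 (e2 t) $ k)"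
      by (simp add: fun_eq_iff I.tang_def pdv_def mult.assoc sum_distrib_left[symmetric] sum_axis)
    then show ?thesis
      using has_derivative_in_compose[OF 2 1] unfolding has_field_derivative_def by (simp only:)
  qed
  \<comment> \<open>The first component of the transition map is 0 along the boundary line, so its
    derivative along that line vanishes and boundary tangents go to boundary tangents.\<close>
  have tang1: "I.tang 2 (e2 t) $ 1 = 0" if t: "e2 t \<in> ?W" for t
  proof -
    obtain U where U: "open U" "?W = half_space \<inter> U" using I.hs_open_W hs_open_iff by blast
    have A: "e2 -` ?W = e2 -` U" unfolding U(2) by (auto simp: half_space_def)
    then have op: "open (e2 -` ?W)" using open_vimage[OF U(1)] continuous_e2[of UNIV] by simp
    have "((\<lambda>t. ?\<Phi> (e2 t) $ 1) has_field_derivative I.tang 2 (e2 t) $ 1) (at t within e2 -` ?W)"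
      by (rule der[OF t]) auto
    then have D: "((\<lambda>t. ?\<Phi> (e2 t) $ 1) has_field_derivative I.tang 2 (e2 t) $ 1) (at t)"
      using at_within_open[OF _ op, of t] t by simp
    have z: "?\<Phi> (e2 s) $ 1 = 0" if "s \<in> e2 -` ?W" for s
    proof -
      have s: "s \<in> bdom c" "gam c s \<in> fst d"
        using that map_dom_iff[OF chart[OF c], where d=d and F=id and x="e2 s"] by (auto simp: bdom_def gam_def)
      then show ?thesis using mboundary_iff[OF d s(2)] gam_mem(3)[OF c s(1)] by (simp add: rep)
    qed
    have "((\<lambda>t. 0) has_field_derivative I.tang 2 (e2 t) $ 1) (at t)"
      by (rule has_field_derivative_transform_within_open[OF D op]) (use t z in auto)
    then show ?thesis by (metis DERIV_const DERIV_unique)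
  qed
  have k: "bdens c t = \<bar>\<tau>' t\<bar> * bdens d (\<tau> t)" if t: "t \<in> bpre c E" for t
  proof -
    have "metric_in S c (e2 t) $ 2 $ 2 = ip (metric_in S d (?\<Phi> (e2 t))) (I.tang 2 (e2 t)) (I.tang 2 (e2 t))"
      by (rule I.iso[OF W[OF t]])
    also have "I.tang 2 (e2 t) = \<tau>' t *\<^sub>R axis 2 1"
      using tang1[OF W[OF t]] by (simp add: vec_eq_iff forall_2 \<tau>'_def axis_def)
    finally have "metric_in S c (e2 t) $ 2 $ 2 = (\<tau>' t)\<^sup>2 * metric_in S d (e2 (\<tau> t)) $ 2 $ 2"
      unfolding rep \<tau>e[OF t] by (simp add: ip_simps ip_axis power2_eq_square)
    then have "dens c t = \<bar>\<tau>' t\<bar> * dens d (\<tau> t)" by (simp add: dens_def real_sqrt_mult)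
    moreover have "\<tau> t \<in> bdom d" using im t bpre_eq[OF d E(3)] by blast
    ultimately show ?thesis using g(2)[OF t] by (simp add: bdens_def)
  qed
  have sub: "bpre c E \<subseteq> bdom c" "bpre d E \<subseteq> bdom d" using bpre_eq[OF c E(2)] bpre_eq[OF d E(3)] by auto
  have m: "bpre c E \<in> sets borel" "bpre d E \<in> sets borel" using bpre_borel[OF c E(1,2)] bpre_borel[OF d E(1,3)] by auto
  have "(\<integral>\<^sup>+s\<in>\<tau> ` bpre c E. ennreal (bdens d s) \<partial>lborel) = (\<integral>\<^sup>+t\<in>bpre c E. ennreal (bdens c t) \<partial>lborel)"
  proof (rule nn_integral_change_of_variables[where \<tau>' = \<tau>'])
    show "(\<tau> has_real_derivative \<tau>' t) (at t within bpre c E)" if "t \<in> bpre c E" for t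
      using der[OF W[OF that], of "bpre c E" 2] W by (auto simp: rep \<tau>_def[abs_def] \<tau>'_def)
  qed (use m im inj bdens_borel c d bdens_nonneg k in auto)
  then show ?thesis
    unfolding im blen_def using m bdens_borel c d by (subst (1 2) emeasure_density) auto
qed

end

context compact_surface begin

lemma sigma_algebra_bsets: "sigma_algebra (mboundary S) bsets"
  unfolding bsets_def by (rule sigma_algebra_sigma_sets) auto

lemma bsets_openin: "openin (mtop S) U \<Longrightarrow> mboundary S \<inter> U \<in> bsets"
  unfolding bsets_def by (rule sigma_sets.Basic) blast

lemma compactin_mboundary: "compactin (mtop S) (mboundary S)"
  by (rule closedin_compact_space[OF compact closedin_mboundary])

definition is_length_measure :: "'s measure \<Rightarrow> bool" where
  "is_length_measure m \<longleftrightarrow> space m = mboundary S \<and> sets m = bsets \<and>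
     (\<forall>c\<in>atlas S. \<forall>E\<in>sets m. E \<subseteq> fst c \<longrightarrow> emeasure m E = (\<integral>\<^sup>+t\<in>bpre c E. ennreal (dens c t) \<partial>lborel))"

text \<open>Compactness gives finitely many charts; removing the earlier ones from each makes the
  pieces disjoint, so a measure may be given piece by piece.\<close>

lemma boundary_cover:
  obtains cs and A :: "nat \<Rightarrow> 's set" and N where "\<And>n. n < N \<Longrightarrow> cs n \<in> atlas S" "\<And>n. n < N \<Longrightarrow> A n \<in> bsets"
    "\<And>n. n < N \<Longrightarrow> A n \<subseteq> fst (cs n)" "disjoint_family_on A {..<N}" "(\<Union>n<N. A n) = mboundary S"
proof -
  have op: "openin (mtop S) (fst c)" if "c \<in> atlas S" for c using chart[OF that] by (simp add: is_chart_def)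
  have "mboundary S \<subseteq> \<Union> (fst ` atlas S)" using mboundary_subset charts_cover by auto
  then have "\<exists>\<F>. finite \<F> \<and> \<F> \<subseteq> fst ` atlas S \<and> mboundary S \<subseteq> \<Union> \<F>"
    by (intro compactinD[OF compactin_mboundary]) (use op in auto)
  then obtain \<F> where F: "finite \<F>" "\<F> \<subseteq> fst ` atlas S" "mboundary S \<subseteq> \<Union> \<F>"
    by blast
  obtain f N where f: "\<F> = f ` {i. i < (N::nat)}" using finite_imp_nat_seg_image_inj_on[OF F(1)] by blast
  have "\<forall>n<N. \<exists>c\<in>atlas S. fst c = f n" 
  proof (intro allI impI)
    fix n assume "n < N"
    then have "f n \<in> fst ` atlas S" using F(2) unfolding f by auto
    then show "\<exists>c\<in>atlas S. fst c = f n" by auto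
  qed
  then obtain cs where cs: "\<And>n. n < N \<Longrightarrow> cs n \<in> atlas S \<and> fst (cs n) = f n" by metis
  define A where "A n = (mboundary S \<inter> f n) - (\<Union>j<n. mboundary S \<inter> f j)" for n
  interpret B: sigma_algebra "mboundary S" bsets by (rule sigma_algebra_bsets)
  have b: "mboundary S \<inter> f n \<in> bsets" if "n < N" for n using bsets_openin op cs[OF that] by metis
  have Ab: "A n \<in> bsets" if "n < N" for n unfolding A_def using b that by (intro B.Diff B.finite_UN) auto
  have disj: "A i \<inter> A j = {}" if "i < j" for i j using that by (auto simp: A_def)
  have "disjoint_family_on A {..<N}"
    unfolding disjoint_family_on_def using disj by (metis Int_commute nat_neq_iff)
  moreover have "(\<Union>n<N. A n) = mboundary S"
  proof
    show "(\<Union>n<N. A n) \<subseteq> mboundary S" by (auto simp: A_def)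
    show "mboundary S \<subseteq> (\<Union>n<N. A n)"
    proof
      fix p assume p: "p \<in> mboundary S"
      then have ex: "\<exists>n. n < N \<and> p \<in> f n" using F(3) unfolding f by auto
      define n where "n = (LEAST n. n < N \<and> p \<in> f n)"
      have n: "n < N \<and> p \<in> f n" unfolding n_def by (rule LeastI_ex[OF ex])
      have "p \<notin> f j" if "j < n" for j
        using not_less_Least[OF that[unfolded n_def]] that n by auto
      then show "p \<in> (\<Union>n<N. A n)" using n p by (auto simp: A_def)
    qed
  qed
  ultimately show ?thesis using that[of N cs A] cs Ab by (auto simp: A_def)
qed

lemma length_measure_ex: "\<exists>m. is_length_measure m"
proof -
  obtain cs A and N :: nat where cs: "\<And>n. n < N \<Longrightarrow> cs n \<in> atlas S" and Ab: "\<And>n. n < N \<Longrightarrow> A n \<in> bsets"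
    and Ac: "\<And>n. n < N \<Longrightarrow> A n \<subseteq> fst (cs n)" and disj: "disjoint_family_on A {..<N}" and un: "(\<Union>n<N. A n) = mboundary S"
    by (rule boundary_cover) blast
  interpret B: sigma_algebra "mboundary S" bsets by (rule sigma_algebra_bsets)
  define \<mu> where "\<mu> E = (\<Sum>n<N. emeasure (blen (cs n)) (bpre (cs n) (E \<inter> A n)))" for E
  define m where "m = measure_of (mboundary S) bsets \<mu>"
  have sub: "bsets \<subseteq> Pow (mboundary S)" using bsets_subset by blast
  have sm: "sets m = bsets" and spm: "space m = mboundary S"
    unfolding m_def using sub B.sigma_sets_eq by (simp_all add: sets_measure_of space_measure_of)
  have bp: "bpre (cs n) (E \<inter> A n) \<in> sets (blen (cs n))" if "n < N" "E \<in> bsets" for n E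
    using bpre_borel[OF cs[OF that(1)], of "E \<inter> A n"] Ac[OF that(1)] Ab[OF that(1)] that(2) by (auto simp: blen_def)
  have "countably_additive bsets \<mu>"
    unfolding countably_additive_def
  proof (intro allI impI)
    fix E :: "nat \<Rightarrow> 's set" assume E: "range E \<subseteq> bsets" "disjoint_family E" "(\<Union>i. E i) \<in> bsets"
    have "(\<Sum>i. \<mu> (E i)) = (\<Sum>n<N. \<Sum>i. emeasure (blen (cs n)) (bpre (cs n) (E i \<inter> A n)))"
      unfolding \<mu>_def by (rule suminf_sum) auto
    also have "\<dots> = (\<Sum>n<N. emeasure (blen (cs n)) (bpre (cs n) ((\<Union>i. E i) \<inter> A n)))"
    proof (rule sum.cong[OF refl])
      fix n assume "n \<in> {..<N}"
      then have n: "n < N" by simp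
      have "(\<Union>i. bpre (cs n) (E i \<inter> A n)) = bpre (cs n) ((\<Union>i. E i) \<inter> A n)" by (auto simp: bpre_def)
      moreover have "disjoint_family (\<lambda>i. bpre (cs n) (E i \<inter> A n))"
        unfolding disjoint_family_on_def
      proof (intro ballI impI)
        fix i j :: nat assume "i \<noteq> j"
        then have "E i \<inter> E j = {}" using E(2) by (auto simp: disjoint_family_on_def)
        moreover have "bpre (cs n) (E i \<inter> A n) = {t \<in> bdom (cs n). gam (cs n) t \<in> E i \<inter> A n}" for i
          using bpre_eq[OF cs[OF n], of "E i \<inter> A n"] Ac[OF n] by blast
        ultimately show "bpre (cs n) (E i \<inter> A n) \<inter> bpre (cs n) (E j \<inter> A n) = {}" by auto
      qed
      moreover have "range (\<lambda>i. bpre (cs n) (E i \<inter> A n)) \<subseteq> sets (blen (cs n))" using bp[OF n] E(1) by auto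
      ultimately show "(\<Sum>i. emeasure (blen (cs n)) (bpre (cs n) (E i \<inter> A n))) = emeasure (blen (cs n)) (bpre (cs n) ((\<Union>i. E i) \<inter> A n))"
        using suminf_emeasure[of "\<lambda>i. bpre (cs n) (E i \<inter> A n)" "blen (cs n)"] by simp
    qed
    finally show "(\<Sum>i. \<mu> (E i)) = \<mu> (\<Union>i. E i)" unfolding \<mu>_def .
  qed
  moreover have "positive bsets \<mu>" by (simp add: positive_def \<mu>_def bpre_def)
  ultimately have em: "emeasure m E = \<mu> E" if "E \<in> bsets" for E
    unfolding m_def using that by (intro emeasure_measure_of_sigma B.sigma_algebra_axioms)
  have "emeasure m E = (\<integral>\<^sup>+t\<in>bpre c E. ennreal (dens c t) \<partial>lborel)" if c: "c \<in> atlas S" and E: "E \<in> bsets" "E \<subseteq> fst c" for c E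
  proof -
    have EA: "E \<inter> A n \<in> bsets" "E \<inter> A n \<subseteq> fst c" "E \<inter> A n \<subseteq> fst (cs n)" if "n < N" for n
      using Ab[OF that] Ac[OF that] E by auto
    have "emeasure m E = (\<Sum>n<N. emeasure (blen c) (bpre c (E \<inter> A n)))"
      unfolding em[OF E(1)] \<mu>_def
      using bpre_transition[OF c cs EA(1) EA(2) EA(3)] by (intro sum.cong) auto
    also have "\<dots> = emeasure (blen c) (\<Union>n<N. bpre c (E \<inter> A n))"
    proof (rule sum_emeasure)
      show "(\<lambda>n. bpre c (E \<inter> A n)) ` {..<N} \<subseteq> sets (blen c)"
        using bpre_borel[OF c] EA by (auto simp: blen_def)
      show "disjoint_family_on (\<lambda>n. bpre c (E \<inter> A n)) {..<N}"
        unfolding disjoint_family_on_def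
      proof (intro ballI impI)
        fix i j assume ij: "i \<in> {..<N}" "j \<in> {..<N}" "i \<noteq> j"
        then have "A i \<inter> A j = {}" using disj by (auto simp: disjoint_family_on_def)
        moreover have "bpre c (E \<inter> A i) = {t \<in> bdom c. gam c t \<in> E \<inter> A i}" for i
          using E(2) by (intro bpre_eq[OF c]) auto
        ultimately show "bpre c (E \<inter> A i) \<inter> bpre c (E \<inter> A j) = {}" by auto
      qed
    qed (rule finite_lessThan)
    also have "(\<Union>n<N. bpre c (E \<inter> A n)) = bpre c E"
      using un bsets_subset[OF E(1)] by (fastforce simp: bpre_def)
    also have "emeasure (blen c) (bpre c E) = (\<integral>\<^sup>+t\<in>bpre c E. ennreal (dens c t) \<partial>lborel)"
      using bpre_eq[OF c E(2)] by (intro emeasure_blen c bpre_borel E) auto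
    finally show ?thesis .
  qed
  then show ?thesis unfolding is_length_measure_def using sm spm by blast
qed

lemma length_measure_unique:
  assumes "is_length_measure m" "is_length_measure m'" shows "m = m'"
proof (rule measure_eqI)
  show s: "sets m = sets m'" using assms by (simp add: is_length_measure_def)
  obtain cs A and N :: nat where cs: "\<And>n. n < N \<Longrightarrow> cs n \<in> atlas S" and Ab: "\<And>n. n < N \<Longrightarrow> A n \<in> bsets"
    and Ac: "\<And>n. n < N \<Longrightarrow> A n \<subseteq> fst (cs n)" and disj: "disjoint_family_on A {..<N}" and un: "(\<Union>n<N. A n) = mboundary S"
    by (rule boundary_cover) blast
  fix E assume "E \<in> sets m"
  then have E: "E \<in> bsets" using assms by (simp add: is_length_measure_def)
  interpret B: sigma_algebra "mboundary S" bsets by (rule sigma_algebra_bsets)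
  have "emeasure m E = (\<Sum>n<N. \<integral>\<^sup>+t\<in>bpre (cs n) (E \<inter> A n). ennreal (dens (cs n) t) \<partial>lborel)" if m: "is_length_measure m" for m
  proof -
    have sm: "sets m = bsets" using m by (simp add: is_length_measure_def)
    have "emeasure m E = (\<Sum>n<N. emeasure m (E \<inter> A n))"
    proof (rule sum_emeasure_cover)
      show "E \<subseteq> (\<Union>n\<in>{..<N}. A n)" unfolding un by (rule bsets_subset[OF E])
    qed (use sm E Ab disj in auto)
    also have "\<dots> = (\<Sum>n<N. \<integral>\<^sup>+t\<in>bpre (cs n) (E \<inter> A n). ennreal (dens (cs n) t) \<partial>lborel)"
    proof (rule sum.cong[OF refl])
      fix n assume "n \<in> {..<N}"
      then have n: "n < N" by simp
      have "E \<inter> A n \<in> sets m" unfolding sm by (rule B.Int[OF E Ab[OF n]])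
      moreover have "E \<inter> A n \<subseteq> fst (cs n)" using Ac[OF n] by (rule le_infI2)
      ultimately show "emeasure m (E \<inter> A n) = (\<integral>\<^sup>+t\<in>bpre (cs n) (E \<inter> A n). ennreal (dens (cs n) t) \<partial>lborel)"
        using m cs[OF n] unfolding is_length_measure_def by blast
    qed
    finally show ?thesis .
  qed
  then show "emeasure m E = emeasure m' E" using assms by simp
qed

text \<open>\<open>boundary_length_measure\<close> is a definite description; existence and
  uniqueness are what give it its intended meaning.\<close>

lemma is_length_measure_boundary: "is_length_measure (boundary_length_measure S)"
proof -
  have "boundary_length_measure S = (THE m. is_length_measure m)"
    unfolding boundary_length_measure_def is_length_measure_def bsets_def bpre_def dens_def by (rule refl)
  then show ?thesis using theI'[of is_length_measure] length_measure_ex length_measure_unique by metis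
qed

abbreviation BL :: "'s measure" where "BL \<equiv> boundary_length_measure S"

lemma space_BL: "space BL = mboundary S" and sets_BL: "sets BL = bsets"
  and emeasure_BL: "c \<in> atlas S \<Longrightarrow> E \<in> bsets \<Longrightarrow> E \<subseteq> fst c \<Longrightarrow> emeasure BL E = (\<integral>\<^sup>+t\<in>bpre c E. ennreal (dens c t) \<partial>lborel)"
  using is_length_measure_boundary unfolding is_length_measure_def by auto

lemma finite_near:
  assumes p: "p \<in> mboundary S"
  shows "\<exists>U. openin (mtop S) U \<and> p \<in> U \<and> emeasure BL (mboundary S \<inter> U) < \<infinity>"
proof -
  obtain c where c: "c \<in> atlas S" "p \<in> fst c" using p mboundary_subset chart_ex by blast
  define t0 where "t0 = snd c p $ 2"
  have t0: "t0 \<in> bdom c" unfolding t0_def by (rule bdom_snd[OF c p])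
  obtain \<epsilon> where \<epsilon>: "\<epsilon> > 0" "cball t0 \<epsilon> \<subseteq> bdom c" using open_contains_cball open_bdom[OF c(1)] t0 by blast
  have "compact (dens c ` cball t0 \<epsilon>)"
    by (intro compact_continuous_image continuous_on_subset[OF continuous_dens[OF c(1)] \<epsilon>(2)] compact_cball)
  then obtain K where K: "\<And>t. t \<in> cball t0 \<epsilon> \<Longrightarrow> dens c t \<le> K"
    using compact_imp_bounded bounded_real by (metis abs_le_D1 imageI)
  define U where "U = {q \<in> fst c. snd c q \<in> patch c \<inter> {x. \<bar>x $ 2 - t0\<bar> < \<epsilon>}}"
  have "openin (top_of_set (patch c)) (patch c \<inter> {x. \<bar>x $ 2 - t0\<bar> < \<epsilon>})"
    by (intro openin_open_Int open_Collect_less continuous_intros)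
  then have U: "openin (mtop S) U" unfolding U_def by (rule chart_preimage_open[OF chart[OF c(1)]])
  have pU: "p \<in> U" using c(2) \<epsilon> by (simp add: U_def t0_def)
  have Ub: "mboundary S \<inter> U \<in> bsets" by (rule bsets_openin[OF U])
  have sub: "mboundary S \<inter> U \<subseteq> fst c" by (auto simp: U_def)
  have "bpre c (mboundary S \<inter> U) \<subseteq> cball t0 \<epsilon>"
  proof
    fix t assume "t \<in> bpre c (mboundary S \<inter> U)"
    then have t: "t \<in> bdom c" "gam c t \<in> U" unfolding bpre_eq[OF c(1) sub] by auto
    have "\<bar>e2 t $ 2 - t0\<bar> < \<epsilon>" using t(2) unfolding U_def gam_mem(2)[OF c(1) t(1), symmetric] by simp
    then show "t \<in> cball t0 \<epsilon>" by (simp add: dist_real_def)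
  qed
  then have "emeasure BL (mboundary S \<inter> U) \<le> (\<integral>\<^sup>+t. ennreal K * indicator (cball t0 \<epsilon>) t \<partial>lborel)"
    unfolding emeasure_BL[OF c(1) Ub sub] using K
    by (intro nn_integral_mono) (auto simp: indicator_def intro!: ennreal_leI)
  also have "\<dots> = ennreal K * emeasure lborel (cball t0 \<epsilon>)" by (intro nn_integral_cmult_indicator) auto
  also have "\<dots> < \<infinity>"
    using emeasure_lborel_cbox_finite[of "t0 - \<epsilon>" "t0 + \<epsilon>"]
    by (simp add: ennreal_mult_less_top cball_eq_atLeastAtMost cbox_interval)
  finally show ?thesis using U pU by blast
qed

lemma finite_BL: "emeasure BL (mboundary S) < \<infinity>"
proof -
  let ?\<U> = "{U. openin (mtop S) U \<and> emeasure BL (mboundary S \<inter> U) < \<infinity>}"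
  have "\<exists>\<F>. finite \<F> \<and> \<F> \<subseteq> ?\<U> \<and> mboundary S \<subseteq> \<Union> \<F>"
    by (intro compactinD[OF compactin_mboundary]) (use finite_near in blast)+
  then obtain \<F> where F: "finite \<F>" "\<F> \<subseteq> ?\<U>" "mboundary S \<subseteq> \<Union> \<F>" by blast
  have "emeasure BL (mboundary S) \<le> emeasure BL (\<Union>U\<in>\<F>. mboundary S \<inter> U)"
  proof (rule emeasure_mono)
    show "(\<Union>U\<in>\<F>. mboundary S \<inter> U) \<in> sets BL"
      using F bsets_openin unfolding sets_BL[symmetric] by (intro sets.finite_UN) auto
  qed (use F in auto)
  also have "\<dots> \<le> (\<Sum>U\<in>\<F>. emeasure BL (mboundary S \<inter> U))"
    using F bsets_openin by (intro emeasure_subadditive_finite) (auto simp: sets_BL)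
  also have "\<dots> < \<infinity>" using F by (auto simp: less_top)
  finally show ?thesis .
qed

lemma pos_near:
  assumes p: "p \<in> mboundary S" and U: "openin (mtop S) U" "p \<in> U"
  shows "emeasure BL (mboundary S \<inter> U) > 0"
proof -
  obtain c where c: "c \<in> atlas S" "p \<in> fst c" using p mboundary_subset chart_ex by blast
  define t0 where "t0 = snd c p $ 2"
  let ?U = "fst c \<inter> U"
  have opU: "openin (mtop S) ?U" using chart[OF c(1)] U(1) by (auto simp: is_chart_def)
  have t0: "t0 \<in> {t \<in> bdom c. gam c t \<in> ?U}" using bdom_snd[OF c p] c(2) U(2) by (simp add: t0_def)
  obtain \<epsilon> where \<epsilon>: "\<epsilon> > 0" "cball t0 \<epsilon> \<subseteq> {t \<in> bdom c. gam c t \<in> ?U}"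
    using open_contains_cball open_gam_preimage[OF c(1) opU] t0 by blast
  have b: "mboundary S \<inter> ?U \<in> bsets" by (rule bsets_openin[OF opU])
  have sub: "mboundary S \<inter> ?U \<subseteq> fst c" by auto
  have T: "cball t0 \<epsilon> \<subseteq> bpre c (mboundary S \<inter> ?U)"
    using \<epsilon>(2) gam_mem(3)[OF c(1)] unfolding bpre_eq[OF c(1) sub] by auto
  have "\<exists>t\<in>cball t0 \<epsilon>. \<forall>s\<in>cball t0 \<epsilon>. dens c t \<le> dens c s"
    using \<epsilon> by (intro continuous_attains_inf continuous_on_subset[OF continuous_dens[OF c(1)]]) auto
  then obtain t1 where t1: "t1 \<in> cball t0 \<epsilon>" "\<And>s. s \<in> cball t0 \<epsilon> \<Longrightarrow> dens c t1 \<le> dens c s" by blast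
  have k: "dens c t1 > 0" using dens_pos[OF c(1)] t1(1) \<epsilon>(2) by blast
  have "0 < ennreal (dens c t1) * emeasure lborel (cball t0 \<epsilon>)"
    using k \<epsilon>(1) by (simp add: cball_eq_atLeastAtMost ennreal_zero_less_mult_iff)
  also have "\<dots> = (\<integral>\<^sup>+t. ennreal (dens c t1) * indicator (cball t0 \<epsilon>) t \<partial>lborel)"
    by (intro nn_integral_cmult_indicator[symmetric]) auto
  also have "\<dots> \<le> emeasure BL (mboundary S \<inter> ?U)"
    unfolding emeasure_BL[OF c(1) b sub] using T t1(2)
    by (intro nn_integral_mono) (auto simp: indicator_def subset_iff intro!: ennreal_leI)
  also have "\<dots> \<le> emeasure BL (mboundary S \<inter> U)"
    using bsets_openin[OF U(1)] by (intro emeasure_mono) (auto simp: sets_BL)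
  finally show ?thesis .
qed

text \<open>A negative value persists on a relatively open part of the boundary, and
  \<open>pos_near\<close> gives that part positive length.\<close>

lemma boundary_integral_neg:
  fixes g :: "'s \<Rightarrow> real"
  assumes g: "continuous_map (subtopology (mtop S) (mboundary S)) euclideanreal g"
    and nonpos: "\<And>p. p \<in> mboundary S \<Longrightarrow> g p \<le> 0" and p: "p \<in> mboundary S" "g p < 0"
  shows "(LINT p|BL. g p) < 0"
proof -
  have op: "\<exists>U. openin (mtop S) U \<and> {q \<in> mboundary S. g q \<in> V} = mboundary S \<inter> U" if "open V" for V
  proof -
    have "topspace (subtopology (mtop S) (mboundary S)) = mboundary S" using mboundary_subset by auto
    then have "openin (subtopology (mtop S) (mboundary S)) {q \<in> mboundary S. g q \<in> V}"
      using openin_continuous_map_preimage[OF g, of V] that by simp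
    then show ?thesis by (auto simp: openin_subtopology)
  qed
  have meas: "g \<in> borel_measurable BL"
  proof (rule borel_measurableI)
    fix V :: "real set" assume "open V"
    then obtain U where "openin (mtop S) U" "{q \<in> mboundary S. g q \<in> V} = mboundary S \<inter> U" using op by blast
    moreover have "g -` V \<inter> space BL = {q \<in> mboundary S. g q \<in> V}" by (auto simp: space_BL)
    ultimately show "g -` V \<inter> space BL \<in> sets BL" using bsets_openin by (simp add: sets_BL)
  qed
  have "compactin euclideanreal (g ` mboundary S)"
    using image_compactin[OF _ g, of "mboundary S"] compactin_mboundary by (simp add: compactin_subtopology)
  then have "bounded (g ` mboundary S)" by (simp add: compact_imp_bounded)
  then obtain K where K: "\<And>q. q \<in> mboundary S \<Longrightarrow> \<bar>g q\<bar> \<le> K" by (metis bounded_real imageI)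
  \<comment> \<open>Integrability matters: the integral of a function that is not integrable is 0 by
    convention, and the strict inequality would fail. It follows from finite length and
    compactness.\<close>
  have int: "integrable BL g"
    by (rule integrableI_bounded_set[of "space BL" _ _ K]) (use meas finite_BL K sets.top[of BL] in \<open>auto simp: space_BL\<close>)
  have le: "(LINT p|BL. g p) \<le> 0"
    using Bochner_Integration.integral_nonneg[of BL "\<lambda>p. - g p"] nonpos by (simp add: space_BL)
  moreover have "(LINT p|BL. g p) \<noteq> 0"
  proof
    assume z: "(LINT p|BL. g p) = 0"
    then have z: "(LINT p|BL. - g p) = 0" by simp
    have "AE q in BL. 0 \<le> - g q" by (rule AE_I2) (use nonpos in \<open>simp add: space_BL\<close>)
    then have "AE q in BL. - g q = 0"
      using integral_nonneg_eq_0_iff_AE[where M=BL and f="\<lambda>q. - g q"] int z by simp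
    then have AE: "AE q in BL. \<not> g q < 0" by eventually_elim simp
    obtain U where U: "openin (mtop S) U" "{q \<in> mboundary S. g q \<in> {..<0}} = mboundary S \<inter> U" using op[of "{..<0}"] by auto
    have "{q \<in> space BL. \<not> \<not> g q < 0} = mboundary S \<inter> U" using U(2) by (auto simp: space_BL)
    moreover have "mboundary S \<inter> U \<in> sets BL" using bsets_openin[OF U(1)] by (simp add: sets_BL)
    ultimately have "emeasure BL (mboundary S \<inter> U) = 0"
      using AE AE_iff_measurable[of "mboundary S \<inter> U" BL "\<lambda>q. \<not> g q < 0"] by simp
    moreover have "p \<in> U" using U(2) p by auto
    ultimately show False using pos_near[OF p(1) U(1)] by simp
  qed
  ultimately show ?thesis by simp
qed

end

section \<open>Changes of coordinates\<close>

lemma (in map_patch) hs_open_preimage: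
  assumes "hs_open D'" shows "hs_open {x \<in> W. \<Phi> x \<in> D'}"
proof -
  obtain U where U: "open U" "D' = half_space \<inter> U" using assms hs_open_iff by blast
  have "D \<subseteq> half_space" using hs_open by (auto simp: hs_open_iff)
  then have "{x \<in> W. \<Phi> x \<in> D'} = W \<inter> \<Phi> -` U" using map_in U(2) by auto
  moreover have "openin (top_of_set W) (W \<inter> \<Phi> -` U)"
    by (rule continuous_openin_preimage_gen[OF smooth_on_imp_continuous_on[OF smooth_map] U(1)])
  ultimately show ?thesis using hs_open_openin[OF hs_open_W] by simp
qed

context iso_map begin

context
  fixes D' W'
  assumes R: "hs_open D'" "D' \<subseteq> D" "hs_open W'" "W' \<subseteq> W" "\<And>x. x \<in> W' \<Longrightarrow> \<Phi> x \<in> D'"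
begin

lemma tang_restrict: "x \<in> W' \<Longrightarrow> map_patch.tang W' \<Phi> a x = tang a x"
proof -
  assume x: "x \<in> W'"
  interpret D': riem_patch D' G by (rule riem_patch_W[OF R(1,2)])
  interpret M': map_patch D' G W' \<Phi>
    by unfold_locales (use R smooth_on_subset[OF smooth_map] in auto)
  show ?thesis
    by (simp add: M'.tang_def tang_def pdv_def vec_eq_iff pd_restrict[OF hs_open_W R(3,4) x])
qed

lemma iso_map_restrict: "iso_map D' G W' \<Phi> GW"
proof -
  interpret D': riem_patch D' G by (rule riem_patch_W[OF R(1,2)])
  interpret M': map_patch D' G W' \<Phi>
    by unfold_locales (use R smooth_on_subset[OF smooth_map] in auto)
  interpret W': riem_patch W' GW by (rule Wp.riem_patch_W[OF R(3,4)])
  show ?thesis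
    by unfold_locales (use R(4) tang_restrict iso in auto)
qed

lemma cd_tang_restrict: "x \<in> W' \<Longrightarrow> map_patch.cd D' G W' \<Phi> a (map_patch.tang W' \<Phi> b) x = cd a (tang b) x"
proof -
  assume x: "x \<in> W'"
  interpret I': iso_map D' G W' \<Phi> GW by (rule iso_map_restrict)
  have "pd W' a (\<lambda>y. I'.tang b y $ k) x = pd W a (\<lambda>y. tang b y $ k) x" for k
    using pd_cong[of W' "\<lambda>y. I'.tang b y $ k" "\<lambda>y. tang b y $ k" x a] tang_restrict x
      pd_restrict[OF hs_open_W R(3,4) x] by simp
  moreover have "I'.Gam (\<Phi> x) v = Gam (\<Phi> x) v" for v
    using christoffel_W[OF R(1,2) R(5)[OF x]] by (simp add: I'.Gam_def Gam_def)
  ultimately show ?thesis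
    by (simp add: I'.cd_def cd_def pdv_def tang_restrict[OF x])
qed

end

end

lemma (in surface_patch)
  assumes R: "hs_open D'" "D' \<subseteq> D" "hs_open W'" "W' \<subseteq> W" "\<And>x. x \<in> W' \<Longrightarrow> \<Phi> x \<in> D'"
  shows surface_patch_restrict: "surface_patch D' G W' \<Phi> GW"
    and Aff_restrict: "x \<in> W' \<Longrightarrow> surface_patch.Aff D' G W' \<Phi> x n = Aff x n"
proof -
  show "surface_patch D' G W' \<Phi> GW"
    using iso_map_restrict[OF R] by (simp add: surface_patch_def)
  then interpret S': surface_patch D' G W' \<Phi> GW .
  show "x \<in> W' \<Longrightarrow> surface_patch.Aff D' G W' \<Phi> x n = Aff x n"
    by (simp add: S'.Aff_def Aff_def cd_tang_restrict[OF R])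
qed

context riem_patch begin

lemma hessian_cong:
  assumes "\<And>y. y \<in> D \<Longrightarrow> u y = v y" "x \<in> D"
  shows "hessian D G u x = hessian D G v x"
proof -
  have "pd D j u y = pd D j v y" if "y \<in> D" for y j by (rule pd_cong[OF assms(1) that])
  moreover from this have "pd D i (pd D j u) x = pd D i (pd D j v) x" for i j by (rule pd_cong[OF _ assms(2)])
  ultimately show ?thesis using assms(2) by (simp add: hessian_def)
qed

lemma hessian_diff_cmult:
  assumes u: "smooth_on D u" "smooth_on D v" and x: "x \<in> D"
  shows "hessian D G (\<lambda>y. u y - e * v y) x = hessian D G u x - e *\<^sub>R hessian D G v x"
proof -
  have p: "pd D j (\<lambda>y. u y - e * v y) y = pd D j u y - e * pd D j v y" if "y \<in> D" for y j
    by (simp add: pd_diff pd_cmult u hs_open that smooth_on_mult smooth_on_const)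
  have q: "pd D i (pd D j (\<lambda>y. u y - e * v y)) x = pd D i (pd D j u) x - e * pd D i (pd D j v) x" for i j
    using pd_cong[of D "pd D j (\<lambda>y. u y - e * v y)" "\<lambda>y. pd D j u y - e * pd D j v y" x i, OF p x]
    by (simp add: pd_diff pd_cmult smooth_on_pd u hs_open x smooth_on_mult smooth_on_const)
  show ?thesis
    by (simp add: hessian_def vec_eq_iff p[OF x] q sum_subtractf sum_distrib_left algebra_simps)
qed

lemma dif_gradient_nonneg: "x \<in> D \<Longrightarrow> dif u x \<bullet> gradient D G u x \<ge> 0"
  unfolding ip_gradient[symmetric]
  using pos_G[of x "gradient D G u x"] by (cases "gradient D G u x = 0") (auto simp: ip_simps)

lemma laplacian_compose:
  assumes u: "smooth_on D u" and s: "smooth_on D (\<lambda>y. h1 (u y))" and x: "x \<in> D"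
    and d: "\<And>t. (h has_real_derivative h1 t) (at t)" "(h1 has_real_derivative c2) (at (u x))"
  shows "laplacian D G (\<lambda>y. h (u y)) x = h1 (u x) * laplacian D G u x + c2 * (dif u x \<bullet> gradient D G u x)"
proof -
  have p: "pd D j (\<lambda>y. h (u y)) y = h1 (u y) * pd D j u y" if "y \<in> D" for y j
    by (rule pd_real_compose[OF u d(1) hs_open that])
  have q: "pd D i (pd D j (\<lambda>y. h (u y))) x = h1 (u x) * pd D i (pd D j u) x + c2 * pd D i u x * pd D j u x" for i j
    using pd_cong[of D "pd D j (\<lambda>y. h (u y))" "\<lambda>y. h1 (u y) * pd D j u y" x i, OF p x]
    by (simp add: pd_mult[OF s smooth_on_pd[OF u hs_open] hs_open x] pd_real_compose[OF u d(2) hs_open x])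
  have "hessian D G (\<lambda>y. h (u y)) x $ i $ j = h1 (u x) * hessian D G u x $ i $ j + c2 * pd D i u x * pd D j u x" for i j
    by (simp add: hessian_def p[OF x] q sum_distrib_left algebra_simps)
  then have "laplacian D G (\<lambda>y. h (u y)) x = h1 (u x) * laplacian D G u x
      + c2 * (\<Sum>i\<in>UNIV. \<Sum>j\<in>UNIV. matrix_inv (G x) $ i $ j * (pd D i u x * pd D j u x))"
    by (simp add: laplacian_def sum.distrib sum_distrib_left distrib_left mult_ac)
  also have "(\<Sum>i\<in>UNIV. \<Sum>j\<in>UNIV. matrix_inv (G x) $ i $ j * (pd D i u x * pd D j u x)) = dif u x \<bullet> gradient D G u x"
    by (simp add: dif_def gradient_def inner_vec_def matrix_vector_mult_def sum_distrib_left mult_ac)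
  finally show ?thesis .
qed

end

locale iso_chart = iso_map D G W \<Phi> GW
  for D :: "(real^'n::{finite,one}) set" and G and W :: "(real^'n::{finite,one}) set" and \<Phi> and GW
begin

definition J :: "real^'n::{finite,one} \<Rightarrow> real^'n::{finite,one}^'n::{finite,one}" where "J x = (\<chi> k a. tang a x $ k)"

lemma congruence_J: "(transpose (J x) ** M ** J x) $ a $ b = ip M (tang a x) (tang b x)"
  by (simp add: matrix_mult_nth transpose_def J_def ip_expand sum_distrib_right) (rule sum.swap)

lemma GW_J: "x \<in> W \<Longrightarrow> GW x = transpose (J x) ** G (\<Phi> x) ** J x"
  by (simp add: vec_eq_iff congruence_J iso)

lemma det_J: "x \<in> W \<Longrightarrow> det (J x) \<noteq> 0"
  using Wp.det_G[of x] by (auto simp: GW_J det_mul)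

lemma J_inv: "x \<in> W \<Longrightarrow> J x ** matrix_inv (J x) = mat 1" "x \<in> W \<Longrightarrow> matrix_inv (J x) ** J x = mat 1"
  using matrix_inv_right matrix_inv_left det_J by blast+

lemma transpose_J_cancel: assumes x: "x \<in> W" and e: "transpose (J x) ** A = transpose (J x) ** B" shows "A = B"
proof -
  have "transpose (matrix_inv (J x)) ** transpose (J x) = mat 1"
    using arg_cong[OF J_inv(1)[OF x], of transpose] by (simp add: matrix_transpose_mul transpose_mat)
  then show ?thesis using arg_cong[OF e, of "\<lambda>M. transpose (matrix_inv (J x)) ** M"] by (simp add: matrix_mul_assoc)
qed

text \<open>Between patches of equal dimension the tangent vectors of the map span the whole space,
  because \<open>J x\<close> is invertible, while \<open>Pi\<close> is orthogonal to all of them.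
  Hence Hessians transform as plain tensors.\<close>

lemma Pi_zero: assumes x: "x \<in> W" shows "Pi a b x = 0"
proof -
  have "transpose (J x) *v (G (\<Phi> x) *v Pi a b x) = 0"
  proof -
    have "tang c x \<bullet> (G (\<Phi> x) *v Pi a b x) = 0" for c
      using Pi_orth[OF x, of a b c] ipG_commute[OF x, of "Pi a b x"] by (simp add: ip_def)
    then show ?thesis
      by (simp add: vec_eq_iff matrix_vector_mult_def transpose_def J_def inner_vec_def del: transpose_matrix_vector)
  qed
  moreover have "transpose (matrix_inv (J x)) ** transpose (J x) = mat 1"
    using arg_cong[OF J_inv(1)[OF x], of transpose] by (simp add: matrix_transpose_mul transpose_mat)
  ultimately have "G (\<Phi> x) *v Pi a b x = 0"
    by (metis matrix_vector_mul_assoc matrix_vector_mul_lid matrix_vector_mult_0_right)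
  then show ?thesis using pos_G[OF map_in[OF x], of "Pi a b x"] by (auto simp: ip_def)
qed

lemma hessian_J:
  assumes "smooth_on D u" "x \<in> W" "\<And>y. y \<in> W \<Longrightarrow> u' y = u (\<Phi> y)"
  shows "hessian W GW u' x = transpose (J x) ** hessian D G u (\<Phi> x) ** J x"
proof -
  have "hessian W GW u' x = hessian W GW (\<lambda>y. u (\<Phi> y)) x" by (rule Wp.hessian_cong[OF assms(3,2)])
  then show ?thesis
    by (simp add: vec_eq_iff congruence_J hessian_comp[OF assms(1,2)] Pi_zero[OF assms(2)])
qed

lemma dif_J:
  assumes "smooth_on D u" "x \<in> W" "\<And>y. y \<in> W \<Longrightarrow> u' y = u (\<Phi> y)"
  shows "Wp.dif u' x = transpose (J x) *v dif u (\<Phi> x)"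
  using pd_cong[of W u' "\<lambda>y. u (\<Phi> y)", OF assms(3,2)]
  by (simp add: Wp.dif_def dif_def pd_comp[OF assms(1,2)] vec_eq_iff matrix_vector_mult_def transpose_def J_def del: transpose_matrix_vector)

lemma gradient_norm_J:
  assumes "smooth_on D u" "x \<in> W" "\<And>y. y \<in> W \<Longrightarrow> u' y = u (\<Phi> y)"
  shows "Wp.dif u' x \<bullet> gradient W GW u' x = dif u (\<Phi> x) \<bullet> gradient D G u (\<Phi> x)"
proof -
  note x = assms(2)
  let ?v = "gradient W GW u' x" and ?d = "dif u (\<Phi> x)"
  have "GW x *v ?v = Wp.dif u' x"
    using Wp.G_inv(1)[OF x] by (simp add: gradient_def Wp.dif_def matrix_vector_mul_assoc)
  then have "transpose (J x) *v (G (\<Phi> x) *v (J x *v ?v)) = transpose (J x) *v ?d"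
    by (simp only: GW_J[OF x] dif_J[OF assms] matrix_vector_mul_assoc matrix_mul_assoc)
  moreover have "transpose (matrix_inv (J x)) ** transpose (J x) = mat 1"
    using arg_cong[OF J_inv(1)[OF x], of transpose] by (simp add: matrix_transpose_mul transpose_mat)
  ultimately have "G (\<Phi> x) *v (J x *v ?v) = ?d"
    by (metis matrix_vector_mul_assoc matrix_vector_mul_lid)
  then have "J x *v ?v = gradient D G u (\<Phi> x)"
    using G_inv(2)[OF map_in[OF x]] unfolding gradient_def dif_def
    by (metis matrix_vector_mul_assoc matrix_vector_mul_lid)
  moreover have "(transpose (J x) *v ?d) \<bullet> ?v = ?d \<bullet> (J x *v ?v)"
    using inner_transpose[of "J x" ?d ?v] by (simp add: inner_commute del: transpose_matrix_vector)
  ultimately show ?thesis by (simp only: dif_J[OF assms])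
qed

end

locale fluid_chart = iso_chart D G W \<Phi> GW + F: fluid_patch D G f \<rho> r + F': fluid_patch W GW f' \<rho>' r
  for D :: "(real^3) set" and G W \<Phi> GW f \<rho> r f' \<rho>' +
  assumes f_eq: "\<And>x. x \<in> W \<Longrightarrow> f' x = f (\<Phi> x)" and rho_eq: "\<And>x. x \<in> W \<Longrightarrow> \<rho>' x = \<rho> (\<Phi> x)"
begin

context fixes x assumes x: "x \<in> W" begin

lemma congruence_lin: "transpose (J x) ** (A + B) ** J x = transpose (J x) ** A ** J x + transpose (J x) ** B ** J x"
  "transpose (J x) ** (c *\<^sub>R A) ** J x = c *\<^sub>R (transpose (J x) ** A ** J x)"
  by (simp_all add: vec_eq_iff congruence_J ip_expand sum.distrib sum_distrib_left algebra_simps)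

text \<open>The field equation expresses \<open>Ric\<close> by the Hessian of \<open>f\<close> and
  the metric, whose transformation is already known. This avoids transforming the curvature tensor
  itself.\<close>

lemma ricci_J: "ricci W GW x = transpose (J x) ** ricci D G (\<Phi> x) ** J x"
proof -
  have "f' x *\<^sub>R ricci W GW x = transpose (J x) ** (f (\<Phi> x) *\<^sub>R ricci D G (\<Phi> x)) ** J x"
    using hessian_J[OF F.smooth_f x f_eq] unfolding F.field_eq[OF map_in[OF x]] F'.field_eq[OF x]
    by (simp add: congruence_lin f_eq rho_eq x GW_J)
  then show ?thesis using F'.f_pos[OF x] by (simp add: congruence_lin f_eq x)
qed

lemma BB_J: "F'.BB x = transpose (J x) ** F.BB (\<Phi> x) ** J x"
proof -
  have "F'.BB x = ricci W GW x + (- (2 * r)) *\<^sub>R GW x" "F.BB (\<Phi> x) = ricci D G (\<Phi> x) + (- (2 * r)) *\<^sub>R G (\<Phi> x)"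
    by (simp_all add: F'.BB_def F.BB_def)
  then show ?thesis by (simp only: congruence_lin ricci_J GW_J[OF x])
qed

lemma Bh_J: "F'.Bh x = matrix_inv (J x) ** (F.Bh (\<Phi> x) ** J x)"
proof -
  have "GW x ** F'.Bh x = F'.BB x"
    using Wp.G_inv(1)[OF x] by (simp add: F'.Bh_def matrix_mul_assoc)
  then have "transpose (J x) ** (G (\<Phi> x) ** (J x ** F'.Bh x)) = transpose (J x) ** (F.BB (\<Phi> x) ** J x)"
    by (simp add: GW_J[OF x] BB_J matrix_mul_assoc)
  then have "G (\<Phi> x) ** (J x ** F'.Bh x) = F.BB (\<Phi> x) ** J x" by (rule transpose_J_cancel[OF x])
  from arg_cong[OF this, of "\<lambda>M. matrix_inv (G (\<Phi> x)) ** M"]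
  have "J x ** F'.Bh x = F.Bh (\<Phi> x) ** J x"
    using G_inv(2)[OF map_in[OF x]] by (simp add: F.Bh_def matrix_mul_assoc)
  from arg_cong[OF this, of "\<lambda>M. matrix_inv (J x) ** M"]
  show ?thesis using J_inv(2)[OF x] by (simp add: matrix_mul_assoc)
qed

text \<open>\<open>Bh\<close> is conjugated by the Jacobian, and the trace of a product of such
  endomorphisms is invariant under conjugation.\<close>

lemma bt_J: "F'.bt x = F.bt (\<Phi> x)" and zz_J: "F'.zz x = F.zz (\<Phi> x)"
proof -
  let ?K = "matrix_inv (J x)" and ?B = "F.Bh (\<Phi> x)"
  have c: "(?K ** (A ** J x)) ** (?K ** (B ** J x)) = ?K ** ((A ** B) ** J x)" for A B
  proof -
    have "(?K ** (A ** J x)) ** (?K ** (B ** J x)) = ?K ** (A ** ((J x ** ?K) ** (B ** J x)))"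
      by (simp only: matrix_mul_assoc)
    then show ?thesis by (simp add: J_inv(1)[OF x] matrix_mul_assoc)
  qed
  have t: "trace (?K ** (A ** J x)) = trace A" for A
    using trace_mul_sym[of ?K "A ** J x"] J_inv(1)[OF x] by (simp add: matrix_mul_assoc[symmetric])
  show "F'.bt x = F.bt (\<Phi> x)" "F'.zz x = F.zz (\<Phi> x)"
    unfolding F'.bt_def F'.zz_def F.bt_def F.zz_def Bh_J c by (rule t)+
qed

lemma ww_J: "F'.ww x = F.ww (\<Phi> x)"
  by (simp add: F.ww_def F'.ww_def bt_J zz_J)

end

end

lemma hs_open_imp_openin: "hs_open V \<Longrightarrow> V \<subseteq> W \<Longrightarrow> hs_open W \<Longrightarrow> openin (top_of_set W) V"
  using openin_subset_trans[of half_space V W] by (simp add: hs_open_def openin_imp_subset)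

lemma hs_open_ball:
  assumes "hs_open V" "x \<in> V"
  obtains e where "e > 0" "half_space \<inter> ball x e \<subseteq> V"
proof -
  obtain U where U: "open U" "V = half_space \<inter> U" using assms(1) hs_open_iff by blast
  then obtain e where "e > 0" "ball x e \<subseteq> U" using assms(2) open_contains_ball by blast
  then show ?thesis using that[of e] U(2) by blast
qed

lemma convex_half_ball: "convex (half_space \<inter> ball x e)"
proof -
  have "half_space = {x :: real^'n::{finite,one}. axis 1 1 \<bullet> x \<ge> 0}" by (simp add: half_space_def inner_axis')
  then have "convex (half_space :: (real^'n::{finite,one}) set)" using convex_halfspace_ge by metis
  then show ?thesis by (rule convex_Int[OF _ convex_ball])
qed

text \<open>The intersection of a ball with the half-space is convex, so a vanishing derivative
  forces constancy at boundary points as well.\<close>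

lemma pd_zero_constant:
  fixes u :: "real^'n::{finite,one} \<Rightarrow> real"
  assumes V: "hs_open V" "x \<in> V" and u: "smooth_on V u" "\<And>y i. y \<in> V \<Longrightarrow> pd V i u y = 0"
  obtains V' where "hs_open V'" "V' \<subseteq> V" "x \<in> V'" "\<And>y. y \<in> V' \<Longrightarrow> u y = u x"
proof -
  obtain e where e: "e > 0" "half_space \<inter> ball x e \<subseteq> V" by (rule hs_open_ball[OF V])
  let ?C = "half_space \<inter> ball x e"
  have C: "hs_open ?C" unfolding hs_open_iff by blast
  have x: "x \<in> ?C" using e(1) V by (auto simp: hs_open_iff)
  have "(u has_derivative (\<lambda>h. 0)) (at y within ?C)" if "y \<in> ?C" for y
  proof -
    have y: "y \<in> V" using that e(2) by blast
    have "(u has_derivative (\<lambda>v. \<Sum>j\<in>UNIV. v $ j * pd V j u y)) (at y within V)"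
      by (rule has_derivative_pd[OF smooth_on_differentiable[OF u(1) y]])
    then show ?thesis using has_derivative_subset[OF _ e(2)] by (simp add: u(2)[OF y])
  qed
  then obtain k where "\<And>y. y \<in> ?C \<Longrightarrow> u y = k"
    using has_derivative_zero_constant[OF convex_half_ball, of x e u] by blast
  then show ?thesis using that[OF C e(2) x] x by simp
qed

context fluid_patch begin

context
  fixes W assumes W: "hs_open W" "W \<subseteq> D"
begin

lemma bt_W: "x \<in> W \<Longrightarrow> fluid_patch.bt W G r x = bt x" and ww_W: "x \<in> W \<Longrightarrow> fluid_patch.ww W G r x = ww x"
proof -
  assume x: "x \<in> W"
  interpret W: fluid_patch W G f \<rho> r by (rule fluid_patch_W[OF W])
  have "W.Bh x = Bh x" by (simp add: W.Bh_def Bh_def W.BB_def BB_def ricci_W[OF W x])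
  then show "W.bt x = bt x" "W.ww x = ww x" by (simp_all add: W.bt_def bt_def W.ww_def ww_def W.zz_def zz_def)
qed

end

definition cD :: "(real^3) set" where "cD = {x \<in> D. bt x \<noteq> 0}"

lemma hs_open_cD: "hs_open cD" "cD \<subseteq> D"
  using hs_open_smooth_preimage[OF smooth_bt, of "- {0}"] by (auto simp: cD_def)

lemma curved_patch_cD: "curved_patch cD G f \<rho> r"
proof -
  interpret W: fluid_patch cD G f \<rho> r by (rule fluid_patch_W[OF hs_open_cD])
  show ?thesis by unfold_locales (use bt_W[OF hs_open_cD] in \<open>auto simp: cD_def\<close>)
qed

end

lemma (in curved_patch) curved_patch_W:
  assumes W: "hs_open W" "W \<subseteq> D" shows "curved_patch W G f \<rho> r"
    and PP_W: "x \<in> W \<Longrightarrow> curved_patch.PP W G r x = PP x"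
proof -
  interpret W: fluid_patch W G f \<rho> r by (rule fluid_patch_W[OF W])
  show "curved_patch W G f \<rho> r" by unfold_locales (use bt_W[OF W] W bt_nz in auto)
  then interpret W: curved_patch W G f \<rho> r .
  have "pd W i W.ww x = pd D i ww x" if "x \<in> W" for x i
    using pd_cong[of W W.ww ww x i] ww_W[OF W] pd_restrict[OF hs_open W that] that by simp
  then show "x \<in> W \<Longrightarrow> W.PP x = PP x"
    using ww_W[OF W] by (simp add: W.PP_def PP_def W.dif_def dif_def gradient_def)
qed

lemma (in fluid_chart) PP_J:
  assumes "curved_patch D G f \<rho> r" "curved_patch W GW f' \<rho>' r" and x: "x \<in> W"
  shows "curved_patch.PP W GW r x = curved_patch.PP D G r (\<Phi> x)"
proof -
  interpret C: curved_patch D G f \<rho> r by fact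
  interpret C': curved_patch W GW f' \<rho>' r by fact
  show ?thesis
    using gradient_norm_J[OF C.smooth_ww x ww_J] by (simp add: C.PP_def C'.PP_def ww_J[OF x])
qed

section \<open>Scalar invariants of the fluid space\<close>

locale fluid_space = riem_manifold M for M :: "('m, 3) riem_structure" +
  fixes f \<rho> \<mu> :: "'m \<Rightarrow> real" and c r :: real
  assumes spf: "static_perfect_fluid M f \<rho> \<mu>"
    and scal: "\<And>d x. d \<in> atlas M \<Longrightarrow> x \<in> patch d \<Longrightarrow> scalar_curvature (patch d) (metric_in M d) x = 6 * r"
    and harm: "harmonic_curvature M"
    and bdry: "mboundary M = {p \<in> topspace (mtop M). f p = c}"
    and regv: "regular_value M f c"
begin

lemma f_pos: "q \<in> topspace (mtop M) \<Longrightarrow> f q > 0"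
  using spf by (simp add: static_perfect_fluid_def)

lemma fluid_eqs:
  assumes d: "d \<in> atlas M" and x: "x \<in> patch d"
  shows "in_chart d f x *\<^sub>R ricci (patch d) (metric_in M d) x
      = hessian (patch d) (metric_in M d) (in_chart d f) x + ((3 * r - in_chart d \<rho> x) / 2 * in_chart d f x) *\<^sub>R metric_in M d x"
    and "laplacian (patch d) (metric_in M d) (in_chart d f) x = (3 * r + 3 * in_chart d \<rho> x) / 2 * in_chart d f x"
    and "in_chart d \<mu> x = 3 * r"
proof -
  note p = chart_inv_mem[OF chart[OF d] x]
  let ?D = "patch d" and ?G = "metric_in M d" and ?p = "chart_inv d x"
  have "?p \<in> fst d \<Longrightarrow> f ?p *\<^sub>R ricci ?D ?G (snd d ?p) = hessian ?D ?G (in_chart d f) (snd d ?p) + ((\<mu> ?p - \<rho> ?p) / 2 * f ?p) *\<^sub>R ?G (snd d ?p) \<and>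
        laplacian ?D ?G (in_chart d f) (snd d ?p) = (\<mu> ?p + 3 * \<rho> ?p) / 2 * f ?p \<and>
        \<mu> ?p = scalar_curvature ?D ?G (snd d ?p) / 2"
    using bspec[OF bspec[OF conjunct2[OF conjunct2[OF conjunct2[OF conjunct2[OF conjunct2[OF
      spf[unfolded static_perfect_fluid_def Let_def]]]]]] d], of ?p] .
  note e = this[OF p(1), unfolded p(2) scal[OF d x]]
  from e show m: "in_chart d \<mu> x = 3 * r" by simp
  show "in_chart d f x *\<^sub>R ricci (patch d) (metric_in M d) x
      = hessian (patch d) (metric_in M d) (in_chart d f) x + ((3 * r - in_chart d \<rho> x) / 2 * in_chart d f x) *\<^sub>R metric_in M d x"
    "laplacian (patch d) (metric_in M d) (in_chart d f) x = (3 * r + 3 * in_chart d \<rho> x) / 2 * in_chart d f x"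
    using e unfolding m by blast+
qed

lemma mu: assumes "q \<in> topspace (mtop M)" shows "\<mu> q = 3 * r"
proof -
  obtain d where d: "d \<in> atlas M" "q \<in> fst d" using chart_ex[OF assms] by blast
  show ?thesis using fluid_eqs(3)[OF d(1), of "snd d q"] d(2) by (simp add: chart_inv_eq[OF chart[OF d(1)]])
qed

lemma fluid: assumes d: "d \<in> atlas M" shows "fluid_patch (patch d) (metric_in M d) (in_chart d f) (in_chart d \<rho>) r"
proof -
  interpret R: riem_patch "patch d" "metric_in M d" by (rule riem_patch[OF d])
  show ?thesis
  proof unfold_locales
    show "smooth_on (patch d) (in_chart d f)" "smooth_on (patch d) (in_chart d \<rho>)"
      using spf d by (auto simp: static_perfect_fluid_def smooth_function_def)
    fix x assume x: "x \<in> patch d"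
    show "in_chart d f x > 0"
      using chart_inv_mem(1)[OF chart[OF d] x] chart_subset[OF chart[OF d]] f_pos by blast
    show "div_riem (patch d) (metric_in M d) k i j x = 0" for k i j
      using harm d x unfolding harmonic_curvature_def by blast
  qed (use d fluid_eqs scal in auto)
qed

lemma fluid_transition:
  assumes a: "a \<in> atlas M" and b: "b \<in> atlas M"
  shows "fluid_chart (patch b) (metric_in M b) (map_dom a b id) (map_rep a b id) (metric_in M a) (in_chart b f) (in_chart b \<rho>) r
     (in_chart a f) (in_chart a \<rho>)"
proof -
  interpret A: fluid_patch "patch a" "metric_in M a" "in_chart a f" "in_chart a \<rho>" r by (rule fluid[OF a])
  interpret B: fluid_patch "patch b" "metric_in M b" "in_chart b f" "in_chart b \<rho>" r by (rule fluid[OF b])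
  interpret I: iso_map "patch b" "metric_in M b" "map_dom a b id" "map_rep a b id" "metric_in M a"
    by (rule iso_map_transition[OF a b])
  have W: "map_dom a b id \<subseteq> patch a" by (auto simp: map_dom_def)
  interpret A': fluid_patch "map_dom a b id" "metric_in M a" "in_chart a f" "in_chart a \<rho>" r
    by (rule A.fluid_patch_W[OF I.hs_open_W W])
  show ?thesis
    by unfold_locales (auto simp: map_rep_def map_dom_iff[OF chart[OF a]] chart_inv_eq[OF chart[OF b]])
qed

definition Bt :: "'m \<Rightarrow> real" where
  "Bt q = (let d = chart_at M q in fluid_patch.bt (patch d) (metric_in M d) r (snd d q))"
definition Ww :: "'m \<Rightarrow> real" where
  "Ww q = (let d = chart_at M q in fluid_patch.ww (patch d) (metric_in M d) r (snd d q))"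
abbreviation cpatch :: "('m, 3) chart \<Rightarrow> (real^3) set" where
  "cpatch d \<equiv> fluid_patch.cD (patch d) (metric_in M d) r"
definition Pp :: "'m \<Rightarrow> real" where
  "Pp q = (let d = chart_at M q in curved_patch.PP (cpatch d) (metric_in M d) r (snd d q))"

lemma transition_scalars:
  assumes a: "a \<in> atlas M" "q \<in> fst a" and b: "b \<in> atlas M" "q \<in> fst b"
  shows "fluid_patch.bt (patch a) (metric_in M a) r (snd a q) = fluid_patch.bt (patch b) (metric_in M b) r (snd b q)" (is "?bt")
    and "fluid_patch.ww (patch a) (metric_in M a) r (snd a q) = fluid_patch.ww (patch b) (metric_in M b) r (snd b q)" (is "?ww")
    and "snd a q \<in> cpatch a \<Longrightarrow>
      curved_patch.PP (cpatch a) (metric_in M a) r (snd a q) = curved_patch.PP (cpatch b) (metric_in M b) r (snd b q)"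
proof -
  let ?W = "map_dom a b id" and ?\<Phi> = "map_rep a b id"
  interpret A: fluid_patch "patch a" "metric_in M a" "in_chart a f" "in_chart a \<rho>" r by (rule fluid[OF a(1)])
  interpret B: fluid_patch "patch b" "metric_in M b" "in_chart b f" "in_chart b \<rho>" r by (rule fluid[OF b(1)])
  interpret T: fluid_chart "patch b" "metric_in M b" ?W ?\<Phi> "metric_in M a" "in_chart b f" "in_chart b \<rho>" r "in_chart a f" "in_chart a \<rho>"
    by (rule fluid_transition[OF a(1) b(1)])
  have Wa: "?W \<subseteq> patch a" by (auto simp: map_dom_def)
  have x: "snd a q \<in> ?W" using a b by (auto simp: map_dom_def)
  have \<Phi>x: "?\<Phi> (snd a q) = snd b q" using a by (simp add: map_rep_def chart_inv_eq[OF chart[OF a(1)]])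
  note W = T.hs_open_W Wa
  show bt: ?bt and ?ww
    using T.bt_J[OF x] T.ww_J[OF x] unfolding \<Phi>x A.bt_W[OF W x] A.ww_W[OF W x] .
  show "curved_patch.PP (cpatch a) (metric_in M a) r (snd a q) = curved_patch.PP (cpatch b) (metric_in M b) r (snd b q)"
    if "snd a q \<in> cpatch a"
  proof -
    \<comment> \<open>The function \<open>PP\<close> exists only where \<open>B \<noteq> 0\<close>.
      The coordinate change is therefore cut down to the points sent into \<open>cpatch b\<close>;
      by invariance of \<open>bt\<close> these lie in \<open>cpatch a\<close>.\<close>
    let ?W' = "{x \<in> ?W. ?\<Phi> x \<in> cpatch b}"
    have W': "hs_open ?W'" "?W' \<subseteq> ?W" using T.hs_open_preimage[OF B.hs_open_cD(1)] by auto
    have sub: "?W' \<subseteq> cpatch a"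
    proof
      fix y assume y: "y \<in> ?W'"
      then have "A.bt y = B.bt (?\<Phi> y)" using T.bt_J[of y] A.bt_W[OF W, of y] by simp
      then show "y \<in> cpatch a" using y Wa by (auto simp: A.cD_def B.cD_def)
    qed
    have x': "snd a q \<in> ?W'" using x that b(2) bt \<Phi>x unfolding A.cD_def B.cD_def by auto
    interpret CA: curved_patch "cpatch a" "metric_in M a" "in_chart a f" "in_chart a \<rho>" r by (rule A.curved_patch_cD)
    interpret CB: curved_patch "cpatch b" "metric_in M b" "in_chart b f" "in_chart b \<rho>" r by (rule B.curved_patch_cD)
    interpret CW: curved_patch ?W' "metric_in M a" "in_chart a f" "in_chart a \<rho>" r by (rule CA.curved_patch_W[OF W'(1) sub])
    interpret I: iso_map "cpatch b" "metric_in M b" ?W' ?\<Phi> "metric_in M a"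
      by (rule T.iso_map_restrict[OF B.hs_open_cD W']) simp
    interpret T': fluid_chart "cpatch b" "metric_in M b" ?W' ?\<Phi> "metric_in M a" "in_chart b f" "in_chart b \<rho>" r "in_chart a f" "in_chart a \<rho>"
      by unfold_locales (use T.f_eq T.rho_eq in auto)
    show ?thesis
      using T'.PP_J[OF CB.curved_patch_axioms CW.curved_patch_axioms x'] CA.PP_W[OF W'(1) sub x'] \<Phi>x by simp
  qed
qed

lemma chart_scalars:
  assumes d: "d \<in> atlas M" "q \<in> fst d"
  shows "Bt q = fluid_patch.bt (patch d) (metric_in M d) r (snd d q)"
    and "Ww q = fluid_patch.ww (patch d) (metric_in M d) r (snd d q)"
    and "Bt q \<noteq> 0 \<longleftrightarrow> snd d q \<in> cpatch d"
    and "Bt q \<noteq> 0 \<Longrightarrow> Pp q = curved_patch.PP (cpatch d) (metric_in M d) r (snd d q)"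
proof -
  have q: "q \<in> topspace (mtop M)" using chart_subset[OF chart[OF d(1)]] d(2) by blast
  note e = chart_at[OF q, THEN conjunct1] chart_at[OF q, THEN conjunct2]
  interpret A: fluid_patch "patch d" "metric_in M d" "in_chart d f" "in_chart d \<rho>" r by (rule fluid[OF d(1)])
  interpret B: fluid_patch "patch (chart_at M q)" "metric_in M (chart_at M q)" "in_chart (chart_at M q) f" "in_chart (chart_at M q) \<rho>" r
    by (rule fluid[OF e(1)])
  note t = transition_scalars[OF e d]
  show 1: "Bt q = A.bt (snd d q)" and "Ww q = A.ww (snd d q)" by (simp_all only: Bt_def Ww_def Let_def t)
  show "Bt q \<noteq> 0 \<longleftrightarrow> snd d q \<in> cpatch d" using d(2) by (simp add: 1 A.cD_def)
  assume "Bt q \<noteq> 0"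
  then have "snd (chart_at M q) q \<in> cpatch (chart_at M q)" using e(2) by (simp add: Bt_def Let_def B.cD_def)
  then show "Pp q = curved_patch.PP (cpatch d) (metric_in M d) r (snd d q)" using t(3) by (simp only: Pp_def Let_def)
qed

lemma continuous_Bt: "continuous_map (mtop M) euclideanreal Bt"
proof (rule continuous_map_in_chart)
  fix d assume d: "d \<in> atlas M"
  interpret A: fluid_patch "patch d" "metric_in M d" "in_chart d f" "in_chart d \<rho>" r by (rule fluid[OF d])
  have "A.bt x = in_chart d Bt x" if "x \<in> patch d" for x
    using chart_scalars(1)[OF d chart_inv_mem(1)[OF chart[OF d] that]] chart_inv_mem(2)[OF chart[OF d] that] by simp
  then show "continuous_on (patch d) (in_chart d Bt)"
    using continuous_on_cong[OF refl, of "patch d" A.bt "in_chart d Bt"] smooth_on_imp_continuous_on[OF A.smooth_bt] by blast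
qed

lemma chart_nhd: "d \<in> atlas M \<Longrightarrow> hs_open V \<Longrightarrow> V \<subseteq> patch d \<Longrightarrow> openin (mtop M) {q \<in> fst d. snd d q \<in> V}"
  using chart_preimage_open[OF chart] hs_open_imp_openin[OF _ _ hs_open_patch[OF chart]] by blast

lemma locally_constant_chart:
  assumes d: "d \<in> atlas M" and V: "hs_open V" "V \<subseteq> patch d" and q: "q \<in> fst d" "snd d q \<in> V"
    and v: "smooth_on V v" "\<And>y i. y \<in> V \<Longrightarrow> pd V i v y = 0" and uv: "\<And>q. q \<in> fst d \<Longrightarrow> snd d q \<in> V \<Longrightarrow> u q = v (snd d q)"
  shows "\<exists>U. openin (mtop M) U \<and> q \<in> U \<and> (\<forall>q'\<in>U. u q' = u q)"
proof -
  obtain V' where V': "hs_open V'" "V' \<subseteq> V" "snd d q \<in> V'" "\<And>y. y \<in> V' \<Longrightarrow> v y = v (snd d q)"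
    using pd_zero_constant[OF V(1) q(2) v] by blast
  have "openin (mtop M) {q \<in> fst d. snd d q \<in> V'}" using chart_nhd[OF d V'(1)] V'(2) V(2) by blast
  moreover have "u q' = u q" if "q' \<in> {q \<in> fst d. snd d q \<in> V'}" for q'
    using uv[of q'] uv[OF q] V'(2,4) that by auto
  ultimately show ?thesis using q(1) V'(3) by blast
qed

definition Al :: "'m \<Rightarrow> real" where "Al q = (\<mu> q + \<rho> q) * f q"

lemma Al_chart:
  assumes "d \<in> atlas M" "q \<in> fst d"
  shows "Al q = fluid_patch.al (in_chart d f) (in_chart d \<rho>) r (snd d q)"
proof -
  interpret A: fluid_patch "patch d" "metric_in M d" "in_chart d f" "in_chart d \<rho>" r by (rule fluid[OF assms(1)])
  have "q \<in> topspace (mtop M)" using chart_subset[OF chart[OF assms(1)]] assms(2) by blast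
  from mu[OF this] show ?thesis by (simp add: Al_def A.al_def chart_inv_eq[OF chart[OF assms(1)] assms(2)])
qed

lemma Al_locally_constant:
  assumes "q \<in> topspace (mtop M)" shows "\<exists>U. openin (mtop M) U \<and> q \<in> U \<and> (\<forall>q'\<in>U. Al q' = Al q)"
proof -
  obtain d where d: "d \<in> atlas M" "q \<in> fst d" using chart_ex[OF assms] by blast
  interpret A: fluid_patch "patch d" "metric_in M d" "in_chart d f" "in_chart d \<rho>" r by (rule fluid[OF d(1)])
  show ?thesis
    by (rule locally_constant_chart[OF d(1) A.hs_open _ d(2) _ A.smooth_al A.pd_al]) (use d Al_chart[OF d(1)] in auto)
qed

definition Ee :: "'m \<Rightarrow> real" where "Ee q = exp (- (1 / 3) * ln ((Ww q)\<^sup>2)) * (Pp q + r + Ww q)"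

lemma Ee_locally_constant:
  assumes "q \<in> topspace (mtop M)" "Bt q \<noteq> 0"
  shows "\<exists>U. openin (mtop M) U \<and> q \<in> U \<and> (\<forall>q'\<in>U. Ee q' = Ee q)"
proof -
  obtain d where d: "d \<in> atlas M" "q \<in> fst d" using chart_ex[OF assms(1)] by blast
  interpret A: fluid_patch "patch d" "metric_in M d" "in_chart d f" "in_chart d \<rho>" r by (rule fluid[OF d(1)])
  interpret C: curved_patch "cpatch d" "metric_in M d" "in_chart d f" "in_chart d \<rho>" r by (rule A.curved_patch_cD)
  show ?thesis
  proof (rule locally_constant_chart[OF d(1) C.hs_open A.hs_open_cD(2) d(2) _ C.smooth_EE C.pd_EE])
    show "snd d q \<in> cpatch d" using chart_scalars(3)[OF d] assms(2) by blast
    fix q' assume q': "q' \<in> fst d" "snd d q' \<in> cpatch d"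
    then show "Ee q' = C.EE (snd d q')"
      using chart_scalars(2,3,4)[OF d(1) q'(1)] A.ww_W[OF A.hs_open_cD q'(2)] by (simp add: Ee_def C.EE_def)
  qed
qed

end

context curved_patch begin

definition sD :: "(real^3) set" where "sD = {x \<in> D. PP x > 0}"

lemma hs_open_sD: "hs_open sD" "sD \<subseteq> D"
  using hs_open_smooth_preimage[OF smooth_PP, of "{0<..}"] by (auto simp: sD_def)

lemma static_vacuum_patch_sD: "static_vacuum_patch sD G f \<rho> r"
proof -
  interpret W: curved_patch sD G f \<rho> r by (rule curved_patch_W(1)[OF hs_open_sD])
  show ?thesis by unfold_locales (use PP_W[OF hs_open_sD] in \<open>auto simp: sD_def\<close>)
qed

end

context fluid_space begin

abbreviation spatch :: "('m, 3) chart \<Rightarrow> (real^3) set" where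
  "spatch d \<equiv> curved_patch.sD (cpatch d) (metric_in M d) r"

text \<open>The global form of \<open>f0\<close>, with \<open>sqrt\<close> in place of an
  exponential of a logarithm: it becomes 0 where \<open>Pp\<close> is 0 and thus stays continuous
  throughout the region \<open>Bt \<noteq> 0\<close>.\<close>

definition F0 :: "'m \<Rightarrow> real" where "F0 q = exp (- (1 / 6) * ln ((Ww q)\<^sup>2)) * sqrt (Pp q)"

lemma curved: "d \<in> atlas M \<Longrightarrow> curved_patch (cpatch d) (metric_in M d) (in_chart d f) (in_chart d \<rho>) r"
  by (rule fluid_patch.curved_patch_cD[OF fluid])

lemma cpatch: "d \<in> atlas M \<Longrightarrow> hs_open (cpatch d)" "d \<in> atlas M \<Longrightarrow> cpatch d \<subseteq> patch d"
  by (rule fluid_patch.hs_open_cD[OF fluid], assumption)+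

lemma spatch: "d \<in> atlas M \<Longrightarrow> hs_open (spatch d)" "d \<in> atlas M \<Longrightarrow> spatch d \<subseteq> cpatch d"
  by (rule curved_patch.hs_open_sD[OF curved], assumption)+

lemma static_vacuum: "d \<in> atlas M \<Longrightarrow> static_vacuum_patch (spatch d) (metric_in M d) (in_chart d f) (in_chart d \<rho>) r"
  by (rule curved_patch.static_vacuum_patch_sD[OF curved])

lemma spatch_iff:
  assumes "d \<in> atlas M" "q \<in> fst d" shows "snd d q \<in> spatch d \<longleftrightarrow> Bt q \<noteq> 0 \<and> Pp q > 0"
proof -
  interpret C: curved_patch "cpatch d" "metric_in M d" "in_chart d f" "in_chart d \<rho>" r by (rule curved[OF assms(1)])
  show ?thesis using chart_scalars(3,4)[OF assms] by (auto simp: C.sD_def)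
qed

lemma F0_chart:
  assumes d: "d \<in> atlas M" "q \<in> fst d" and q: "snd d q \<in> spatch d"
  shows "F0 q = static_vacuum_patch.f0 (spatch d) (metric_in M d) r (snd d q)"
proof -
  interpret A: fluid_patch "patch d" "metric_in M d" "in_chart d f" "in_chart d \<rho>" r by (rule fluid[OF d(1)])
  interpret C: curved_patch "cpatch d" "metric_in M d" "in_chart d f" "in_chart d \<rho>" r by (rule curved[OF d(1)])
  interpret V: static_vacuum_patch "spatch d" "metric_in M d" "in_chart d f" "in_chart d \<rho>" r by (rule static_vacuum[OF d(1)])
  have s: "Bt q \<noteq> 0" "Pp q > 0" using spatch_iff[OF d] q by auto
  have "spatch d \<subseteq> patch d" using spatch(2)[OF d(1)] cpatch(2)[OF d(1)] by blast
  then have "V.ww (snd d q) = Ww q" using A.ww_W[OF spatch(1)[OF d(1)] _ q] chart_scalars(2)[OF d] by simp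
  moreover have "V.PP (snd d q) = Pp q" using C.PP_W[OF spatch[OF d(1)] q] chart_scalars(4)[OF d s(1)] by simp
  ultimately show ?thesis by (simp only: V.f0_def F0_def exp_add exp_half_ln[OF s(2)])
qed

end

section \<open>Free boundary minimal surfaces\<close>

locale free_surface = fluid_space M f \<rho> \<mu> c r + S: compact_surface S
  for M :: "('m, 3) riem_structure" and f \<rho> \<mu> c r and S :: "('s, 2) riem_structure" +
  fixes F :: "'s \<Rightarrow> 'm" and N :: "('m, 3) chart \<Rightarrow> 's \<Rightarrow> real^3" and \<kappa> :: real
  assumes imm: "immersed_surface M S F" and nrm: "unit_normal_field M S F N" and minim: "minimal_surface M S F N"
    and free: "free_boundary M f S F"
    and K_pos: "\<And>p. p \<in> topspace (mtop S) \<Longrightarrow> gauss_curvature_at S p > 0"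
    and kappa: "\<And>p. p \<in> mboundary S \<Longrightarrow> grad_norm_at M f (F p) = \<kappa>"
begin

lemma F_cont: "continuous_map (mtop S) (mtop M) F"
  using imm by (simp add: immersed_surface_def)

lemma F_top: "p \<in> topspace (mtop S) \<Longrightarrow> F p \<in> topspace (mtop M)"
  using F_cont by (auto simp: continuous_map_def)

lemma F_nhd: "openin (mtop M) U \<Longrightarrow> openin (mtop S) {p \<in> topspace (mtop S). F p \<in> U}"
  using openin_continuous_map_preimage[OF F_cont] .

context
  fixes a d assumes a: "a \<in> atlas S" and d: "d \<in> atlas M"
begin

lemma surface_dom: "hs_open (map_dom a d F)" "map_dom a d F \<subseteq> patch a"
  using hs_open_map_dom[OF S.chart[OF a] chart[OF d] F_cont] by (auto simp: map_dom_def)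

lemma surface_smooth: "smooth_on (map_dom a d F) (map_rep a d F)"
  using imm a d by (simp add: immersed_surface_def)

lemma surface_map_patch: "map_patch (patch d) (metric_in M d) (map_dom a d F) (map_rep a d F)"
proof -
  interpret D: riem_patch "patch d" "metric_in M d" by (rule riem_patch[OF d])
  show ?thesis
    by unfold_locales (rule surface_dom surface_smooth map_rep_mem[OF S.chart[OF a]], assumption?)+
qed

lemma surface_jac:
  "x \<in> map_dom a d F \<Longrightarrow> map_jac a d F x $ k $ i = map_patch.tang (map_dom a d F) (map_rep a d F) i x $ k"
  using jacobian_nth_pd[OF surface_smooth surface_dom(1)]
  by (simp add: map_jac_def map_patch.tang_def[OF surface_map_patch] pdv_def)

lemma surface: "surface_patch (patch d) (metric_in M d) (map_dom a d F) (map_rep a d F) (metric_in S a)"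
proof -
  interpret P: map_patch "patch d" "metric_in M d" "map_dom a d F" "map_rep a d F" by (rule surface_map_patch)
  interpret C: riem_patch "patch a" "metric_in S a" by (rule S.riem_patch[OF a])
  interpret W: riem_patch "map_dom a d F" "metric_in S a" by (rule C.riem_patch_W[OF surface_dom])
  show ?thesis
  proof unfold_locales
    fix x i j assume x: "x \<in> map_dom a d F"
    have "metric_in S a x = transpose (map_jac a d F x) ** metric_in M d (map_rep a d F x) ** map_jac a d F x"
      using imm a d x by (simp add: immersed_surface_def)
    then show "metric_in S a x $ i $ j = ip (metric_in M d (map_rep a d F x)) (P.tang i x) (P.tang j x)"
      by (simp add: matrix_mult_nth transpose_def surface_jac[OF x] ip_expand sum_distrib_right) (rule sum.swap)
  qed
qed

context
  fixes p assumes p: "p \<in> fst a" "F p \<in> fst d"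
begin

lemma point_dom: "snd a p \<in> map_dom a d F" "map_rep a d F (snd a p) = snd d (F p)"
  using p by (auto simp: map_dom_def map_rep_def chart_inv_eq[OF S.chart[OF a]])

lemma normal:
  "ip (metric_in M d (snd d (F p))) (N d p) (N d p) = 1"
  "ip (metric_in M d (snd d (F p))) (N d p) (map_jac a d F (snd a p) *v v) = 0"
  "ip (metric_in M d (snd d (F p))) (N d p) (map_patch.tang (map_dom a d F) (map_rep a d F) i (snd a p)) = 0"
proof -
  have n: "ip (metric_in M d (snd d (F p))) (N d p) (N d p) = 1 \<and>
      (\<forall>v. ip (metric_in M d (snd d (F p))) (N d p) (map_jac a d F (snd a p) *v v) = 0)"
    using nrm a d point_dom unfolding unit_normal_field_def Let_def
    by (metis chart_inv_eq[OF S.chart[OF a] p(1)])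
  then show "ip (metric_in M d (snd d (F p))) (N d p) (N d p) = 1"
    "ip (metric_in M d (snd d (F p))) (N d p) (map_jac a d F (snd a p) *v v) = 0" by blast+
  have "map_jac a d F (snd a p) *v axis i 1 = map_patch.tang (map_dom a d F) (map_rep a d F) i (snd a p)"
    by (simp add: vec_eq_iff matrix_vector_mult_basis column_def surface_jac[OF point_dom(1)])
  then show "ip (metric_in M d (snd d (F p))) (N d p) (map_patch.tang (map_dom a d F) (map_rep a d F) i (snd a p)) = 0"
    using n by metis
qed

lemma sff_Aff: "sff M F N a d (snd a p) = surface_patch.Aff (patch d) (metric_in M d) (map_dom a d F) (map_rep a d F) (snd a p) (N d p)"
proof -
  interpret P: surface_patch "patch d" "metric_in M d" "map_dom a d F" "map_rep a d F" "metric_in S a" by (rule surface)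
  let ?x = "snd a p"
  have "(\<Sum>i\<in>UNIV. \<Sum>j\<in>UNIV. christoffel (patch d) (metric_in M d) k i j y * u $ i * w $ j) = (P.Gam y u *v w) $ k" for k y u w
    by (subst sum.swap) (simp add: P.Gam_def matrix_vector_mult_def sum_distrib_right sum_distrib_left mult_ac)
  then have "(\<chi> k. pd (map_dom a d F) i (pd (map_dom a d F) j (\<lambda>y. map_rep a d F y $ k)) ?x
      + (\<Sum>l\<in>UNIV. \<Sum>m\<in>UNIV. christoffel (patch d) (metric_in M d) k l m (map_rep a d F ?x)
          * pd (map_dom a d F) i (\<lambda>y. map_rep a d F y $ l) ?x * pd (map_dom a d F) j (\<lambda>y. map_rep a d F y $ m) ?x))
      = P.cd i (P.tang j) ?x" for i j
  proof -
    have t: "P.tang i y $ l = pd (map_dom a d F) i (\<lambda>y. map_rep a d F y $ l) y" for i y l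
      by (simp add: P.tang_def pdv_def)
    have "(\<lambda>z. P.tang j z $ k) = pd (map_dom a d F) j (\<lambda>y. map_rep a d F y $ k)" for k
      by (simp add: t fun_eq_iff)
    then show ?thesis
      unfolding t[symmetric] \<open>\<And>k y u w. (\<Sum>i\<in>UNIV. \<Sum>j\<in>UNIV. christoffel (patch d) (metric_in M d) k i j y * u $ i * w $ j) = (P.Gam y u *v w) $ k\<close>
      by (simp add: vec_eq_iff P.cd_def pdv_def)
  qed
  then show ?thesis
    by (simp only: sff_def P.Aff_def Let_def chart_inv_eq[OF S.chart[OF a] p(1)])
qed

lemma min_Aff:
  "(\<Sum>i\<in>UNIV. \<Sum>j\<in>UNIV. matrix_inv (metric_in S a (snd a p)) $ i $ j *
    surface_patch.Aff (patch d) (metric_in M d) (map_dom a d F) (map_rep a d F) (snd a p) (N d p) $ i $ j) = 0"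
  using minim a d point_dom(1) unfolding minimal_surface_def sff_Aff[symmetric] by blast

lemma surface_local:
  assumes V: "hs_open V" "V \<subseteq> patch d" "snd d (F p) \<in> V" and u: "smooth_on V u" and U: "openin (mtop S) U" "p \<in> U"
    and \<phi>: "\<And>q. q \<in> U \<Longrightarrow> F q \<in> fst d \<Longrightarrow> snd d (F q) \<in> V \<Longrightarrow> \<phi> q = u (snd d (F q))"
  shows "\<exists>Z. openin (top_of_set (patch a)) Z \<and> snd a p \<in> Z \<and> smooth_on Z (in_chart a \<phi>)" (is ?sm)
    and "laplacian (patch a) (metric_in S a) (in_chart a \<phi>) (snd a p)
      = laplacian V (metric_in M d) u (snd d (F p)) - ip (hessian V (metric_in M d) u (snd d (F p))) (N d p) (N d p)" (is ?lap)
    and "pd (patch a) i (in_chart a \<phi>) (snd a p) = (\<Sum>k\<in>UNIV. map_jac a d F (snd a p) $ k $ i * pd V k u (snd d (F p)))" (is ?pd)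
proof -
  let ?W = "map_dom a d F" and ?\<Phi> = "map_rep a d F" and ?x = "snd a p"
  interpret P: surface_patch "patch d" "metric_in M d" ?W ?\<Phi> "metric_in S a" by (rule surface)
  interpret C: riem_patch "patch a" "metric_in S a" by (rule S.riem_patch[OF a])
  define Z where "Z = {x \<in> ?W. ?\<Phi> x \<in> V} \<inter> snd a ` (fst a \<inter> U)"
  have Z: "hs_open Z" "Z \<subseteq> ?W"
    unfolding Z_def using hs_open_Int[OF P.hs_open_preimage[OF V(1)] chart_image_open[OF S.chart[OF a] U(1)]] by auto
  have Za: "Z \<subseteq> patch a" using Z(2) surface_dom(2) by blast
  have ZV: "?\<Phi> x \<in> V" if "x \<in> Z" for x using that by (simp add: Z_def)
  have xZ: "?x \<in> Z" using point_dom V(3) U(2) p by (auto simp: Z_def)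
  have e: "in_chart a \<phi> x = u (?\<Phi> x)" if "x \<in> Z" for x
  proof -
    have "x \<in> snd a ` (fst a \<inter> U)" using that by (simp add: Z_def)
    then obtain q where q: "q \<in> fst a" "q \<in> U" "x = snd a q" by blast
    have i: "chart_inv a x = q" using q chart_inv_eq[OF S.chart[OF a]] by simp
    have "F q \<in> fst d" using that Z(2) map_dom_iff[OF S.chart[OF a], of x d F] i by auto
    moreover have "?\<Phi> x = snd d (F q)" by (simp add: map_rep_def i)
    ultimately show ?thesis using \<phi>[OF q(2)] ZV[OF that] i by simp
  qed
  interpret Q: surface_patch V "metric_in M d" Z ?\<Phi> "metric_in S a"
    by (rule P.surface_patch_restrict[OF V(1,2) Z ZV])
  have t: "Q.tang k ?x = P.tang k ?x" for k by (rule P.tang_restrict[OF V(1,2) Z ZV xZ])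
  show ?sm
    using hs_open_imp_openin[OF Z(1) Za C.hs_open] xZ smooth_on_cong[OF Q.smooth_comp[OF u]] e by metis
  have "laplacian (patch a) (metric_in S a) (in_chart a \<phi>) ?x = laplacian Z (metric_in S a) (in_chart a \<phi>) ?x"
    by (rule C.laplacian_W[OF Z(1) Za xZ, symmetric])
  also have "\<dots> = laplacian Z (metric_in S a) (\<lambda>y. u (?\<Phi> y)) ?x"
    unfolding laplacian_def using Q.Wp.hessian_cong[OF e xZ] by simp
  also have "\<dots> = laplacian V (metric_in M d) u (snd d (F p)) - ip (hessian V (metric_in M d) u (snd d (F p))) (N d p) (N d p)"
    unfolding point_dom(2)[symmetric]
    by (rule Q.laplacian_surface[OF xZ _ _ _ u])
      (use normal min_Aff point_dom(2) t P.Aff_restrict[OF V(1,2) Z ZV xZ] in auto)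
  finally show ?lap .
  have "pd (patch a) i (in_chart a \<phi>) ?x = pd Z i (in_chart a \<phi>) ?x"
    by (rule pd_restrict[OF C.hs_open Z(1) Za xZ, symmetric])
  also have "\<dots> = pd Z i (\<lambda>y. u (?\<Phi> y)) ?x" by (rule pd_cong[OF e xZ])
  also have "\<dots> = (\<Sum>k\<in>UNIV. Q.tang i ?x $ k * pd V k u (?\<Phi> ?x))" by (rule Q.pd_comp[OF u xZ])
  finally show ?pd by (simp add: t point_dom surface_jac)
qed

lemma gauss_local:
  defines "A \<equiv> sff M F N a d (snd a p)" and "H \<equiv> matrix_inv (metric_in S a (snd a p))"
  defines "N2 \<equiv> \<Sum>i\<in>UNIV. \<Sum>j\<in>UNIV. \<Sum>i'\<in>UNIV. \<Sum>j'\<in>UNIV. H $ i $ i' * H $ j $ j' * A $ i $ j * A $ i' $ j'"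
  shows "gauss_curvature (patch a) (metric_in S a) (snd a p)
      = 3 * r - ip (ricci (patch d) (metric_in M d) (snd d (F p))) (N d p) (N d p) - N2 / 2" and "N2 \<ge> 0"
proof -
  interpret P: fluid_patch "patch d" "metric_in M d" "in_chart d f" "in_chart d \<rho>" r by (rule fluid[OF d])
  interpret C: riem_patch "patch a" "metric_in S a" by (rule S.riem_patch[OF a])
  have K: "gauss_curvature (patch a) (metric_in S a) (snd a p) = gauss_curvature (map_dom a d F) (metric_in S a) (snd a p)"
    by (simp add: gauss_curvature_def C.riem_W[OF surface_dom point_dom(1)])
  note g = P.gauss_surface[OF surface point_dom(1), of "N d p", unfolded point_dom(2), OF normal(1) normal(3) min_Aff]
  show "gauss_curvature (patch a) (metric_in S a) (snd a p)
      = 3 * r - ip (ricci (patch d) (metric_in M d) (snd d (F p))) (N d p) (N d p) - N2 / 2" "N2 \<ge> 0"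
    unfolding K N2_def A_def H_def sff_Aff using g by simp_all
qed

end

end

end

section \<open>Scalars along the surface\<close>

context free_surface begin

abbreviation RN :: "'s \<Rightarrow> real" where "RN \<equiv> ricci_normal_at M F N"
abbreviation A2 :: "'s \<Rightarrow> real" where "A2 \<equiv> sff_norm_sq_at M S F N"

lemma S_chart_at: "p \<in> topspace (mtop S) \<Longrightarrow> chart_at S p \<in> atlas S" "p \<in> topspace (mtop S) \<Longrightarrow> p \<in> fst (chart_at S p)"
  using S.chart_at by blast+

lemma M_chart_at: "p \<in> topspace (mtop S) \<Longrightarrow> chart_at M (F p) \<in> atlas M"
  "p \<in> topspace (mtop S) \<Longrightarrow> F p \<in> fst (chart_at M (F p))"
  using chart_at[OF F_top] by blast+

text \<open>The Gauss equation reads \<open>K = 3 r - RN - A2 / 2\<close> with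
  \<open>A2 \<ge> 0\<close>. Here positive Gauss curvature enters the argument.\<close>

lemma A2_nonneg: "p \<in> topspace (mtop S) \<Longrightarrow> A2 p \<ge> 0"
  and RN_less: "p \<in> topspace (mtop S) \<Longrightarrow> RN p < 3 * r"
proof -
  assume p: "p \<in> topspace (mtop S)"
  note g = gauss_local[OF S_chart_at(1)[OF p] M_chart_at(1)[OF p] S_chart_at(2)[OF p] M_chart_at(2)[OF p]]
  have A2: "A2 p = (let A = sff M F N (chart_at S p) (chart_at M (F p)) (snd (chart_at S p) p); H = matrix_inv (metric_in S (chart_at S p) (snd (chart_at S p) p)) in
    \<Sum>i\<in>UNIV. \<Sum>j\<in>UNIV. \<Sum>i'\<in>UNIV. \<Sum>j'\<in>UNIV. H $ i $ i' * H $ j $ j' * A $ i $ j * A $ i' $ j')"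
    by (simp only: sff_norm_sq_at_def Let_def)
  show n: "A2 p \<ge> 0" using g(2) unfolding A2 Let_def .
  have "gauss_curvature_at S p = 3 * r - RN p - A2 p / 2"
    using g(1) unfolding A2 Let_def gauss_curvature_at_def ricci_normal_at_def .
  then show "RN p < 3 * r" using K_pos[OF p] n by simp
qed

lemma RN_chart:
  assumes p: "p \<in> topspace (mtop S)" and d: "d \<in> atlas M" "F p \<in> fst d"
  shows "RN p = ip (ricci (patch d) (metric_in M d) (snd d (F p))) (N d p) (N d p)"
proof -
  define a where "a = chart_at M (F p)"
  note a = M_chart_at[OF p, folded a_def]
  let ?W = "map_dom a d id" and ?x = "snd a (F p)"
  interpret A: riem_patch "patch a" "metric_in M a" by (rule riem_patch[OF a(1)])
  interpret T: fluid_chart "patch d" "metric_in M d" ?W "map_rep a d id" "metric_in M a" "in_chart d f" "in_chart d \<rho>" r "in_chart a f" "in_chart a \<rho>"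
    by (rule fluid_transition[OF a(1) d(1)])
  have W: "?W \<subseteq> patch a" by (auto simp: map_dom_def)
  have x: "?x \<in> ?W" using a d by (auto simp: map_dom_def)
  have \<Phi>x: "map_rep a d id ?x = snd d (F p)" using a by (simp add: map_rep_def chart_inv_eq[OF chart[OF a(1)]])
  have J: "map_jac a d id ?x = T.J ?x"
    using jacobian_nth_pd[OF T.smooth_map T.hs_open_W x] by (simp add: vec_eq_iff map_jac_def T.J_def T.tang_def pdv_def)
  have N: "N d p = T.J ?x *v N a p"
    using nrm a d p unfolding unit_normal_field_def J[symmetric] by blast
  have "ricci (patch a) (metric_in M a) ?x = transpose (T.J ?x) ** ricci (patch d) (metric_in M d) (snd d (F p)) ** T.J ?x"
    using T.ricci_J[OF x] unfolding A.ricci_W[OF T.hs_open_W W x] \<Phi>x .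
  moreover have "ip (transpose L ** R ** L) v v = ip R (L *v v) (L *v v)" for L R :: "real^3^3" and v
    using inner_transpose[of L "R *v (L *v v)" v]
    by (simp add: ip_def inner_commute matrix_vector_mul_assoc[symmetric] del: transpose_matrix_vector)
  ultimately show ?thesis by (simp add: ricci_normal_at_def Let_def a_def[symmetric] N)
qed

lemma continuous_RN: "continuous_map (mtop S) euclideanreal RN"
proof (rule continuous_map_locally)
  fix p assume p: "p \<in> topspace (mtop S)"
  obtain a where a: "a \<in> atlas S" "p \<in> fst a" using S.chart_ex[OF p] by blast
  obtain d where d: "d \<in> atlas M" "F p \<in> fst d" using chart_ex[OF F_top[OF p]] by blast
  interpret P: surface_patch "patch d" "metric_in M d" "map_dom a d F" "map_rep a d F" "metric_in S a" by (rule surface[OF a(1) d(1)])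
  interpret Fl: fluid_patch "patch d" "metric_in M d" "in_chart d f" "in_chart d \<rho>" r by (rule fluid[OF d(1)])
  note ch = S.chart[OF a(1)]
  define U where "U = {q \<in> fst a. snd a q \<in> map_dom a d F}"
  have U: "openin (mtop S) U"
    unfolding U_def by (rule chart_preimage_open[OF ch hs_open_imp_openin[OF surface_dom[OF a(1) d(1)] hs_open_patch[OF ch]]])
  have pU: "p \<in> U" using a d by (auto simp: U_def map_dom_def)
  have sN: "smv (map_dom a d F) (in_chart a (N d))"
    using nrm a(1) d(1) unfolding unit_normal_field_def by (auto simp: smv_def intro: smooth_on_nth)
  have "smm (map_dom a d F) (\<lambda>x. ricci (patch d) (metric_in M d) (map_rep a d F x))"
    using Fl.smm_ricci by (auto simp: smm_def intro: P.smooth_comp)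
  then have "smooth_on (map_dom a d F) (\<lambda>x. ip (ricci (patch d) (metric_in M d) (map_rep a d F x)) (in_chart a (N d) x) (in_chart a (N d) x))"
    by (intro smooth_on_ip sN)
  note c = smooth_on_imp_continuous_on[OF this]
  have "continuous_map (subtopology (mtop S) U) (top_of_set (map_dom a d F)) (snd a)"
  proof -
    have "continuous_map (subtopology (mtop S) U) (top_of_set (patch a)) (snd a)"
      using continuous_map_from_subtopology_mono[OF continuous_map_chart[OF ch], of U] by (auto simp: U_def)
    then show ?thesis using pU surface_dom(2)[OF a(1) d(1)] by (auto simp: continuous_map_in_subtopology U_def)
  qed
  from continuous_map_compose[OF this, of euclideanreal] c
  have "continuous_map (subtopology (mtop S) U) euclideanreal
      ((\<lambda>x. ip (ricci (patch d) (metric_in M d) (map_rep a d F x)) (in_chart a (N d) x) (in_chart a (N d) x)) \<circ> snd a)"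
    by simp
  then have "continuous_map (subtopology (mtop S) U) euclideanreal RN"
  proof (rule continuous_map_eq)
    fix q assume "q \<in> topspace (subtopology (mtop S) U)"
    then have q: "q \<in> topspace (mtop S)" "q \<in> fst a" "snd a q \<in> map_dom a d F" by (auto simp: U_def)
    have "F q \<in> fst d" using q(3) map_dom_iff[OF ch, of _ d F] by (simp add: chart_inv_eq[OF ch q(2)])
    from RN_chart[OF q(1) d(1) this]
    show "((\<lambda>x. ip (ricci (patch d) (metric_in M d) (map_rep a d F x)) (in_chart a (N d) x) (in_chart a (N d) x)) \<circ> snd a) q = RN q"
      by (simp add: map_rep_def chart_inv_eq[OF ch q(2)])
  qed
  then show "\<exists>U. openin (mtop S) U \<and> p \<in> U \<and> continuous_map (subtopology (mtop S) U) euclideanreal RN"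
    using U pU by blast
qed

section \<open>Functions on the surface given by functions on the ambient space\<close>

text \<open>Near \<open>p\<close> the function on the surface is the restriction of an ambient
  function \<open>u\<close>. The domain \<open>V\<close> may be smaller than the patch, since
  \<open>f0\<close> is smooth only where \<open>P > 0\<close>, and \<open>u\<close> may change from
  point to point, as for functions cut off on a clopen set.\<close>

definition lifts :: "('s \<Rightarrow> real) \<Rightarrow> 's \<Rightarrow> ('m, 3) chart \<Rightarrow> (real^3) set \<Rightarrow> (real^3 \<Rightarrow> real) \<Rightarrow> bool" where
  "lifts \<phi> p d V u \<longleftrightarrow> d \<in> atlas M \<and> F p \<in> fst d \<and> hs_open V \<and> V \<subseteq> patch d \<and> snd d (F p) \<in> V \<and> smooth_on V u \<and>
    (\<exists>U. openin (mtop S) U \<and> p \<in> U \<and> (\<forall>q\<in>U. F q \<in> fst d \<longrightarrow> snd d (F q) \<in> V \<longrightarrow> \<phi> q = u (snd d (F q))))"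

lemma lifts_chart:
  assumes "lifts \<phi> p d V u" and a: "a \<in> atlas S" "p \<in> fst a"
  shows "\<exists>Z. openin (top_of_set (patch a)) Z \<and> snd a p \<in> Z \<and> smooth_on Z (in_chart a \<phi>)"
    and "laplacian (patch a) (metric_in S a) (in_chart a \<phi>) (snd a p)
      = laplacian V (metric_in M d) u (snd d (F p)) - ip (hessian V (metric_in M d) u (snd d (F p))) (N d p) (N d p)"
    and "pd (patch a) i (in_chart a \<phi>) (snd a p) = (\<Sum>k\<in>UNIV. map_jac a d F (snd a p) $ k $ i * pd V k u (snd d (F p)))"
proof -
  obtain U where l: "d \<in> atlas M" "F p \<in> fst d" "hs_open V" "V \<subseteq> patch d" "snd d (F p) \<in> V" "smooth_on V u"
    and U: "openin (mtop S) U" "p \<in> U" "\<And>q. q \<in> U \<Longrightarrow> F q \<in> fst d \<Longrightarrow> snd d (F q) \<in> V \<Longrightarrow> \<phi> q = u (snd d (F q))"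
    using assms(1) unfolding lifts_def by blast
  note s = surface_local[where \<phi>=\<phi> and u=u, OF a(1) l(1) a(2) l(2-6) U]
  show "\<exists>Z. openin (top_of_set (patch a)) Z \<and> snd a p \<in> Z \<and> smooth_on Z (in_chart a \<phi>)" by (rule s(1))
  show "laplacian (patch a) (metric_in S a) (in_chart a \<phi>) (snd a p)
      = laplacian V (metric_in M d) u (snd d (F p)) - ip (hessian V (metric_in M d) u (snd d (F p))) (N d p) (N d p)" by (rule s(2))
  show "pd (patch a) i (in_chart a \<phi>) (snd a p) = (\<Sum>k\<in>UNIV. map_jac a d F (snd a p) $ k $ i * pd V k u (snd d (F p)))" by (rule s(3))
qed

lemma smooth_function_lifts:
  assumes "\<And>p. p \<in> topspace (mtop S) \<Longrightarrow> \<exists>d V u. lifts \<phi> p d V u" shows "smooth_function S \<phi>"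
  unfolding smooth_function_def
proof
  fix a assume a: "a \<in> atlas S"
  show "smooth_on (patch a) (in_chart a \<phi>)"
  proof (rule smooth_on_local)
    fix x assume "x \<in> patch a"
    then obtain p where p: "p \<in> fst a" "x = snd a p" by blast
    then have "p \<in> topspace (mtop S)" using chart_subset[OF S.chart[OF a]] by blast
    then obtain d V u where "lifts \<phi> p d V u" using assms by blast
    from lifts_chart(1)[OF this a p(1)] show "\<exists>W. x \<in> W \<and> openin (top_of_set (patch a)) W \<and> smooth_on W (in_chart a \<phi>)"
      unfolding p(2) by blast
  qed
qed

lemma laplacian_lifts:
  assumes p: "p \<in> topspace (mtop S)" and l: "lifts \<phi> p d V u"
  shows "laplacian_at S \<phi> p = laplacian V (metric_in M d) u (snd d (F p)) - ip (hessian V (metric_in M d) u (snd d (F p))) (N d p) (N d p)"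
  using lifts_chart(2)[OF l S_chart_at[OF p]] by (simp add: laplacian_at_def)

text \<open>The chain rule has the extra term \<open>c2\<close> times the squared gradient of
  \<open>\<psi>\<close>, which is nonnegative for a convex \<open>h\<close>. A lower bound suffices,
  because the interior integrand only has to be nonnegative.\<close>

lemma laplacian_at_compose:
  assumes p: "p \<in> topspace (mtop S)" and l: "lifts \<psi> p d V u" and U: "openin (mtop S) U" "p \<in> U" "\<And>q. q \<in> U \<Longrightarrow> \<phi> q = h (\<psi> q)"
    and h: "\<And>t. (h has_real_derivative h1 t) (at t)" "(h1 has_real_derivative c2) (at (\<psi> p))" "c2 \<ge> 0"
    and sh1: "\<And>Z w. smooth_on Z w \<Longrightarrow> smooth_on Z (\<lambda>x :: real^2. h1 (w x))"
  shows "laplacian_at S \<phi> p \<ge> h1 (\<psi> p) * laplacian_at S \<psi> p"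
proof -
  define a where "a = chart_at S p"
  note a = S_chart_at[OF p, folded a_def]
  note ch = S.chart[OF a(1)]
  let ?x = "snd a p"
  interpret C: riem_patch "patch a" "metric_in S a" by (rule S.riem_patch[OF a(1)])
  obtain Z0 where Z0: "openin (top_of_set (patch a)) Z0" "?x \<in> Z0" "smooth_on Z0 (in_chart a \<psi>)"
    using lifts_chart(1)[OF l a] by blast
  define Z where "Z = Z0 \<inter> snd a ` (fst a \<inter> U)"
  have Z: "hs_open Z" "Z \<subseteq> patch a" "?x \<in> Z"
    unfolding Z_def using hs_open_Int[OF hs_open_openin[OF C.hs_open Z0(1)] chart_image_open[OF ch U(1)]] Z0(2) a(2) U(2) by auto
  interpret W: riem_patch Z "metric_in S a" by (rule C.riem_patch_W[OF Z(1,2)])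
  have s: "smooth_on Z (in_chart a \<psi>)" by (rule smooth_on_subset[OF Z0(3)]) (simp add: Z_def)
  have e: "in_chart a \<phi> x = h (in_chart a \<psi> x)" if "x \<in> Z" for x
  proof -
    have "x \<in> snd a ` (fst a \<inter> U)" using that by (simp add: Z_def)
    then obtain q where "q \<in> fst a" "q \<in> U" "x = snd a q" by blast
    then show ?thesis using U(3) by (simp add: chart_inv_eq[OF ch])
  qed
  have \<psi>p: "in_chart a \<psi> ?x = \<psi> p" by (simp add: chart_inv_eq[OF ch a(2)])
  have "laplacian_at S \<phi> p = laplacian Z (metric_in S a) (in_chart a \<phi>) ?x"
    by (simp add: laplacian_at_def a_def[symmetric] C.laplacian_W[OF Z])
  also have "\<dots> = laplacian Z (metric_in S a) (\<lambda>x. h (in_chart a \<psi> x)) ?x"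
    using W.hessian_cong[OF e Z(3)] by (simp add: laplacian_def)
  also have "\<dots> = h1 (\<psi> p) * laplacian Z (metric_in S a) (in_chart a \<psi>) ?x
      + c2 * (W.dif (in_chart a \<psi>) ?x \<bullet> gradient Z (metric_in S a) (in_chart a \<psi>) ?x)"
    using W.laplacian_compose[OF s sh1[OF s] Z(3) h(1)] h(2) unfolding \<psi>p by blast
  also have "laplacian Z (metric_in S a) (in_chart a \<psi>) ?x = laplacian_at S \<psi> p"
    by (simp add: laplacian_at_def a_def[symmetric] C.laplacian_W[OF Z])
  finally show ?thesis using mult_nonneg_nonneg[OF h(3) W.dif_gradient_nonneg[OF Z(3), of "in_chart a \<psi>"]] by simp
qed

lemma hessian_f_normal:
  assumes p: "p \<in> topspace (mtop S)" and d: "d \<in> atlas M" "F p \<in> fst d"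
  shows "ip (hessian (patch d) (metric_in M d) (in_chart d f) (snd d (F p))) (N d p) (N d p) = f (F p) * (RN p - 3 * r) + Al (F p) / 2"
proof -
  interpret Fl: fluid_patch "patch d" "metric_in M d" "in_chart d f" "in_chart d \<rho>" r by (rule fluid[OF d(1)])
  have y: "snd d (F p) \<in> patch d" using d by blast
  obtain a where a: "a \<in> atlas S" "p \<in> fst a" using S.chart_ex[OF p] by blast
  have e: "hessian (patch d) (metric_in M d) (in_chart d f) (snd d (F p)) =
      f (F p) *\<^sub>R ricci (patch d) (metric_in M d) (snd d (F p)) + (- ((3 * r - \<rho> (F p)) / 2 * f (F p))) *\<^sub>R metric_in M d (snd d (F p))"
    using Fl.field_eq[OF y] by (simp add: chart_inv_eq[OF chart[OF d(1)] d(2)])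
  have lin: "ip (s *\<^sub>R A + t *\<^sub>R B) v v = s * ip A v v + t * ip B v v" for s t A B and v :: "real^3"
    by (simp add: ip_expand sum.distrib sum_distrib_left algebra_simps)
  show ?thesis
    unfolding e lin RN_chart[OF p d, symmetric] normal(1)[OF a(1) d(1) a(2) d(2)]
    by (simp add: Al_def mu[OF F_top[OF p]] field_simps)
qed

text \<open>The Laplacian on the surface is \<open>\<Delta> f\<close> minus
  \<open>Hess f(N, N)\<close>; the terms with \<open>\<mu>\<close> and \<open>\<rho>\<close> combine
  to \<open>a\<close> and the Ricci term survives with a negative sign. In the Jacobi operator the
  latter cancels.\<close>

lemma laplacian_f:
  assumes p: "p \<in> topspace (mtop S)" and U: "openin (mtop S) U" "p \<in> U" "\<And>q. q \<in> U \<Longrightarrow> \<phi> q = f (F q)"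
  shows "lifts \<phi> p (chart_at M (F p)) (patch (chart_at M (F p))) (in_chart (chart_at M (F p)) f)"
    and "laplacian_at S \<phi> p = Al (F p) - RN p * f (F p)"
proof -
  define d where "d = chart_at M (F p)"
  note d = M_chart_at[OF p, folded d_def]
  interpret Fl: fluid_patch "patch d" "metric_in M d" "in_chart d f" "in_chart d \<rho>" r by (rule fluid[OF d(1)])
  have l: "lifts \<phi> p d (patch d) (in_chart d f)"
    unfolding lifts_def using d Fl.hs_open Fl.smooth_f U by (auto simp: chart_inv_eq[OF chart[OF d(1)]])
  then show "lifts \<phi> p (chart_at M (F p)) (patch (chart_at M (F p))) (in_chart (chart_at M (F p)) f)" by (simp only: d_def)
  have y: "snd d (F p) \<in> patch d" using d by blast
  show "laplacian_at S \<phi> p = Al (F p) - RN p * f (F p)"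
    unfolding laplacian_lifts[OF p l] hessian_f_normal[OF p d] Fl.lap_eq[OF y]
    by (simp add: Al_def mu[OF F_top[OF p]] chart_inv_eq[OF chart[OF d(1)] d(2)] field_simps)
qed

lemma laplacian_const:
  assumes p: "p \<in> topspace (mtop S)" and U: "openin (mtop S) U" "p \<in> U" "\<And>q. q \<in> U \<Longrightarrow> \<phi> q = k"
  shows "lifts \<phi> p (chart_at M (F p)) (patch (chart_at M (F p))) (\<lambda>x. k)"
    and "laplacian_at S \<phi> p = 0"
proof -
  define d where "d = chart_at M (F p)"
  note d = M_chart_at[OF p, folded d_def]
  interpret Fl: fluid_patch "patch d" "metric_in M d" "in_chart d f" "in_chart d \<rho>" r by (rule fluid[OF d(1)])
  have l: "lifts \<phi> p d (patch d) (\<lambda>x. k)"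
    unfolding lifts_def using d Fl.hs_open U by (auto intro: smooth_intros)
  then show "lifts \<phi> p (chart_at M (F p)) (patch (chart_at M (F p))) (\<lambda>x. k)" by (simp only: d_def)
  have y: "snd d (F p) \<in> patch d" using d by blast
  have "pd (patch d) i (pd (patch d) j (\<lambda>x. k)) (snd d (F p)) = 0" for i j
    using pd_cong[of "patch d" "pd (patch d) j (\<lambda>x. k)" "\<lambda>x. 0" "snd d (F p)" i] y Fl.hs_open by simp
  then have "hessian (patch d) (metric_in M d) (\<lambda>x. k) (snd d (F p)) = 0"
    by (simp add: hessian_def vec_eq_iff Fl.hs_open y)
  then show "laplacian_at S \<phi> p = 0"
    unfolding laplacian_lifts[OF p l] by (simp add: laplacian_def ip_def)
qed

text \<open>For \<open>f0\<close> the ambient trace is \<open>-3 r f0\<close> and the normal part of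
  the Hessian is \<open>f0 (RN - 3 r)\<close>, so their difference is \<open>-RN f0\<close> with no
  constant. The term with \<open>Al\<close> comes from \<open>f\<close> alone and is positive when
  \<open>a < 0\<close>.\<close>

lemma laplacian_F0:
  assumes p: "p \<in> topspace (mtop S)" and s: "Bt (F p) \<noteq> 0" "Pp (F p) > 0"
  defines "d \<equiv> chart_at M (F p)"
  shows "lifts (\<lambda>q. F0 (F q) - e * f (F q)) p d (spatch d)
      (\<lambda>x. static_vacuum_patch.f0 (spatch d) (metric_in M d) r x - e * in_chart d f x)"
    and "laplacian_at S (\<lambda>q. F0 (F q) - e * f (F q)) p = - RN p * (F0 (F p) - e * f (F p)) - e * Al (F p)"
proof -
  note d = M_chart_at[OF p, folded d_def]
  interpret Fl: fluid_patch "patch d" "metric_in M d" "in_chart d f" "in_chart d \<rho>" r by (rule fluid[OF d(1)])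
  interpret V: static_vacuum_patch "spatch d" "metric_in M d" "in_chart d f" "in_chart d \<rho>" r by (rule static_vacuum[OF d(1)])
  have sub: "spatch d \<subseteq> patch d" using spatch(2)[OF d(1)] cpatch(2)[OF d(1)] by blast
  let ?y = "snd d (F p)"
  have y: "?y \<in> spatch d" using spatch_iff[OF d] s by simp
  have yp: "?y \<in> patch d" using sub y by blast
  let ?u = "\<lambda>x. V.f0 x - e * in_chart d f x"
  have sm: "smooth_on (spatch d) ?u" by (intro smooth_intros V.smooth_f0 V.smooth_f)
  show l: "lifts (\<lambda>q. F0 (F q) - e * f (F q)) p d (spatch d) ?u"
    unfolding lifts_def
  proof (intro conjI exI[of _ "topspace (mtop S)"] ballI impI)
    fix q assume "F q \<in> fst d" "snd d (F q) \<in> spatch d"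
    then show "F0 (F q) - e * f (F q) = V.f0 (snd d (F q)) - e * in_chart d f (snd d (F q))"
      using F0_chart[OF d(1)] by (simp add: chart_inv_eq[OF chart[OF d(1)]])
  qed (use d V.hs_open sub y sm p in auto)
  have fe: "in_chart d f ?y = f (F p)" by (simp add: chart_inv_eq[OF chart[OF d(1)] d(2)])
  have F0e: "V.f0 ?y = F0 (F p)" using F0_chart[OF d y] by simp
  have R: "ricci (spatch d) (metric_in M d) ?y = ricci (patch d) (metric_in M d) ?y"
    by (rule Fl.ricci_W[OF V.hs_open sub y])
  have h: "hessian (spatch d) (metric_in M d) ?u ?y = hessian (spatch d) (metric_in M d) V.f0 ?y
      - e *\<^sub>R hessian (patch d) (metric_in M d) (in_chart d f) ?y"
    unfolding V.hessian_diff_cmult[OF V.smooth_f0 V.smooth_f y] Fl.hessian_W[OF V.hs_open sub y] ..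
  have h0: "hessian (spatch d) (metric_in M d) V.f0 ?y = F0 (F p) *\<^sub>R (ricci (patch d) (metric_in M d) ?y - (3 * r) *\<^sub>R metric_in M d ?y)"
    unfolding V.hessian_f0[OF y] F0e V.BB_def R by (simp add: vec_eq_iff algebra_simps)
  obtain a where a: "a \<in> atlas S" "p \<in> fst a" using S.chart_ex[OF p] by blast
  note n = normal(1)[OF a(1) d(1) a(2) d(2)]
  have ipd: "ip (A - t *\<^sub>R B) v v = ip A v v - t * ip B v v" "ip (t *\<^sub>R A) v v = t * ip A v v" for t A B and v :: "real^3"
    by (simp_all add: ip_expand sum_subtractf sum_distrib_left algebra_simps)
  define tr where "tr A = (\<Sum>i\<in>UNIV. \<Sum>j\<in>UNIV. matrix_inv (metric_in M d ?y) $ i $ j * A $ i $ j)" for A :: "real^3^3"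
  have trl: "tr (A - t *\<^sub>R B) = tr A - t * tr B" "tr (t *\<^sub>R A) = t * tr A" for A B t
    by (simp_all add: tr_def sum_subtractf sum_distrib_left algebra_simps)
  obtain fr where fr: "frame (metric_in M d ?y) fr" using Fl.frame_at[OF yp] by blast
  have trG: "tr (metric_in M d ?y) = 3"
    unfolding tr_def frame_contraction[OF fr Fl.transpose_G[OF yp]] by (simp add: frameD[OF fr])
  have trR: "tr (ricci (patch d) (metric_in M d) ?y) = 6 * r"
    using Fl.scal_eq[OF yp] by (simp add: tr_def scalar_curvature_def)
  have trH: "tr (hessian (patch d) (metric_in M d) (in_chart d f) ?y) = (3 * r + 3 * \<rho> (F p)) / 2 * f (F p)"
    using Fl.lap_eq[OF yp] by (simp add: tr_def laplacian_def chart_inv_eq[OF chart[OF d(1)] d(2)])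
  have L: "laplacian (spatch d) (metric_in M d) ?u ?y = tr (hessian (spatch d) (metric_in M d) ?u ?y)"
    by (simp add: tr_def laplacian_def)
  show "laplacian_at S (\<lambda>q. F0 (F q) - e * f (F q)) p = - RN p * (F0 (F p) - e * f (F p)) - e * Al (F p)"
    unfolding laplacian_lifts[OF p l] L h h0 trl ipd trG trR trH n RN_chart[OF p d, symmetric] hessian_f_normal[OF p d]
    by (simp add: Al_def mu[OF F_top[OF p]] field_simps)
qed

end

section \<open>The free boundary\<close>

context free_surface begin

lemma S_boundary:
  assumes "p \<in> mboundary S"
  shows "p \<in> topspace (mtop S)" "f (F p) = c"
  using assms S.mboundary_subset imm bdry F_top by (auto simp: immersed_surface_def)

text \<open>By \<open>hessian_f_normal\<close> this is \<open>Hess f(N, N)\<close>. The explicit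
  formula yields continuity from that of \<open>RN\<close> and \<open>Al\<close>.\<close>

definition HN :: "'s \<Rightarrow> real" where "HN p = f (F p) * (RN p - 3 * r) + Al (F p) / 2"

text \<open>The first summand of \<open>HN\<close> is negative by \<open>RN_less\<close>; in this
  way positive Gauss curvature controls the second fundamental form of the boundary.\<close>

lemma HN_less: "p \<in> topspace (mtop S) \<Longrightarrow> HN p < Al (F p) / 2"
  using mult_pos_neg[of "f (F p)" "RN p - 3 * r"] f_pos[OF F_top] RN_less[of p] by (simp add: HN_def)

context
  fixes p assumes p: "p \<in> mboundary S"
begin

abbreviation (input) d0 where "d0 \<equiv> chart_at M (F p)"
abbreviation (input) y0 where "y0 \<equiv> snd d0 (F p)"

lemmas d0 = M_chart_at[OF S_boundary(1)[OF p]]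

lemma y0: "y0 \<in> patch d0" using d0 by blast

text \<open>The boundary of the surface lies in the level set of the regular value \<open>c\<close>,
  where \<open>df\<close> does not vanish.\<close>

lemma kappa_pos: "\<kappa> > 0"
  and uu_kappa: "fluid_patch.uu (patch d0) (metric_in M d0) (in_chart d0 f) y0 = \<kappa>\<^sup>2"
  and gradient_norm_kappa: "gradient_norm (patch d0) (metric_in M d0) (in_chart d0 f) y0 = \<kappa>"
proof -
  interpret Fl: fluid_patch "patch d0" "metric_in M d0" "in_chart d0 f" "in_chart d0 \<rho>" r by (rule fluid[OF d0(1)])
  show g: "gradient_norm (patch d0) (metric_in M d0) (in_chart d0 f) y0 = \<kappa>"
    using kappa[OF p] by (simp add: grad_norm_at_def Let_def)
  have "\<exists>i. pd (patch d0) i (in_chart d0 f) y0 \<noteq> 0"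
    using regv d0 S_boundary(2)[OF p] by (simp add: regular_value_def)
  then have "Fl.dif (in_chart d0 f) y0 \<noteq> 0" by (auto simp: Fl.dif_def vec_eq_iff)
  then have "Fl.uu y0 > 0" using Fl.uu_eq_0[OF y0] Fl.uu_nonneg[OF y0] by auto
  moreover have "\<kappa> = sqrt (Fl.uu y0)" using g by (simp add: gradient_norm_def Fl.uu_gr[OF y0])
  ultimately show "\<kappa> > 0" "Fl.uu y0 = \<kappa>\<^sup>2" by simp_all
qed

lemma level_normal_jac:
  assumes a: "a \<in> atlas S" "p \<in> fst a"
  shows "map_jac a d0 F (snd a p) *v outward_unit_normal (metric_in S a) (snd a p)
    = - (gradient (patch d0) (metric_in M d0) (in_chart d0 f) y0 /\<^sub>R \<kappa>)"
proof -
  have "snd a p $ 1 = 0" using S.mboundary_iff[OF a] p by blast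
  then have "map_jac a d0 F (snd a p) *v outward_unit_normal (metric_in S a) (snd a p)
      = level_normal (patch d0) (metric_in M d0) (in_chart d0 f) (map_rep a d0 F (snd a p))"
    using free a(1) d0(1) point_dom(1)[OF a(1) d0(1) a(2) d0(2)] unfolding free_boundary_def by blast
  then show ?thesis
    unfolding point_dom(2)[OF a(1) d0(1) a(2) d0(2)] level_normal_def gradient_norm_kappa .
qed

text \<open>At a free boundary the conormal is \<open>- grad f / \<kappa>\<close>, so
  \<open>grad f\<close> is tangent to the surface and orthogonal to \<open>N\<close>.\<close>

lemma dif_f_normal: "riem_patch.dif (patch d0) (in_chart d0 f) y0 \<bullet> N d0 p = 0"
proof -
  interpret Fl: fluid_patch "patch d0" "metric_in M d0" "in_chart d0 f" "in_chart d0 \<rho>" r by (rule fluid[OF d0(1)])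
  obtain a where a: "a \<in> atlas S" "p \<in> fst a" using S.chart_ex S_boundary(1)[OF p] by blast
  have "ip (metric_in M d0 y0) (N d0 p) (- (Fl.gr y0 /\<^sub>R \<kappa>)) = 0"
    unfolding level_normal_jac[OF a, symmetric] by (rule normal(2)[OF a(1) d0(1) a(2) d0(2)])
  then have "ip (metric_in M d0 y0) (N d0 p) (Fl.gr y0) = 0"
    using kappa_pos by (simp add: ip_simps)
  then show ?thesis
    using Fl.ip_gradient[OF y0, of "in_chart d0 f" "N d0 p"] ip_commute[OF Fl.transpose_G[OF y0]] by metis
qed

lemma boundary_sff: "boundary_sff_at M f (F p) (N d0 p) = - HN p / \<kappa>"
proof -
  interpret Fl: fluid_patch "patch d0" "metric_in M d0" "in_chart d0 f" "in_chart d0 \<rho>" r by (rule fluid[OF d0(1)])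
  have "ip (metric_in M d0 y0) (Fl.gr y0) (Fl.gr y0) \<noteq> 0"
    using uu_kappa kappa_pos by (simp add: Fl.uu_gr[OF y0])
  from Fl.level_sff[OF Fl.smooth_f y0 dif_f_normal this]
  show ?thesis
    by (simp add: boundary_sff_at_def Let_def HN_def gradient_norm_kappa hessian_f_normal[OF S_boundary(1)[OF p] d0])
qed

text \<open>\<open>N\<close> is orthogonal to \<open>grad f\<close>, hence
  \<open>B(N, N) = w / 2\<close>. As \<open>df\<close> is nonzero at the boundary,
  \<open>ww_form\<close> applies whether or not \<open>B\<close> vanishes.\<close>

lemma RN_ww: "RN p = 2 * r + Ww (F p) / 2"
proof -
  interpret Fl: fluid_patch "patch d0" "metric_in M d0" "in_chart d0 f" "in_chart d0 \<rho>" r by (rule fluid[OF d0(1)])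
  obtain a where a: "a \<in> atlas S" "p \<in> fst a" using S.chart_ex S_boundary(1)[OF p] by blast
  have "Fl.uu y0 \<noteq> 0" using uu_kappa kappa_pos by simp
  from Fl.ww_form(1)[OF y0 this, of "N d0 p" "N d0 p"]
  show ?thesis
    by (simp add: dif_f_normal normal(1)[OF a(1) d0(1) a(2) d0(2)] Fl.ip_BB RN_chart[OF S_boundary(1)[OF p] d0, symmetric]
        chart_scalars(2)[OF d0])
qed

lemma outward_lifts:
  assumes l: "lifts \<phi> p d0 V u"
  shows "outward_deriv_at S \<phi> p
    = - (\<Sum>k\<in>UNIV. gradient (patch d0) (metric_in M d0) (in_chart d0 f) y0 $ k * pd V k u y0) / \<kappa>"
proof -
  define a where "a = chart_at S p"
  note a = S_chart_at[OF S_boundary(1)[OF p], folded a_def]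
  let ?\<nu> = "outward_unit_normal (metric_in S a) (snd a p)"
  have "outward_deriv_at S \<phi> p = (\<Sum>i\<in>UNIV. \<Sum>k\<in>UNIV. ?\<nu> $ i * (map_jac a d0 F (snd a p) $ k $ i * pd V k u y0))"
    by (simp add: outward_deriv_at_def Let_def a_def[symmetric] lifts_chart(3)[OF l a] sum_distrib_left)
  also have "\<dots> = (\<Sum>k\<in>UNIV. (map_jac a d0 F (snd a p) *v ?\<nu>) $ k * pd V k u y0)"
    by (subst sum.swap) (simp add: matrix_vector_mult_def sum_distrib_left sum_distrib_right mult_ac)
  finally show ?thesis
    unfolding level_normal_jac[OF a] by (simp add: sum_negf sum_distrib_left divide_inverse mult_ac)
qed

lemma gradient_dif: "(\<Sum>k\<in>UNIV. gradient (patch d0) (metric_in M d0) (in_chart d0 f) y0 $ k * pd (patch d0) k (in_chart d0 f) y0) = \<kappa>\<^sup>2"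
proof -
  interpret Fl: fluid_patch "patch d0" "metric_in M d0" "in_chart d0 f" "in_chart d0 \<rho>" r by (rule fluid[OF d0(1)])
  show ?thesis unfolding uu_kappa[symmetric] Fl.uu_def by (simp add: inner_vec_def Fl.dif_def mult.commute)
qed

lemma outward_f:
  assumes "openin (mtop S) U" "p \<in> U" "\<And>q. q \<in> U \<Longrightarrow> \<phi> q = f (F q)"
  shows "outward_deriv_at S \<phi> p = - \<kappa>"
proof -
  have "lifts \<phi> p d0 (patch d0) (in_chart d0 f)" by (rule laplacian_f(1)[OF S_boundary(1)[OF p] assms])
  from outward_lifts[OF this] show ?thesis
    unfolding gradient_dif using kappa_pos by (simp add: power2_eq_square)
qed

lemma outward_const:
  assumes "openin (mtop S) U" "p \<in> U" "\<And>q. q \<in> U \<Longrightarrow> \<phi> q = k"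
  shows "outward_deriv_at S \<phi> p = 0"
proof -
  have "lifts \<phi> p d0 (patch d0) (\<lambda>x. k)" by (rule laplacian_const(1)[OF S_boundary(1)[OF p] assms])
  from outward_lifts[OF this] show ?thesis
    using y0 hs_open_patch[OF chart[OF d0(1)]] by simp
qed

text \<open>Because \<open>N\<close> lies in the complement of \<open>grad f\<close>, the eigenvalue
  \<open>yy\<close> of Hess f is \<open>Hess f(N, N)\<close>. Then
  \<open>uu * PP = yy\<^sup>2\<close> becomes \<open>\<kappa>\<^sup>2 P = HN\<^sup>2\<close>, and
  \<open>HN < 0\<close> selects the root.\<close>

lemma boundary_curved:
  assumes b: "Bt (F p) \<noteq> 0" and al: "Al (F p) \<le> 0"
  shows "Pp (F p) > 0" "sqrt (Pp (F p)) = - HN p / \<kappa>"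
    and "curved_patch.yy (cpatch d0) (metric_in M d0) (in_chart d0 f) (in_chart d0 \<rho>) r y0 = HN p"
proof -
  interpret Fl: fluid_patch "patch d0" "metric_in M d0" "in_chart d0 f" "in_chart d0 \<rho>" r by (rule fluid[OF d0(1)])
  interpret C: curved_patch "cpatch d0" "metric_in M d0" "in_chart d0 f" "in_chart d0 \<rho>" r by (rule curved[OF d0(1)])
  have y: "y0 \<in> cpatch d0" using chart_scalars(3)[OF d0] b by blast
  have fe: "in_chart d0 f y0 = f (F p)" by (simp add: chart_inv_eq[OF chart[OF d0(1)] d0(2)])
  have "C.ww y0 = Ww (F p)" using Fl.ww_W[OF Fl.hs_open_cD y] chart_scalars(2)[OF d0] by simp
  then show yy: "C.yy y0 = HN p"
    using RN_ww by (simp add: C.yy_def HN_def fe Al_chart[OF d0] algebra_simps)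
  have "C.dif (in_chart d0 f) y0 = Fl.dif (in_chart d0 f) y0" "C.gr y0 = Fl.gr y0"
    by (simp_all add: C.dif_def Fl.dif_def gradient_def pd_restrict[OF Fl.hs_open Fl.hs_open_cD y])
  then have "C.uu y0 = \<kappa>\<^sup>2" using uu_kappa by (simp add: C.uu_def Fl.uu_def)
  then have P: "\<kappa>\<^sup>2 * Pp (F p) = (HN p)\<^sup>2" using C.uu_PP[OF y] chart_scalars(4)[OF d0 b] yy by simp
  then have Pe: "Pp (F p) = (HN p / \<kappa>)\<^sup>2" using kappa_pos by (simp add: power_divide field_simps)
  have neg: "HN p < 0" using HN_less[OF S_boundary(1)[OF p]] al by simp
  then show "Pp (F p) > 0" "sqrt (Pp (F p)) = - HN p / \<kappa>" using kappa_pos by (simp_all add: Pe)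
qed

text \<open>By \<open>pd_f0\<close> the differential of \<open>f0\<close> is a multiple of
  \<open>df\<close>. At the boundary \<open>yy = HN\<close> and
  \<open>sqrt P = - HN / \<kappa>\<close>, so \<open>HN\<close> cancels and the outward derivative
  of \<open>F0\<close> is minus a positive weight times \<open>3 r - RN\<close>, a negative number.
  The summand \<open>e * \<kappa>\<close> comes from \<open>- e f\<close>.\<close>

lemma outward_F0:
  assumes b: "Bt (F p) \<noteq> 0" and al: "Al (F p) \<le> 0"
    and U: "openin (mtop S) U" "p \<in> U" "\<And>q. q \<in> U \<Longrightarrow> \<phi> q = h (F0 (F q) - e * f (F q))"
    and h: "\<And>t. (h has_real_derivative h1 t) (at t)" and sh: "\<And>Z w. smooth_on Z w \<Longrightarrow> smooth_on Z (\<lambda>x :: real^3. h (w x))"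
  shows "\<exists>d V u. lifts \<phi> p d V u"
    and "outward_deriv_at S \<phi> p = h1 (F0 (F p) - e * f (F p)) * (e * \<kappa> - exp (- (1 / 6) * ln ((Ww (F p))\<^sup>2)) * (3 * r - RN p))"
proof -
  interpret Fl: fluid_patch "patch d0" "metric_in M d0" "in_chart d0 f" "in_chart d0 \<rho>" r by (rule fluid[OF d0(1)])
  interpret C: curved_patch "cpatch d0" "metric_in M d0" "in_chart d0 f" "in_chart d0 \<rho>" r by (rule curved[OF d0(1)])
  interpret V: static_vacuum_patch "spatch d0" "metric_in M d0" "in_chart d0 f" "in_chart d0 \<rho>" r by (rule static_vacuum[OF d0(1)])
  note bc = boundary_curved[OF b al]
  have pS: "p \<in> topspace (mtop S)" by (rule S_boundary[OF p])
  have sub: "spatch d0 \<subseteq> patch d0" using spatch(2)[OF d0(1)] cpatch(2)[OF d0(1)] by blast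
  have y: "y0 \<in> spatch d0" using spatch_iff[OF d0] b bc(1) by simp
  let ?t = "\<lambda>x. V.f0 x - e * in_chart d0 f x"
  let ?u = "\<lambda>x. h (?t x)"
  have st: "smooth_on (spatch d0) ?t" by (intro smooth_intros V.smooth_f0 V.smooth_f)
  have l0: "lifts (\<lambda>q. F0 (F q) - e * f (F q)) p d0 (spatch d0) ?t" by (rule laplacian_F0(1)[OF pS b bc(1)])
  have l: "lifts \<phi> p d0 (spatch d0) ?u"
    unfolding lifts_def
  proof (intro conjI exI[of _ U] ballI impI)
    fix q assume "q \<in> U" "F q \<in> fst d0" "snd d0 (F q) \<in> spatch d0"
    then show "\<phi> q = h (V.f0 (snd d0 (F q)) - e * in_chart d0 f (snd d0 (F q)))"
      using F0_chart[OF d0(1)] U(3) by (simp add: chart_inv_eq[OF chart[OF d0(1)]])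
  qed (use d0 V.hs_open sub y sh[OF st] U in auto)
  then show "\<exists>d V u. lifts \<phi> p d V u" by blast
  have fe: "in_chart d0 f y0 = f (F p)" by (simp add: chart_inv_eq[OF chart[OF d0(1)] d0(2)])
  have F0e: "V.f0 y0 = F0 (F p)" using F0_chart[OF d0 y] by simp
  have ww: "V.ww y0 = Ww (F p)" using Fl.ww_W[OF V.hs_open sub y] chart_scalars(2)[OF d0] by simp
  have yy: "V.yy y0 = HN p"
    using bc(3) C.ww_W[OF spatch[OF d0(1)] y] by (simp add: V.yy_def C.yy_def)
  have neg: "HN p < 0" using HN_less[OF pS] al by simp
  have pf: "pd (spatch d0) k (in_chart d0 f) y0 = pd (patch d0) k (in_chart d0 f) y0" for k
    by (rule pd_restrict[OF Fl.hs_open V.hs_open sub y])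
  have "pd (spatch d0) k V.f0 y0 = - F0 (F p) * (3 * r - RN p) / HN p * pd (patch d0) k (in_chart d0 f) y0" for k
  proof -
    have "r - Ww (F p) / 2 = 3 * r - RN p" using RN_ww by simp
    then have "HN p * pd (spatch d0) k V.f0 y0 = - F0 (F p) * (3 * r - RN p) * pd (patch d0) k (in_chart d0 f) y0"
      using V.pd_f0[OF y, of k] unfolding yy F0e ww pf by simp
    moreover have "HN p \<noteq> 0" using neg by simp
    moreover have "v = t / s * w" if "s * v = t * w" "s \<noteq> 0" for s t v w :: real using that by (simp add: field_simps)
    ultimately show ?thesis by blast
  qed
  then have pt: "pd (spatch d0) k ?t y0 = (- F0 (F p) * (3 * r - RN p) / HN p - e) * pd (patch d0) k (in_chart d0 f) y0" for k
    using pd_diff[OF V.smooth_f0 smooth_on_mult[OF smooth_on_const V.smooth_f] V.hs_open y, of k e]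
      pd_cmult[OF V.smooth_f V.hs_open y, of k e] by (simp add: pf algebra_simps)
  have pu: "pd (spatch d0) k ?u y0 = h1 (F0 (F p) - e * f (F p)) * ((- F0 (F p) * (3 * r - RN p) / HN p - e) * pd (patch d0) k (in_chart d0 f) y0)" for k
    using pd_real_compose[OF st h V.hs_open y, of k] unfolding pt fe F0e .
  have "outward_deriv_at S \<phi> p = - (h1 (F0 (F p) - e * f (F p)) * (- F0 (F p) * (3 * r - RN p) / HN p - e)) *
      (\<Sum>k\<in>UNIV. gradient (patch d0) (metric_in M d0) (in_chart d0 f) y0 $ k * pd (patch d0) k (in_chart d0 f) y0) / \<kappa>"
    unfolding outward_lifts[OF l] pu sum_distrib_left by (simp add: sum_distrib_left mult_ac sum_negf)
  also have "\<dots> = h1 (F0 (F p) - e * f (F p)) * (e * \<kappa> + F0 (F p) * (3 * r - RN p) * \<kappa> / HN p)"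
    unfolding gradient_dif using kappa_pos neg by (simp add: field_simps power2_eq_square)
  also have "F0 (F p) * (3 * r - RN p) * \<kappa> / HN p = - (exp (- (1 / 6) * ln ((Ww (F p))\<^sup>2)) * (3 * r - RN p))"
    unfolding F0_def bc(2) using kappa_pos neg by (simp add: field_simps)
  finally show "outward_deriv_at S \<phi> p = h1 (F0 (F p) - e * f (F p)) * (e * \<kappa> - exp (- (1 / 6) * ln ((Ww (F p))\<^sup>2)) * (3 * r - RN p))"
    by simp
qed

end

text \<open>Because the interior integrand is nonnegative everywhere, no property of the volume measure, not even its existence, is needed.\<close>

lemma unstable:
  assumes sm: "smooth_function S \<phi>" and off: "\<And>p. p \<notin> topspace (mtop S) \<Longrightarrow> \<phi> p = 0"
    and int: "\<And>p. p \<in> topspace (mtop S) \<Longrightarrow> \<phi> p * (laplacian_at S \<phi> p + (RN p + A2 p) * \<phi> p) \<ge> 0"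
    and g: "continuous_map (subtopology (mtop S) (mboundary S)) euclideanreal g" "\<And>p. p \<in> mboundary S \<Longrightarrow> g p \<le> 0"
    and bd: "\<And>p. p \<in> mboundary S \<Longrightarrow> \<phi> p * (outward_deriv_at S \<phi> p + HN p / \<kappa> * \<phi> p) = g p"
    and p: "p \<in> mboundary S" "g p < 0"
  shows "\<not> stable_free_boundary M f S F N"
proof -
  have "0 \<le> (LINT p|volume_measure S. \<phi> p * (laplacian_at S \<phi> p + (RN p + A2 p) * \<phi> p))"
    using int off by (intro Bochner_Integration.integral_nonneg) (metis mult_zero_left order_refl)
  moreover have "(LINT p|boundary_length_measure S. \<phi> p * (outward_deriv_at S \<phi> p
      - boundary_sff_at M f (F p) (N (chart_at M (F p)) p) * \<phi> p)) = (LINT p|boundary_length_measure S. g p)"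
    by (rule Bochner_Integration.integral_cong[OF refl]) (use bd boundary_sff in \<open>simp add: S.space_BL\<close>)
  moreover have "(LINT p|boundary_length_measure S. g p) < 0" by (rule S.boundary_integral_neg[OF g p])
  ultimately have "\<not> - (LINT p|volume_measure S. \<phi> p * (laplacian_at S \<phi> p + (RN p + A2 p) * \<phi> p))
      + (LINT p|boundary_length_measure S. \<phi> p * (outward_deriv_at S \<phi> p
        - boundary_sff_at M f (F p) (N (chart_at M (F p)) p) * \<phi> p)) \<ge> 0" by linarith
  then show ?thesis using sm unfolding stable_free_boundary_def by blast
qed

end

section \<open>Signs and continuity of the scalar invariants\<close>

context fluid_space begin

lemma Bt_sq: "q \<in> topspace (mtop M) \<Longrightarrow> Bt q \<noteq> 0 \<Longrightarrow> Bt q = 3 / 2 * (Ww q)\<^sup>2"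
  and Ww_nz: "q \<in> topspace (mtop M) \<Longrightarrow> Bt q \<noteq> 0 \<Longrightarrow> Ww q \<noteq> 0"
  and Pp_nonneg: "q \<in> topspace (mtop M) \<Longrightarrow> Bt q \<noteq> 0 \<Longrightarrow> Pp q \<ge> 0"
proof -
  assume q: "q \<in> topspace (mtop M)" and b: "Bt q \<noteq> 0"
  obtain d where d: "d \<in> atlas M" "q \<in> fst d" using chart_ex[OF q] by blast
  interpret A: fluid_patch "patch d" "metric_in M d" "in_chart d f" "in_chart d \<rho>" r by (rule fluid[OF d(1)])
  interpret C: curved_patch "cpatch d" "metric_in M d" "in_chart d f" "in_chart d \<rho>" r by (rule curved[OF d(1)])
  have y: "snd d q \<in> cpatch d" using chart_scalars(3)[OF d] b by blast
  have "C.ww (snd d q) = Ww q" "C.bt (snd d q) = Bt q"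
    using A.ww_W[OF A.hs_open_cD y] A.bt_W[OF A.hs_open_cD y] chart_scalars(1,2)[OF d] by simp_all
  then show "Bt q = 3 / 2 * (Ww q)\<^sup>2" "Ww q \<noteq> 0" using C.ww_sq[OF y] C.ww_nz[OF y] by simp_all
  show "Pp q \<ge> 0" using C.PP_nonneg[OF y] chart_scalars(4)[OF d b] by simp
qed

lemma openin_Bt_nz: "openin (mtop M) {q \<in> topspace (mtop M). Bt q \<noteq> 0}"
  using openin_continuous_map_preimage[OF continuous_Bt, of "- {0}"] by (simp add: open_Compl)

lemma continuous_curved:
  fixes u :: "'m \<Rightarrow> real"
  assumes "\<And>d. d \<in> atlas M \<Longrightarrow> \<exists>g. continuous_on (cpatch d) g \<and> (\<forall>q\<in>fst d. snd d q \<in> cpatch d \<longrightarrow> u q = g (snd d q))"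
  shows "continuous_map (subtopology (mtop M) {q. Bt q \<noteq> 0}) euclideanreal u"
proof (rule continuous_map_locally)
  fix q assume "q \<in> topspace (subtopology (mtop M) {q. Bt q \<noteq> 0})"
  then have q: "q \<in> topspace (mtop M)" "Bt q \<noteq> 0" by auto
  obtain d where d: "d \<in> atlas M" "q \<in> fst d" using chart_ex[OF q(1)] by blast
  obtain g where g: "continuous_on (cpatch d) g" "\<And>q. q \<in> fst d \<Longrightarrow> snd d q \<in> cpatch d \<Longrightarrow> u q = g (snd d q)"
    using assms[OF d(1)] by blast
  note ch = chart[OF d(1)]
  define U where "U = {q \<in> fst d. snd d q \<in> cpatch d}"
  have U: "openin (mtop M) U" unfolding U_def by (rule chart_nhd[OF d(1) cpatch[OF d(1)]])
  have sub: "U \<subseteq> {q. Bt q \<noteq> 0}" using chart_scalars(3)[OF d(1)] by (auto simp: U_def)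
  have "continuous_map (subtopology (mtop M) U) (top_of_set (patch d)) (snd d)"
    using continuous_map_from_subtopology_mono[OF continuous_map_chart[OF ch], of U] by (auto simp: U_def)
  then have "continuous_map (subtopology (mtop M) U) (top_of_set (cpatch d)) (snd d)"
    using cpatch(2)[OF d(1)] by (auto simp: continuous_map_in_subtopology U_def)
  from continuous_map_compose[OF this, of euclideanreal g] g(1)
  have "continuous_map (subtopology (mtop M) U) euclideanreal (g \<circ> snd d)" by simp
  then have "continuous_map (subtopology (mtop M) U) euclideanreal u"
    by (rule continuous_map_eq) (use g(2) in \<open>auto simp: U_def\<close>)
  moreover have "subtopology (subtopology (mtop M) {q. Bt q \<noteq> 0}) U = subtopology (mtop M) U"
    using sub by (simp add: subtopology_subtopology Int_absorb1)
  moreover have "openin (subtopology (mtop M) {q. Bt q \<noteq> 0}) U"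
    using U sub by (metis Int_absorb2 openin_subtopology_Int)
  moreover have "q \<in> U" using d(2) chart_scalars(3)[OF d] q(2) by (simp add: U_def)
  ultimately show "\<exists>U. openin (subtopology (mtop M) {q. Bt q \<noteq> 0}) U \<and> q \<in> U \<and>
      continuous_map (subtopology (subtopology (mtop M) {q. Bt q \<noteq> 0}) U) euclideanreal u" by metis
qed

lemma continuous_weight: "continuous_map (subtopology (mtop M) {q. Bt q \<noteq> 0}) euclideanreal (\<lambda>q. exp (- (1 / 6) * ln ((Ww q)\<^sup>2)))"
  and continuous_F0: "continuous_map (subtopology (mtop M) {q. Bt q \<noteq> 0}) euclideanreal F0"
proof -
  have "(\<exists>g. continuous_on (cpatch d) g \<and> (\<forall>q\<in>fst d. snd d q \<in> cpatch d \<longrightarrow> exp (- (1 / 6) * ln ((Ww q)\<^sup>2)) = g (snd d q)))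
    \<and> (\<exists>g. continuous_on (cpatch d) g \<and> (\<forall>q\<in>fst d. snd d q \<in> cpatch d \<longrightarrow> F0 q = g (snd d q)))"
    if d: "d \<in> atlas M" for d
  proof -
    interpret A: fluid_patch "patch d" "metric_in M d" "in_chart d f" "in_chart d \<rho>" r by (rule fluid[OF d])
    interpret C: curved_patch "cpatch d" "metric_in M d" "in_chart d f" "in_chart d \<rho>" r by (rule curved[OF d])
    have "smooth_on (cpatch d) (\<lambda>x. exp (- (1 / 6) * ln ((C.ww x)\<^sup>2)))" by (intro smooth_intros C.smooth_ln_ww)
    note 1 = smooth_on_imp_continuous_on[OF this]
    have 2: "continuous_on (cpatch d) (\<lambda>x. exp (- (1 / 6) * ln ((C.ww x)\<^sup>2)) * sqrt (C.PP x))"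
      by (intro continuous_on_mult 1 continuous_on_real_sqrt smooth_on_imp_continuous_on[OF C.smooth_PP])
    have w: "C.ww (snd d q) = Ww q" and P: "C.PP (snd d q) = Pp q" if "q \<in> fst d" "snd d q \<in> cpatch d" for q
      using chart_scalars(2,3,4)[OF d that(1)] A.ww_W[OF A.hs_open_cD that(2)] that(2) by simp_all
    show ?thesis
      by (intro conjI exI[of _ "\<lambda>x. exp (- (1 / 6) * ln ((C.ww x)\<^sup>2))"] exI[of _ "\<lambda>x. exp (- (1 / 6) * ln ((C.ww x)\<^sup>2)) * sqrt (C.PP x)"] 1 2)
        (simp_all add: w P F0_def)
  qed
  then show "continuous_map (subtopology (mtop M) {q. Bt q \<noteq> 0}) euclideanreal (\<lambda>q. exp (- (1 / 6) * ln ((Ww q)\<^sup>2)))"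
    "continuous_map (subtopology (mtop M) {q. Bt q \<noteq> 0}) euclideanreal F0"
    by (intro continuous_curved; blast)+
qed

end

lemma openin_locally_constant:
  assumes "\<And>p. p \<in> topspace X \<Longrightarrow> \<exists>U. openin X U \<and> p \<in> U \<and> (\<forall>q\<in>U. u q = u p)"
  shows "openin X {p \<in> topspace X. P (u p)}"
proof (subst openin_subopen, intro ballI)
  fix p assume p: "p \<in> {p \<in> topspace X. P (u p)}"
  then obtain U where U: "openin X U" "p \<in> U" "\<forall>q\<in>U. u q = u p" using assms by blast
  then have "U \<subseteq> {p \<in> topspace X. P (u p)}" using p openin_subset by fastforce
  then show "\<exists>T. openin X T \<and> p \<in> T \<and> T \<subseteq> {p \<in> topspace X. P (u p)}" using U by blast
qed

lemma continuous_map_if_clopen: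
  fixes g :: "'a \<Rightarrow> real"
  assumes T: "openin X T" "openin X (topspace X - T)" and g: "continuous_map (subtopology X T) euclideanreal g"
  shows "continuous_map X euclideanreal (\<lambda>p. if p \<in> T then g p else 0)"
proof (rule continuous_map_locally)
  fix p assume p: "p \<in> topspace X"
  show "\<exists>U. openin X U \<and> p \<in> U \<and> continuous_map (subtopology X U) euclideanreal (\<lambda>p. if p \<in> T then g p else 0)"
  proof (cases "p \<in> T")
    case True
    have "continuous_map (subtopology X T) euclideanreal (\<lambda>p. if p \<in> T then g p else 0)"
      by (rule continuous_map_eq[OF g]) simp
    then show ?thesis using T(1) True by blast
  next
    case False
    have "continuous_map (subtopology X (topspace X - T)) euclideanreal (\<lambda>p. if p \<in> T then g p else 0)"
      by (rule continuous_map_eq[of _ _ "\<lambda>p. 0"]) simp_all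
    then show ?thesis using T(2) False p by blast
  qed
qed

section \<open>Invariant components of the surface\<close>

context free_surface begin

definition clopen :: "'s set \<Rightarrow> bool" where
  "clopen T \<longleftrightarrow> openin (mtop S) T \<and> openin (mtop S) (topspace (mtop S) - T)"

lemma clopen_Int: "clopen T \<Longrightarrow> clopen T' \<Longrightarrow> clopen (T \<inter> T')"
proof -
  assume T: "clopen T" "clopen T'"
  have "topspace (mtop S) - T \<inter> T' = (topspace (mtop S) - T) \<union> (topspace (mtop S) - T')" by blast
  then show ?thesis using T by (simp add: clopen_def openin_Int openin_Un)
qed

lemma Al_F_locally_constant:
  assumes "p \<in> topspace (mtop S)"
  shows "\<exists>U. openin (mtop S) U \<and> p \<in> U \<and> (\<forall>q\<in>U. Al (F q) = Al (F p))"
proof -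
  obtain U where U: "openin (mtop M) U" "F p \<in> U" "\<forall>q'\<in>U. Al q' = Al (F p)" using Al_locally_constant[OF F_top[OF assms]] by blast
  let ?U = "{p \<in> topspace (mtop S). F p \<in> U}"
  have "openin (mtop S) ?U" by (rule F_nhd[OF U(1)])
  moreover have "p \<in> ?U" using assms U(2) by simp
  moreover have "\<forall>q\<in>?U. Al (F q) = Al (F p)" using U(3) by simp
  ultimately show ?thesis by blast
qed

lemma clopen_Al: "clopen {p \<in> topspace (mtop S). Al (F p) = k}"
proof -
  note o = openin_locally_constant[OF Al_F_locally_constant]
  have "topspace (mtop S) - {p \<in> topspace (mtop S). Al (F p) = k} = {p \<in> topspace (mtop S). Al (F p) \<noteq> k}" by blast
  then show ?thesis using o[of "\<lambda>a. a = k"] o[of "\<lambda>a. a \<noteq> k"] by (simp add: clopen_def)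
qed

text \<open>At a zero of \<open>B\<close> one has \<open>Ric = 2 r g\<close>, so
  \<open>RN_less\<close> reads \<open>2 r < 3 r\<close>.\<close>

lemma r_pos:
  assumes p: "p \<in> topspace (mtop S)" and b: "Bt (F p) = 0"
  shows "RN p = 2 * r" "r > 0"
proof -
  obtain a where a: "a \<in> atlas S" "p \<in> fst a" using S.chart_ex[OF p] by blast
  note d = M_chart_at[OF p]
  let ?d = "chart_at M (F p)"
  interpret A: fluid_patch "patch ?d" "metric_in M ?d" "in_chart ?d f" "in_chart ?d \<rho>" r by (rule fluid[OF d(1)])
  have y: "snd ?d (F p) \<in> patch ?d" using d by blast
  have "A.BB (snd ?d (F p)) = 0" by (rule A.bt_zero[OF y]) (use chart_scalars(1)[OF d] b in simp)
  then show R: "RN p = 2 * r"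
    using A.ip_BB[of "snd ?d (F p)" "N ?d p" "N ?d p"] normal(1)[OF a(1) d(1) a(2) d(2)] RN_chart[OF p d]
    by (simp add: ip_def)
  show "r > 0" using RN_less[OF p] R by simp
qed

text \<open>Openness of the complement is the issue at a zero of \<open>B\<close>. There
  \<open>r > 0\<close>, and since \<open>P \<ge> 0\<close>, \<open>Ee\<close> is at least
  \<open>\<bar>w\<bar>^(-2/3) (r + w)\<close>, which exceeds any given \<open>k\<close> once
  \<open>w\<close> is small enough. So the level set cannot accumulate at such a point.\<close>

lemma clopen_Ee: "clopen {p \<in> topspace (mtop S). Bt (F p) \<noteq> 0 \<and> Ee (F p) = k}"
  unfolding clopen_def
proof
  let ?T = "{p \<in> topspace (mtop S). Bt (F p) \<noteq> 0 \<and> Ee (F p) = k}"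
  have nhd: "\<exists>U. openin (mtop S) U \<and> p \<in> U \<and> (\<forall>q\<in>U. Bt (F q) \<noteq> 0 \<and> Ee (F q) = Ee (F p))"
    if p: "p \<in> topspace (mtop S)" "Bt (F p) \<noteq> 0" for p
  proof -
    obtain U where U: "openin (mtop M) U" "F p \<in> U" "\<forall>q'\<in>U. Ee q' = Ee (F p)" using Ee_locally_constant[OF F_top[OF p(1)] p(2)] by blast
    let ?U = "{p \<in> topspace (mtop S). F p \<in> U \<inter> {q \<in> topspace (mtop M). Bt q \<noteq> 0}}"
    have "openin (mtop S) ?U" by (rule F_nhd[OF openin_Int[OF U(1) openin_Bt_nz]])
    moreover have "p \<in> ?U" using p U(2) F_top by simp
    moreover have "\<forall>q\<in>?U. Bt (F q) \<noteq> 0 \<and> Ee (F q) = Ee (F p)" using U(3) by simp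
    ultimately show ?thesis by blast
  qed
  show "openin (mtop S) ?T"
  proof (subst openin_subopen, intro ballI)
    fix p assume p: "p \<in> ?T"
    then obtain U where U: "openin (mtop S) U" "p \<in> U" "\<forall>q\<in>U. Bt (F q) \<noteq> 0 \<and> Ee (F q) = Ee (F p)" using nhd by blast
    then have "U \<subseteq> ?T" using p openin_subset by fastforce
    then show "\<exists>T. openin (mtop S) T \<and> p \<in> T \<and> T \<subseteq> ?T" using U by blast
  qed
  show "openin (mtop S) (topspace (mtop S) - ?T)"
  proof (subst openin_subopen, intro ballI)
    fix p assume p: "p \<in> topspace (mtop S) - ?T"
    show "\<exists>T. openin (mtop S) T \<and> p \<in> T \<and> T \<subseteq> topspace (mtop S) - ?T"
    proof (cases "Bt (F p) = 0")
      case False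
      then obtain U where U: "openin (mtop S) U" "p \<in> U" "\<forall>q\<in>U. Bt (F q) \<noteq> 0 \<and> Ee (F q) = Ee (F p)" using nhd p by blast
      then have "Ee (F p) \<noteq> k" using p False by blast
      then have "U \<subseteq> topspace (mtop S) - ?T" using U(3) openin_subset[OF U(1)] by auto
      then show ?thesis using U by blast
    next
      case True
      have r: "r > 0" using r_pos[of p] True p by blast
      \<comment> \<open>\<open>Bt = 3 w\<^sup>2 / 2\<close> below \<open>3 s^6 / 2\<close> means
        \<open>\<bar>w\<bar> < s^3\<close> and \<open>\<bar>w\<bar>^(2/3) < s^2\<close>. Then
        \<open>Ee = k\<close> would give
        \<open>r \<le> s^2 \<bar>k\<bar> + s^3 < s (\<bar>k\<bar> + 2)\<close>, which the choice of
        \<open>s\<close> excludes.\<close>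
      define s where "s = min 1 (r / (\<bar>k\<bar> + 2))"
      have s: "s > 0" "s \<le> 1" "s * (\<bar>k\<bar> + 2) \<le> r"
      proof -
        have "r / (\<bar>k\<bar> + 2) > 0" using r by (intro divide_pos_pos) auto
        then show "s > 0" "s \<le> 1" by (simp_all add: s_def)
        have "s \<le> r / (\<bar>k\<bar> + 2)" by (simp add: s_def)
        then show "s * (\<bar>k\<bar> + 2) \<le> r" by (simp add: pos_le_divide_eq add_nonneg_pos)
      qed
      let ?V = "{q \<in> topspace (mtop M). Bt q \<in> {..< 3 / 2 * s ^ 6}}"
      let ?U = "{p \<in> topspace (mtop S). F p \<in> ?V}"
      have "openin (mtop M) ?V" by (rule openin_continuous_map_preimage[OF continuous_Bt]) simp
      then have U: "openin (mtop S) ?U" by (rule F_nhd)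
      have pU: "p \<in> ?U" using p True s(1) F_top by simp
      have "Ee q \<noteq> k" if q: "q \<in> ?V" and b: "Bt q \<noteq> 0" for q
      proof
        assume E: "Ee q = k"
        have qM: "q \<in> topspace (mtop M)" using q by simp
        have w: "(Ww q)\<^sup>2 < s ^ 6" "Ww q \<noteq> 0" using q Bt_sq[OF qM b] Ww_nz[OF qM b] by simp_all
        have "(Ww q)\<^sup>2 < (s ^ 3)\<^sup>2" using w(1) by (simp flip: power_mult)
        then have ws: "\<bar>Ww q\<bar> < s ^ 3" using power2_less_imp_less[of "\<bar>Ww q\<bar>" "s ^ 3"] s(1) by simp
        have "(1 / 3) * ln ((Ww q)\<^sup>2) \<le> (1 / 3) * ln (s ^ 6)" using w s(1) by simp
        also have "\<dots> = 2 * ln s" using s(1) by (simp add: ln_realpow)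
        also have "\<dots> = ln (s\<^sup>2)" using s(1) by (simp add: ln_realpow)
        finally have x: "exp ((1 / 3) * ln ((Ww q)\<^sup>2)) \<le> s\<^sup>2" using s(1) by (metis exp_le_cancel_iff exp_ln zero_less_power)
        have "Pp q + r + Ww q = exp ((1 / 3) * ln ((Ww q)\<^sup>2)) * k"
          unfolding E[symmetric] Ee_def by (simp add: exp_minus)
        also have "\<dots> \<le> exp ((1 / 3) * ln ((Ww q)\<^sup>2)) * \<bar>k\<bar>" by (intro mult_left_mono) auto
        also have "\<dots> \<le> s\<^sup>2 * \<bar>k\<bar>" by (rule mult_right_mono[OF x]) simp
        finally have "r \<le> s\<^sup>2 * \<bar>k\<bar> + s ^ 3" using Pp_nonneg[OF qM b] ws by linarith
        also have "\<dots> \<le> s * \<bar>k\<bar> + s"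
          using s by (intro add_mono mult_right_mono) (auto simp: power_le_one power2_eq_square power3_eq_cube mult_le_one mult_left_le)
        also have "\<dots> < s * (\<bar>k\<bar> + 2)" using s(1) by (simp add: algebra_simps)
        finally show False using s(3) by simp
      qed
      then have "?U \<subseteq> topspace (mtop S) - ?T" by blast
      then show ?thesis using U pU by blast
    qed
  qed
qed

text \<open>A connected coordinate neighbourhood of a zero of \<open>Bt\<close> on the surface misses the clopen sets on which \<open>Ee\<close> is constant.\<close>

lemma clopen_Bt: "clopen {p \<in> topspace (mtop S). Bt (F p) = 0}"
  unfolding clopen_def
proof
  have "topspace (mtop S) - {p \<in> topspace (mtop S). Bt (F p) = 0} = {p \<in> topspace (mtop S). F p \<in> {q \<in> topspace (mtop M). Bt q \<noteq> 0}}"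
    using F_top by auto
  then show "openin (mtop S) (topspace (mtop S) - {p \<in> topspace (mtop S). Bt (F p) = 0})" using F_nhd[OF openin_Bt_nz] by simp
  show "openin (mtop S) {p \<in> topspace (mtop S). Bt (F p) = 0}"
  proof (subst openin_subopen, intro ballI)
    fix p assume "p \<in> {p \<in> topspace (mtop S). Bt (F p) = 0}"
    then have p: "p \<in> topspace (mtop S)" "Bt (F p) = 0" by auto
    obtain a where a: "a \<in> atlas S" "p \<in> fst a" using S.chart_ex[OF p(1)] by blast
    note ch = S.chart[OF a(1)]
    obtain e where e: "e > 0" "half_space \<inter> ball (snd a p) e \<subseteq> patch a"
      using hs_open_ball[OF hs_open_patch[OF ch], of "snd a p"] a(2) by blast
    let ?B = "half_space \<inter> ball (snd a p) e"
    have B: "hs_open ?B" unfolding hs_open_iff by blast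
    let ?U = "{q \<in> fst a. snd a q \<in> ?B}"
    have U: "openin (mtop S) ?U" by (rule chart_preimage_open[OF ch hs_open_imp_openin[OF B e(2) hs_open_patch[OF ch]]])
    have "patch a \<subseteq> half_space" using hs_open_patch[OF ch] by (auto simp: hs_open_iff)
    then have pU: "p \<in> ?U" using a(2) e(1) by auto
    have "?U = chart_inv a ` ?B"
    proof
      show "?U \<subseteq> chart_inv a ` ?B" using chart_inv_eq[OF ch] by force
      show "chart_inv a ` ?B \<subseteq> ?U" using chart_inv_mem[OF ch] e(2) by auto
    qed
    moreover have "connectedin (top_of_set (patch a)) ?B"
      using convex_connected[OF convex_half_ball] e(2) by (simp add: connectedin_subtopology)
    ultimately have conn: "connectedin (mtop S) ?U"
      using connectedin_continuous_map_image[OF continuous_map_chart_inv[OF ch]] by simp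
    have "Bt (F q) = 0" if q: "q \<in> ?U" for q
    proof (rule ccontr)
      assume b: "Bt (F q) \<noteq> 0"
      let ?T = "{p \<in> topspace (mtop S). Bt (F p) \<noteq> 0 \<and> Ee (F p) = Ee (F q)}"
      have qS: "q \<in> topspace (mtop S)" using q openin_subset[OF U] by blast
      have T: "openin (mtop S) ?T" "openin (mtop S) (topspace (mtop S) - ?T)" using clopen_Ee unfolding clopen_def by blast+
      have "closedin (mtop S) ?T" using T(2) by (simp add: closedin_def)
      then have "?U \<subseteq> ?T \<or> disjnt ?U ?T" using connectedin_clopen_cases[OF conn _ T(1)] by blast
      moreover have "q \<in> ?T" using qS b by simp
      ultimately have "p \<in> ?T" using q pU by (auto simp: disjnt_iff)
      then show False using p(2) by simp
    qed
    then have "?U \<subseteq> {p \<in> topspace (mtop S). Bt (F p) = 0}" using openin_subset[OF U] by blast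
    then show "\<exists>T. openin (mtop S) T \<and> p \<in> T \<and> T \<subseteq> {p \<in> topspace (mtop S). Bt (F p) = 0}" using U pU by blast
  qed
qed

end

lemma flat_nonneg: "flat \<delta> n t \<ge> 0"
  by (simp add: flat_def)

lemma flat_Suc: "t * flat \<delta> (Suc n) t = flat \<delta> n t"
  by (simp add: flat_def)

text \<open>The cutoff is h(t) = t exp(-\<delta>/t) for t > 0 and 0 otherwise. It is convex, and t
  h'(t) exceeds h(t) only by \<delta> exp(-\<delta>/t); this excess, which \<delta> makes small, is
  the whole error of the cutoff in the Jacobi operator.\<close>

lemma cutoff_derivatives:
  assumes "\<delta> > 0"
  shows "((\<lambda>t. t * flat \<delta> 0 t) has_real_derivative (flat \<delta> 0 t + \<delta> * flat \<delta> 1 t)) (at t)"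
    and "((\<lambda>t. flat \<delta> 0 t + \<delta> * flat \<delta> 1 t) has_real_derivative \<delta>\<^sup>2 * flat \<delta> 3 t) (at t)"
proof -
  have 0: "(flat \<delta> 0 has_real_derivative \<delta> * flat \<delta> 2 t) (at t)"
    using flat_has_derivative[OF assms, of 0 t] by (simp add: numeral_2_eq_2)
  have 1: "(flat \<delta> 1 has_real_derivative (- flat \<delta> 2 t + \<delta> * flat \<delta> 3 t)) (at t)"
    using flat_has_derivative[OF assms, of 1 t] by (simp add: numeral_2_eq_2 numeral_3_eq_3)
  have e: "t * flat \<delta> 2 t = flat \<delta> 1 t" using flat_Suc[of t \<delta> 1] by (simp add: numeral_2_eq_2)
  have "((\<lambda>t. t * flat \<delta> 0 t) has_real_derivative (1 * flat \<delta> 0 t + \<delta> * flat \<delta> 2 t * t)) (at t)"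
    by (rule DERIV_mult[OF DERIV_ident 0])
  moreover have "\<delta> * flat \<delta> 2 t * t = \<delta> * flat \<delta> 1 t" using e by (simp add: mult_ac)
  ultimately show "((\<lambda>t. t * flat \<delta> 0 t) has_real_derivative (flat \<delta> 0 t + \<delta> * flat \<delta> 1 t)) (at t)" by simp
  have "((\<lambda>t. flat \<delta> 0 t + \<delta> * flat \<delta> 1 t) has_real_derivative (\<delta> * flat \<delta> 2 t + \<delta> * (- flat \<delta> 2 t + \<delta> * flat \<delta> 3 t))) (at t)"
    by (intro DERIV_add 0 DERIV_cmult 1)
  then show "((\<lambda>t. flat \<delta> 0 t + \<delta> * flat \<delta> 1 t) has_real_derivative \<delta>\<^sup>2 * flat \<delta> 3 t) (at t)"
    by (simp add: power2_eq_square algebra_simps)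
qed

section \<open>The destabilizing test functions\<close>

context free_surface begin

lemma continuous_f_F: "continuous_map (mtop S) euclideanreal (\<lambda>p. f (F p))"
proof -
  have "continuous_map (mtop M) euclideanreal f"
    using spf by (intro continuous_map_in_chart smooth_on_imp_continuous_on) (simp add: static_perfect_fluid_def smooth_function_def)
  from continuous_map_compose[OF F_cont this] show ?thesis by (simp add: o_def)
qed

lemma continuous_HN: "continuous_map (mtop S) euclideanreal HN"
proof -
  have "continuous_map (mtop S) euclideanreal (\<lambda>p. Al (F p))"
    unfolding continuous_map_def using openin_locally_constant[OF Al_F_locally_constant] by auto
  then show ?thesis
    unfolding HN_def[abs_def]
    by (intro continuous_map_add continuous_map_real_mult continuous_map_diff continuous_map_real_divide
        continuous_f_F continuous_RN) auto
qed

lemma continuous_curved_F: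
  assumes T: "\<And>p. p \<in> T \<Longrightarrow> Bt (F p) \<noteq> 0" and u: "continuous_map (subtopology (mtop M) {q. Bt q \<noteq> 0}) euclideanreal u"
  shows "continuous_map (subtopology (mtop S) T) euclideanreal (\<lambda>p. u (F p))"
proof -
  have "continuous_map (subtopology (mtop S) T) (subtopology (mtop M) {q. Bt q \<noteq> 0}) F"
    using T by (auto simp: continuous_map_in_subtopology continuous_map_from_subtopology F_cont)
  from continuous_map_compose[OF this u] show ?thesis by (simp add: o_def)
qed

lemma boundary_clopen:
  fixes g :: "'s \<Rightarrow> real"
  assumes T: "clopen T" and g: "continuous_map (subtopology (mtop S) T) euclideanreal g"
  shows "continuous_map (subtopology (mtop S) (mboundary S)) euclideanreal (\<lambda>p. if p \<in> T then g p else 0)"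
  using continuous_map_if_clopen[of "mtop S" T g] T g
  by (intro continuous_map_from_subtopology) (simp add: clopen_def)

lemma clopenD: "clopen T \<Longrightarrow> openin (mtop S) T" "clopen T \<Longrightarrow> openin (mtop S) (topspace (mtop S) - T)" "clopen T \<Longrightarrow> T \<subseteq> topspace (mtop S)"
  by (simp_all add: clopen_def openin_subset)

lemma compact_bound:
  fixes g :: "'s \<Rightarrow> real"
  assumes K: "compactin (mtop S) K" "K \<noteq> {}" and g: "continuous_map (subtopology (mtop S) K) euclideanreal g"
  shows "\<exists>p\<in>K. \<forall>q\<in>K. g p \<le> g q"
proof -
  have "compactin (subtopology (mtop S) K) K" using K(1) by (simp add: compactin_subtopology)
  from image_compactin[OF this g] have "compact (g ` K)" by simp
  from compact_attains_inf[OF this] show ?thesis using K(2) by auto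
qed

lemma off_lifts:
  assumes T: "clopen T" and p: "p \<in> topspace (mtop S)" "p \<notin> T" and \<phi>: "\<And>p. p \<notin> T \<Longrightarrow> \<phi> p = 0"
  shows "\<exists>d V u. lifts \<phi> p d V u"
proof -
  have "p \<in> topspace (mtop S) - T" using p by blast
  from laplacian_const(1)[OF p(1) clopenD(2)[OF T] this, of \<phi> 0] \<phi> show ?thesis by blast
qed

lemma unstable_nonneg:
  assumes p0: "p0 \<in> mboundary S" and al: "Al (F p0) \<ge> 0"
    and hyp: "\<And>p. p \<in> topspace (mtop S) \<Longrightarrow> \<mu> (F p) + \<rho> (F p) \<le> 2 * \<kappa>\<^sup>2 / c\<^sup>2"
  shows "\<not> stable_free_boundary M f S F N"
proof -
  define T where "T = {p \<in> topspace (mtop S). Al (F p) = Al (F p0)}"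
  have T: "clopen T" unfolding T_def by (rule clopen_Al)
  note o = clopenD[OF T]
  have p0T: "p0 \<in> T" using S_boundary(1)[OF p0] by (simp add: T_def)
  define \<phi> where "\<phi> p = (if p \<in> T then f (F p) else 0)" for p
  have \<phi>: "\<And>p. p \<notin> T \<Longrightarrow> \<phi> p = 0" "\<And>p. p \<in> T \<Longrightarrow> \<phi> p = f (F p)" by (simp_all add: \<phi>_def)
  define g where "g p = f (F p) * (- \<kappa> + HN p / \<kappa> * f (F p))" for p
  \<comment> \<open>On the boundary \<open>f = c\<close>, and the integrand is negative exactly if
    \<open>HN * c < \<kappa>\<^sup>2\<close>. Since
    \<open>HN < a / 2 = (\<mu> + \<rho>) c / 2\<close>, the bound with the constant
    \<open>2 * \<kappa>\<^sup>2 / c\<^sup>2\<close> is what this requires.\<close>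
  have gneg: "g p < 0" if p: "p \<in> mboundary S" for p
  proof -
    note pS = S_boundary[OF p]
    have k: "\<kappa> > 0" by (rule kappa_pos[OF p])
    have c: "c > 0" using f_pos[OF F_top[OF pS(1)]] pS(2) by simp
    have "HN p < (\<mu> (F p) + \<rho> (F p)) * c / 2" using HN_less[OF pS(1)] by (simp add: Al_def pS(2))
    also have "\<dots> \<le> \<kappa>\<^sup>2 / c"
    proof -
      have "(\<mu> (F p) + \<rho> (F p)) * c \<le> 2 * \<kappa>\<^sup>2 / c\<^sup>2 * c" by (rule mult_right_mono[OF hyp[OF pS(1)] less_imp_le[OF c]])
      moreover have "2 * \<kappa>\<^sup>2 / c\<^sup>2 * c = 2 * (\<kappa>\<^sup>2 / c)" using c by (simp add: power2_eq_square)
      ultimately show ?thesis by linarith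
    qed
    finally have "HN p * c < \<kappa>\<^sup>2" using c by (simp add: pos_less_divide_eq)
    then have "HN p / \<kappa> * c < \<kappa>" using k by (simp add: pos_divide_less_eq power2_eq_square)
    then show ?thesis unfolding g_def pS(2) using c by (simp add: mult_pos_neg)
  qed
  show ?thesis
  proof (rule unstable[of \<phi> "\<lambda>p. if p \<in> T then g p else 0"])
    show "smooth_function S \<phi>"
    proof (rule smooth_function_lifts)
      fix p assume p: "p \<in> topspace (mtop S)"
      show "\<exists>d V u. lifts \<phi> p d V u"
      proof (cases "p \<in> T")
        case True
        from laplacian_f(1)[OF p o(1) True, of \<phi>] \<phi>(2) show ?thesis by blast
      qed (rule off_lifts[OF T p], assumption, rule \<phi>(1))
    qed
    show "\<phi> p = 0" if "p \<notin> topspace (mtop S)" for p using that o(3) \<phi>(1) by blast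
    show "\<phi> p * (laplacian_at S \<phi> p + (RN p + A2 p) * \<phi> p) \<ge> 0" if p: "p \<in> topspace (mtop S)" for p
    proof (cases "p \<in> T")
      case True
      have l: "laplacian_at S \<phi> p = Al (F p) - RN p * f (F p)" by (rule laplacian_f(2)[OF p o(1) True \<phi>(2)])
      have "Al (F p) \<ge> 0" using True al by (simp add: T_def)
      then have "f (F p) * (Al (F p) + A2 p * f (F p)) \<ge> 0" using f_pos[OF F_top[OF p]] A2_nonneg[OF p] by simp
      then show ?thesis unfolding l \<phi>(2)[OF True] by (simp add: algebra_simps)
    qed (simp add: \<phi>(1))
    show "continuous_map (subtopology (mtop S) (mboundary S)) euclideanreal (\<lambda>p. if p \<in> T then g p else 0)"
      unfolding g_def divide_inverse
      by (intro boundary_clopen[OF T] continuous_map_from_subtopology continuous_map_real_mult continuous_map_add continuous_f_F continuous_HN) auto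
    show "\<phi> p * (outward_deriv_at S \<phi> p + HN p / \<kappa> * \<phi> p) = (if p \<in> T then g p else 0)" if p: "p \<in> mboundary S" for p
    proof (cases "p \<in> T")
      case True
      have "outward_deriv_at S \<phi> p = - \<kappa>" by (rule outward_f[OF p o(1) True \<phi>(2)])
      then show ?thesis unfolding \<phi>(2)[OF True] g_def using True by simp
    qed (simp add: \<phi>_def)
    show "(if p \<in> T then g p else 0) \<le> 0" if "p \<in> mboundary S" for p using gneg[OF that] by simp
    show "p0 \<in> mboundary S" "(if p0 \<in> T then g p0 else 0) < 0" using p0 p0T gneg[OF p0] by simp_all
  qed
qed

text \<open>For the test function 1 the interior integrand is \<open>RN + A2\<close> with
  \<open>RN = 2 r > 0\<close>, and the boundary integrand is \<open>HN / \<kappa>\<close>, negative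
  because \<open>HN < a / 2 < 0\<close>.\<close>

lemma unstable_flat:
  assumes p0: "p0 \<in> mboundary S" and al: "Al (F p0) < 0" and b: "Bt (F p0) = 0"
  shows "\<not> stable_free_boundary M f S F N"
proof -
  define T where "T = {p \<in> topspace (mtop S). Al (F p) = Al (F p0)} \<inter> {p \<in> topspace (mtop S). Bt (F p) = 0}"
  have T: "clopen T" unfolding T_def by (intro clopen_Int clopen_Al clopen_Bt)
  note o = clopenD[OF T]
  have p0T: "p0 \<in> T" using S_boundary(1)[OF p0] b by (simp add: T_def)
  define \<phi> :: "'s \<Rightarrow> real" where "\<phi> p = (if p \<in> T then 1 else 0)" for p
  have \<phi>: "\<And>p. p \<notin> T \<Longrightarrow> \<phi> p = 0" "\<And>p. p \<in> T \<Longrightarrow> \<phi> p = 1" by (simp_all add: \<phi>_def)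
  have neg: "HN p / \<kappa> < 0" if p: "p \<in> mboundary S" "p \<in> T" for p
    using HN_less[OF S_boundary(1)[OF p(1)]] p(2) al kappa_pos[OF p(1)] by (intro divide_neg_pos) (simp_all add: T_def)
  show ?thesis
  proof (rule unstable[of \<phi> "\<lambda>p. if p \<in> T then HN p / \<kappa> else 0"])
    show "smooth_function S \<phi>"
    proof (rule smooth_function_lifts)
      fix p assume p: "p \<in> topspace (mtop S)"
      show "\<exists>d V u. lifts \<phi> p d V u"
      proof (cases "p \<in> T")
        case True
        from laplacian_const(1)[OF p o(1) True, of \<phi> 1] \<phi>(2) show ?thesis by blast
      qed (rule off_lifts[OF T p], assumption, rule \<phi>(1))
    qed
    show "\<phi> p = 0" if "p \<notin> topspace (mtop S)" for p using that o(3) \<phi>(1) by blast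
    show "\<phi> p * (laplacian_at S \<phi> p + (RN p + A2 p) * \<phi> p) \<ge> 0" if p: "p \<in> topspace (mtop S)" for p
    proof (cases "p \<in> T")
      case True
      have l: "laplacian_at S \<phi> p = 0" by (rule laplacian_const(2)[OF p o(1) True \<phi>(2)])
      have "Bt (F p) = 0" using True by (simp add: T_def)
      from r_pos[OF p this] A2_nonneg[OF p] show ?thesis unfolding l \<phi>(2)[OF True] by simp
    qed (simp add: \<phi>(1))
    show "continuous_map (subtopology (mtop S) (mboundary S)) euclideanreal (\<lambda>p. if p \<in> T then HN p / \<kappa> else 0)"
      unfolding divide_inverse
      by (intro boundary_clopen[OF T] continuous_map_from_subtopology continuous_map_real_mult continuous_HN) auto
    show "\<phi> p * (outward_deriv_at S \<phi> p + HN p / \<kappa> * \<phi> p) = (if p \<in> T then HN p / \<kappa> else 0)" if p: "p \<in> mboundary S" for p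
    proof (cases "p \<in> T")
      case True
      have "outward_deriv_at S \<phi> p = 0" by (rule outward_const[OF p o(1) True \<phi>(2)])
      then show ?thesis unfolding \<phi>(2)[OF True] using True by simp
    qed (simp add: \<phi>_def)
    show "(if p \<in> T then HN p / \<kappa> else 0) \<le> 0" if "p \<in> mboundary S" for p using neg[OF that] by auto
    show "p0 \<in> mboundary S" "(if p0 \<in> T then HN p0 / \<kappa> else 0) < 0" using p0 p0T neg[OF p0] by simp_all
  qed
qed

lemma unstable_curved:
  assumes p0: "p0 \<in> mboundary S" and al: "Al (F p0) < 0" and b: "Bt (F p0) \<noteq> 0"
  shows "\<not> stable_free_boundary M f S F N"
proof -
  define T where "T = {p \<in> topspace (mtop S). Al (F p) = Al (F p0)}
    \<inter> {p \<in> topspace (mtop S). Bt (F p) \<noteq> 0 \<and> Ee (F p) = Ee (F p0)}"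
  have T: "clopen T" unfolding T_def by (intro clopen_Int clopen_Al clopen_Ee)
  note o = clopenD[OF T]
  have p0T: "p0 \<in> T" using S_boundary(1)[OF p0] b by (simp add: T_def)
  have TB: "Bt (F p) \<noteq> 0" and TA: "Al (F p) = Al (F p0)" if "p \<in> T" for p using that by (simp_all add: T_def)
  have k: "\<kappa> > 0" by (rule kappa_pos[OF p0])
  have c: "c > 0" using f_pos[OF F_top[OF S_boundary(1)[OF p0]]] S_boundary(2)[OF p0] by simp
  define w6 where "w6 p = exp (- (1 / 6) * ln ((Ww (F p))\<^sup>2))" for p
  define m where "m p = w6 p * (3 * r - RN p)" for p
  have cw: "continuous_map (subtopology (mtop S) T) euclideanreal w6"
    unfolding w6_def by (rule continuous_curved_F[OF TB continuous_weight])
  have cm: "continuous_map (subtopology (mtop S) T) euclideanreal m"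
    unfolding m_def by (intro continuous_map_real_mult continuous_map_diff cw continuous_map_from_subtopology[OF continuous_RN]) auto
  have "closedin (mtop S) T" using o by (simp add: closedin_def)
  from closedin_compact_space[OF S.compact closedin_Int[OF this S.closedin_mboundary]]
  have "compactin (mtop S) (T \<inter> mboundary S)" .
  moreover have "continuous_map (subtopology (mtop S) (T \<inter> mboundary S)) euclideanreal m"
    by (rule continuous_map_from_subtopology_mono[OF cm]) blast
  ultimately obtain p1 where p1: "p1 \<in> T \<inter> mboundary S" "\<forall>q\<in>T \<inter> mboundary S. m p1 \<le> m q"
    using compact_bound p0 p0T by blast
  have mpos: "m p1 > 0" using RN_less[of p1] p1(1) o(3) by (auto simp: m_def w6_def)
  have F0pos: "F0 (F p0) > 0" using boundary_curved(1)[OF p0 b] al by (simp add: F0_def)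
  \<comment> \<open>The first bound makes \<open>e * \<kappa> - m\<close> nonpositive along the
    relevant boundary, where \<open>m\<close> attains its positive minimum at \<open>p1\<close>. The
    second keeps \<open>F0 - e f\<close> positive at \<open>p0\<close>, where \<open>f = c\<close>,
    so that the test function does not vanish there.\<close>
  define e where "e = min (m p1 / \<kappa>) (F0 (F p0) / (2 * c))"
  have e: "e > 0" using mpos k F0pos c by (simp add: e_def)
  have ek: "e * \<kappa> \<le> m p1"
  proof -
    have "e \<le> m p1 / \<kappa>" by (simp add: e_def)
    then show ?thesis using k by (simp add: pos_le_divide_eq)
  qed
  have ep0: "F0 (F p0) - e * f (F p0) > 0"
  proof -
    have "e \<le> F0 (F p0) / (2 * c)" by (simp add: e_def)
    then have "2 * (e * c) \<le> F0 (F p0)" using c by (simp add: pos_le_divide_eq mult_ac)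
    then show ?thesis using F0pos S_boundary(2)[OF p0] by simp
  qed
  have "compactin (mtop S) (topspace (mtop S))" using S.compact by (simp add: compact_space_def)
  moreover have "continuous_map (subtopology (mtop S) (topspace (mtop S))) euclideanreal (\<lambda>p. - RN p)"
    using continuous_RN by (intro continuous_map_minus) simp
  ultimately obtain p2 where p2: "\<forall>q\<in>topspace (mtop S). - RN p2 \<le> - RN q"
    using compact_bound S_boundary(1)[OF p0] by blast
  \<comment> \<open>\<open>RN\<close> is maximal at \<open>p2\<close>, so \<open>C\<close> bounds it
    from above; the summand 1 makes \<open>C\<close> positive for the division in
    \<open>\<delta>\<close>.\<close>
  define C where "C = \<bar>RN p2\<bar> + 1"
  have C: "C > 0" "RN q \<le> C" if "q \<in> topspace (mtop S)" for q using p2 that by (fastforce simp: C_def)+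
  have C0: "C > 0" by (simp add: C_def)
  \<comment> \<open>Chosen so that \<open>\<delta> * RN \<le> - e a\<close> everywhere: the gain
    from \<open>- e f\<close> in the Jacobi operator then covers the excess of the cutoff.\<close>
  define \<delta> where "\<delta> = e * - Al (F p0) / C"
  have \<delta>: "\<delta> > 0" "\<delta> * C = e * - Al (F p0)" using divide_pos_pos[OF mult_pos_pos[OF e, of "- Al (F p0)"] C0] al C0 by (simp_all add: \<delta>_def)
  let ?h = "\<lambda>t. t * flat \<delta> 0 t" and ?h1 = "\<lambda>t. flat \<delta> 0 t + \<delta> * flat \<delta> 1 t"
  note dh = cutoff_derivatives[OF \<delta>(1)]
  have sh: "smooth_on Z (\<lambda>x. ?h (w x))" if "smooth_on Z w" for Z and w :: "real^3 \<Rightarrow> real"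
    by (intro smooth_intros that \<delta>(1))
  have sh1: "smooth_on Z (\<lambda>x. ?h1 (w x))" if "smooth_on Z w" for Z and w :: "real^2 \<Rightarrow> real"
    by (intro smooth_intros that \<delta>(1))
  define \<psi> where "\<psi> p = F0 (F p) - e * f (F p)" for p
  define \<phi> where "\<phi> p = (if p \<in> T then ?h (\<psi> p) else 0)" for p
  have \<phi>: "\<And>p. p \<notin> T \<Longrightarrow> \<phi> p = 0" "\<And>p. p \<in> T \<Longrightarrow> \<phi> p = ?h (\<psi> p)" by (simp_all add: \<phi>_def)
  have c\<psi>: "continuous_map (subtopology (mtop S) T) euclideanreal \<psi>"
    unfolding \<psi>_def by (intro continuous_map_diff continuous_map_real_mult continuous_curved_F[OF TB continuous_F0]
      continuous_map_from_subtopology[OF continuous_f_F]) auto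
  \<comment> \<open>Since \<open>e f > 0\<close>, nonnegativity of \<open>\<psi>\<close> forces
    \<open>F0 > 0\<close>, hence \<open>Pp > 0\<close>: the points where \<open>F0\<close> may fail
    to be smooth lie strictly inside the region removed by the cutoff.\<close>
  have Pp: "Pp (F p) > 0" if p: "p \<in> T" "\<psi> p \<ge> 0" for p
  proof -
    have pS: "p \<in> topspace (mtop S)" using p(1) o(3) by blast
    have "e * f (F p) > 0" by (rule mult_pos_pos[OF e f_pos[OF F_top[OF pS]]])
    then have "F0 (F p) > 0" using p(2) unfolding \<psi>_def by linarith
    then have "Pp (F p) \<noteq> 0" by (auto simp: F0_def)
    then show ?thesis using Pp_nonneg[OF F_top[OF pS] TB[OF p(1)]] by simp
  qed
  define g where "g p = ?h (\<psi> p) * (?h1 (\<psi> p) * (e * \<kappa> - m p) + HN p / \<kappa> * ?h (\<psi> p))" for p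
  have hn: "HN p / \<kappa> < 0" if p: "p \<in> mboundary S" "p \<in> T" for p
    using HN_less[OF S_boundary(1)[OF p(1)]] TA[OF p(2)] al k by (intro divide_neg_pos) simp_all
  have h0: "?h t \<ge> 0" "?h1 t \<ge> 0" for t
  proof -
    show "?h t \<ge> 0" by (cases "t > 0") (simp_all add: flat_def)
    show "?h1 t \<ge> 0" using \<delta>(1) by (simp add: flat_nonneg)
  qed
  have gle: "g p \<le> 0" and glt: "\<psi> p > 0 \<Longrightarrow> g p < 0" if p: "p \<in> mboundary S" "p \<in> T" for p
  proof -
    have "m p1 \<le> m p" using p1(2) p by blast
    then have "e * \<kappa> - m p \<le> 0" using ek by linarith
    then have 1: "?h1 (\<psi> p) * (e * \<kappa> - m p) \<le> 0" by (rule mult_nonneg_nonpos[OF h0(2)])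
    have 2: "HN p / \<kappa> * ?h (\<psi> p) \<le> 0" by (rule mult_nonpos_nonneg[OF less_imp_le[OF hn[OF p]] h0(1)])
    show "g p \<le> 0" unfolding g_def by (rule mult_nonneg_nonpos[OF h0(1)]) (use 1 2 in linarith)
    assume "\<psi> p > 0"
    then have h: "?h (\<psi> p) > 0" by (simp add: flat_def)
    have "HN p / \<kappa> * ?h (\<psi> p) < 0" by (rule mult_neg_pos[OF hn[OF p] h])
    then show "g p < 0" unfolding g_def using 1 by (intro mult_pos_neg[OF h]) linarith
  qed
  show ?thesis
  proof (rule unstable[of \<phi> "\<lambda>p. if p \<in> T then g p else 0"])
    show "smooth_function S \<phi>"
    proof (rule smooth_function_lifts)
      fix p assume p: "p \<in> topspace (mtop S)"
      show "\<exists>d V u. lifts \<phi> p d V u"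
      proof (cases "p \<in> T")
        case False
        then show ?thesis by (rule off_lifts[OF T p]) (rule \<phi>(1))
      next
        case pT: True
        \<comment> \<open>Where \<open>\<psi> < 0\<close> the test function is 0 in a neighbourhood.
          All other points, including the zeros of \<open>\<psi>\<close>, have
          \<open>Pp > 0\<close>, so there it is the cutoff of a smooth function.\<close>
        show ?thesis
        proof (cases "\<psi> p < 0")
          case True
          have "openin (subtopology (mtop S) T) {q \<in> topspace (subtopology (mtop S) T). \<psi> q \<in> {..<0}}"
            by (rule openin_continuous_map_preimage[OF c\<psi>]) simp
          then have U: "openin (mtop S) {q \<in> topspace (subtopology (mtop S) T). \<psi> q \<in> {..<0}}"
            using o(1) openin_open_subtopology by blast
          have "\<phi> q = 0" if "q \<in> {q \<in> topspace (subtopology (mtop S) T). \<psi> q \<in> {..<0}}" for q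
            using that by (simp add: \<phi>_def flat_def)
          then have "lifts \<phi> p (chart_at M (F p)) (patch (chart_at M (F p))) (\<lambda>x. 0)"
            by (rule laplacian_const(1)[OF p U, rotated]) (use pT True p in \<open>simp_all add: o(3)\<close>)
          then show ?thesis by blast
        next
          case False
          note P = TB[OF pT] Pp[OF pT, unfolded not_less[symmetric], OF False]
          let ?d = "chart_at M (F p)"
          note l = laplacian_F0(1)[OF p P, of e]
          let ?t = "\<lambda>x. static_vacuum_patch.f0 (spatch ?d) (metric_in M ?d) r x - e * in_chart ?d f x"
          obtain U where U: "openin (mtop S) U" "p \<in> U"
            "\<And>q. q \<in> U \<Longrightarrow> F q \<in> fst ?d \<Longrightarrow> snd ?d (F q) \<in> spatch ?d \<Longrightarrow> F0 (F q) - e * f (F q) = ?t (snd ?d (F q))"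
            using l unfolding lifts_def by blast
          have "lifts \<phi> p ?d (spatch ?d) (\<lambda>x. ?h (?t x))"
            unfolding lifts_def
          proof (intro conjI exI[of _ "U \<inter> T"] ballI impI)
            show "smooth_on (spatch ?d) (\<lambda>x. ?h (?t x))" by (rule sh) (use l in \<open>simp add: lifts_def\<close>)
            show "openin (mtop S) (U \<inter> T)" by (rule openin_Int[OF U(1) o(1)])
            fix q assume q: "q \<in> U \<inter> T" "F q \<in> fst ?d" "snd ?d (F q) \<in> spatch ?d"
            then show "\<phi> q = ?h (?t (snd ?d (F q)))" using U(3)[of q] by (simp only: \<phi>_def \<psi>_def Int_iff if_True)
          qed (use l U(2) pT in \<open>auto simp: lifts_def\<close>)
          then show ?thesis by blast
        qed
      qed
    qed
    show "\<phi> p = 0" if "p \<notin> topspace (mtop S)" for p using that o(3) \<phi>(1) by blast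
    show "\<phi> p * (laplacian_at S \<phi> p + (RN p + A2 p) * \<phi> p) \<ge> 0" if p: "p \<in> topspace (mtop S)" for p
    proof (cases "p \<in> T \<and> \<psi> p > 0")
      case False
      then have "\<phi> p = 0" by (auto simp: \<phi>_def flat_def)
      then show ?thesis by simp
    next
      case True
      then have pT: "p \<in> T" and pos: "\<psi> p > 0" by blast+
      note P = TB[OF pT] Pp[OF pT less_imp_le[OF pos]]
      let ?E = "flat \<delta> 0 (\<psi> p)"
      have "laplacian_at S \<phi> p \<ge> ?h1 (\<psi> p) * laplacian_at S \<psi> p"
      proof (rule laplacian_at_compose[OF p _ o(1) pT \<phi>(2) dh])
        show "lifts \<psi> p (chart_at M (F p)) (spatch (chart_at M (F p)))
            (\<lambda>x. static_vacuum_patch.f0 (spatch (chart_at M (F p))) (metric_in M (chart_at M (F p))) r x - e * in_chart (chart_at M (F p)) f x)"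
          unfolding \<psi>_def[abs_def] by (rule laplacian_F0(1)[OF p P])
        show "0 \<le> \<delta>\<^sup>2 * flat \<delta> 3 (\<psi> p)" by (simp add: flat_nonneg)
      qed (assumption, rule sh1)
      also have "laplacian_at S \<psi> p = - RN p * \<psi> p - e * Al (F p0)"
        using laplacian_F0(2)[OF p P, of e] TA[OF pT] by (simp add: \<psi>_def[abs_def])
      finally have L: "laplacian_at S \<phi> p \<ge> ?h1 (\<psi> p) * (- RN p * \<psi> p - e * Al (F p0))" .
      \<comment> \<open>This replaces \<open>h' \<psi>\<close> by \<open>h\<close> plus the excess,
        so that \<open>RN h\<close> cancels in the Jacobi operator. The remainder is a sum of three
        nonnegative terms, the first by the choice of \<open>\<delta>\<close>.\<close>
      have h1e: "?h1 (\<psi> p) * \<psi> p = ?h (\<psi> p) + \<delta> * ?E"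
        using flat_Suc[of "\<psi> p" \<delta> 0] by (simp add: algebra_simps)
      have "?h1 (\<psi> p) * (- RN p * \<psi> p - e * Al (F p0)) + (RN p + A2 p) * ?h (\<psi> p)
          = - RN p * (?h1 (\<psi> p) * \<psi> p) + ?h1 (\<psi> p) * (e * - Al (F p0)) + (RN p + A2 p) * ?h (\<psi> p)"
        by (simp add: algebra_simps)
      also have "\<dots> = ?E * (e * - Al (F p0) - \<delta> * RN p) + \<delta> * flat \<delta> 1 (\<psi> p) * (e * - Al (F p0)) + A2 p * ?h (\<psi> p)"
        unfolding h1e by (simp add: algebra_simps)
      also have "\<dots> \<ge> 0"
      proof -
        have "\<delta> * RN p \<le> e * - Al (F p0)" using mult_left_mono[OF C(2)[OF p], of \<delta>] \<delta> by simp
        then have 1: "?E * (e * - Al (F p0) - \<delta> * RN p) \<ge> 0" by (intro mult_nonneg_nonneg flat_nonneg) simp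
        have 2: "\<delta> * flat \<delta> 1 (\<psi> p) * (e * - Al (F p0)) \<ge> 0"
          using \<delta>(1) e al by (intro mult_nonneg_nonneg flat_nonneg) simp_all
        have "A2 p * ?h (\<psi> p) \<ge> 0" by (rule mult_nonneg_nonneg[OF A2_nonneg[OF p] h0(1)])
        then show ?thesis using 1 2 by linarith
      qed
      finally have "laplacian_at S \<phi> p + (RN p + A2 p) * \<phi> p \<ge> 0" using L unfolding \<phi>(2)[OF pT] by linarith
      then show ?thesis using \<phi>(2)[OF pT] h0(1) by (intro mult_nonneg_nonneg) simp_all
    qed
    have ch: "continuous_map X euclideanreal (\<lambda>p. u (w p))"
      if "continuous_map X euclideanreal w" "continuous_on UNIV u" for X and w :: "'s \<Rightarrow> real" and u :: "real \<Rightarrow> real"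
      using continuous_map_compose[OF that(1), of euclideanreal u] that(2) by (simp add: o_def)
    have cu: "continuous_on UNIV ?h" "continuous_on UNIV ?h1"
      using dh DERIV_isCont by (blast intro: continuous_at_imp_continuous_on)+
    show "continuous_map (subtopology (mtop S) (mboundary S)) euclideanreal (\<lambda>p. if p \<in> T then g p else 0)"
      unfolding g_def divide_inverse
      by (intro boundary_clopen[OF T] continuous_map_real_mult[where f="\<lambda>p. ?h (\<psi> p)"] continuous_map_add ch[OF c\<psi> cu(1)]
          continuous_map_real_mult[where f="\<lambda>p. ?h1 (\<psi> p)"] ch[OF c\<psi> cu(2)] continuous_map_diff cm
          continuous_map_real_mult[where g="\<lambda>p. ?h (\<psi> p)"] continuous_map_real_mult[where f=HN]
          continuous_map_from_subtopology[OF continuous_HN]) auto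
    show "\<phi> p * (outward_deriv_at S \<phi> p + HN p / \<kappa> * \<phi> p) = (if p \<in> T then g p else 0)" if p: "p \<in> mboundary S" for p
    proof (cases "p \<in> T")
      case True
      have "outward_deriv_at S \<phi> p = ?h1 (F0 (F p) - e * f (F p)) * (e * \<kappa> - exp (- (1 / 6) * ln ((Ww (F p))\<^sup>2)) * (3 * r - RN p))"
        by (rule outward_F0(2)[OF p TB[OF True] _ o(1) True _ dh(1) sh])
          (use TA[OF True] al \<phi>(2) in \<open>simp_all add: \<psi>_def\<close>)
      then have "outward_deriv_at S \<phi> p = ?h1 (\<psi> p) * (e * \<kappa> - m p)" by (simp only: m_def w6_def \<psi>_def)
      then show ?thesis using True by (simp only: \<phi>_def g_def if_True)
    qed (simp add: \<phi>_def)
    show "(if p \<in> T then g p else 0) \<le> 0" if "p \<in> mboundary S" for p using gle[OF that] by auto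
    show "p0 \<in> mboundary S" by (rule p0)
    show "(if p0 \<in> T then g p0 else 0) < 0" using p0T glt[OF p0 p0T] ep0 by (simp only: \<psi>_def if_True)
  qed
qed

end

theorem theorem1p16:
  fixes M :: "('m, 3) riem_structure"
    and f \<rho> \<mu> :: "'m \<Rightarrow> real"
    and c :: real
  assumes "static_perfect_fluid M f \<rho> \<mu>"
    and "constant_scalar_curvature M"
    and "harmonic_curvature M"
    and "mboundary M = {p \<in> topspace (mtop M). f p = c}"
    and "regular_value M f c"
    and "outward_normal_is_level_normal M f"
  shows "\<not> (\<exists>(S :: ('s, 2) riem_structure) F N \<kappa>.
            immersed_surface M S F
          \<and> compact_space (mtop S)
          \<and> mboundary S \<noteq> {}
          \<and> unit_normal_field M S F N
          \<and> minimal_surface M S F N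
          \<and> free_boundary M f S F
          \<and> stable_free_boundary M f S F N
          \<and> (\<forall>p\<in>topspace (mtop S). gauss_curvature_at S p > 0)
          \<and> (\<forall>p\<in>mboundary S. grad_norm_at M f (F p) = \<kappa>)
          \<and> (\<forall>p\<in>topspace (mtop S). \<mu> (F p) + \<rho> (F p) \<le> 2 * \<kappa>\<^sup>2 / c\<^sup>2))"
proof
  assume "\<exists>(S :: ('s, 2) riem_structure) F N \<kappa>.
            immersed_surface M S F
          \<and> compact_space (mtop S)
          \<and> mboundary S \<noteq> {}
          \<and> unit_normal_field M S F N
          \<and> minimal_surface M S F N
          \<and> free_boundary M f S F
          \<and> stable_free_boundary M f S F N
          \<and> (\<forall>p\<in>topspace (mtop S). gauss_curvature_at S p > 0)
          \<and> (\<forall>p\<in>mboundary S. grad_norm_at M f (F p) = \<kappa>)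
          \<and> (\<forall>p\<in>topspace (mtop S). \<mu> (F p) + \<rho> (F p) \<le> 2 * \<kappa>\<^sup>2 / c\<^sup>2)"
  then obtain S :: "('s, 2) riem_structure" and F N \<kappa> where
    S: "immersed_surface M S F" "compact_space (mtop S)" "mboundary S \<noteq> {}" "unit_normal_field M S F N"
      "minimal_surface M S F N" "free_boundary M f S F" "stable_free_boundary M f S F N"
      "\<And>p. p \<in> topspace (mtop S) \<Longrightarrow> gauss_curvature_at S p > 0" "\<And>p. p \<in> mboundary S \<Longrightarrow> grad_norm_at M f (F p) = \<kappa>"
      "\<And>p. p \<in> topspace (mtop S) \<Longrightarrow> \<mu> (F p) + \<rho> (F p) \<le> 2 * \<kappa>\<^sup>2 / c\<^sup>2"
    by blast
  obtain R0 where R0: "\<And>d x. d \<in> atlas M \<Longrightarrow> x \<in> patch d \<Longrightarrow> scalar_curvature (patch d) (metric_in M d) x = R0"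
    using assms(2) unfolding constant_scalar_curvature_def by blast
  have "fluid_space M f \<rho> \<mu> c (R0 / 6)"
    by unfold_locales (use assms R0 in \<open>auto simp: static_perfect_fluid_def\<close>)
  moreover have "compact_surface S"
    by unfold_locales (use S in \<open>auto simp: immersed_surface_def\<close>)
  ultimately have "free_surface M f \<rho> \<mu> c (R0 / 6) S F N \<kappa>"
    using S unfolding free_surface_def free_surface_axioms_def by blast
  then interpret free_surface M f \<rho> \<mu> c "R0 / 6" S F N \<kappa> .
  obtain p0 where p0: "p0 \<in> mboundary S" using S(3) by blast
  consider "Al (F p0) \<ge> 0" | "Al (F p0) < 0" "Bt (F p0) = 0" | "Al (F p0) < 0" "Bt (F p0) \<noteq> 0" by linarith
  then have "\<not> stable_free_boundary M f S F N"
    using unstable_nonneg[OF p0 _ S(10)] unstable_flat[OF p0] unstable_curved[OF p0] by cases blast+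
  then show False using S(7) by blast
qed

end
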